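(* Let $\approx$ be a substring consistent equivalence relation and $\mathcal{E}$ an encoding function for it, with preprocessing/query functions $\pi^{\mathcal{E}},\rho^{\mathcal{E}}$. Given a string $T$ of length $n$ over an integer alphabet, the number of non-equivalent $\approx$-square substrings of $T$ can be computed in $\mathcal{O}(\pi^{\mathcal{E}}(n)+n\rho^{\mathcal{E}}(n)+n\log n)$ time. The number of $\approx$-square substrings of $T$ that are distinct as strings can be computed in the same time complexity.
   Context: Strings are over an integer alphabet $[0\mathinner{.\,.} n^{\mathcal{O}(1)}]$; the model is the word-RAM. $X[i\mathinner{.\,.} j]$ is the substring from position $i$ to $j$ (positions from 1). A substring consistent equivalence relation (SCER) is an equivalence relation $\approx$ on strings such that $X\approx Y$ implies $|X|=|Y|$ and $X[i\mathinner{.\,.} j]\approx Y[i\mathinner{.\,.} j]$ for all $1\le i\le j\le|X|$. A function $\mathcal{E}$ from strings to $\mathbb{Z}$ is an encoding function for $\approx$ if for all strings $X,Y$: $X\approx Y \iff (|X|=|Y|$ and $\mathcal{E}(X[1\mathinner{.\,.} i])=\mathcal{E}(Y[1\mathinner{.\,.} i])$ for all $i\in[1\mathinner{.\,.}|X|])$. $\pi^{\mathcal{E}}(n),\rho^{\mathcal{E}}(n)$ are functions such that for any string $T$ of length $n$ over an integer alphabet, after $\pi^{\mathcal{E}}(n)$ preprocessing time, $\mathcal{E}(T[i\mathinner{.\,.} j])$ for any $i\le j$ can be computed in $\rho^{\mathcal{E}}(n)$ time. An $\approx$-square is a string $XY$ with $|X|=|Y|\ge1$ and $X\approx Y$; two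 $\approx$-squares are equivalent if they are $\approx$-related. Counting non-equivalent $\approx$-square substrings means counting equivalence classes (under $\approx$) of substrings of $T$ that are $\approx$-squares. *)

theory Defs
  imports Complex_Main "HOL-Library.Landau_Symbols"
begin

section \<open>Strings, SCERs and squares\<close>

type_synonym str = "nat list"

definition substr :: "str \<Rightarrow> nat \<Rightarrow> nat \<Rightarrow> str"
  where "substr X i j = take (j + 1 - i) (drop (i - 1) X)"  \<comment> \<open>positions count from 1\<close>

definition scer :: "str rel \<Rightarrow> bool"
  where "scer R \<longleftrightarrow> equiv UNIV R \<and>
    (\<forall>X Y. (X, Y) \<in> R \<longrightarrow> length X = length Y \<and>
      (\<forall>i j. 1 \<le> i \<and> i \<le> j \<and> j \<le> length X \<longrightarrow> (substr X i j, substr Y i j) \<in> R))"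

definition encoding_function :: "str rel \<Rightarrow> (str \<Rightarrow> int) \<Rightarrow> bool"
  where "encoding_function R E \<longleftrightarrow>
    (\<forall>X Y. (X, Y) \<in> R \<longleftrightarrow>
      length X = length Y \<and> (\<forall>i\<in>{1..length X}. E (substr X 1 i) = E (substr Y 1 i)))"

definition is_square :: "str rel \<Rightarrow> str \<Rightarrow> bool"
  where "is_square R Z \<longleftrightarrow>
    (\<exists>X Y. Z = X @ Y \<and> length X = length Y \<and> length X \<ge> 1 \<and> (X, Y) \<in> R)"

definition square_substrings :: "str rel \<Rightarrow> str \<Rightarrow> str set"
  where "square_substrings R T =
    {substr T i j | i j. 1 \<le> i \<and> i \<le> j \<and> j \<le> length T \<and> is_square R (substr T i j)}"

definition nonequiv_square_count :: "str rel \<Rightarrow> str \<Rightarrow> nat"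
  where "nonequiv_square_count R T = card (square_substrings R T // R)"

definition distinct_square_count :: "str rel \<Rightarrow> str \<Rightarrow> nat"
  where "distinct_square_count R T = card (square_substrings R T)"


section \<open>The word-RAM\<close>

text \<open>
  A machine word of \<open>w\<close> bits is an integer in \<open>{-(2^(w-1))..<2^(w-1)}\<close> (two's complement);
  results of operations are reduced to this range. A program is a structured program over a
  finite set of registers and a finite set of arrays (memory segments); an array is addressed by
  arbitrary words, so that indirect addressing is available. Programs do not depend on \<open>w\<close>.
  Each elementary instruction and each test takes one time unit.
\<close>

datatype operand = Const int | Reg nat

datatype binop = Add | Sub | Mult | Div | Mod | BitAnd | BitOr | BitXor | ShiftL | ShiftR

datatype comparison = Less | LessEq | Equal | NotEqual

datatype prog =
    Skip
  | Move nat operand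
  | Op nat binop operand operand
  | Load nat nat operand           \<comment> \<open>target register, array, address\<close>
  | Store nat operand operand      \<comment> \<open>array, address, value\<close>
  | Seq prog prog
  | If comparison operand operand prog prog
  | While comparison operand operand prog

record state =
  regs :: "nat \<Rightarrow> int"
  arrays :: "nat \<Rightarrow> int \<Rightarrow> int"

definition wrap :: "nat \<Rightarrow> int \<Rightarrow> int"
  where "wrap w x = signed_take_bit (w - 1) x"

fun operand_val :: "nat \<Rightarrow> state \<Rightarrow> operand \<Rightarrow> int" where
  "operand_val w s (Const x) = wrap w x"
| "operand_val w s (Reg r) = regs s r"

fun binop_val :: "binop \<Rightarrow> int \<Rightarrow> int \<Rightarrow> int" where
  "binop_val Add x y = x + y"
| "binop_val Sub x y = x - y"
| "binop_val Mult x y = x * y"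
| "binop_val Div x y = x div y"
| "binop_val Mod x y = x mod y"
| "binop_val BitAnd x y = Bit_Operations.and x y"
| "binop_val BitOr x y = Bit_Operations.or x y"
| "binop_val BitXor x y = Bit_Operations.xor x y"
| "binop_val ShiftL x y = push_bit (nat y) x"
| "binop_val ShiftR x y = drop_bit (nat y) x"

fun compare_val :: "comparison \<Rightarrow> int \<Rightarrow> int \<Rightarrow> bool" where
  "compare_val Less x y \<longleftrightarrow> x < y"
| "compare_val LessEq x y \<longleftrightarrow> x \<le> y"
| "compare_val Equal x y \<longleftrightarrow> x = y"
| "compare_val NotEqual x y \<longleftrightarrow> x \<noteq> y"

definition set_reg :: "nat \<Rightarrow> int \<Rightarrow> state \<Rightarrow> state"
  where "set_reg r x s = s\<lparr>regs := (regs s)(r := x)\<rparr>"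

definition set_cell :: "nat \<Rightarrow> int \<Rightarrow> int \<Rightarrow> state \<Rightarrow> state"
  where "set_cell a p x s = s\<lparr>arrays := (arrays s)(a := (arrays s a)(p := x))\<rparr>"

text \<open>\<open>exec w P s k s'\<close>: with word size \<open>w\<close>, program \<open>P\<close> started in state \<open>s\<close> halts after exactly
  \<open>k\<close> time units in state \<open>s'\<close>.\<close>

inductive exec :: "nat \<Rightarrow> prog \<Rightarrow> state \<Rightarrow> nat \<Rightarrow> state \<Rightarrow> bool" for w :: nat where
  Skip: "exec w Skip s 1 s"
| Move: "exec w (Move r a) s 1 (set_reg r (operand_val w s a) s)"
| Op: "exec w (Op r f a b) s 1
         (set_reg r (wrap w (binop_val f (operand_val w s a) (operand_val w s b))) s)"
| Load: "exec w (Load r m a) s 1 (set_reg r (arrays s m (operand_val w s a)) s)"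
| Store: "exec w (Store m a b) s 1 (set_cell m (operand_val w s a) (operand_val w s b) s)"
| Seq: "exec w P s k s' \<Longrightarrow> exec w Q s' l s'' \<Longrightarrow> exec w (Seq P Q) s (k + l) s''"
| IfTrue: "compare_val f (operand_val w s a) (operand_val w s b) \<Longrightarrow>
     exec w P s k s' \<Longrightarrow> exec w (If f a b P Q) s (1 + k) s'"
| IfFalse: "\<not> compare_val f (operand_val w s a) (operand_val w s b) \<Longrightarrow>
     exec w Q s k s' \<Longrightarrow> exec w (If f a b P Q) s (1 + k) s'"
| WhileTrue: "compare_val f (operand_val w s a) (operand_val w s b) \<Longrightarrow>
     exec w P s k s' \<Longrightarrow> exec w (While f a b P) s' l s'' \<Longrightarrow>
     exec w (While f a b P) s (1 + k + l) s''"
| WhileFalse: "\<not> compare_val f (operand_val w s a) (operand_val w s b) \<Longrightarrow>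
     exec w (While f a b P) s 1 s"

text \<open>The input string is stored in array 0 at addresses \<open>1..n\<close>, its length \<open>n\<close> in register 0.\<close>

definition input_state :: "str \<Rightarrow> state"
  where "input_state T =
    \<lparr>regs = (\<lambda>_. 0)(0 := int (length T)),
     arrays = (\<lambda>_ _. 0)(0 := (\<lambda>p. if 1 \<le> p \<and> p \<le> int (length T) then int (T ! nat (p - 1)) else 0))\<rparr>"

text \<open>An integer alphabet is \<open>[0..n^d]\<close> for a constant \<open>d\<close>. A word size is admissible with constant
  \<open>c\<close> if \<open>w \<ge> c * log 2 (n + 2)\<close>; below, \<open>c \<ge> d + 2\<close> guarantees that letters and positions are
  words.\<close>

definition over_integer_alphabet :: "nat \<Rightarrow> str \<Rightarrow> bool"
  where "over_integer_alphabet d T \<longleftrightarrow> set T \<subseteq> {0..length T ^ d}"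

definition admissible_word_size :: "nat \<Rightarrow> nat \<Rightarrow> nat \<Rightarrow> bool"
  where "admissible_word_size c n w \<longleftrightarrow> (n + 2) ^ c \<le> 2 ^ w"

definition computable_in_time :: "nat \<Rightarrow> (str \<Rightarrow> nat) \<Rightarrow> (nat \<Rightarrow> real) \<Rightarrow> bool"
  where "computable_in_time d f t \<longleftrightarrow>
    (\<exists>P. \<exists>c\<ge>d + 2. \<forall>w T. over_integer_alphabet d T \<and> admissible_word_size c (length T) w \<longrightarrow>
      (\<exists>k s. exec w P (input_state T) k s \<and> real k \<le> t (length T) \<and> regs s 0 = int (f T)))"


section \<open>Preprocessing and query time of an encoding function\<close>

definition query_state :: "nat \<Rightarrow> nat \<Rightarrow> state \<Rightarrow> state"
  where "query_state i j s = set_reg 1 (int j) (set_reg 0 (int i) s)"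

text \<open>States reached by preprocessing \<open>T\<close> with \<open>P\<close> and then answering any finite sequence of
  queries with \<open>Q\<close>. Thus queries may modify the data structure.\<close>

inductive ready :: "nat \<Rightarrow> prog \<Rightarrow> prog \<Rightarrow> str \<Rightarrow> state \<Rightarrow> bool" for w P Q T where
  preprocessed: "exec w P (input_state T) k s \<Longrightarrow> ready w P Q T s"
| queried: "ready w P Q T s \<Longrightarrow> 1 \<le> i \<Longrightarrow> i \<le> j \<Longrightarrow> j \<le> length T \<Longrightarrow>
     exec w Q (query_state i j s) k s' \<Longrightarrow> ready w P Q T s'"

definition encoding_times ::
    "nat \<Rightarrow> (str \<Rightarrow> int) \<Rightarrow> (nat \<Rightarrow> real) \<Rightarrow> (nat \<Rightarrow> real) \<Rightarrow> bool"
  where "encoding_times d E \<pi> \<rho> \<longleftrightarrow>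
    (\<exists>P Q. \<exists>c\<ge>d + 2. \<forall>w T. over_integer_alphabet d T \<and> admissible_word_size c (length T) w \<longrightarrow>
      (\<exists>k s. exec w P (input_state T) k s \<and> real k \<le> \<pi> (length T)) \<and>
      (\<forall>s i j. ready w P Q T s \<and> 1 \<le> i \<and> i \<le> j \<and> j \<le> length T \<longrightarrow>
        (\<exists>k s'. exec w Q (query_state i j s) k s' \<and> real k \<le> \<rho> (length T) \<and>
          regs s' 0 = E (substr T i j))))"

end

theory Submission
  imports Defs
begin

text \<open>An occurrence of a square at position \<open>i\<close> is the first one of its class iff its length exceeds
  \<open>lpf i\<close>, the longest match of the suffix at \<open>i\<close> with an earlier suffix. So the classes correspond to
  pairs \<open>i < j\<close> such that the suffixes at \<open>i\<close> and \<open>j\<close> match on \<open>j - i\<close> symbols and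
  \<open>i + lpf i div 2 < j\<close>. The left side of this inequality is monotone in \<open>i\<close>, because
  \<open>lpf (i + 1) \<ge> lpf i - 1\<close> for a substring consistent relation; hence the condition on \<open>i\<close> is an upper
  bound that depends on \<open>j\<close>. For the distinct squares \<open>lpf\<close> refers to equality of strings, but the
  match on \<open>j - i\<close> symbols to the given relation.

  The suffixes are inserted one by one into a trie over encoded prefixes; \<open>lpf (i + 1) \<ge> lpf i - 1\<close> gives
  the depth at which the insertion of the next suffix starts, binary lifting gives the node there, and each
  step downwards takes a constant number of oracle queries and one dictionary lookup. The leaf order of the
  trie is then split recursively: a subtree with one to two thirds of the leaves of a segment is cut out, and
  a leaf outside matches all leaves of the subtree on the same length. So for a fixed outside leaf the
  partners inside the subtree form an interval of positions, and they are counted by rank queries, which are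
  answered offline in linear time per level. There are \<open>O(log n)\<close> levels.\<close>

section \<open>Weakest preconditions with a time budget\<close>

text \<open>The squares cannot be listed: under the relation of equal length every nonempty
  substring of even length is a square, so there may be quadratically many distinct ones. Hence
  pairs are only counted, in bulk, and the condition on a partner has to become an interval of
  positions. The separators achieve this for the square condition by fixing the match length,
  monotone thresholds achieve it for being the first occurrence. Suffix links in the usual sense are
  missing, since dropping the first symbol may change all codes. What survives is a leaf:
  \<open>link i + 1\<close> matches \<open>i + 1\<close> on \<open>lpf i - 1\<close> symbols, so the
  wanted node lies on the path of a suffix already present. Climbing to it costs a logarithm per
  suffix, while the steps downwards telescope to O(n). Encodings do not grow with the word size and
  hence are polynomial in \<open>n\<close>. So a node together with a code fits into one address,
  and an array serves as the dictionary without hashing.\<close>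

text \<open>The second argument of the postcondition is the budget that is left. It may be negative, so \<open>t\<close>
  bounds the running time only if the postcondition demands a nonnegative rest.\<close>

definition wp :: "nat \<Rightarrow> prog \<Rightarrow> (state \<Rightarrow> int \<Rightarrow> bool) \<Rightarrow> state \<Rightarrow> int \<Rightarrow> bool" where
  "wp w P Q s t \<longleftrightarrow> (\<exists>k s'. exec w P s k s' \<and> Q s' (t - int k))"

inductive_cases exec_SkipE: "exec w Skip s k s'"
inductive_cases exec_MoveE: "exec w (Move r a) s k s'"
inductive_cases exec_OpE: "exec w (Op r f a b) s k s'"
inductive_cases exec_LoadE: "exec w (Load r m a) s k s'"
inductive_cases exec_StoreE: "exec w (Store m a b) s k s'"
inductive_cases exec_SeqE: "exec w (Seq P Q) s k s'"
inductive_cases exec_IfE: "exec w (If f a b P Q) s k s'"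

lemma wp_Skip: "wp w Skip Q s t \<longleftrightarrow> Q s (t - 1)"
  unfolding wp_def by (force intro: exec.Skip elim: exec_SkipE)

lemma wp_Move: "wp w (Move r a) Q s t \<longleftrightarrow> Q (set_reg r (operand_val w s a) s) (t - 1)"
  unfolding wp_def by (force intro: exec.Move elim: exec_MoveE)

lemma wp_Op: "wp w (Op r f a b) Q s t \<longleftrightarrow>
   Q (set_reg r (wrap w (binop_val f (operand_val w s a) (operand_val w s b))) s) (t - 1)"
  unfolding wp_def by (force intro: exec.Op elim: exec_OpE)

lemma wp_Load: "wp w (Load r m a) Q s t \<longleftrightarrow>
   Q (set_reg r (arrays s m (operand_val w s a)) s) (t - 1)"
  unfolding wp_def by (force intro: exec.Load elim: exec_LoadE)

lemma wp_Store: "wp w (Store m a b) Q s t \<longleftrightarrow>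
   Q (set_cell m (operand_val w s a) (operand_val w s b) s) (t - 1)"
  unfolding wp_def by (force intro: exec.Store elim: exec_StoreE)

lemma wp_Seq: "wp w (Seq P P') Q s t \<longleftrightarrow> wp w P (wp w P' Q) s t"
proof
  assume "wp w (Seq P P') Q s t"
  then obtain k s' where e: "exec w (Seq P P') s k s'" and q: "Q s' (t - int k)"
    unfolding wp_def by blast
  from e obtain k1 s1 k2 where "exec w P s k1 s1" "exec w P' s1 k2 s'" "k = k1 + k2"
    by (rule exec_SeqE) auto
  then show "wp w P (wp w P' Q) s t"
    using q unfolding wp_def by (force simp: algebra_simps)
next
  assume "wp w P (wp w P' Q) s t"
  then obtain k1 s1 k2 s2 where "exec w P s k1 s1" "exec w P' s1 k2 s2"
    and q: "Q s2 (t - int k1 - int k2)"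
    unfolding wp_def by blast
  then have "exec w (Seq P P') s (k1 + k2) s2" by (blast intro: exec.Seq)
  then show "wp w (Seq P P') Q s t"
    using q unfolding wp_def by (metis diff_diff_eq of_nat_add)
qed

lemma wp_If: "wp w (If f a b P P') Q s t \<longleftrightarrow>
  (if compare_val f (operand_val w s a) (operand_val w s b) then wp w P Q s (t - 1)
   else wp w P' Q s (t - 1))"
  unfolding wp_def
  by (auto elim!: exec_IfE simp: diff_diff_eq)
     (metis exec.IfTrue exec.IfFalse of_nat_1 of_nat_add)+

text \<open>Every iteration costs at least one time unit, so the remaining budget is the variant.\<close>

lemma wp_While:
  assumes inv: "I s t"
    and nonneg: "\<And>s t. I s t \<Longrightarrow> 0 \<le> t"
    and step: "\<And>s t. I s t \<Longrightarrow> compare_val f (operand_val w s a) (operand_val w s b) \<Longrightarrow>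
      wp w P I s (t - 1)"
    and final: "\<And>s t. I s t \<Longrightarrow> \<not> compare_val f (operand_val w s a) (operand_val w s b) \<Longrightarrow>
      Q s (t - 1)"
  shows "wp w (While f a b P) Q s t"
  using inv
proof (induction "nat t" arbitrary: s t rule: less_induct)
  case less
  show ?case
  proof (cases "compare_val f (operand_val w s a) (operand_val w s b)")
    case True
    from step[OF less.prems True] obtain k s1 where
      e1: "exec w P s k s1" and i1: "I s1 (t - 1 - int k)" unfolding wp_def by blast
    from nonneg[OF i1] have "nat (t - 1 - int k) < nat t" by auto
    from less.hyps[OF this i1] obtain l s2 where
      e2: "exec w (While f a b P) s1 l s2" and q: "Q s2 (t - 1 - int k - int l)"
      unfolding wp_def by blast
    have "exec w (While f a b P) s (1 + k + l) s2" using True e1 e2 by (rule exec.WhileTrue)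
    moreover have "t - int (1 + k + l) = t - 1 - int k - int l" by simp
    ultimately show ?thesis unfolding wp_def using q by metis
  next
    case False
    have "exec w (While f a b P) s 1 s" using False by (rule exec.WhileFalse)
    then show ?thesis unfolding wp_def using final[OF less.prems False]
      by (metis of_nat_1)
  qed
qed

lemma regs_set_reg: "regs (set_reg r x s) r' = (if r' = r then x else regs s r')"
  and arrays_set_reg: "arrays (set_reg r x s) = arrays s"
  and regs_set_cell: "regs (set_cell m p x s) = regs s"
  and arrays_set_cell: "arrays (set_cell m p x s) m' =
        (if m' = m then (arrays s m)(p := x) else arrays s m')"
  by (simp_all add: set_reg_def set_cell_def)

lemma set_reg_overwrite: "set_reg r x (set_reg r y s) = set_reg r x s"
  by (simp add: set_reg_def)

section \<open>Frames: what a program leaves unchanged\<close>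

definition same_outside :: "nat set \<Rightarrow> nat set \<Rightarrow> state \<Rightarrow> state \<Rightarrow> bool" where
  "same_outside Rs As s s' \<longleftrightarrow>
    (\<forall>r. r \<notin> Rs \<longrightarrow> regs s' r = regs s r) \<and> (\<forall>m. m \<notin> As \<longrightarrow> arrays s' m = arrays s m)"

lemma same_outside_refl: "same_outside Rs As s s"
  by (simp add: same_outside_def)

lemma same_outside_regs: "same_outside Rs As s s' \<Longrightarrow> r \<notin> Rs \<Longrightarrow> regs s' r = regs s r"
  and same_outside_arrays: "same_outside Rs As s s' \<Longrightarrow> m \<notin> As \<Longrightarrow> arrays s' m = arrays s m"
  by (simp_all add: same_outside_def)

lemma same_outside_set_reg:
  "r \<in> Rs \<Longrightarrow> same_outside Rs As s s' \<Longrightarrow> same_outside Rs As s (set_reg r x s')"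
  by (auto simp: same_outside_def regs_set_reg arrays_set_reg)

lemma same_outside_set_cell:
  "m \<in> As \<Longrightarrow> same_outside Rs As s s' \<Longrightarrow> same_outside Rs As s (set_cell m p x s')"
  by (auto simp: same_outside_def regs_set_cell arrays_set_cell)

lemma same_outside_trans:
  "same_outside Rs As s s' \<Longrightarrow> same_outside Rs' As' s' s'' \<Longrightarrow> Rs \<subseteq> Rs'' \<Longrightarrow> Rs' \<subseteq> Rs'' \<Longrightarrow>
   As \<subseteq> As'' \<Longrightarrow> As' \<subseteq> As'' \<Longrightarrow> same_outside Rs'' As'' s s''"
  unfolding same_outside_def by (metis subsetD)

lemma same_outside_mono:
  "same_outside Rs As s s' \<Longrightarrow> Rs \<subseteq> Rs' \<Longrightarrow> As \<subseteq> As' \<Longrightarrow> same_outside Rs' As' s s'"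
  unfolding same_outside_def by blast

lemmas wp_simps = wp_Skip wp_Move wp_Op wp_Load wp_Store wp_Seq wp_If
  regs_set_reg arrays_set_reg regs_set_cell arrays_set_cell
  same_outside_refl same_outside_set_reg same_outside_set_cell

fun seqs :: "prog list \<Rightarrow> prog" where
  "seqs [] = Skip"
| "seqs [P] = P"
| "seqs (P # Q # Ps) = Seq P (seqs (Q # Ps))"

abbreviation inc :: "nat \<Rightarrow> prog" where "inc r \<equiv> Op r Add (Reg r) (Const 1)"
abbreviation dec :: "nat \<Rightarrow> prog" where "dec r \<equiv> Op r Sub (Reg r) (Const 1)"

text \<open>\<open>X\<close> is the first number beyond the signed words. The quadratic margin makes
  room for addresses of the form \<open>k * (n + 1) + x\<close> and for the counters, which may
  reach \<open>21 * (n + 2) * (n + 2)\<close> in the rank sweeps.\<close>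

locale ram =
  fixes w :: nat and X :: int and n :: int
  assumes X_eq: "X = 2 ^ (w - 1)"
    and n_pos: "1 \<le> n"
    and X_big: "100 * (n + 2) * (n + 2) < X"
begin

lemma wrap_id: "- X \<le> x \<Longrightarrow> x < X \<Longrightarrow> wrap w x = x"
  unfolding wrap_def X_eq by (rule signed_take_bit_int_eq_self)

lemma X_linear: "100 * n + 200 < X"
proof -
  have "100 * n + 200 \<le> 100 * (n + 2) * (n + 2)"
    using n_pos by (simp add: algebra_simps)
  then show ?thesis using X_big by simp
qed

lemma small_const: "- 100 \<le> x \<Longrightarrow> x \<le> 100 \<Longrightarrow> wrap w x = x"
  using X_linear n_pos by (intro wrap_id) auto

lemma wrap_numerals [simp]: "wrap w 0 = 0" "wrap w 1 = 1" "wrap w (- 1) = - 1"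
   "wrap w 2 = 2" "wrap w 3 = 3"
  by (simp_all add: small_const)

end

section \<open>Longest previous factors\<close>

text \<open>\<open>e i j\<close> is the encoding of \<open>T[i..j]\<close>, and \<open>agree n e m i j\<close> says that \<open>T[i..i+m-1]\<close> and
  \<open>T[j..j+m-1]\<close> are equivalent strings. Positions are integers, so that no subtraction truncates.\<close>

definition agree :: "int \<Rightarrow> (int \<Rightarrow> int \<Rightarrow> int) \<Rightarrow> int \<Rightarrow> int \<Rightarrow> int \<Rightarrow> bool" where
  "agree n e m i j \<longleftrightarrow> 0 \<le> m \<and> i + m \<le> n + 1 \<and> j + m \<le> n + 1 \<and>
     (\<forall>k. 0 \<le> k \<and> k < m \<longrightarrow> e i (i + k) = e j (j + k))"

text \<open>\<open>agree_shift\<close> is what substring consistency leaves of the relation: a match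
  survives the loss of its first symbols. Shortening a match at its end is built into
  \<open>agree\<close>, which compares prefix by prefix.\<close>

locale matching =
  fixes n :: int and e :: "int \<Rightarrow> int \<Rightarrow> int"
  assumes n_ge_1: "1 \<le> n"
    and agree_shift: "1 \<le> i \<Longrightarrow> 1 \<le> j \<Longrightarrow> 0 \<le> m \<Longrightarrow> agree n e (m + 1) i j \<Longrightarrow> agree n e m (i + 1) (j + 1)"
begin

abbreviation "ev \<equiv> agree n e"

lemma ev_refl: "0 \<le> m \<Longrightarrow> i + m \<le> n + 1 \<Longrightarrow> ev m i i"
  by (simp add: agree_def)

lemma ev_sym: "ev m i j \<Longrightarrow> ev m j i"
  by (simp add: agree_def)

lemma ev_trans: "ev m i j \<Longrightarrow> ev m j k \<Longrightarrow> ev m i k"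
  by (simp add: agree_def)

lemma ev_mono: "ev m i j \<Longrightarrow> 0 \<le> m' \<Longrightarrow> m' \<le> m \<Longrightarrow> ev m' i j"
  by (simp add: agree_def)

lemma ev_zero: "i \<le> n \<Longrightarrow> j \<le> n \<Longrightarrow> ev 0 i j"
  by (simp add: agree_def)

lemma ev_bounds: "ev m i j \<Longrightarrow> 0 \<le> m \<and> i + m \<le> n + 1 \<and> j + m \<le> n + 1"
  by (simp add: agree_def)

lemma ev_Suc:
  assumes "0 \<le> m"
  shows "ev (m + 1) i j \<longleftrightarrow> ev m i j \<and> i + m \<le> n \<and> j + m \<le> n \<and> e i (i + m) = e j (j + m)"
    (is "?l \<longleftrightarrow> ?r")
proof
  assume l: ?l
  then have "e i (i + m) = e j (j + m)" using assms unfolding agree_def by simp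
  then show ?r using l assms unfolding agree_def by simp
next
  assume r: ?r
  have "e i (i + k) = e j (j + k)" if "0 \<le> k" "k < m + 1" for k
  proof (cases "k = m")
    case False
    then have "k < m" using that by simp
    then show ?thesis using r that unfolding agree_def by blast
  qed (use r in simp)
  then show ?l using r assms unfolding agree_def by simp
qed

text \<open>A trie node at depth \<open>m\<close> is named by its smallest position. Two suffixes
  pass through the same node at depth \<open>m\<close> exactly if these names agree, so nodes need
  no storage of their own.\<close>

definition owner :: "int \<Rightarrow> int \<Rightarrow> int" where
  "owner m i = Min {j. 1 \<le> j \<and> j \<le> i \<and> ev m j i}"

definition lpf :: "int \<Rightarrow> int" where
  "lpf i = Max (insert 0 {m. \<exists>j. 1 \<le> j \<and> j < i \<and> ev m j i})"

text \<open>The suffix at \<open>i\<close> leaves the trie of the earlier suffixes at the node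
  \<open>(link i, lpf i)\<close>. Position 1 has no earlier suffix and becomes its own link, the
  fixed point of all jumps.\<close>

definition link :: "int \<Rightarrow> int" where
  "link i = owner (lpf i) i"

lemma owner_props:
  assumes "1 \<le> i" "0 \<le> m" "i + m \<le> n + 1"
  shows "1 \<le> owner m i" "owner m i \<le> i" "ev m (owner m i) i"
    "\<And>j. 1 \<le> j \<Longrightarrow> ev m j i \<Longrightarrow> owner m i \<le> j"
proof -
  let ?S = "{j. 1 \<le> j \<and> j \<le> i \<and> ev m j i}"
  have fin: "finite ?S" by (rule finite_subset[of _ "{1..i}"]) auto
  have "i \<in> ?S" using assms ev_refl by auto
  then have "Min ?S \<in> ?S" using fin by (intro Min_in) auto
  then show a: "1 \<le> owner m i" "owner m i \<le> i" "ev m (owner m i) i"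
    unfolding owner_def by auto
  fix j assume "1 \<le> j" "ev m j i"
  show "owner m i \<le> j"
  proof (cases "j \<le> i")
    case True
    then show ?thesis unfolding owner_def using fin \<open>1 \<le> j\<close> \<open>ev m j i\<close> by (intro Min_le) auto
  qed (use a in auto)
qed

lemma owner_eqI:
  assumes "1 \<le> i" "1 \<le> y" "ev m y i" "\<And>j. 1 \<le> j \<Longrightarrow> j < y \<Longrightarrow> \<not> ev m j i"
  shows "owner m i = y"
proof -
  have b: "0 \<le> m" "i + m \<le> n + 1" using ev_bounds[OF assms(3)] by auto
  note p = owner_props[OF assms(1) b]
  have "owner m i \<le> y" using p(4) assms by blast
  moreover have "\<not> owner m i < y" using p assms(4) by blast
  ultimately show ?thesis by simp
qed

lemma owner_cong:
  assumes "1 \<le> i" "1 \<le> j" "ev m i j"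
  shows "owner m i = owner m j"
proof -
  have b: "0 \<le> m" "i + m \<le> n + 1" "j + m \<le> n + 1" using ev_bounds[OF assms(3)] by auto
  note p = owner_props[OF assms(1) b(1,2)] and q = owner_props[OF assms(2) b(1,3)]
  show ?thesis
    by (rule antisym) (meson p q assms ev_trans ev_sym)+
qed

lemma owner_zero: "1 \<le> i \<Longrightarrow> i \<le> n \<Longrightarrow> owner 0 i = 1"
  by (rule owner_eqI) (auto intro: ev_zero)

lemma lpf_set: "finite (insert 0 {m. \<exists>j. 1 \<le> j \<and> j < i \<and> ev m j i})"
  by (rule finite_subset[of _ "insert 0 {0..n+1}"]) (auto dest: ev_bounds)

lemma lpf_nonneg: "0 \<le> lpf i"
  unfolding lpf_def using lpf_set by (intro Max_ge) auto

lemma lpf_ge: "1 \<le> j \<Longrightarrow> j < i \<Longrightarrow> ev m j i \<Longrightarrow> m \<le> lpf i"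
  unfolding lpf_def using lpf_set by (intro Max_ge) auto

lemma lpf_attained: "2 \<le> i \<Longrightarrow> i \<le> n \<Longrightarrow> \<exists>j. 1 \<le> j \<and> j < i \<and> ev (lpf i) j i"
proof -
  assume i: "2 \<le> i" "i \<le> n"
  have "lpf i \<in> insert 0 {m. \<exists>j. 1 \<le> j \<and> j < i \<and> ev m j i}"
    unfolding lpf_def by (rule Max_in[OF lpf_set]) auto
  then show ?thesis using i ev_zero[of 1 i] by force
qed

lemma lpf_one: "lpf 1 = 0"
proof -
  have "{m. \<exists>j. 1 \<le> j \<and> j < 1 \<and> ev m j 1} = {}" by auto
  then show ?thesis unfolding lpf_def by (simp only: Max_singleton)
qed

lemma lpf_bound: "1 \<le> i \<Longrightarrow> i \<le> n \<Longrightarrow> i + lpf i \<le> n + 1"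
  using lpf_attained[of i] lpf_one ev_bounds by (cases "i = 1") fastforce+

lemma link_props:
  assumes "1 \<le> i" "i \<le> n"
  shows "1 \<le> link i" "link i \<le> i" "ev (lpf i) (link i) i"
  using owner_props[OF assms(1) lpf_nonneg lpf_bound[OF assms]] unfolding link_def by auto

lemma link_less: "2 \<le> i \<Longrightarrow> i \<le> n \<Longrightarrow> link i < i"
  using lpf_attained[of i] owner_props(4)[of i "lpf i"] lpf_nonneg[of i] lpf_bound[of i]
  unfolding link_def by fastforce

lemma link_one: "link 1 = 1"
  using link_props[of 1] n_ge_1 by auto

lemma owner_self:
  assumes "1 \<le> i" "i + m \<le> n + 1" "lpf i < m"
  shows "owner m i = i"
  by (rule owner_eqI) (use assms lpf_ge lpf_nonneg[of i] ev_refl in force)+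

lemma owner_link:
  assumes "1 \<le> i" "i \<le> n" "0 \<le> m" "m \<le> lpf i"
  shows "owner m i = owner m (link i)"
  using owner_cong[OF _ assms(1), of "link i" m] link_props[OF assms(1,2)] ev_mono assms by metis

text \<open>Otherwise some position before \<open>link i\<close> would match \<open>link i\<close>,
  and hence \<open>i\<close>, on \<open>lpf i\<close> symbols, against the choice of
  \<open>link i\<close> as the first such position. For \<open>lpf i = 0\<close> the link is 1 and
  strictness fails.\<close>

lemma lpf_link_less:
  assumes "1 \<le> i" "i \<le> n" "1 \<le> lpf i"
  shows "lpf (link i) < lpf i"
proof (rule ccontr)
  assume a: "\<not> lpf (link i) < lpf i"
  note p = link_props[OF assms(1,2)]
  have "2 \<le> link i" using a assms(3) p lpf_one by (cases "link i = 1") auto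
  then obtain j where j: "1 \<le> j" "j < link i" "ev (lpf (link i)) j (link i)"
    using lpf_attained[of "link i"] p assms by fastforce
  then have "ev (lpf i) j i" using a p ev_mono ev_trans lpf_nonneg by (metis not_less)
  then have "link i \<le> j"
    unfolding link_def using owner_props(4)[OF assms(1) lpf_nonneg lpf_bound[OF assms(1,2)]] j by blast
  then show False using j by simp
qed

lemma link_zero: "1 \<le> i \<Longrightarrow> i \<le> n \<Longrightarrow> lpf i = 0 \<Longrightarrow> link i = 1"
  by (simp add: link_def owner_zero)

lemma lpf_link_le:
  assumes "1 \<le> i" "i \<le> n" shows "lpf (link i) \<le> lpf i"
proof (cases "lpf i = 0")
  case True
  then show ?thesis using link_zero assms lpf_one by simp
next
  case False
  then show ?thesis using lpf_link_less assms lpf_nonneg[of i] by fastforce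
qed

text \<open>Every link from a position above 1 goes to a smaller one, so at least one is lost per
  link until 1 is reached. Thus \<open>n\<close> links always end at 1, which starts off the binary
  lifting.\<close>

lemma iter_link_bounds:
  assumes "1 \<le> i" "i \<le> n"
  shows "1 \<le> (link ^^ k) i \<and> (link ^^ k) i \<le> max 1 (i - int k)"
proof (induction k)
  case (Suc k)
  let ?y = "(link ^^ k) i"
  have y: "1 \<le> ?y" "?y \<le> n" using Suc assms n_ge_1 by auto
  show ?case
  proof (cases "?y = 1")
    case True then show ?thesis using link_one by simp
  next
    case False
    then have "link ?y < ?y" using y link_less by auto
    then show ?thesis using link_props[OF y] Suc False by auto
  qed
qed (use assms in auto)

text \<open>Since \<open>lpf\<close> does not increase along links, every intermediate link also
  keeps a match of \<open>m\<close> symbols and stays in the same node at depth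
  \<open>m\<close>.\<close>

lemma owner_iter_link:
  assumes "1 \<le> i" "i \<le> n" "0 \<le> m" "m \<le> lpf ((link ^^ k) i)"
  shows "owner m ((link ^^ k) i) = owner m i"
  using assms(4)
proof (induction k)
  case (Suc k)
  let ?y = "(link ^^ k) i"
  have y: "1 \<le> ?y" "?y \<le> n" using iter_link_bounds[OF assms(1,2), of k] assms n_ge_1 by auto
  have "m \<le> lpf ?y" using lpf_link_le[OF y] Suc.prems by simp
  then show ?case using owner_link[OF y assms(3)] Suc.IH by simp
qed simp

lemma owner_lt_iff:
  assumes "2 \<le> i" "i \<le> n" "0 \<le> m" "i + m \<le> n + 1"
  shows "owner m i < i \<longleftrightarrow> m \<le> lpf i"
proof
  assume "owner m i < i"
  then show "m \<le> lpf i" using owner_props[of i m] assms lpf_ge by auto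
next
  assume "m \<le> lpf i"
  then have "ev m (link i) i" using link_props[of i] ev_mono assms by auto
  then have "owner m i \<le> link i" using owner_props(4)[of i m "link i"] link_props[of i] assms by auto
  then show "owner m i < i" using link_less assms by fastforce
qed

lemma owner_Suc_same:
  assumes "1 \<le> i" "0 \<le> m" "i + m \<le> n" "e (owner m i) (owner m i + m) = e i (i + m)"
  shows "owner (m + 1) i = owner m i"
proof (rule owner_eqI)
  note p = owner_props[OF assms(1,2)]
  show "1 \<le> i" "1 \<le> owner m i" using assms p by auto
  show "ev (m + 1) (owner m i) i" using p assms by (auto simp: ev_Suc)
  fix j assume "1 \<le> j" "j < owner m i"
  then show "\<not> ev (m + 1) j i" using p assms ev_mono[of "m + 1" j i m] by fastforce
qed

lemma owner_Suc_child:
  assumes "1 \<le> i" "0 \<le> m" "i + m \<le> n" "2 \<le> z" "z + m \<le> n" "link z = owner m i" "lpf z = m"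
    "e z (z + m) = e i (i + m)"
  shows "owner (m + 1) i = z"
proof -
  have "ev m (owner m i) i" using owner_props[of i m] assms by auto
  moreover have "ev m (link z) z" using link_props[of z] assms by auto
  ultimately have "ev m z i" using assms ev_sym ev_trans by metis
  then have "ev (m + 1) z i" using assms by (simp add: ev_Suc)
  then have "owner (m + 1) i = owner (m + 1) z" using owner_cong[of z i "m + 1"] assms by auto
  also have "\<dots> = z" using owner_self assms by auto
  finally show ?thesis .
qed

text \<open>This is why a branch can be stored under the position that opened it. The first suffix
  \<open>z\<close> in the child matches the owner, an earlier position, on \<open>m\<close> symbols;
  a longer earlier match would put a smaller position into the child. So \<open>z\<close> left the
  trie precisely at this node.\<close>

lemma child_of_owner:
  assumes "1 \<le> i" "0 \<le> m" "i + m \<le> n" "e (owner m i) (owner m i + m) \<noteq> e i (i + m)"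
  defines "z \<equiv> owner (m + 1) i"
  shows "2 \<le> z" "z \<le> i" "z + m \<le> n" "link z = owner m i" "lpf z = m" "e z (z + m) = e i (i + m)"
proof -
  have p: "1 \<le> z" "z \<le> i" "ev (m + 1) z i" "\<And>j. 1 \<le> j \<Longrightarrow> ev (m + 1) j i \<Longrightarrow> z \<le> j"
    using owner_props[of i "m + 1"] assms by auto
  note q = owner_props[of i m]
  have evm: "ev m z i" and enc: "e z (z + m) = e i (i + m)" and zm: "z + m \<le> n"
    using p(3) assms by (auto simp: ev_Suc)
  have le: "owner m i \<le> z" using q(4)[of z] evm p assms by auto
  have ne: "owner m i \<noteq> z" using enc assms by auto
  have ez: "ev m (owner m i) z" using q(3) evm ev_trans ev_sym assms by (smt (verit))
  have "m \<le> lpf z" using lpf_ge[OF _ _ ez] q(1) le ne assms by auto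
  moreover have "lpf z \<le> m"
  proof (rule ccontr)
    assume a: "\<not> lpf z \<le> m"
    have "2 \<le> z" using le ne q(1) assms by auto
    then obtain j where j: "1 \<le> j" "j < z" "ev (lpf z) j z" using lpf_attained[of z] zm assms by auto
    have "ev (m + 1) j z" using ev_mono[OF j(3)] a assms by auto
    then have "ev (m + 1) j i" using p(3) ev_trans by blast
    then show False using p(4) j by fastforce
  qed
  ultimately show l: "lpf z = m" by simp
  show "2 \<le> z" using le ne q(1) assms by auto
  show "z \<le> i" "z + m \<le> n" "e z (z + m) = e i (i + m)" using p zm enc by auto
  show "link z = owner m i" unfolding link_def l using owner_cong[OF p(1) assms(1) evm] .
qed

lemma lpf_eq_iff_stop:
  assumes "2 \<le> i" "i \<le> n" "0 \<le> m" "m \<le> lpf i" "i + m > n \<or> owner (m + 1) i = i"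
  shows "lpf i = m"
proof (cases "i + m > n")
  case True
  then show ?thesis using lpf_bound[of i] assms by auto
next
  case False
  then have "\<not> m + 1 \<le> lpf i" using owner_lt_iff[of i "m + 1"] assms by auto
  then show ?thesis using assms by auto
qed

text \<open>The match with the link is shifted by one symbol. Its partner \<open>link i + 1\<close>
  is still earlier than \<open>i + 1\<close>, because \<open>lpf 1 = 0\<close> excludes
  \<open>i = 1\<close>.\<close>

lemma lpf_Suc:
  assumes "1 \<le> i" "i < n" "1 \<le> lpf i"
  shows "ev (lpf i - 1) (link i + 1) (i + 1)" "lpf i - 1 \<le> lpf (i + 1)"
proof -
  have i: "2 \<le> i" using assms lpf_one by (cases "i = 1") auto
  note p = link_props[of i]
  show a: "ev (lpf i - 1) (link i + 1) (i + 1)"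
    using agree_shift[of "link i" i "lpf i - 1"] p assms by auto
  show "lpf i - 1 \<le> lpf (i + 1)"
    by (rule lpf_ge[OF _ _ a]) (use p link_less[of i] i assms in auto)
qed

lemma lpf_Suc_ge: "1 \<le> i \<Longrightarrow> i < n \<Longrightarrow> lpf i - 1 \<le> lpf (i + 1)"
  using lpf_Suc[of i] lpf_nonneg[of "i + 1"] by linarith

text \<open>A square that starts at \<open>i\<close> and has its second half at \<open>j\<close> is longer than \<open>lpf i\<close> iff
  \<open>threshold i \<le> j\<close>.\<close>

definition threshold :: "int \<Rightarrow> int" where
  "threshold i = i + lpf i div 2 + 1"

text \<open>\<open>lpf\<close> drops by at most one, so its half drops by at most one as well, and
  the growth of \<open>i\<close> makes up for it.\<close>

lemma threshold_Suc: "1 \<le> i \<Longrightarrow> i < n \<Longrightarrow> threshold i \<le> threshold (i + 1)"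
  using lpf_Suc_ge[of i] unfolding threshold_def by linarith

lemma threshold_mono:
  assumes "1 \<le> i" "i \<le> j" "j \<le> n"
  shows "threshold i \<le> threshold j"
  using assms(2,3)
proof (induction j rule: int_ge_induct)
  case (step j) then show ?case using threshold_Suc[of j] assms(1) by force
qed simp

lemma threshold_bounds: "1 \<le> i \<Longrightarrow> i \<le> n \<Longrightarrow> i < threshold i \<and> threshold i \<le> n + 2"
  using lpf_bound[of i] lpf_nonneg[of i] unfolding threshold_def by auto

end

section \<open>Computing longest previous factors\<close>

text \<open>All programs keep \<open>n\<close>, \<open>n + 1\<close>, a bound \<open>Z\<close> above twice the absolute value of all encodings, and the number of
  binary digits of \<open>n\<close> in registers 0 to 3. Oracle programs expect the query in registers 10 and 11 and
  answer in register 12. Arrays 5 and 6 receive \<open>lpf\<close> and \<open>link\<close>; array 7 holds the \<open>2 ^ k\<close>-fold iterate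
  of \<open>link\<close> at \<open>x\<close> in cell \<open>k * (n + 1) + x\<close>. Registers 20, 21 and 22 hold the suffix to be inserted,
  the current depth and the first position in the current trie node.\<close>

definition climb :: prog where
  "climb = seqs [Move 23 (Reg 3),
     While Less (Const 0) (Reg 23) (seqs [dec 23, Op 24 Mult (Reg 23) (Reg 1),
       Op 24 Add (Reg 24) (Reg 22), Load 24 7 (Reg 24), Load 25 5 (Reg 24),
       If LessEq (Reg 21) (Reg 25) (Move 22 (Reg 24)) Skip]),
     Load 25 5 (Reg 22), If LessEq (Reg 21) (Reg 25) (Load 22 6 (Reg 22)) Skip]"

text \<open>Only branches off the path of the owner are in the dictionary; the continuation of the
  owner itself is tested by a second query. After a mismatch an empty cell therefore means that the
  suffix opens a new branch here, and register 26 ends the loop.\<close>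

definition descend :: "nat \<Rightarrow> prog \<Rightarrow> prog" where
  "descend d G = seqs [Move 26 (Const 1),
     While Equal (Reg 26) (Const 1) (seqs [
       Op 11 Add (Reg 20) (Reg 21),
       If Less (Reg 0) (Reg 11) (Move 26 (Const 0)) (seqs [
         Move 10 (Reg 20), G, Move 27 (Reg 12),
         Move 10 (Reg 22), Op 11 Add (Reg 22) (Reg 21), G,
         If Equal (Reg 12) (Reg 27) (inc 21) (seqs [
           Op 28 Mult (Reg 22) (Reg 1), Op 28 Add (Reg 28) (Reg 21),
           Op 28 Mult (Reg 28) (Reg 2), Op 28 Add (Reg 28) (Reg 27), Load 29 d (Reg 28),
           If Equal (Reg 29) (Const 0)
             (seqs [Store d (Reg 28) (Reg 20), Move 26 (Const 0)])
             (seqs [Move 22 (Reg 29), inc 21])])])])]"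

text \<open>A jump of length \<open>2 ^ (k + 1)\<close> is composed of two jumps of length
  \<open>2 ^ k\<close>. The second one starts at an earlier position, whose entries are
  complete.\<close>

definition record_suffix :: prog where
  "record_suffix = seqs [Store 5 (Reg 20) (Reg 21), Store 6 (Reg 20) (Reg 22),
     Store 7 (Reg 20) (Reg 22), Move 24 (Reg 22), Move 23 (Const 1), Move 25 (Const 0),
     While Less (Reg 23) (Reg 3) (seqs [Op 30 Add (Reg 25) (Reg 24), Load 24 7 (Reg 30),
       Op 25 Add (Reg 25) (Reg 1), Op 30 Add (Reg 25) (Reg 20), Store 7 (Reg 30) (Reg 24), inc 23])]"

definition build :: "nat \<Rightarrow> prog \<Rightarrow> prog" where
  "build d G = seqs [Move 20 (Const 1), Move 21 (Const 0), Move 22 (Const 1), record_suffix,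
     Move 20 (Const 2),
     While LessEq (Reg 20) (Reg 0) (seqs [
       Op 24 Sub (Reg 20) (Const 1), Load 21 5 (Reg 24), dec 21, Load 22 6 (Reg 24), inc 22,
       If LessEq (Reg 21) (Const 0) (seqs [Move 21 (Const 0), Move 22 (Const 1)]) climb,
       descend d G, record_suffix, inc 20])]"

context ram begin

lemma mult_bound:
  assumes "0 \<le> a" "a \<le> n + 1" "0 \<le> b" "b \<le> n + 1"
  shows "0 \<le> a * b" "a * b \<le> (n + 2) * (n + 2)" "100 * (a * b) < X"
proof -
  show "0 \<le> a * b" using assms by simp
  show le: "a * b \<le> (n + 2) * (n + 2)" by (rule mult_mono) (use assms in auto)
  then show "100 * (a * b) < X" using X_big by linarith
qed

lemma wrap_mult:
  assumes "0 \<le> a" "a \<le> n + 1" "0 \<le> b" "b \<le> n + 1"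
  shows "wrap w (a * b) = a * b"
  using mult_bound[OF assms] by (intro wrap_id) linarith+

lemma wrap_mult_add:
  assumes "0 \<le> a" "a \<le> n + 1" "0 \<le> b" "b \<le> n + 1" "0 \<le> c" "c \<le> n + 1"
  shows "wrap w (a * b + c) = a * b + c"
  using mult_bound[OF assms(1-4)] X_linear assms n_pos by (intro wrap_id) linarith+

end

lemma digits_unique:
  fixes a b x y N :: int
  assumes "a * N + x = b * N + y" "0 \<le> x" "x < N" "0 \<le> y" "y < N"
  shows "a = b" "x = y"
proof -
  have "(a * N + x) div N = a" using assms(2,3) by simp
  moreover have "(b * N + y) div N = b" using assms(4,5) by simp
  ultimately show "a = b" using assms(1) by simp
  then show "x = y" using assms(1) by simp
qed

text \<open>\<open>J\<close> is the invariant that keeps the oracle \<open>G\<close> usable; it may depend only on registers and arrays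
  from 100 on and on the input array 0.\<close>

locale builder = ram w X n + matching n e for w X n e +
  fixes Z Lg q :: int and G :: prog and J :: "state \<Rightarrow> bool"
  assumes Lg: "n < 2 ^ nat Lg" "1 \<le> Lg" "Lg \<le> n + 1"
    and q_nonneg: "0 \<le> q"
    and enc_bound: "1 \<le> i \<Longrightarrow> i \<le> j \<Longrightarrow> j \<le> n \<Longrightarrow> 2 * \<bar>e i j\<bar> < Z"
    and Z_bound: "(n + 2) * (n + 2) * Z < X"
    and J_frame: "J s \<Longrightarrow> same_outside {..<100} {1..<100} s s' \<Longrightarrow> J s'"
    and G_spec: "J s \<Longrightarrow> regs s 10 = i \<Longrightarrow> regs s 11 = j \<Longrightarrow> 1 \<le> i \<Longrightarrow> i \<le> j \<Longrightarrow> j \<le> n \<Longrightarrow>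
      (\<And>s' t'. J s' \<Longrightarrow> same_outside (insert 12 {100..}) {100..} s s' \<Longrightarrow> regs s' 12 = e i j \<Longrightarrow>
         t' \<ge> t - q \<Longrightarrow> Q s' t') \<Longrightarrow> wp w G Q s t"
begin

section \<open>Binary lifting along links\<close>

definition tables :: "state \<Rightarrow> int \<Rightarrow> bool" where
  "tables s i \<longleftrightarrow> (\<forall>x. 1 \<le> x \<and> x < i \<longrightarrow> arrays s 5 x = lpf x \<and> arrays s 6 x = link x \<and>
     (\<forall>k. int k < Lg \<longrightarrow> arrays s 7 (int k * (n + 1) + x) = (link ^^ (2 ^ k)) x))"

lemma tablesD:
  assumes "tables s i" "1 \<le> x" "x < i"
  shows "arrays s 5 x = lpf x" "arrays s 6 x = link x"
    "int k < Lg \<Longrightarrow> arrays s 7 (int k * (n + 1) + x) = (link ^^ (2 ^ k)) x"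
  using assms unfolding tables_def by auto

lemma iter_link_le: "1 \<le> i \<Longrightarrow> i \<le> n \<Longrightarrow> (link ^^ k) i \<le> i"
  using iter_link_bounds[of i k] by linarith

lemma iter_link_end:
  assumes "1 \<le> x" "x \<le> n" "1 \<le> m"
  shows "lpf ((link ^^ (2 ^ nat Lg)) x) < m"
proof -
  have "n < int (2 ^ nat Lg)" using Lg(1) by simp
  then have "(link ^^ (2 ^ nat Lg)) x = 1"
    using iter_link_bounds[OF assms(1,2), of "2 ^ nat Lg"] assms by linarith
  then show ?thesis using lpf_one assms by simp
qed

text \<open>While \<open>k\<close> bits are left, \<open>2 ^ k\<close> further links would lead to a
  value of \<open>lpf\<close> below \<open>m\<close>. A jump is made only if its target still has
  \<open>lpf\<close> at least \<open>m\<close>, and then the node at depth \<open>m\<close> is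
  unchanged by \<open>owner_iter_link\<close>. At the end one link suffices to get below
  \<open>m\<close>, and a position whose \<open>lpf\<close> is below \<open>m\<close> is its own
  owner.\<close>

lemma wp_climb:
  assumes tab: "tables s i" and i: "i \<le> n" and x: "1 \<le> x" "x < i" and m: "1 \<le> m" "x + m \<le> n + 1"
    and rg: "regs s 1 = n + 1" "regs s 3 = Lg" "regs s 21 = m" "regs s 22 = x"
    and t: "8 * Lg + 6 \<le> t"
    and Q: "\<And>s' t'. same_outside {22,23,24,25} {} s s' \<Longrightarrow> regs s' 22 = owner m x \<Longrightarrow>
      t' \<ge> t - (8 * Lg + 6) \<Longrightarrow> Q s' t'"
  shows "wp w climb Q s t"
proof -
  define I where "I = (\<lambda>s' t'. \<exists>k::nat. regs s' 23 = int k \<and> int k \<le> Lg \<and>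
    same_outside {22,23,24,25} {} s s' \<and> 1 \<le> regs s' 22 \<and> regs s' 22 \<le> x \<and>
    owner m (regs s' 22) = owner m x \<and> lpf ((link ^^ (2 ^ k)) (regs s' 22)) < m \<and>
    t' \<ge> t - 1 - 8 * (Lg - int k))"
  have step: "wp w (seqs [dec 23, Op 24 Mult (Reg 23) (Reg 1),
       Op 24 Add (Reg 24) (Reg 22), Load 24 7 (Reg 24), Load 25 5 (Reg 24),
       If LessEq (Reg 21) (Reg 25) (Move 22 (Reg 24)) Skip]) I s' (t' - 1)"
    if I: "I s' t'" and c: "compare_val Less (operand_val w s' (Const 0)) (operand_val w s' (Reg 23))" for s' t'
  proof -
    obtain k where k: "regs s' 23 = int k" "int k \<le> Lg"
      and fr: "same_outside {22,23,24,25} {} s s'" and y: "1 \<le> regs s' 22" "regs s' 22 \<le> x"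
      "owner m (regs s' 22) = owner m x" "lpf ((link ^^ (2 ^ k)) (regs s' 22)) < m"
      and t': "t' \<ge> t - 1 - 8 * (Lg - int k)" using I unfolding I_def by blast
    obtain k' where k': "k = Suc k'" using c k by (cases k) auto
    have rs: "regs s' 1 = n + 1" "regs s' 3 = Lg" "regs s' 21 = m"
      using same_outside_regs[OF fr] rg by auto
    have ar: "arrays s' = arrays s" using same_outside_arrays[OF fr] by auto
    let ?y = "regs s' 22" and ?z = "(link ^^ (2 ^ k')) (regs s' 22)"
    have k'L: "int k' < Lg" using k k' by simp
    have yb: "1 \<le> ?y" "?y \<le> n" using y x i by auto
    have z: "1 \<le> ?z" "?z \<le> ?y" using iter_link_bounds[OF yb, of "2 ^ k'"] iter_link_le[OF yb] by auto
    have up: "arrays s 7 (int k' * (n + 1) + ?y) = ?z" using tablesD[OF tab _ _] y x k'L by auto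
    have hz: "arrays s 5 ?z = lpf ?z" using tablesD[OF tab z(1)] z y x by auto
    have w1: "wrap w (int k) = int k" "wrap w (int k') = int k'" "wrap w (1 + int k' - 1) = int k'"
      using k k' Lg X_linear n_pos by (auto intro!: wrap_id)
    have w2: "wrap w (int k' * (n + 1)) = int k' * (n + 1)"
      by (rule wrap_mult) (use k'L Lg n_pos in auto)
    have w3: "wrap w (int k' * (n + 1) + ?y) = int k' * (n + 1) + ?y"
      by (rule wrap_mult_add) (use k'L Lg n_pos yb in auto)
    have dbl: "(link ^^ (2 ^ k')) ?z = (link ^^ (2 ^ k)) ?y"
      unfolding k' by (simp add: funpow_add mult_2)
    have own: "m \<le> lpf ?z \<Longrightarrow> owner m ?z = owner m x"
      using owner_iter_link[OF yb, of m "2 ^ k'"] m y by simp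
    show ?thesis
      using k k' k'L fr y rs t' z own dbl
      by (auto simp: wp_simps I_def w1 w2 w3 ar up hz intro!: exI[of _ k'])
  qed
  have fin: "wp w (seqs [Load 25 5 (Reg 22), If LessEq (Reg 21) (Reg 25) (Load 22 6 (Reg 22)) Skip]) Q s' (t' - 1)"
    if I: "I s' t'" and c: "\<not> compare_val Less (operand_val w s' (Const 0)) (operand_val w s' (Reg 23))" for s' t'
  proof -
    obtain k where k: "regs s' 23 = int k" "int k \<le> Lg"
      and fr: "same_outside {22,23,24,25} {} s s'" and y: "1 \<le> regs s' 22" "regs s' 22 \<le> x"
      "owner m (regs s' 22) = owner m x" "lpf ((link ^^ (2 ^ k)) (regs s' 22)) < m"
      and t': "t' \<ge> t - 1 - 8 * (Lg - int k)" using I unfolding I_def by blast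
    let ?y = "regs s' 22"
    have k0: "k = 0" using c k by auto
    have lk: "lpf (link ?y) < m" using y(4) k0 by simp
    have rs: "regs s' 21 = m" using same_outside_regs[OF fr] rg by auto
    have ar: "arrays s' = arrays s" using same_outside_arrays[OF fr] by auto
    have yb: "1 \<le> ?y" "?y \<le> n" using y x i by auto
    have tb: "arrays s 5 ?y = lpf ?y" "arrays s 6 ?y = link ?y" using tablesD[OF tab yb(1)] y x by auto
    have lb: "link ?y + m \<le> n + 1" using link_props[OF yb] y m by auto
    have o1: "owner m x = link ?y" if "m \<le> lpf ?y"
      using owner_link[OF yb, of m] owner_self[OF link_props(1)[OF yb] lb lk] that m y by simp
    have o2: "owner m x = ?y" if "\<not> m \<le> lpf ?y"
      using owner_self[of ?y m] that y m by auto
    show ?thesis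
      using fr t' k k0 o1 o2 rs
      by (auto simp: wp_simps ar tb intro!: Q)
  qed
  have I0: "I (set_reg 23 Lg s) (t - 1)"
    unfolding I_def using Lg rg x i m iter_link_end[of x m]
    by (intro exI[of _ "nat Lg"]) (auto simp: wp_simps)
  show ?thesis
    unfolding climb_def seqs.simps wp_Seq wp_Move
    apply (rule wp_While[where I=I])
    subgoal using I0 rg by simp
    subgoal for s t unfolding I_def using \<open>8 * Lg + 6 \<le> _\<close> by auto
    subgoal for s' t' using step[of s' t'] by simp
    subgoal for s' t' using fin[of s' t'] by (simp add: wp_Seq)
    done
qed

lemma wp_record_suffix:
  assumes tab: "tables s i" and i: "1 \<le> i" "i \<le> n"
    and rg: "regs s 1 = n + 1" "regs s 3 = Lg" "regs s 20 = i" "regs s 21 = lpf i" "regs s 22 = link i"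
    and t: "7 * Lg + 8 \<le> t"
    and Q: "\<And>s' t'. same_outside {23,24,25,30} {5,6,7} s s' \<Longrightarrow> tables s' (i + 1) \<Longrightarrow>
      t' \<ge> t - (7 * Lg + 8) \<Longrightarrow> Q s' t'"
  shows "wp w record_suffix Q s t"
proof -
  define I where "I = (\<lambda>s' t'. \<exists>k::nat. regs s' 23 = int k + 1 \<and> int k < Lg \<and>
    same_outside {23,24,25,30} {5,6,7} s s' \<and> regs s' 24 = (link ^^ (2 ^ k)) i \<and>
    regs s' 25 = int k * (n + 1) \<and> tables s' i \<and> arrays s' 5 i = lpf i \<and> arrays s' 6 i = link i \<and>
    (\<forall>j\<le>k. arrays s' 7 (int j * (n + 1) + i) = (link ^^ (2 ^ j)) i) \<and>
    t' \<ge> t - 6 - 7 * int k)"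
  have step: "wp w (seqs [Op 30 Add (Reg 25) (Reg 24), Load 24 7 (Reg 30),
       Op 25 Add (Reg 25) (Reg 1), Op 30 Add (Reg 25) (Reg 20), Store 7 (Reg 30) (Reg 24), inc 23]) I s' (t' - 1)"
    if I: "I s' t'" and c: "compare_val Less (operand_val w s' (Reg 23)) (operand_val w s' (Reg 3))" for s' t'
  proof -
    obtain k where k: "regs s' 23 = int k + 1" "int k < Lg"
      and fr: "same_outside {23,24,25,30} {5,6,7} s s'" and z: "regs s' 24 = (link ^^ (2 ^ k)) i"
      and b: "regs s' 25 = int k * (n + 1)" and tb: "tables s' i" "arrays s' 5 i = lpf i" "arrays s' 6 i = link i"
      and row: "\<forall>j\<le>k. arrays s' 7 (int j * (n + 1) + i) = (link ^^ (2 ^ j)) i"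
      and t': "t' \<ge> t - 6 - 7 * int k" using I unfolding I_def by blast
    have rs: "regs s' 1 = n + 1" "regs s' 3 = Lg" "regs s' 20 = i"
      using same_outside_regs[OF fr] rg by auto
    have kL: "int k + 1 < Lg" using c k rs by simp
    let ?z = "(link ^^ (2 ^ k)) i"
    have zb: "1 \<le> ?z" "?z \<le> i" using iter_link_bounds[OF i, of "2 ^ k"] iter_link_le[OF i] by auto
    have up: "arrays s' 7 (int k * (n + 1) + ?z) = (link ^^ (2 ^ Suc k)) i"
    proof (cases "?z = i")
      \<comment> \<open>Only \<open>i = 1\<close> is its own iterate; the entry for the second jump
        is then one that this loop has already written.\<close>
      case True
      then have "arrays s' 7 (int k * (n + 1) + ?z) = ?z" using row by simp
      moreover have "(link ^^ (2 ^ Suc k)) i = (link ^^ (2 ^ k)) ?z" by (simp add: funpow_add mult_2)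
      ultimately show ?thesis using True by simp
    next
      case False
      then have "arrays s' 7 (int k * (n + 1) + ?z) = (link ^^ (2 ^ k)) ?z"
        using tablesD(3)[OF tb(1) zb(1), of k] zb k by auto
      then show ?thesis by (simp add: funpow_add mult_2)
    qed
    have w1: "wrap w (int k * (n + 1) + ?z) = int k * (n + 1) + ?z"
      "wrap w (int k * (n + 1) + (n + 1)) = int (Suc k) * (n + 1)"
      "wrap w (int (Suc k) * (n + 1) + i) = int (Suc k) * (n + 1) + i"
      using wrap_mult_add[of "int k" "n + 1" ?z] wrap_mult_add[of "int k" "n + 1" "n + 1"]
        wrap_mult_add[of "int (Suc k)" "n + 1" i] kL Lg n_pos zb i by (auto simp: algebra_simps)
    have w2: "wrap w (2 + int k) = int (Suc k) + 1"
      using X_linear kL Lg n_pos by (subst wrap_id) auto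
    let ?a = "int (Suc k) * (n + 1) + i"
    have other: "int j * (n + 1) + x \<noteq> ?a" if "0 \<le> x" "x \<le> n" "x \<noteq> i \<or> j \<noteq> Suc k" for j x
    proof
      assume eq: "int j * (n + 1) + x = ?a"
      show False using digits_unique[OF eq] that i by auto
    qed
    define s2 where "s2 = set_reg 23 (int (Suc k) + 1) (set_cell 7 ?a ((link ^^ (2 ^ Suc k)) i)
      (set_reg 30 ?a (set_reg 25 (int (Suc k) * (n + 1)) (set_reg 24 ((link ^^ (2 ^ Suc k)) i)
        (set_reg 30 (int k * (n + 1) + ?z) s')))))"
    have fr2: "same_outside {23,24,25,30} {5,6,7} s s2" using fr unfolding s2_def by (simp add: wp_simps)
    have tb2: "tables s2 i" using tb(1) other i unfolding tables_def s2_def by (auto simp: wp_simps)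
    have row2: "\<forall>j\<le>Suc k. arrays s2 7 (int j * (n + 1) + i) = (link ^^ (2 ^ j)) i"
    proof (intro allI impI)
      fix j assume "j \<le> Suc k"
      then show "arrays s2 7 (int j * (n + 1) + i) = (link ^^ (2 ^ j)) i"
        using row other[of i j] i unfolding s2_def by (cases "j = Suc k") (auto simp: wp_simps)
    qed
    have "I s2 (t' - 1 - 6)" unfolding I_def
      using fr2 tb2 row2 tb t' kL
      by (intro exI[of _ "Suc k"]) (auto simp: s2_def wp_simps)
    then show ?thesis unfolding s2_def
      using k rs z b up by (simp add: wp_simps w1 w2 del: of_nat_Suc funpow.simps power.simps)
  qed
  have I0: "I (set_reg 25 0 (set_reg 23 1 (set_reg 24 (link i) (set_cell 7 i (link i)
      (set_cell 6 i (link i) (set_cell 5 i (lpf i) s)))))) (t - 6)"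
  proof -
    have "int j * (n + 1) + x \<noteq> i" if "0 \<le> x" "x < i" for j x
      using digits_unique[of "int j" "n + 1" x 0 i] that i by auto
    then show ?thesis unfolding I_def using tab Lg rg i
      by (intro exI[of _ 0]) (auto simp: wp_simps tables_def)
  qed
  have fin: "Q s' (t' - 1)"
    if I: "I s' t'" and c: "\<not> compare_val Less (operand_val w s' (Reg 23)) (operand_val w s' (Reg 3))" for s' t'
  proof -
    obtain k where k: "regs s' 23 = int k + 1" "int k < Lg"
      and fr: "same_outside {23,24,25,30} {5,6,7} s s'" 
      and tb: "tables s' i" "arrays s' 5 i = lpf i" "arrays s' 6 i = link i"
      and row: "\<forall>j\<le>k. arrays s' 7 (int j * (n + 1) + i) = (link ^^ (2 ^ j)) i"
      and t': "t' \<ge> t - 6 - 7 * int k" using I unfolding I_def by blast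
    have rs: "regs s' 3 = Lg" using same_outside_regs[OF fr] rg by auto
    have kL: "Lg = int k + 1" using c k rs by simp
    have "tables s' (i + 1)" unfolding tables_def
    proof (intro allI impI)
      fix x assume x: "1 \<le> x \<and> x < i + 1"
      show "arrays s' 5 x = lpf x \<and> arrays s' 6 x = link x \<and>
         (\<forall>k. int k < Lg \<longrightarrow> arrays s' 7 (int k * (n + 1) + x) = (link ^^ 2 ^ k) x)"
      proof (cases "x = i")
        case True then show ?thesis using tb row kL by auto
      next
        case False then show ?thesis using tablesD[OF tb(1), of x] x by auto
      qed
    qed
    then show ?thesis using fr t' kL by (intro Q) auto
  qed
  show ?thesis
    unfolding record_suffix_def seqs.simps wp_Seq wp_Move wp_Store
    apply (rule wp_While[where I=I])
    subgoal using I0 rg by (simp add: wp_simps)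
    subgoal for s t unfolding I_def using \<open>7 * Lg + 8 \<le> _\<close> by auto
    subgoal for s' t' using step[of s' t'] by simp
    subgoal for s' t' using fin[of s' t'] by simp
    done
qed

text \<open>The dictionary is an array addressed by \<open>key\<close>. This needs no initialisation since all cells are
  zero in the beginning.\<close>

definition key :: "int \<Rightarrow> int \<Rightarrow> int \<Rightarrow> int" where
  "key y m v = (y * (n + 1) + m) * Z + v"

lemma key_unique:
  assumes "key y m v = key y' m' v'" "0 \<le> m" "m \<le> n" "0 \<le> m'" "m' \<le> n" "2 * \<bar>v\<bar> < Z" "2 * \<bar>v'\<bar> < Z"
  shows "y = y' \<and> m = m' \<and> v = v'"
proof -
  \<comment> \<open>\<open>v\<close> may be negative; adding half of \<open>Z\<close> turns it into
    a digit to the base \<open>Z\<close>. This is the origin of the factor 2 in the bound on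
    encodings.\<close>
  define H where "H = Z div 2"
  have H: "0 \<le> v + H" "v + H < Z" "0 \<le> v' + H" "v' + H < Z" using assms unfolding H_def by linarith+
  have "(y * (n + 1) + m) * Z + (v + H) = (y' * (n + 1) + m') * Z + (v' + H)"
    using assms(1) unfolding key_def by simp
  from digits_unique[OF this H] have a: "y * (n + 1) + m = y' * (n + 1) + m'" "v = v'" by auto
  from digits_unique[OF a(1)] show ?thesis using assms a by auto
qed

lemma Z_pos: "1 \<le> Z"
  using enc_bound[of 1 1] n_pos by auto

lemma key_wraps:
  assumes "1 \<le> y" "y \<le> n" "0 \<le> m" "m \<le> n" "2 * \<bar>v\<bar> < Z"
  shows "wrap w (y * (n + 1)) = y * (n + 1)" "wrap w (y * (n + 1) + m) = y * (n + 1) + m"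
    "wrap w ((y * (n + 1) + m) * Z) = (y * (n + 1) + m) * Z"
    "wrap w ((y * (n + 1) + m) * Z + v) = key y m v"
proof -
  show "wrap w (y * (n + 1)) = y * (n + 1)" "wrap w (y * (n + 1) + m) = y * (n + 1) + m"
    using wrap_mult[of y "n + 1"] wrap_mult_add[of y "n + 1" m] assms n_pos by auto
  have b: "y * (n + 1) \<le> n * (n + 1)" using assms n_pos by (intro mult_right_mono) auto
  have c: "y * (n + 1) + m + 1 \<le> (n + 2) * (n + 2)"
    using b assms n_pos by (simp add: algebra_simps)
  have d: "(y * (n + 1) + m + 1) * Z \<le> (n + 2) * (n + 2) * Z"
    using c Z_pos by (intro mult_right_mono) auto
  have p: "0 \<le> (y * (n + 1) + m) * Z" using assms n_pos Z_pos by auto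
  have u: "(y * (n + 1) + m) * Z + Z < X" using d Z_bound by (simp add: algebra_simps)
  have "Z * 1 \<le> Z * ((n + 2) * (n + 2))"
  proof (rule mult_left_mono)
    have "0 \<le> n * (n + 4)" using n_pos by auto
    then show "1 \<le> (n + 2) * (n + 2)" by (simp add: algebra_simps)
  qed (use Z_pos in auto)
  then have ZX: "Z < X" using Z_bound by (simp add: algebra_simps)
  show "wrap w ((y * (n + 1) + m) * Z) = (y * (n + 1) + m) * Z"
    by (rule wrap_id) (use p u Z_pos ZX in linarith)+
  show "wrap w ((y * (n + 1) + m) * Z + v) = key y m v"
    unfolding key_def by (rule wrap_id) (use p u Z_pos ZX assms(5) in linarith)+
qed

text \<open>\<open>z\<close> is the first position in the node that is reached from the trie node \<open>(y, m)\<close> with the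
  encoding \<open>v\<close>.\<close>

definition child :: "int \<Rightarrow> int \<Rightarrow> int \<Rightarrow> int \<Rightarrow> int \<Rightarrow> bool" where
  "child i y m v z \<longleftrightarrow> 2 \<le> z \<and> z < i \<and> z + m \<le> n \<and> link z = y \<and> lpf z = m \<and> e z (z + m) = v"

text \<open>The two directions serve the two outcomes of a lookup: a zero cell proves that no
  earlier suffix opened the branch, and a nonzero cell names the one that did. Only keys in range
  are constrained, where \<open>key_unique\<close> applies.\<close>

definition dict_ok :: "(int \<Rightarrow> int) \<Rightarrow> int \<Rightarrow> bool" where
  "dict_ok f i \<longleftrightarrow> (\<forall>y m v. 1 \<le> y \<and> y \<le> n \<and> 0 \<le> m \<and> m \<le> n \<and> 2 * \<bar>v\<bar> < Z \<longrightarrow>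
     (\<forall>z. child i y m v z \<longrightarrow> f (key y m v) = z) \<and>
     (f (key y m v) \<noteq> 0 \<longrightarrow> child i y m v (f (key y m v))))"

lemma J_set_reg: "J s \<Longrightarrow> r < 100 \<Longrightarrow> J (set_reg r x s)"
  and J_set_cell: "J s \<Longrightarrow> 1 \<le> m \<Longrightarrow> m < 100 \<Longrightarrow> J (set_cell m p x s)"
  by (auto elim!: J_frame simp: same_outside_def regs_set_reg arrays_set_reg regs_set_cell arrays_set_cell)

text \<open>A suffix that is matched up to its end opens no branch, since \<open>child\<close> asks
  for a further symbol.\<close>

lemma dict_ok_stop:
  assumes "dict_ok f i" "2 \<le> i" "n < i + lpf i"
  shows "dict_ok f (i + 1)"
proof -
  have "child (i + 1) y m v z = child i y m v z" for y m v z
    using assms(2,3) unfolding child_def by (cases "z = i") auto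
  then show ?thesis using assms(1) unfolding dict_ok_def by simp
qed

lemma dict_ok_insert:
  assumes ok: "dict_ok f i" and i: "2 \<le> i" "i + lpf i \<le> n"
    and z: "f (key (link i) (lpf i) (e i (i + lpf i))) = 0"
  shows "dict_ok (f(key (link i) (lpf i) (e i (i + lpf i)) := i)) (i + 1)"
  unfolding dict_ok_def
proof (intro allI impI, elim conjE)
  fix y m v assume a: "1 \<le> y" "y \<le> n" "0 \<le> m" "m \<le> n" "2 * \<bar>v\<bar> < Z"
  let ?k = "key (link i) (lpf i) (e i (i + lpf i))"
  have li: "lpf i \<le> n" "0 \<le> lpf i" "2 * \<bar>e i (i + lpf i)\<bar> < Z"
    using i lpf_nonneg[of i] enc_bound[of i "i + lpf i"] by auto
  have old: "(\<forall>z. child i y m v z \<longrightarrow> f (key y m v) = z)"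
     "(f (key y m v) \<noteq> 0 \<longrightarrow> child i y m v (f (key y m v)))"
    using ok a unfolding dict_ok_def by blast+
  show "(\<forall>z. child (i + 1) y m v z \<longrightarrow> (f(?k := i)) (key y m v) = z) \<and>
     ((f(?k := i)) (key y m v) \<noteq> 0 \<longrightarrow> child (i + 1) y m v ((f(?k := i)) (key y m v)))"
  proof (cases "key y m v = ?k")
    case True
    then have eq: "y = link i" "m = lpf i" "v = e i (i + lpf i)"
      using key_unique[OF True] a li by auto
    have "\<not> child i y m v z" for z using old(1) \<open>f ?k = 0\<close> True by (auto simp: child_def)
    then have "child (i + 1) y m v z \<longrightarrow> z = i" for z unfolding child_def by force
    moreover have "child (i + 1) y m v i" unfolding child_def using eq i by auto
    ultimately show ?thesis using True by auto
  next
    case False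
    then have "child (i + 1) y m v z = child i y m v z" for z
      unfolding child_def by (cases "z = i") auto
    then show ?thesis using old False by auto
  qed
qed

text \<open>All passes but the last increase the depth by one, which gives their number; a pass asks
  the oracle twice, and 17 covers its other steps. In the invariant the case with register 26 at 0
  is charged for the last pass.\<close>

lemma wp_descend:
  assumes Js: "J s" and i: "2 \<le> i" "i \<le> n" and d: "1 \<le> d" "d < 100"
    and dict: "dict_ok (arrays s d) i"
    and m: "0 \<le> m0" "m0 \<le> lpf i"
    and rg: "regs s 0 = n" "regs s 1 = n + 1" "regs s 2 = Z" "regs s 20 = i" "regs s 21 = m0"
      "regs s 22 = owner m0 i"
    and t: "(2 * q + 17) * (lpf i - m0 + 1) + 2 \<le> t"
    and Q: "\<And>s' t'. J s' \<Longrightarrow> same_outside ({10,11,12,21,22,26,27,28,29} \<union> {100..}) ({d} \<union> {100..}) s s' \<Longrightarrow>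
      regs s' 21 = lpf i \<Longrightarrow> regs s' 22 = link i \<Longrightarrow> dict_ok (arrays s' d) (i + 1) \<Longrightarrow>
      t' \<ge> t - ((2 * q + 17) * (lpf i - m0 + 1) + 2) \<Longrightarrow> Q s' t'"
  shows "wp w (descend d G) Q s t"
proof -
  let ?Rs = "{10,11,12,21,22,26,27,28,29} \<union> {100..} :: nat set" and ?As = "{d} \<union> {100..}"
  define c where "c = 2 * q + 17"
  have c0: "17 \<le> c" using q_nonneg unfolding c_def by simp
  define I where "I = (\<lambda>s' t'. J s' \<and> same_outside ?Rs ?As s s' \<and>
     m0 \<le> regs s' 21 \<and> regs s' 21 \<le> lpf i \<and> regs s' 22 = owner (regs s' 21) i \<and>
     (regs s' 26 = 1 \<and> dict_ok (arrays s' d) i \<and> t' \<ge> t - 1 - c * (regs s' 21 - m0) \<or>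
      regs s' 26 = 0 \<and> dict_ok (arrays s' d) (i + 1) \<and> regs s' 21 = lpf i \<and>
        t' \<ge> t - 1 - c * (regs s' 21 - m0 + 1)))"
  let ?body = "seqs [
       Op 11 Add (Reg 20) (Reg 21),
       If Less (Reg 0) (Reg 11) (Move 26 (Const 0)) (seqs [
         Move 10 (Reg 20), G, Move 27 (Reg 12),
         Move 10 (Reg 22), Op 11 Add (Reg 22) (Reg 21), G,
         If Equal (Reg 12) (Reg 27) (inc 21) (seqs [
           Op 28 Mult (Reg 22) (Reg 1), Op 28 Add (Reg 28) (Reg 21),
           Op 28 Mult (Reg 28) (Reg 2), Op 28 Add (Reg 28) (Reg 27), Load 29 d (Reg 28),
           If Equal (Reg 29) (Const 0)
             (seqs [Store d (Reg 28) (Reg 20), Move 26 (Const 0)])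
             (seqs [Move 22 (Reg 29), inc 21])])])]"
  have step: "wp w ?body I s' (t' - 1)"
    if I: "I s' t'" and "compare_val Equal (operand_val w s' (Reg 26)) (operand_val w s' (Const 1))" for s' t'
  proof -
    have r26: "regs s' 26 = 1" using that(2) by simp
    define m where "m = regs s' 21"
    define y where "y = owner m i"
    have J': "J s'" and fr: "same_outside ?Rs ?As s s'" and mm: "m0 \<le> m" "m \<le> lpf i"
      and r22: "regs s' 22 = y" and r21: "regs s' 21 = m"
      and dk: "dict_ok (arrays s' d) i" and t': "t' \<ge> t - 1 - c * (m - m0)"
      using I r26 unfolding I_def m_def y_def by auto
    have rs: "regs s' 0 = n" "regs s' 1 = n + 1" "regs s' 2 = Z" "regs s' 20 = i"
      using same_outside_regs[OF fr] rg by auto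
    have im: "i + m \<le> n + 1" using mm lpf_bound[of i] i by auto
    have m0': "0 \<le> m" using mm m by simp
    have yp: "1 \<le> y" "y < i" using owner_props[of i m] owner_lt_iff[of i m] i m0' im mm unfolding y_def by auto
    have wa: "wrap w (i + m) = i + m" "wrap w (y + m) = y + m" "wrap w (m + 1) = m + 1"
      using X_linear n_pos im m0' i yp by (auto intro!: wrap_id)
    show ?thesis
    proof (cases "n < i + m")
      case True
      have l: "lpf i = m" using lpf_eq_iff_stop[of i m] True i m0' mm by auto
      have "dict_ok (arrays s' d) (i + 1)" using dict_ok_stop[OF dk i(1)] True l by auto
      then show ?thesis using True rs r21 r22 J' fr mm t' l c0 i
        unfolding seqs.simps
        by (simp add: wp_simps wa I_def J_set_reg y_def algebra_simps)
    next
      case False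
      then have imn: "i + m \<le> n" by simp
      define s1 where "s1 = set_reg 10 i (set_reg 11 (i + m) s')"
      have J1: "J s1" using J' unfolding s1_def by (simp add: J_set_reg)
      let ?c1 = "seqs [Move 27 (Reg 12),
         Move 10 (Reg 22), Op 11 Add (Reg 22) (Reg 21), G,
         If Equal (Reg 12) (Reg 27) (inc 21) (seqs [
           Op 28 Mult (Reg 22) (Reg 1), Op 28 Add (Reg 28) (Reg 21),
           Op 28 Mult (Reg 28) (Reg 2), Op 28 Add (Reg 28) (Reg 27), Load 29 d (Reg 28),
           If Equal (Reg 29) (Const 0)
             (seqs [Store d (Reg 28) (Reg 20), Move 26 (Const 0)])
             (seqs [Move 22 (Reg 29), inc 21])])]"
      let ?c2 = "If Equal (Reg 12) (Reg 27) (inc 21) (seqs [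
           Op 28 Mult (Reg 22) (Reg 1), Op 28 Add (Reg 28) (Reg 21),
           Op 28 Mult (Reg 28) (Reg 2), Op 28 Add (Reg 28) (Reg 27), Load 29 d (Reg 28),
           If Equal (Reg 29) (Const 0)
             (seqs [Store d (Reg 28) (Reg 20), Move 26 (Const 0)])
             (seqs [Move 22 (Reg 29), inc 21])])"
      have c2: "wp w ?c2 I s2 t2"
        if J2: "J s2" and fr2: "same_outside ({10,11,12,27} \<union> {100..}) {100..} s' s2"
          and v: "regs s2 12 = e y (y + m)" "regs s2 27 = e i (i + m)" and t2: "t2 \<ge> t' - 2 * q - 8" for s2 t2
      proof -
        have r2: "regs s2 0 = n" "regs s2 1 = n + 1" "regs s2 2 = Z" "regs s2 20 = i" "regs s2 21 = m"
            "regs s2 22 = y" "regs s2 26 = 1"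
          using same_outside_regs[OF fr2] rs r21 r22 r26 by auto
        have a2: "arrays s2 d = arrays s' d" using same_outside_arrays[OF fr2] d by auto
        have frs: "same_outside ?Rs ?As s s2" by (rule same_outside_trans[OF fr fr2]) auto
        let ?v = "e i (i + m)"
        have vb: "2 * \<bar>?v\<bar> < Z" using enc_bound[of i "i + m"] imn i m0' by auto
        have rng: "1 \<le> y" "y \<le> n" "0 \<le> m" "m \<le> n" using yp i m0' imn by auto
        note kw = key_wraps[OF rng vb]
        show ?thesis
        proof (cases "e y (y + m) = ?v")
          case True
          then have ow: "owner (m + 1) i = y" using owner_Suc_same[of i m] imn i m0' unfolding y_def by auto
          have ml: "m + 1 \<le> lpf i" using owner_lt_iff[of i "m + 1"] ow yp i imn m0' by auto
          have t3: "t2 - 2 \<ge> t - 1 - c * (m + 1 - m0)"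
            using t2 t' unfolding c_def by (simp add: algebra_simps)
          show ?thesis using True v r2 J2 frs a2 dk mm ow ml t3
            by (simp add: wp_simps wa I_def J_set_reg)
        next
          case ne: False
          let ?z = "owner (m + 1) i" and ?k = "key y m ?v"
          have ch: "2 \<le> ?z" "?z \<le> i" "?z + m \<le> n" "link ?z = y" "lpf ?z = m" "e ?z (?z + m) = ?v"
            using child_of_owner[of i m] ne i m0' imn unfolding y_def by auto
          have dkk: "\<And>z. child i y m ?v z \<Longrightarrow> arrays s' d ?k = z"
             "arrays s' d ?k \<noteq> 0 \<Longrightarrow> child i y m ?v (arrays s' d ?k)"
            using dk rng vb unfolding dict_ok_def by blast+
          show ?thesis
          proof (cases "arrays s' d ?k = 0")
            case True
            \<comment> \<open>No earlier position opened this branch, so \<open>i\<close> is the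
              first one in it and its longest match ends at depth \<open>m\<close>.\<close>
            have "\<not> child i y m ?v ?z" using dkk(1)[of ?z] True ch(1) by auto
            then have "?z = i" using ch unfolding child_def by auto
            then have l: "lpf i = m" "link i = y" using ch by auto
            have "dict_ok ((arrays s' d)(?k := i)) (i + 1)"
              using dict_ok_insert[OF dk i(1)] l imn True by simp
            moreover have t3: "t2 - 9 \<ge> t - 1 - c * (m - m0 + 1)"
              using t2 t' unfolding c_def by (simp add: algebra_simps)
            ultimately show ?thesis using ne v r2 J2 frs a2 mm l True d
              by (simp add: wp_simps kw I_def J_set_reg J_set_cell y_def[symmetric])
          next
            case False
            let ?u = "arrays s' d ?k"
            have cu: "child i y m ?v ?u" using dkk(2) False by blast
            then have ow: "owner (m + 1) i = ?u"
              using owner_Suc_child[of i m ?u] i m0' imn unfolding child_def y_def by auto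
            then have ml: "m + 1 \<le> lpf i"
              using owner_lt_iff[of i "m + 1"] cu i imn m0' unfolding child_def by auto
            have t3: "t2 - 9 \<ge> t - 1 - c * (m + 1 - m0)"
              using t2 t' unfolding c_def by (simp add: algebra_simps)
            show ?thesis using ne v r2 J2 frs a2 dk mm ow ml t3 False
              by (simp add: wp_simps wa kw I_def J_set_reg)
          qed
        qed
      qed
      have c1: "wp w ?c1 I s2 t2"
        if J2: "J s2" and fr2: "same_outside (insert 12 {100..}) {100..} s1 s2"
          and v: "regs s2 12 = e i (i + m)" and t2: "t2 \<ge> t' - q - 4" for s2 t2
      proof -
        define s3 where "s3 = set_reg 11 (y + m) (set_reg 10 y (set_reg 27 (e i (i + m)) s2))"
        have r2: "regs s2 21 = m" "regs s2 22 = y"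
          using same_outside_regs[OF fr2] r21 r22 unfolding s1_def by (auto simp: regs_set_reg)
        have fr3: "same_outside ({10,11,12,27} \<union> {100..}) {100..} s' s3"
        proof -
          have "same_outside ({10,11,12,27} \<union> {100..}) {100..} s' s2"
            by (rule same_outside_trans[OF _ fr2, of "{10,11}" "{}"]) (auto simp: s1_def wp_simps)
          then show ?thesis unfolding s3_def by (simp add: wp_simps)
        qed
        have "wp w G (wp w ?c2 I) s3 (t2 - 3)"
        proof (rule G_spec)
          show "J s3" using J2 unfolding s3_def by (simp add: J_set_reg)
          show "regs s3 10 = y" "regs s3 11 = y + m" by (simp_all add: s3_def regs_set_reg)
          show "1 \<le> y" "y \<le> y + m" "y + m \<le> n" using yp m0' imn by auto
          fix s4 t4 assume J4: "J s4" and fr4: "same_outside (insert 12 {100..}) {100..} s3 s4"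
            and v4: "regs s4 12 = e y (y + m)" and t4: "t4 \<ge> t2 - 3 - q"
          have "regs s4 27 = e i (i + m)"
            using same_outside_regs[OF fr4, of 27] by (simp add: s3_def regs_set_reg)
          moreover have "same_outside ({10,11,12,27} \<union> {100..}) {100..} s' s4"
            by (rule same_outside_trans[OF fr3 fr4]) auto
          ultimately show "wp w ?c2 I s4 t4" using c2[OF J4 _ v4] t4 t2 by auto
        qed
        then show ?thesis using r2 v unfolding s3_def seqs.simps
          by (simp add: wp_Seq wp_Move wp_Op regs_set_reg wa)
      qed
      have "wp w G (wp w ?c1 I) s1 (t' - 4)"
        by (rule G_spec[OF J1, of i "i + m"])
           (use c1 imn i m0' in \<open>auto simp: s1_def regs_set_reg\<close>)
      then show ?thesis using False rs r21 unfolding s1_def seqs.simps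
        by (simp add: wp_Seq wp_Move wp_Op wp_If regs_set_reg wa)
    qed
  qed
  have I0: "I (set_reg 26 1 s) (t - 1)"
    unfolding I_def using Js rg m dict by (simp add: wp_simps J_set_reg)
  have tc: "c * (lpf i - m0 + 1) + 2 \<le> t" using t unfolding c_def .
  have pos: "0 \<le> t'" if "I s' t'" for s' t'
  proof -
    have "c * (regs s' 21 - m0) \<le> c * (regs s' 21 - m0 + 1)" using c0 by simp
    moreover have "c * (regs s' 21 - m0 + 1) \<le> c * (lpf i - m0 + 1)"
      using that c0 unfolding I_def by (intro mult_left_mono) auto
    moreover have "t' \<ge> t - 1 - c * (regs s' 21 - m0) \<or> t' \<ge> t - 1 - c * (regs s' 21 - m0 + 1)"
      using that unfolding I_def by blast
    ultimately show ?thesis using tc by linarith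
  qed
  have fin: "Q s' (t' - 1)"
    if I: "I s' t'" and "\<not> compare_val Equal (operand_val w s' (Reg 26)) (operand_val w s' (Const 1))" for s' t'
  proof -
    have "regs s' 26 \<noteq> 1" using that(2) by simp
    then show ?thesis
      using I unfolding I_def by (intro Q) (auto simp: c_def link_def)
  qed
  show ?thesis
    unfolding descend_def
    apply (subst seqs.simps(3), subst seqs.simps(2))
    unfolding wp_Seq wp_Move
    apply (rule wp_While[where I=I])
    subgoal using I0 by simp
    subgoal using pos by blast
    subgoal using step by blast
    subgoal using fin by blast
    done
qed

text \<open>In the invariant \<open>c * lpf (i - 1)\<close> is a potential. The descent for
  \<open>i\<close> starts at depth at least \<open>lpf (i - 1) - 1\<close> and costs
  \<open>c\<close> per level, so these costs telescope to \<open>c * n\<close> plus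
  \<open>2 * c\<close> per suffix. The rest of \<open>B\<close> pays for climbing and
  recording.\<close>

lemma wp_build:
  assumes Js: "J s" and d: "8 \<le> d" "d < 100"
    and zero: "arrays s d = (\<lambda>_. 0)"
    and rg: "regs s 0 = n" "regs s 1 = n + 1" "regs s 2 = Z" "regs s 3 = Lg"
    and t: "n * (6 * q + 15 * Lg + 100) + 7 * Lg + 20 \<le> t"
    and Q: "\<And>s' t'. J s' \<Longrightarrow> same_outside ({10..30} \<union> {100..}) ({5,6,7,d} \<union> {100..}) s s' \<Longrightarrow>
      (\<And>x. 1 \<le> x \<Longrightarrow> x \<le> n \<Longrightarrow> arrays s' 5 x = lpf x \<and> arrays s' 6 x = link x) \<Longrightarrow>
      t' \<ge> t - (n * (6 * q + 15 * Lg + 100) + 7 * Lg + 20) \<Longrightarrow> Q s' t'"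
  shows "wp w (build d G) Q s t"
proof -
  let ?Rs = "{10..30} \<union> {100..} :: nat set" and ?As = "{5,6,7,d} \<union> {100..}"
  define c where "c = 2 * q + 17"
  define B where "B = 15 * Lg + 32 + 2 * c"
  have c0: "17 \<le> c" and B0: "0 \<le> B" using q_nonneg Lg unfolding c_def B_def by auto
  define I where "I = (\<lambda>s' t'. \<exists>i. regs s' 20 = i \<and> 2 \<le> i \<and> i \<le> n + 1 \<and> J s' \<and> same_outside ?Rs ?As s s' \<and>
     tables s' i \<and> dict_ok (arrays s' d) i \<and> t' \<ge> t - (7 * Lg + 12) - B * (i - 2) - c * lpf (i - 1))"
  let ?body = "seqs [
       Op 24 Sub (Reg 20) (Const 1), Load 21 5 (Reg 24), dec 21, Load 22 6 (Reg 24), inc 22,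
       If LessEq (Reg 21) (Const 0) (seqs [Move 21 (Const 0), Move 22 (Const 1)]) climb,
       descend d G, record_suffix, inc 20]"
  have lpf_n: "lpf x \<le> n" if "1 \<le> x" "x \<le> n" for x using lpf_bound[OF that] that by simp
  have cost: "c * n + B * n + 7 * Lg + 14 \<le> n * (6 * q + 15 * Lg + 100) + 7 * Lg + 20"
    unfolding B_def c_def using n_pos by (simp add: algebra_simps)
  have tge: "B * (i - 2) + c * lpf (i - 1) + B + (7 * Lg + 13) \<le> t" if "2 \<le> i" "i \<le> n" for i
  proof -
    have "B * (i - 2 + 1) \<le> B * n" using that B0 by (intro mult_left_mono) auto
    moreover have "c * lpf (i - 1) \<le> c * n" using that c0 lpf_n[of "i - 1"] by (intro mult_left_mono) auto
    ultimately show ?thesis using t cost by (simp add: algebra_simps)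
  qed
  have step: "wp w ?body I s' (t' - 1)"
    if I: "I s' t'" and "compare_val LessEq (operand_val w s' (Reg 20)) (operand_val w s' (Reg 0))" for s' t'
  proof -
    define i where "i = regs s' 20"
    have i: "2 \<le> i" and J': "J s'" and fr: "same_outside ?Rs ?As s s'" and tb: "tables s' i"
      and dk: "dict_ok (arrays s' d) i" and t': "t' \<ge> t - (7 * Lg + 12) - B * (i - 2) - c * lpf (i - 1)"
      using I unfolding I_def i_def by auto
    have rs: "regs s' 0 = n" "regs s' 1 = n + 1" "regs s' 2 = Z" "regs s' 3 = Lg"
      using same_outside_regs[OF fr] rg by auto
    have i2: "i \<le> n" using that(2) rs i_def by simp
    define g where "g = lpf (i - 1)"
    define x where "x = link (i - 1) + 1"
    define m where "m = max 0 (g - 1)"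
    have ta: "arrays s' 5 (i - 1) = g" "arrays s' 6 (i - 1) = link (i - 1)"
      using tablesD[OF tb, of "i - 1"] i unfolding g_def by auto
    have lb: "1 \<le> link (i - 1)" "link (i - 1) \<le> i - 1" using link_props[of "i - 1"] i i2 by auto
    have gb: "0 \<le> g" "g \<le> n" using lpf_nonneg lpf_n[of "i - 1"] i i2 unfolding g_def by auto
    have m: "0 \<le> m" "m \<le> lpf i" using lpf_Suc_ge[of "i - 1"] lpf_nonneg[of i] i i2 unfolding m_def g_def by auto
    have mg: "g \<le> m + 1" unfolding m_def by simp
    have ws: "wrap w (i - 1) = i - 1" "wrap w (g - 1) = g - 1" "wrap w (link (i - 1) + 1) = x"
      using X_linear n_pos i i2 gb lb unfolding x_def by (auto intro!: wrap_id)
    define tt where "tt = (c * (lpf i - m + 1) + 2) + (7 * Lg + 8) + 2"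
    have ccc: "c * lpf i - c * g + 2 * c \<ge> c * (lpf i - m + 1)"
    proof -
      have "c * g \<le> c * (m + 1)" using mg c0 by (intro mult_left_mono) auto
      then show ?thesis by (simp add: algebra_simps)
    qed
    let ?rest = "seqs [descend d G, record_suffix, inc 20]"
    have rest: "wp w ?rest I s2 t2"
      if J2: "J s2" and fr2: "same_outside {21,22,23,24,25} {} s' s2" and r2: "regs s2 21 = m" "regs s2 22 = owner m i"
        and t2: "t2 \<ge> t' - 8 * Lg - 13" for s2 t2
    proof -
      have rs2: "regs s2 0 = n" "regs s2 1 = n + 1" "regs s2 2 = Z" "regs s2 20 = i" "regs s2 3 = Lg"
        using same_outside_regs[OF fr2] rs i_def by auto
      have a2: "arrays s2 = arrays s'" using same_outside_arrays[OF fr2] by auto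
      have t2b: "t2 \<ge> t - (7 * Lg + 12) - B * (i - 2) - c * g - 8 * Lg - 13" using t2 t' unfolding g_def by linarith
      have t2c: "t2 \<ge> (t - (7 * Lg + 12) - B * (i - 2 + 1) - c * lpf i) + tt"
        using t2b ccc unfolding tt_def B_def by (simp add: algebra_simps)
      have nn: "0 \<le> t - (7 * Lg + 13) - B * (i - 2 + 1) - c * lpf i"
      proof (cases "i = n")
        case True
        have "B * (i - 2 + 1) \<le> B * n" using i i2 B0 by (intro mult_left_mono) auto
        moreover have "c * lpf i \<le> c * n" using i i2 c0 lpf_n[of i] by (intro mult_left_mono) auto
        ultimately show ?thesis using t cost by linarith
      next
        case False
        then show ?thesis using tge[of "i + 1"] i i2 B0 by (auto simp: algebra_simps)
      qed
      show ?thesis unfolding seqs.simps wp_Seq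
      proof (rule wp_descend[OF J2 i i2 _ d(2) _ m])
        show "1 \<le> d" using d by simp
        show "dict_ok (arrays s2 d) i" using dk a2 by simp
        show "(2 * q + 17) * (lpf i - m + 1) + 2 \<le> t2"
          using t2c nn Lg unfolding tt_def c_def[symmetric] by linarith
        fix s3 t3 assume J3: "J s3" and fr3: "same_outside ({10,11,12,21,22,26,27,28,29} \<union> {100..}) ({d} \<union> {100..}) s2 s3"
          and r3: "regs s3 21 = lpf i" "regs s3 22 = link i" and dk3: "dict_ok (arrays s3 d) (i + 1)"
          and t3: "t3 \<ge> t2 - ((2 * q + 17) * (lpf i - m + 1) + 2)"
        have rs3: "regs s3 1 = n + 1" "regs s3 3 = Lg" "regs s3 20 = i"
          using same_outside_regs[OF fr3] rs2 by auto
        have tb3: "tables s3 i" using tb same_outside_arrays[OF fr3] a2 d unfolding tables_def by auto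
        have t3b: "t3 \<ge> (t - (7 * Lg + 12) - B * (i - 2 + 1) - c * lpf i) + (7 * Lg + 8) + 2"
          using t3 t2c unfolding tt_def c_def[symmetric] by linarith
        show "wp w record_suffix (wp w (inc 20) I) s3 t3"
        proof (rule wp_record_suffix[OF tb3 _ i2 rs3 r3])
          show "1 \<le> i" using i by simp
          show "7 * Lg + 8 \<le> t3" using t3b nn by linarith
          fix s4 t4 assume fr4: "same_outside {23, 24, 25, 30} {5, 6, 7} s3 s4" and tb4: "tables s4 (i + 1)"
            and t4: "t3 - (7 * Lg + 8) \<le> t4"
          have J4: "J s4" by (rule J_frame[OF J3 same_outside_mono[OF fr4]]) auto
          have d4: "dict_ok (arrays s4 d) (i + 1)" using dk3 same_outside_arrays[OF fr4, of d] d by auto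
          have r4: "regs s4 20 = i" using same_outside_regs[OF fr4, of 20] rs3 by simp
          have "same_outside ?Rs ?As s' s3"
            by (rule same_outside_trans[OF fr2 fr3]) auto
          then have "same_outside ?Rs ?As s s3"
            by (rule same_outside_trans[OF fr]) auto
          then have fr5: "same_outside ?Rs ?As s s4"
            by (rule same_outside_trans[OF _ fr4]) auto
          have wi: "wrap w (i + 1) = i + 1" using X_linear n_pos i i2 by (intro wrap_id) auto
          have t5: "t4 - 1 \<ge> t - (7 * Lg + 12) - B * (i + 1 - 2) - c * lpf i"
            using t4 t3b by (simp add: algebra_simps)
          have tb5: "tables (set_reg 20 (i + 1) s4) (i + 1)" using tb4 unfolding tables_def by (simp add: arrays_set_reg)
          show "wp w (inc 20) I s4 t4"
            using J4 d4 r4 fr5 tb5 t5 i i2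
            by (simp add: wp_simps wi I_def J_set_reg)
        qed
      qed (use rs2 r2 in auto)
    qed
    define s1 where "s1 = set_reg 22 x (set_reg 21 (g - 1) (set_reg 24 (i - 1) s'))"
    have fr1: "same_outside {21,22,23,24,25} {} s' s1" unfolding s1_def by (simp add: wp_simps)
    have J1: "J s1" using J' unfolding s1_def by (simp add: J_set_reg)
    have main: "wp w (If LessEq (Reg 21) (Const 0) (seqs [Move 21 (Const 0), Move 22 (Const 1)]) climb) (wp w ?rest I) s1 (t' - 6)"
    proof (cases "g - 1 \<le> 0")
      case True
      then have m0: "m = 0" unfolding m_def by simp
      have "wp w ?rest I (set_reg 22 1 (set_reg 21 0 s1)) (t' - 6 - 1 - 2)"
        by (rule rest) (use J1 fr1 m0 owner_zero[of i] i i2 Lg in \<open>auto simp: wp_simps J_set_reg\<close>)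
      then show ?thesis using True by (simp add: wp_If wp_Seq wp_Move s1_def regs_set_reg)
    next
      case False
      then have mg: "m = g - 1" "1 \<le> m" unfolding m_def by auto
      \<comment> \<open>\<open>x\<close> is an earlier position on the wanted path: the match of
        \<open>i - 1\<close> with its link, shifted by one.\<close>
      have evx: "ev m x i" using lpf_Suc(1)[of "i - 1"] i i2 mg unfolding g_def x_def by auto
      have i3: "2 \<le> i - 1" using False lpf_one i unfolding g_def by (cases "i - 1 = 1") auto
      have xb: "1 \<le> x" "x < i" "x + m \<le> n + 1"
        using lb link_less[OF i3] i2 ev_bounds[OF evx] unfolding x_def by auto
      have ow: "owner m x = owner m i" using owner_cong[OF _ _ evx] xb i by auto
      have "wp w climb (wp w ?rest I) s1 (t' - 7)"
      proof (rule wp_climb[of s1 i x m])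
        show "tables s1 i" using tb unfolding tables_def s1_def by (simp add: arrays_set_reg)
        show "8 * Lg + 6 \<le> t' - 7" using t' tge[OF i i2] c0 Lg unfolding B_def g_def by (simp add: algebra_simps)
        fix s2 t2 assume fr2: "same_outside {22, 23, 24, 25} {} s1 s2" and o: "regs s2 22 = owner m x"
          and t2: "t' - 7 - (8 * Lg + 6) \<le> t2"
        have J2: "J s2" by (rule J_frame[OF J1 same_outside_mono[OF fr2]]) auto
        have "same_outside {21,22,23,24,25} {} s' s2" by (rule same_outside_trans[OF fr1 fr2]) auto
        moreover have "regs s2 21 = m" using same_outside_regs[OF fr2, of 21] mg by (simp add: s1_def regs_set_reg)
        ultimately show "wp w ?rest I s2 t2" using rest[OF J2] o ow t2 by auto
      qed (use rs i2 xb mg in \<open>auto simp: s1_def regs_set_reg\<close>)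
      then show ?thesis using False by (simp add: wp_If wp_Seq wp_Move s1_def regs_set_reg)
    qed
    show ?thesis
      apply (subst seqs.simps)+
      using main ta rs unfolding s1_def
      by (simp add: wp_Seq wp_Op wp_Load regs_set_reg arrays_set_reg set_reg_overwrite ws i_def[symmetric])
  qed
  have pos: "0 \<le> t'" if "I s' t'" for s' t'
  proof -
    define i where "i = regs s' 20"
    have i: "2 \<le> i" "i \<le> n + 1" "t' \<ge> t - (7 * Lg + 12) - B * (i - 2) - c * lpf (i - 1)"
      using that unfolding I_def i_def by auto
    have "B * (i - 2) \<le> B * n" using i B0 by (intro mult_left_mono) auto
    moreover have "c * lpf (i - 1) \<le> c * n" using i c0 lpf_n[of "i - 1"] by (intro mult_left_mono) auto
    ultimately show ?thesis using i t cost by linarith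
  qed
  have fin: "Q s' (t' - 1)"
    if I: "I s' t'" and "\<not> compare_val LessEq (operand_val w s' (Reg 20)) (operand_val w s' (Reg 0))" for s' t'
  proof -
    define i where "i = regs s' 20"
    have i: "regs s' 20 = i" "2 \<le> i" "i \<le> n + 1" and J': "J s'" and fr: "same_outside ?Rs ?As s s'"
      and tb: "tables s' i" and t': "t' \<ge> t - (7 * Lg + 12) - B * (i - 2) - c * lpf (i - 1)"
      using I unfolding I_def i_def by auto
    have "regs s' 0 = n" using same_outside_regs[OF fr, of 0] rg by simp
    then have in1: "i = n + 1" using that(2) i by simp
    have "B * (i - 2) \<le> B * n" using i B0 by (intro mult_left_mono) auto
    moreover have "c * lpf (i - 1) \<le> c * n" using i c0 lpf_n[of "i - 1"] by (intro mult_left_mono) auto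
    ultimately show ?thesis using J' fr tablesD[OF tb] in1 t' cost by (intro Q) auto
  qed
  define s0 where "s0 = set_reg 22 1 (set_reg 21 0 (set_reg 20 1 s))"
  have fr0: "same_outside ?Rs ?As s s0" unfolding s0_def by (simp add: wp_simps)
  have J0: "J s0" using Js unfolding s0_def by (simp add: J_set_reg)
  have "wp w record_suffix (wp w (seqs [Move 20 (Const 2), While LessEq (Reg 20) (Reg 0) ?body]) Q) s0 (t - 3)"
  proof (rule wp_record_suffix[of s0 1])
    show "tables s0 1" unfolding tables_def by auto
    show "regs s0 21 = lpf 1" "regs s0 22 = link 1" using lpf_one link_one by (simp_all add: s0_def regs_set_reg)
    have "0 \<le> c * n" "0 \<le> B * n" using c0 B0 n_pos by auto
    then show "7 * Lg + 8 \<le> t - 3" using t cost by linarith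
    fix s1 t1 assume fr1: "same_outside {23, 24, 25, 30} {5, 6, 7} s0 s1" and tb1: "tables s1 (1 + 1)"
      and t1: "t - 3 - (7 * Lg + 8) \<le> t1"
    have J1: "J s1" by (rule J_frame[OF J0 same_outside_mono[OF fr1]]) auto
    have fr2: "same_outside ?Rs ?As s s1" by (rule same_outside_trans[OF fr0 fr1]) auto
    have a1: "arrays s1 d = (\<lambda>_. 0)" using same_outside_arrays[OF fr1, of d] zero d by (auto simp: s0_def arrays_set_reg)
    have "dict_ok (arrays s1 d) 2" unfolding dict_ok_def a1 child_def by auto
    moreover have "tables (set_reg 20 2 s1) 2" using tb1 unfolding tables_def by (simp add: arrays_set_reg)
    ultimately have "I (set_reg 20 2 s1) (t1 - 1)"
      unfolding I_def using J1 fr2 t1 n_pos lpf_one by (simp add: wp_simps J_set_reg)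
    then show "wp w (seqs [Move 20 (Const 2), While LessEq (Reg 20) (Reg 0) ?body]) Q s1 t1"
      apply (subst seqs.simps(3), subst seqs.simps(2))
      unfolding wp_Seq wp_Move
      apply (intro wp_While[where I=I])
      subgoal by simp
      subgoal using pos by blast
      subgoal using step by blast
      subgoal using fin by blast
      done
  qed (use n_pos rg in \<open>auto simp: s0_def regs_set_reg\<close>)
  then show ?thesis
    unfolding build_def
    apply (subst seqs.simps(3))+
    apply (subst (asm) seqs.simps(3))
    by (simp add: wp_Seq wp_Move s0_def)
qed

end

section \<open>The leaf order of the trie\<close>

fun chain :: "(int \<Rightarrow> int) \<Rightarrow> int \<Rightarrow> int list \<Rightarrow> bool" where
  "chain f p [] \<longleftrightarrow> p = 0"
| "chain f p (x # xs) \<longleftrightarrow> p = x \<and> x \<noteq> 0 \<and> chain f (f x) xs"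

lemma chain_upd: "x \<notin> set xs \<Longrightarrow> chain (f(x := y)) p xs = chain f p xs"
  by (induction xs arbitrary: p) auto

lemma chain_insert:
  assumes "chain f p (us @ v # vs)" "distinct (us @ v # vs)" "x \<notin> set (us @ v # vs)" "x \<noteq> 0"
  shows "chain (f(x := f v, v := x)) p (us @ v # x # vs)"
  using assms
proof (induction us arbitrary: p)
  case Nil
  then have "chain (f(x := f v, v := x)) (f v) vs" by (simp add: chain_upd del: fun_upd_apply)
  with Nil show ?case by (simp del: fun_upd_apply add: fun_upd_same fun_upd_other fun_upd_twist)
next
  case (Cons a us)
  then have "chain (f(x := f v, v := x)) (f a) (us @ v # x # vs)"
    by (simp del: fun_upd_apply)
  with Cons.prems show ?case by (auto simp del: fun_upd_apply simp add: fun_upd_other)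
qed

text \<open>Bucket sort by linked lists: \<open>hd'\<close> gives the head for each key, and one
  successor array \<open>lk\<close> serves all buckets because they are disjoint. The order within a
  bucket is left open.\<close>

definition buckets :: "(int \<Rightarrow> int) \<Rightarrow> (int \<Rightarrow> int) \<Rightarrow> (int \<Rightarrow> int) \<Rightarrow> int set \<Rightarrow> bool" where
  "buckets hd' lk key S \<longleftrightarrow>
    (\<forall>v. \<exists>xs. chain lk (hd' v) xs \<and> distinct xs \<and> set xs = {x \<in> S. key x = v})"

lemma buckets_empty: "buckets (\<lambda>_. 0) lk key {}"
  unfolding buckets_def by (auto intro!: exI[of _ "[]"])

lemma buckets_push:
  assumes "buckets hd' lk key S" "x \<notin> S" "x \<noteq> 0"
  shows "buckets (hd'(key x := x)) (lk(x := hd' (key x))) key (insert x S)"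
  unfolding buckets_def
proof
  fix v
  obtain xs where xs: "chain lk (hd' v) xs" "distinct xs" "set xs = {y \<in> S. key y = v}"
    using assms(1) unfolding buckets_def by blast
  have nx: "x \<notin> set xs" using xs assms(2) by auto
  show "\<exists>xs. chain (lk(x := hd' (key x))) ((hd'(key x := x)) v) xs \<and> distinct xs \<and>
      set xs = {y \<in> insert x S. key y = v}"
  proof (cases "key x = v")
    case True
    then show ?thesis using xs nx assms(3) by (intro exI[of _ "x # xs"]) (auto simp: chain_upd)
  next
    case False
    then show ?thesis using xs nx by (intro exI[of _ xs]) (auto simp: chain_upd)
  qed
qed

lemma buckets_chain:
  assumes "buckets hd' lk key S"
  obtains xs where "chain lk (hd' v) xs" "distinct xs" "set xs = {x \<in> S. key x = v}"
  using assms unfolding buckets_def by blast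

text \<open>Array 10 receives \<open>threshold\<close> and array 11 its inverse: the largest \<open>i\<close> with
  \<open>threshold i \<le> x\<close>, or 0.\<close>

definition thresholds :: prog where
  "thresholds = seqs [Move 20 (Const 1),
     While LessEq (Reg 20) (Reg 0) (seqs [Load 21 5 (Reg 20), Op 21 Div (Reg 21) (Const 2),
       Op 21 Add (Reg 21) (Reg 20), inc 21, Store 10 (Reg 20) (Reg 21), inc 20]),
     Op 21 Add (Reg 0) (Const 3), Store 10 (Reg 1) (Reg 21),
     Move 20 (Const 1), Move 22 (Const 0),
     While LessEq (Reg 20) (Reg 0) (seqs [Op 21 Add (Reg 22) (Const 1), Load 23 10 (Reg 21),
       If LessEq (Reg 23) (Reg 20) (Move 22 (Reg 21)) (seqs [Store 11 (Reg 20) (Reg 22), inc 20])])]"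

text \<open>Positions are inserted into the linked list in array 14 directly behind their \<open>link\<close>, by
  increasing \<open>lpf\<close>, so that every subtree of the trie becomes contiguous.\<close>

definition make_order :: prog where
  "make_order = seqs [Move 20 (Const 2),
     While LessEq (Reg 20) (Reg 0) (seqs [Load 21 5 (Reg 20), Load 22 12 (Reg 21),
       Store 13 (Reg 20) (Reg 22), Store 12 (Reg 21) (Reg 20), inc 20]),
     Move 20 (Const 0), Store 14 (Const 1) (Const 0),
     While LessEq (Reg 20) (Reg 0) (seqs [Load 21 12 (Reg 20),
       While NotEqual (Reg 21) (Const 0) (seqs [Load 22 6 (Reg 21), Load 23 14 (Reg 22),
         Store 14 (Reg 21) (Reg 23), Store 14 (Reg 22) (Reg 21), Load 21 13 (Reg 21)]),
       inc 20]),
     Move 20 (Const 1), Move 21 (Const 1),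
     While LessEq (Reg 20) (Reg 0) (seqs [Store 1 (Reg 20) (Reg 21), Load 22 5 (Reg 21),
       Store 2 (Reg 20) (Reg 22), Load 21 14 (Reg 21), inc 20]),
     Store 2 (Const 1) (Const (-1)), Store 2 (Reg 1) (Const (-1))]"

section \<open>Lists in trie order\<close>

context matching begin

text \<open>Along such a list \<open>lpf\<close> is what the LCP array is for a suffix array: each
  value is the match with the predecessor, and two entries match on the minimum of the values behind
  the first one, up to and including the second.\<close>

definition trie_list :: "int list \<Rightarrow> bool" where
  "trie_list xs \<longleftrightarrow> (\<forall>ys a zs b ws m. xs = ys @ a # zs @ b # ws \<and> 0 \<le> m \<longrightarrow>
     (ev m a b \<longleftrightarrow> (\<forall>r\<in>set (zs @ [b]). m \<le> lpf r)))"

lemma trie_listD: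
  "trie_list (ys @ a # zs @ b # ws) \<Longrightarrow> 0 \<le> m \<Longrightarrow> ev m a b \<longleftrightarrow> (\<forall>r\<in>set (zs @ [b]). m \<le> lpf r)"
  unfolding trie_list_def by blast

lemma trie_list_single: "trie_list [x]"
  unfolding trie_list_def by (auto simp: Cons_eq_append_conv)

text \<open>No entry matches \<open>x\<close> on more than \<open>lpf x\<close> symbols: an earlier
  position by definition of \<open>lpf\<close>, a later one \<open>y\<close> because the match is at
  most \<open>lpf y\<close>, and \<open>big\<close> applies. So \<open>x\<close> behaves like its
  link up to that depth. For a pair around \<open>x\<close> the new value does not lower the
  minimum, which already contains \<open>lpf b\<close>, at most \<open>lpf x\<close>.\<close>

lemma trie_list_insert:
  assumes tl: "trie_list (us @ v # vs)" and dist: "distinct (us @ v # vs)"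
    and rng: "set (us @ v # vs) \<subseteq> {1..n}" and x: "2 \<le> x" "x \<le> n" "x \<notin> set (us @ v # vs)"
    and v: "v = link x" and big: "\<And>y. y \<in> set (us @ v # vs) \<Longrightarrow> lpf y \<le> lpf x"
  shows "trie_list (us @ v # x # vs)"
  unfolding trie_list_def
proof (intro allI impI, elim conjE)
  fix ys a zs b ws and m :: int
  assume eq: "us @ v # x # vs = ys @ a # zs @ b # ws" and m: "0 \<le> m"
  have vx: "ev (lpf x) v x" "1 \<le> v" "v < x" using link_props[of x] link_less[of x] x v by auto
  have near: "m \<le> lpf x" if "ev m y x" "y \<in> set (us @ v # vs)" for y
  proof (cases "y < x")
    case True then show ?thesis using lpf_ge[of y x m] that rng by auto
  next
    case False
    then have "x < y" using that x by (metis linorder_neqE)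
    then show ?thesis using lpf_ge[of x y m] that ev_sym x big[of y] by force
  qed
  show "ev m a b \<longleftrightarrow> (\<forall>r\<in>set (zs @ [b]). m \<le> lpf r)"
  proof (cases "b = x")
    case True
    have "x \<notin> set (us @ [v])" "x \<notin> set vs" using x by auto
    then have "us @ [v] = ys @ a # zs" using eq True append_Cons_eq_iff[of x "us @ [v]" vs "ys @ a # zs" ws] by simp
    then consider "zs = []" "a = v" | zs' where "zs = zs' @ [v]" "us = ys @ a # zs'"
      by (cases zs rule: rev_cases) auto
    then show ?thesis
    proof cases
      case 1
      have "ev m v x \<longleftrightarrow> m \<le> lpf x" using vx lpf_ge[of v x m] ev_mono m by blast
      then show ?thesis using 1 True by simp
    next
      case 2
      have tl': "ev m a v \<longleftrightarrow> (\<forall>r\<in>set (zs' @ [v]). m \<le> lpf r)" using trie_listD[of ys a zs' v vs m] tl 2 m by simp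
      have ain: "a \<in> set (us @ v # vs)" using 2 by simp
      show ?thesis
      proof
        assume e: "ev m a b"
        then have "m \<le> lpf x" using near ain True by blast
        moreover then have "ev m a v" using e vx ev_mono ev_trans ev_sym m True by blast
        ultimately show "\<forall>r\<in>set (zs @ [b]). m \<le> lpf r" using tl' 2 True by auto
      next
        assume r: "\<forall>r\<in>set (zs @ [b]). m \<le> lpf r"
        then have "ev m a v" using tl' 2 by auto
        moreover have "ev m v x" using r True vx ev_mono m by auto
        ultimately show "ev m a b" using ev_trans True by blast
      qed
    qed
  next
    case bx: False
    show ?thesis
    proof (cases "a = x")
      case True
      have "x \<notin> set (us @ [v])" "x \<notin> set vs" using x by auto
      then have e2: "us @ [v] = ys" "vs = zs @ b # ws"
        using eq True append_Cons_eq_iff[of x "us @ [v]" vs "ys" "zs @ b # ws"] by auto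
      have tl': "ev m v b \<longleftrightarrow> (\<forall>r\<in>set (zs @ [b]). m \<le> lpf r)" using trie_listD[of us v zs b ws m] tl e2 m by simp
      have bin: "b \<in> set (us @ v # vs)" using e2 by simp
      show ?thesis
      proof
        assume e: "ev m a b"
        then have "m \<le> lpf x" using near[of b] bin True ev_sym by blast
        then have "ev m v b" using e vx ev_mono ev_trans m True by blast
        then show "\<forall>r\<in>set (zs @ [b]). m \<le> lpf r" using tl' by blast
      next
        assume r: "\<forall>r\<in>set (zs @ [b]). m \<le> lpf r"
        then have "m \<le> lpf x" using big[OF bin] by auto
        then have "ev m v x" using vx ev_mono m by blast
        then show "ev m a b" using r tl' ev_trans ev_sym True by blast
      qed
    next
      case False
      let ?f = "filter (\<lambda>u. u \<noteq> x)"
      have "?f (us @ v # x # vs) = ?f (ys @ a # zs @ b # ws)" using eq by simp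
      moreover have "?f us = us" "?f vs = vs" "v \<noteq> x" using x by (auto intro!: filter_True)
      ultimately have "us @ v # vs = ?f ys @ a # ?f zs @ b # ?f ws" using False bx by simp
      then have tl': "ev m a b \<longleftrightarrow> (\<forall>r\<in>set (?f zs @ [b]). m \<le> lpf r)"
        and bin: "b \<in> set (us @ v # vs)"
        using trie_listD[of "?f ys" a "?f zs" b "?f ws" m] tl m by auto
      have "lpf b \<le> lpf x" using big[OF bin] .
      then show ?thesis unfolding tl' by auto
    qed
  qed
qed

lemma trie_list_nth:
  assumes "trie_list xs" "i < j" "j < length xs" "0 \<le> m"
  shows "ev m (xs ! i) (xs ! j) \<longleftrightarrow> (\<forall>r. i < r \<and> r \<le> j \<longrightarrow> m \<le> lpf (xs ! r))"
proof -
  let ?zs = "take (j - i - 1) (drop (Suc i) xs)"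
  have "drop (Suc i) xs = ?zs @ drop (j - i - 1) (drop (Suc i) xs)"
    by (rule append_take_drop_id[symmetric])
  also have "drop (j - i - 1) (drop (Suc i) xs) = xs ! j # drop (Suc j) xs"
    using assms by (simp add: Cons_nth_drop_Suc)
  finally have "xs = take i xs @ xs ! i # ?zs @ xs ! j # drop (Suc j) xs"
    using id_take_nth_drop[of i xs] assms by simp
  then have "ev m (xs ! i) (xs ! j) \<longleftrightarrow> (\<forall>r\<in>set (?zs @ [xs ! j]). m \<le> lpf r)"
    using assms(1,4) trie_listD[of "take i xs" "xs ! i" ?zs "xs ! j" "drop (Suc j) xs" m] by simp
  moreover have "set ?zs = {xs ! r | r. i < r \<and> r < j}"
  proof -
    have "set ?zs = {?zs ! k | k. k < j - i - 1}" using assms by (auto simp: set_conv_nth)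
    also have "\<dots> = {xs ! (Suc i + k) | k. k < j - i - 1}"
    proof -
      have "?zs ! k = xs ! (Suc i + k)" if "k < j - i - 1" for k using assms that by simp
      then show ?thesis by (intro Collect_cong) metis
    qed
    also have "\<dots> = {xs ! r | r. i < r \<and> r < j}"
    proof (intro equalityI subsetI)
      fix u assume "u \<in> {xs ! r | r. i < r \<and> r < j}"
      then obtain r where "u = xs ! r" "i < r" "r < j" by auto
      then show "u \<in> {xs ! (Suc i + k) | k. k < j - i - 1}"
        by (intro CollectI exI[of _ "r - Suc i"]) auto
    qed auto
    finally show ?thesis .
  qed
  ultimately show ?thesis using assms(2) by (auto simp: le_less)
qed

text \<open>\<open>ord\<close> lists all positions; \<open>lc p\<close> is the match length of \<open>ord p\<close> with \<open>ord (p - 1)\<close>,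
  or \<open>-1\<close> if a new segment starts at \<open>p\<close>.\<close>

definition segments_ok :: "(int \<Rightarrow> int) \<Rightarrow> (int \<Rightarrow> int) \<Rightarrow> bool" where
  "segments_ok ord lc \<longleftrightarrow> bij_betw ord {1..n} {1..n} \<and> lc 1 = -1 \<and> lc (n + 1) = -1 \<and>
     (\<forall>p. 1 \<le> p \<and> p \<le> n \<longrightarrow> -1 \<le> lc p \<and> lc p \<le> n) \<and>
     (\<forall>p q m. 1 \<le> p \<and> p < q \<and> q \<le> n \<and> 0 \<le> m \<and> (\<forall>r. p < r \<and> r \<le> q \<longrightarrow> 0 \<le> lc r) \<longrightarrow>
        (ev m (ord p) (ord q) \<longleftrightarrow> (\<forall>r. p < r \<and> r \<le> q \<longrightarrow> m \<le> lc r)))"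

text \<open>The whole trie is the first segment. The leading entry has no predecessor in the list,
  so a border takes the place of its value.\<close>

lemma segments_ok_list:
  assumes tl: "trie_list xs" and d: "distinct xs" and st: "set xs = {1..n}"
    and o: "\<And>p. 1 \<le> p \<Longrightarrow> p \<le> n \<Longrightarrow> ord p = xs ! nat (p - 1)"
    and c: "\<And>p. 2 \<le> p \<Longrightarrow> p \<le> n \<Longrightarrow> lc p = lpf (xs ! nat (p - 1))" "lc 1 = -1" "lc (n + 1) = -1"
  shows "segments_ok ord lc"
proof -
  have len: "length xs = nat n" using distinct_card[OF d] st by simp
  have bn: "bij_betw (\<lambda>p. nat (p - 1)) {1..n} {..<nat n}"
    by (rule bij_betw_byWitness[where f' = "\<lambda>k. int k + 1"]) auto
  have "bij_betw ((!) xs) {..<nat n} {1..n}" using bij_betw_nth[OF d, of "{..<nat n}"] len st by auto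
  then have "bij_betw ((!) xs \<circ> (\<lambda>p. nat (p - 1))) {1..n} {1..n}" using bn bij_betw_trans by blast
  then have "bij_betw ord {1..n} {1..n}"
    by (rule bij_betw_cong[THEN iffD1, rotated]) (use o in auto)
  moreover have "-1 \<le> lc p \<and> lc p \<le> n" if "1 \<le> p" "p \<le> n" for p
  proof (cases "p = 1")
    case True then show ?thesis using c(2) n_ge_1 by simp
  next
    case False
    have "xs ! nat (p - 1) \<in> set xs" using that len by (intro nth_mem) auto
    then have "xs ! nat (p - 1) \<in> {1..n}" using st by simp
    then show ?thesis using c(1)[of p] that False lpf_nonneg[of "xs ! nat (p - 1)"] lpf_bound[of "xs ! nat (p - 1)"] by auto
  qed
  moreover have "ev m (ord p) (ord q) \<longleftrightarrow> (\<forall>r. p < r \<and> r \<le> q \<longrightarrow> m \<le> lc r)"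
    if "1 \<le> p" "p < q" "q \<le> n" "0 \<le> m" for p q m
  proof -
    have "ev m (ord p) (ord q) \<longleftrightarrow> (\<forall>r. nat (p - 1) < r \<and> r \<le> nat (q - 1) \<longrightarrow> m \<le> lpf (xs ! r))"
      using trie_list_nth[OF tl, of "nat (p - 1)" "nat (q - 1)" m] o that len by auto
    also have "\<dots> \<longleftrightarrow> (\<forall>r. p < r \<and> r \<le> q \<longrightarrow> m \<le> lc r)"
    proof
      assume a: "\<forall>r. nat (p - 1) < r \<and> r \<le> nat (q - 1) \<longrightarrow> m \<le> lpf (xs ! r)"
      show "\<forall>r. p < r \<and> r \<le> q \<longrightarrow> m \<le> lc r"
      proof (intro allI impI)
        fix r assume r: "p < r \<and> r \<le> q"
        then have "m \<le> lpf (xs ! nat (r - 1))" using a that by auto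
        then show "m \<le> lc r" using c(1)[of r] r that by auto
      qed
    next
      assume a: "\<forall>r. p < r \<and> r \<le> q \<longrightarrow> m \<le> lc r"
      show "\<forall>r. nat (p - 1) < r \<and> r \<le> nat (q - 1) \<longrightarrow> m \<le> lpf (xs ! r)"
      proof (intro allI impI)
        fix r assume r: "nat (p - 1) < r \<and> r \<le> nat (q - 1)"
        then have "p - 1 < int r" "int r \<le> q - 1"
          using that by (simp_all add: nat_less_iff le_nat_iff)
        then have "m \<le> lc (int r + 1)" using a[rule_format, of "int r + 1"] by auto
        then show "m \<le> lpf (xs ! r)" using c(1)[of "int r + 1"] r that by auto
      qed
    qed
    finally show ?thesis .
  qed
  ultimately show ?thesis unfolding segments_ok_def using c by blast
qed

end

section \<open>Programs for the thresholds and the leaf order\<close>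

locale ram_matching = ram w X n + matching n e for w X n e
begin

text \<open>The second loop moves two pointers: since thresholds are monotone, the largest
  \<open>i\<close> with \<open>threshold i \<le> x\<close> never decreases in \<open>x\<close>. Each
  pass advances one of the pointers, so there are at most \<open>2 * n\<close> passes.\<close>

lemma wp_thresholds:
  assumes rg: "regs s 0 = n" "regs s 1 = n + 1"
    and h: "\<And>x. 1 \<le> x \<Longrightarrow> x \<le> n \<Longrightarrow> arrays s 5 x = lpf x"
    and t: "20 * n + 20 \<le> t"
    and Q: "\<And>s' t'. same_outside {20..23} {10,11} s s' \<Longrightarrow>
      (\<And>x. 1 \<le> x \<Longrightarrow> x \<le> n \<Longrightarrow> arrays s' 10 x = threshold x \<and> 0 \<le> arrays s' 11 x \<and> arrays s' 11 x \<le> n \<and>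
         (\<forall>i. 1 \<le> i \<and> i \<le> n \<longrightarrow> (i \<le> arrays s' 11 x \<longleftrightarrow> threshold i \<le> x))) \<Longrightarrow>
      t' \<ge> t - (20 * n + 20) \<Longrightarrow> Q s' t'"
  shows "wp w thresholds Q s t"
proof -
  define I where "I = (\<lambda>s' t'. 1 \<le> regs s' 20 \<and> regs s' 20 \<le> n + 1 \<and> same_outside {20..23} {10,11} s s' \<and>
     (\<forall>x. 1 \<le> x \<and> x < regs s' 20 \<longrightarrow> arrays s' 10 x = threshold x) \<and> t' \<ge> t - 1 - 7 * (regs s' 20 - 1))"
  define I2 where "I2 = (\<lambda>s' t'. 1 \<le> regs s' 20 \<and> regs s' 20 \<le> n + 1 \<and> 0 \<le> regs s' 22 \<and> regs s' 22 \<le> n \<and>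
     same_outside {20..23} {10,11} s s' \<and>
     (\<forall>x. 1 \<le> x \<and> x \<le> n \<longrightarrow> arrays s' 10 x = threshold x) \<and> arrays s' 10 (n + 1) = n + 3 \<and>
     (\<forall>i. 1 \<le> i \<and> i \<le> regs s' 22 \<longrightarrow> threshold i \<le> regs s' 20) \<and>
     (\<forall>x. 1 \<le> x \<and> x < regs s' 20 \<longrightarrow> 0 \<le> arrays s' 11 x \<and> arrays s' 11 x \<le> n \<and>
        (\<forall>i. 1 \<le> i \<and> i \<le> n \<longrightarrow> (i \<le> arrays s' 11 x \<longleftrightarrow> threshold i \<le> x))) \<and>
     t' \<ge> t - 7 * n - 6 - 6 * (regs s' 20 - 1 + regs s' 22))"
  have step1: "wp w (seqs [Load 21 5 (Reg 20), Op 21 Div (Reg 21) (Const 2),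
       Op 21 Add (Reg 21) (Reg 20), inc 21, Store 10 (Reg 20) (Reg 21), inc 20]) I s' (t' - 1)"
    if I: "I s' t'" and c: "compare_val LessEq (operand_val w s' (Reg 20)) (operand_val w s' (Reg 0))" for s' t'
  proof -
    have fr: "same_outside {20..23} {10,11} s s'" using I unfolding I_def by blast
    have rs: "regs s' 0 = n" and ar: "arrays s' 5 = arrays s 5" 
      using same_outside_regs[OF fr, of 0] same_outside_arrays[OF fr] rg by auto
    let ?i = "regs s' 20"
    have i: "1 \<le> ?i" "?i \<le> n" using I c rs unfolding I_def by auto
    have hb: "0 \<le> lpf ?i" "lpf ?i \<le> n" using lpf_nonneg lpf_bound[OF i] i by auto
    have ws: "wrap w (lpf ?i div 2) = lpf ?i div 2" "wrap w (lpf ?i div 2 + ?i) = lpf ?i div 2 + ?i"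
      "wrap w (lpf ?i div 2 + ?i + 1) = threshold ?i" "wrap w (?i + 1) = ?i + 1"
      using X_linear i hb unfolding threshold_def by (subst wrap_id; auto)+
    show ?thesis using I i h[OF i] by (auto simp: wp_simps I_def ws ar)
  qed
  have step2: "wp w (seqs [Op 21 Add (Reg 22) (Const 1), Load 23 10 (Reg 21),
       If LessEq (Reg 23) (Reg 20) (Move 22 (Reg 21)) (seqs [Store 11 (Reg 20) (Reg 22), inc 20])]) I2 s' (t' - 1)"
    if I: "I2 s' t'" and c: "compare_val LessEq (operand_val w s' (Reg 20)) (operand_val w s' (Reg 0))" for s' t'
  proof -
    have fr: "same_outside {20..23} {10,11} s s'" using I unfolding I2_def by blast
    have rs: "regs s' 0 = n" using same_outside_regs[OF fr, of 0] rg by auto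
    let ?j = "regs s' 20" and ?u = "regs s' 22"
    have j: "1 \<le> ?j" "?j \<le> n" and u: "0 \<le> ?u" "?u \<le> n" using I c rs unfolding I2_def by auto
    have old: "\<And>i. 1 \<le> i \<Longrightarrow> i \<le> ?u \<Longrightarrow> threshold i \<le> ?j" using I unfolding I2_def by blast
    have ws: "wrap w (?u + 1) = ?u + 1" "wrap w (?j + 1) = ?j + 1"
      using X_linear j u by (subst wrap_id; auto)+
    have tm: "\<And>x. 1 \<le> x \<Longrightarrow> x \<le> n \<Longrightarrow> arrays s' 10 x = threshold x" "arrays s' 10 (n + 1) = n + 3"
      using I unfolding I2_def by auto
    show ?thesis
    proof (cases "arrays s' 10 (?u + 1) \<le> ?j")
      case True
      \<comment> \<open>Cell \<open>n + 1\<close> holds the sentinel \<open>n + 3\<close>, which no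
        position reaches.\<close>
      then have un: "?u + 1 \<le> n" using tm(2) u j by (cases "?u = n") auto
      have "threshold (?u + 1) \<le> ?j" using True tm(1)[of "?u + 1"] un u by auto
      then have "\<forall>i. 1 \<le> i \<and> i \<le> ?u + 1 \<longrightarrow> threshold i \<le> ?j"
        using threshold_mono[of _ "?u + 1"] un u by force
      then show ?thesis using I True un u by (auto simp: wp_simps I2_def ws)
    next
      case False
      have key: "i \<le> ?u \<longleftrightarrow> threshold i \<le> ?j" if i: "1 \<le> i" "i \<le> n" for i
      proof (cases "i \<le> ?u")
        case True then show ?thesis using old i by simp
      next
        case F: False
        then have "?j < threshold (?u + 1)" using False tm(1)[of "?u + 1"] u i by auto
        then show ?thesis using threshold_mono[of "?u + 1" i] F i u by auto
      qed
      have "\<forall>i. 1 \<le> i \<and> i \<le> ?u \<longrightarrow> threshold i \<le> ?j + 1" using old by force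
      then show ?thesis using I False j u key by (auto simp: wp_simps I2_def ws)
    qed
  qed
  have fin2: "Q s' (t' - 1)"
    if I: "I2 s' t'" and c: "\<not> compare_val LessEq (operand_val w s' (Reg 20)) (operand_val w s' (Reg 0))" for s' t'
  proof -
    have fr: "same_outside {20..23} {10,11} s s'" using I unfolding I2_def by blast
    have "regs s' 0 = n" using same_outside_regs[OF fr, of 0] rg by auto
    then have j: "regs s' 20 = n + 1" using I c unfolding I2_def by auto
    have t': "t' \<ge> t - 7 * n - 6 - 6 * (regs s' 20 - 1 + regs s' 22)" "regs s' 22 \<le> n"
      using I unfolding I2_def by blast+
    show ?thesis
    proof (rule Q[OF fr])
      show "t - (20 * n + 20) \<le> t' - 1" using t' j n_pos by auto
    qed (use I j in \<open>unfold I2_def, auto\<close>)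
  qed
  have fin1: "wp w (seqs [Op 21 Add (Reg 0) (Const 3), Store 10 (Reg 1) (Reg 21),
     Move 20 (Const 1), Move 22 (Const 0),
     While LessEq (Reg 20) (Reg 0) (seqs [Op 21 Add (Reg 22) (Const 1), Load 23 10 (Reg 21),
       If LessEq (Reg 23) (Reg 20) (Move 22 (Reg 21)) (seqs [Store 11 (Reg 20) (Reg 22), inc 20])])]) Q s' (t' - 1)"
    if I: "I s' t'" and c: "\<not> compare_val LessEq (operand_val w s' (Reg 20)) (operand_val w s' (Reg 0))" for s' t'
  proof -
    have fr: "same_outside {20..23} {10,11} s s'" using I unfolding I_def by blast
    have rs: "regs s' 0 = n" "regs s' 1 = n + 1"
      using same_outside_regs[OF fr, of 0] same_outside_regs[OF fr, of 1] rg by auto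
    have j: "regs s' 20 = n + 1" using I c rs unfolding I_def by auto
    have ws: "wrap w (n + 3) = n + 3" using X_linear n_pos by (intro wrap_id) auto
    define s1 where "s1 = set_reg 22 0 (set_reg 20 1 (set_cell 10 (n + 1) (n + 3) (set_reg 21 (n + 3) s')))"
    have "I2 s1 (t' - 5)"
      using I j n_pos unfolding I_def I2_def s1_def by (auto simp: wp_simps)
    then have "wp w (While LessEq (Reg 20) (Reg 0) (seqs [Op 21 Add (Reg 22) (Const 1), Load 23 10 (Reg 21),
       If LessEq (Reg 23) (Reg 20) (Move 22 (Reg 21)) (seqs [Store 11 (Reg 20) (Reg 22), inc 20])])) Q s1 (t' - 5)"
    proof (rule wp_While[where I=I2])
      show "0 \<le> t''" if "I2 s'' t''" for s'' t'' using that t n_pos unfolding I2_def by auto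
    qed (use step2 fin2 in blast)+
    then show ?thesis unfolding s1_def using rs by (simp add: wp_Seq wp_Op wp_Move wp_Store regs_set_reg regs_set_cell ws)
  qed
  have I0: "I (set_reg 20 1 s) (t - 1)" unfolding I_def using n_pos by (auto simp: wp_simps)
  show ?thesis
    unfolding thresholds_def seqs.simps wp_Seq
    apply (subst wp_Move)
    apply (rule wp_While[where I=I])
    subgoal using I0 by simp
    subgoal for s t unfolding I_def using \<open>20 * n + 20 \<le> _\<close> n_pos by auto
    subgoal for s' t' using step1[of s' t'] by (simp only: seqs.simps)
    subgoal for s' t' by (drule (1) fin1) (unfold seqs.simps wp_Seq)
    done
qed

lemma wp_make_order:
  assumes rg: "regs s 0 = n" "regs s 1 = n + 1"
    and h: "\<And>x. 1 \<le> x \<Longrightarrow> x \<le> n \<Longrightarrow> arrays s 5 x = lpf x \<and> arrays s 6 x = link x"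
    and zero: "arrays s 12 = (\<lambda>_. 0)"
    and t: "30 * n + 30 \<le> t"
    and Q: "\<And>s' t'. same_outside {20..23} {1,2,12,13,14} s s' \<Longrightarrow>
      segments_ok (arrays s' 1) (arrays s' 2) \<Longrightarrow> (\<And>p. 2 \<le> p \<Longrightarrow> p \<le> n \<Longrightarrow> 0 \<le> arrays s' 2 p) \<Longrightarrow>
      t' \<ge> t - (30 * n + 30) \<Longrightarrow> Q s' t'"
  shows "wp w make_order Q s t"
proof -
  let ?fr = "same_outside {20..23} {1,2,12,13,14} s"
  have frD: "regs s' 0 = n" "regs s' 1 = n + 1" "arrays s' 5 = arrays s 5" "arrays s' 6 = arrays s 6"
    if "?fr s'" for s'
    using same_outside_regs[OF that] same_outside_arrays[OF that] rg by auto
  define I1 where "I1 = (\<lambda>s' t'. 2 \<le> regs s' 20 \<and> regs s' 20 \<le> max 2 (n + 1) \<and> ?fr s' \<and>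
     buckets (arrays s' 12) (arrays s' 13) lpf {2..<regs s' 20} \<and> t' \<ge> t - 1 - 6 * (regs s' 20 - 2))"
  have step1: "wp w (seqs [Load 21 5 (Reg 20), Load 22 12 (Reg 21),
       Store 13 (Reg 20) (Reg 22), Store 12 (Reg 21) (Reg 20), inc 20]) I1 s' (t' - 1)"
    if I: "I1 s' t'" and c: "compare_val LessEq (operand_val w s' (Reg 20)) (operand_val w s' (Reg 0))" for s' t'
  proof -
    let ?i = "regs s' 20"
    have fr: "?fr s'" using I unfolding I1_def by blast
    note f = frD[OF fr]
    have i: "2 \<le> ?i" "?i \<le> n" using I c f unfolding I1_def by auto
    have hi: "arrays s 5 ?i = lpf ?i" using h i by auto
    have ws: "wrap w (?i + 1) = ?i + 1" using X_linear i by (intro wrap_id) auto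
    have "buckets (arrays s' 12) (arrays s' 13) lpf {2..<?i}" using I unfolding I1_def by blast
    then have "buckets ((arrays s' 12)(lpf ?i := ?i)) ((arrays s' 13)(?i := arrays s' 12 (lpf ?i))) lpf (insert ?i {2..<?i})"
      using buckets_push i by auto
    moreover have "insert ?i {2..<?i} = {2..<?i + 1}" using i by auto
    ultimately show ?thesis using I i unfolding I1_def
      by (simp add: wp_simps ws f hi del: fun_upd_apply)
  qed
  define inv where "inv = (\<lambda>(s'::state) S. \<exists>xs. chain (arrays s' 14) 1 xs \<and> distinct xs \<and> set xs = S \<and> trie_list xs)"
  define base where "base = (\<lambda>s'. ?fr s' \<and> buckets (arrays s' 12) (arrays s' 13) lpf {2..n})"
  \<comment> \<open>The inner loops are charged to the positions inserted so far, which the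
    cardinality counts.\<close>
  define I2 where "I2 = (\<lambda>s' t'. 0 \<le> regs s' 20 \<and> regs s' 20 \<le> n + 1 \<and> base s' \<and>
     inv s' (insert 1 {x \<in> {2..n}. lpf x < regs s' 20}) \<and>
     t' \<ge> t - 6 * n - 10 - 4 * regs s' 20 - 6 * int (card {x \<in> {2..n}. lpf x < regs s' 20}))"
  have cardn: "int (card {x \<in> {2..n}. P x}) \<le> n" for P
  proof -
    have "card {x \<in> {2..n}. P x} \<le> card {2..n}" by (rule card_mono) auto
    then show ?thesis using n_pos by auto
  qed
  have step2: "wp w (seqs [Load 21 12 (Reg 20),
       While NotEqual (Reg 21) (Const 0) (seqs [Load 22 6 (Reg 21), Load 23 14 (Reg 22),
         Store 14 (Reg 21) (Reg 23), Store 14 (Reg 22) (Reg 21), Load 21 13 (Reg 21)]),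
       inc 20]) I2 s1 (t1 - 1)"
    if I: "I2 s1 t1" and c: "compare_val LessEq (operand_val w s1 (Reg 20)) (operand_val w s1 (Reg 0))" for s1 t1
  proof -
    define v where "v = regs s1 20"
    let ?S = "insert 1 {x \<in> {2..n}. lpf x < v}"
    have b1: "base s1" and v0: "0 \<le> v" and inv1: "inv s1 ?S"
      and t1: "t1 \<ge> t - 6 * n - 10 - 4 * v - 6 * int (card {x \<in> {2..n}. lpf x < v})"
      using I unfolding I2_def v_def by auto
    have f1: "?fr s1" and bk: "buckets (arrays s1 12) (arrays s1 13) lpf {2..n}" using b1 unfolding base_def by auto
    have vn: "v \<le> n" using c frD[OF f1] unfolding v_def by simp
    obtain bs where bs: "chain (arrays s1 13) (arrays s1 12 v) bs" "distinct bs" "set bs = {x \<in> {2..n}. lpf x = v}"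
      using buckets_chain[OF bk] by blast
    define K where "K = (\<lambda>s' t'. base s' \<and> regs s' 20 = v \<and> arrays s' 13 = arrays s1 13 \<and>
       (\<exists>ds cs. bs = ds @ cs \<and> chain (arrays s1 13) (regs s' 21) cs \<and> inv s' (?S \<union> set ds) \<and>
        t' \<ge> t1 - 2 - 6 * int (length ds)))"
    have lenb: "int (length bs) = int (card {x \<in> {2..n}. lpf x = v})" using distinct_card[OF bs(2)] bs(3) by simp
    have cadd: "int (card {x \<in> {2..n}. lpf x < v + 1}) = int (card {x \<in> {2..n}. lpf x < v}) + int (length bs)"
    proof -
      have "{x \<in> {2..n}. lpf x < v + 1} = {x \<in> {2..n}. lpf x < v} \<union> {x \<in> {2..n}. lpf x = v}" by auto
      moreover have "card ({x \<in> {2..n}. lpf x < v} \<union> {x \<in> {2..n}. lpf x = v}) =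
          card {x \<in> {2..n}. lpf x < v} + card {x \<in> {2..n}. lpf x = v}"
        by (rule card_Un_disjoint) ((rule finite_subset[of _ "{2..n}"], blast, simp)+, blast)
      ultimately have "card {x \<in> {2..n}. lpf x < v + 1} = card {x \<in> {2..n}. lpf x < v} + card {x \<in> {2..n}. lpf x = v}"
        by (simp only:)
      then show ?thesis using lenb by simp
    qed
    have K0: "K (set_reg 21 (arrays s1 12 v) s1) (t1 - 2)"
      unfolding K_def using b1 bs inv1
      by (intro conjI exI[of _ "[]"] exI[of _ bs]) (simp_all add: base_def v_def inv_def wp_simps)
    have tK: "t1 - 2 - 6 * int (length bs) \<ge> t - 6 * n - 12 - 4 * v - 6 * n"
      using t1 cadd cardn[of "\<lambda>x. lpf x < v + 1"] by linarith
    have stepK: "wp w (seqs [Load 22 6 (Reg 21), Load 23 14 (Reg 22),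
         Store 14 (Reg 21) (Reg 23), Store 14 (Reg 22) (Reg 21), Load 21 13 (Reg 21)]) K s' (t' - 1)"
      if Kk: "K s' t'" and c: "compare_val NotEqual (operand_val w s' (Reg 21)) (operand_val w s' (Const 0))" for s' t'
    proof -
      obtain ds cs where dc: "bs = ds @ cs" "chain (arrays s1 13) (regs s' 21) cs" "inv s' (?S \<union> set ds)"
        and t': "t' \<ge> t1 - 2 - 6 * int (length ds)"
        and b': "base s'" "regs s' 20 = v" "arrays s' 13 = arrays s1 13" using Kk unfolding K_def by blast
      obtain x cs' where cs: "cs = x # cs'" using dc c by (cases cs) auto
      have rx: "regs s' 21 = x" "chain (arrays s1 13) (arrays s1 13 x) cs'" using dc cs by auto
      have xb: "2 \<le> x" "x \<le> n" "lpf x = v" "x \<notin> set ds" using bs dc(1) cs by auto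
      obtain xs where xs: "chain (arrays s' 14) 1 xs" "distinct xs" "set xs = ?S \<union> set ds" "trie_list xs"
        using dc(3) unfolding inv_def by blast
      let ?p = "link x"
      have pb: "1 \<le> ?p" "?p \<le> n" using link_props[of x] xb by auto
      \<comment> \<open>The order of insertion guarantees that the link is already in the list: it
        has a smaller \<open>lpf\<close>, or it is 1, the initial entry.\<close>
      have pS: "?p \<in> set xs"
      proof (cases "?p = 1")
        case True then show ?thesis using xs by simp
      next
        case False
        then have "1 \<le> lpf x" using link_zero[of x] xb lpf_nonneg[of x] by force
        then have "lpf ?p < v" using lpf_link_less[of x] xb by auto
        then show ?thesis using xs(3) pb False by auto
      qed
      have frs: "?fr s'" using b' unfolding base_def by blast
      have hx: "arrays s' 6 x = ?p" using frD[OF frs] h xb by auto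
      obtain us vs where sp: "xs = us @ ?p # vs" using split_list[OF pS] by blast
      have xn: "x \<notin> set xs" using xs(3) xb by auto
      define ar where "ar = (arrays s' 14)(x := arrays s' 14 ?p, ?p := x)"
      have ch: "chain ar 1 (us @ ?p # x # vs)" unfolding ar_def
        by (rule chain_insert) (use xs(1,2) xn xb in \<open>simp_all only: sp, simp_all\<close>)
      have dsS: "set ds \<subseteq> {x \<in> {2..n}. lpf x = v}" using bs dc(1) by auto
      have tl: "trie_list (us @ ?p # x # vs)"
      proof (rule trie_list_insert)
        show "set (us @ ?p # vs) \<subseteq> {1..n}" using xs(3) sp dsS n_pos by auto
        fix y assume "y \<in> set (us @ ?p # vs)"
        then have "y \<in> ?S \<union> set ds" using xs(3) sp by auto
        then show "lpf y \<le> lpf x" using xb dsS lpf_one v0 by auto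
      qed (use xs sp xn xb in auto)
      define s2 where "s2 = set_reg 21 (arrays s1 13 x) (set_cell 14 ?p x (set_cell 14 x (arrays s' 14 ?p)
         (set_reg 23 (arrays s' 14 ?p) (set_reg 22 ?p s'))))"
      have a14: "arrays s2 14 = ar" unfolding s2_def ar_def by (simp add: wp_simps)
      have "inv s2 (?S \<union> set (ds @ [x]))" unfolding inv_def a14
        by (intro exI[of _ "us @ ?p # x # vs"]) (use ch tl xs sp xn in auto)
      moreover have "base s2" using b'(1) unfolding base_def s2_def by (simp add: wp_simps)
      ultimately have "K s2 (t' - 6)" unfolding K_def
        using dc(1) cs rx b' t'
        by (intro conjI exI[of _ "ds @ [x]"] exI[of _ cs']) (simp_all add: s2_def wp_simps)
      then show ?thesis unfolding s2_def using rx(1) hx b'(3) by (simp add: wp_simps)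
    qed
    have finK: "wp w (inc 20) I2 s' (t' - 1)"
      if Kk: "K s' t'" and c: "\<not> compare_val NotEqual (operand_val w s' (Reg 21)) (operand_val w s' (Const 0))" for s' t'
    proof -
      obtain ds cs where dc: "bs = ds @ cs" "chain (arrays s1 13) (regs s' 21) cs" "inv s' (?S \<union> set ds)"
        and t': "t' \<ge> t1 - 2 - 6 * int (length ds)"
        and b': "base s'" "regs s' 20 = v" "arrays s' 13 = arrays s1 13" using Kk unfolding K_def by blast
      have "cs = []" using dc c by (cases cs) auto
      then have ds: "ds = bs" using dc by simp
      have "{x \<in> {2..n}. lpf x < v + 1} = {x \<in> {2..n}. lpf x < v} \<union> set ds" unfolding ds bs(3) by auto
      then have "?S \<union> set ds = insert 1 {x \<in> {2..n}. lpf x < v + 1}" by simp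
      then have i2: "inv s' (insert 1 {x \<in> {2..n}. lpf x < v + 1})" using dc by simp
      have ws: "wrap w (v + 1) = v + 1" using X_linear v0 vn by (intro wrap_id) auto
      have tt: "t' - 2 \<ge> t - 6 * n - 10 - 4 * (v + 1) - 6 * int (card {x \<in> {2..n}. lpf x < v + 1})"
        using t'[unfolded ds] t1 unfolding cadd by (simp add: algebra_simps)
      show ?thesis unfolding wp_Op I2_def using b' i2 tt v0 vn ws
        by (simp add: base_def inv_def wp_simps)
    qed
    have "wp w (While NotEqual (Reg 21) (Const 0) (seqs [Load 22 6 (Reg 21), Load 23 14 (Reg 22),
         Store 14 (Reg 21) (Reg 23), Store 14 (Reg 22) (Reg 21), Load 21 13 (Reg 21)])) (wp w (inc 20) I2)
         (set_reg 21 (arrays s1 12 v) s1) (t1 - 2)"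
    proof (rule wp_While[where I=K])
      show "K (set_reg 21 (arrays s1 12 v) s1) (t1 - 2)" by (rule K0)
      show "0 \<le> t'" if "K s' t'" for s' t'
      proof -
        from that[unfolded K_def] obtain ds cs where "bs = ds @ cs" "t' \<ge> t1 - 2 - 6 * int (length ds)"
          by (elim conjE exE) 
        then have "t' \<ge> t1 - 2 - 6 * int (length bs)" by simp
        then show ?thesis using tK t vn n_pos by linarith
      qed
      show "wp w (seqs [Load 22 6 (Reg 21), Load 23 14 (Reg 22),
         Store 14 (Reg 21) (Reg 23), Store 14 (Reg 22) (Reg 21), Load 21 13 (Reg 21)]) K s' (t' - 1)"
        if "K s' t'" "compare_val NotEqual (operand_val w s' (Reg 21)) (operand_val w s' (Const 0))" for s' t'
        using stepK[OF that] .
      show "wp w (inc 20) I2 s' (t' - 1)"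
        if "K s' t'" "\<not> compare_val NotEqual (operand_val w s' (Reg 21)) (operand_val w s' (Const 0))" for s' t'
        using finK[OF that] .
    qed
    then show ?thesis unfolding v_def by (simp add: wp_Seq wp_Load)
  qed
  define I3 where "I3 = (\<lambda>xs s' t'. 1 \<le> regs s' 20 \<and> regs s' 20 \<le> n + 1 \<and> ?fr s' \<and>
     chain (arrays s' 14) (regs s' 21) (drop (nat (regs s' 20 - 1)) xs) \<and>
     (\<forall>p. 1 \<le> p \<and> p < regs s' 20 \<longrightarrow> arrays s' 1 p = xs ! nat (p - 1) \<and> arrays s' 2 p = lpf (xs ! nat (p - 1))) \<and>
     t' \<ge> t - 16 * n - 20 - 6 * (regs s' 20 - 1))"
  let ?b3 = "seqs [Store 1 (Reg 20) (Reg 21), Load 22 5 (Reg 21),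
       Store 2 (Reg 20) (Reg 22), Load 21 14 (Reg 21), inc 20]"
  let ?tail3 = "seqs [Store 2 (Const 1) (Const (-1)), Store 2 (Reg 1) (Const (-1))]"
  have step3: "wp w ?b3 (I3 xs) s' (t' - 1)"
    if xs: "set xs = {1..n}" "length xs = nat n" and I: "I3 xs s' t'"
      and c: "compare_val LessEq (operand_val w s' (Reg 20)) (operand_val w s' (Reg 0))" for xs s' t'
  proof -
    let ?p = "regs s' 20"
    have fr: "?fr s'" using I unfolding I3_def by blast
    have p: "1 \<le> ?p" "?p \<le> n" using I c frD[OF fr] unfolding I3_def by auto
    let ?k = "nat (?p - 1)"
    have k: "?k < length xs" using p xs by auto
    have dr: "drop ?k xs = xs ! ?k # drop (Suc ?k) xs" using k by (simp add: Cons_nth_drop_Suc)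
    have sk: "nat (?p + 1 - 1) = Suc ?k" using p by auto
    have r21: "regs s' 21 = xs ! ?k" "chain (arrays s' 14) (arrays s' 14 (xs ! ?k)) (drop (Suc ?k) xs)"
      using I dr unfolding I3_def by auto
    have "xs ! ?k \<in> {1..n}" using nth_mem[OF k] xs by simp
    then have hk: "arrays s' 5 (xs ! ?k) = lpf (xs ! ?k)" using h frD[OF fr] by auto
    have ws: "wrap w (?p + 1) = ?p + 1" using X_linear p by (intro wrap_id) auto
    have old: "\<forall>q. 1 \<le> q \<and> q < ?p \<longrightarrow> arrays s' 1 q = xs ! nat (q - 1) \<and> arrays s' 2 q = lpf (xs ! nat (q - 1))"
      and t': "t' \<ge> t - 16 * n - 20 - 6 * (?p - 1)" using I unfolding I3_def by auto
    show ?thesis using fr p r21 hk ws old t' unfolding I3_def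
      by (auto simp: wp_simps simp del: sk simp add: sk[simplified])
  qed
  have fin3: "wp w ?tail3 Q s' (t' - 1)"
    if xs: "set xs = {1..n}" "distinct xs" "trie_list xs" "xs ! 0 = 1" and I: "I3 xs s' t'"
      and c: "\<not> compare_val LessEq (operand_val w s' (Reg 20)) (operand_val w s' (Reg 0))" for xs s' t'
  proof -
    have fr: "?fr s'" using I unfolding I3_def by blast
    note f = frD[OF fr]
    have p: "regs s' 20 = n + 1" using I c f unfolding I3_def by auto
    have all: "\<And>p. 1 \<le> p \<Longrightarrow> p \<le> n \<Longrightarrow> arrays s' 1 p = xs ! nat (p - 1) \<and> arrays s' 2 p = lpf (xs ! nat (p - 1))"
      and t': "t' \<ge> t - 16 * n - 20 - 6 * n"
      using I p unfolding I3_def by auto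
    define s2 where "s2 = set_cell 2 (n + 1) (-1) (set_cell 2 1 (-1) s')"
    have "Q s2 (t' - 3)"
    proof (rule Q)
      show "?fr s2" using fr unfolding s2_def by (simp add: wp_simps)
      show "segments_ok (arrays s2 1) (arrays s2 2)"
        by (rule segments_ok_list[OF xs(3,2,1)]) (use all n_pos in \<open>auto simp: s2_def wp_simps\<close>)
      show "0 \<le> arrays s2 2 p" if "2 \<le> p" "p \<le> n" for p
        using all[of p] that lpf_nonneg by (auto simp: s2_def wp_simps)
      show "t - (30 * n + 30) \<le> t' - 3" using t' n_pos by linarith
    qed
    then show ?thesis unfolding s2_def using f by (simp add: wp_simps)
  qed
  have fin2: "wp w (seqs [Move 20 (Const 1), Move 21 (Const 1), While LessEq (Reg 20) (Reg 0) ?b3,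
      Store 2 (Const 1) (Const (-1)), Store 2 (Reg 1) (Const (-1))]) Q s1 (t1 - 1)"
    if I: "I2 s1 t1" and c: "\<not> compare_val LessEq (operand_val w s1 (Reg 20)) (operand_val w s1 (Reg 0))" for s1 t1
  proof -
    have "base s1" using I unfolding I2_def by blast
    then have fr: "?fr s1" unfolding base_def by blast
    have v: "regs s1 20 = n + 1" using I c frD[OF fr] unfolding I2_def by auto
    have "lpf x < n + 1" if "x \<in> {2..n}" for x using lpf_bound[of x] that by auto
    then have "insert 1 {x \<in> {2..n}. lpf x < n + 1} = {1..n}" using n_pos by auto
    then obtain xs where xs: "chain (arrays s1 14) 1 xs" "distinct xs" "set xs = {1..n}" "trie_list xs"
      using I v unfolding I2_def inv_def by auto
    have x0: "xs ! 0 = 1" using xs(1) by (cases xs) auto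
    have len: "length xs = nat n" using distinct_card[OF xs(2)] xs(3) by simp
    define s2 where "s2 = set_reg 21 1 (set_reg 20 1 s1)"
    have t1: "t1 \<ge> t - 6 * n - 10 - 4 * (n + 1) - 6 * n"
      using I v cardn[of "\<lambda>x. lpf x < n + 1"] unfolding I2_def by auto
    have "I3 xs s2 (t1 - 3)" unfolding I3_def s2_def using fr xs n_pos t1 by (auto simp: wp_simps)
    then have "wp w (While LessEq (Reg 20) (Reg 0) ?b3) (wp w ?tail3 Q) s2 (t1 - 3)"
    proof (rule wp_While[where I="I3 xs"])
      show "0 \<le> t'" if "I3 xs s' t'" for s' t' using that t n_pos unfolding I3_def by auto
    qed (use step3[OF xs(3) len] fin3[OF xs(3,2,4) x0] in blast)+
    then show ?thesis unfolding s2_def by (simp add: wp_Seq wp_Move)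
  qed
  let ?b2 = "seqs [Load 21 12 (Reg 20),
       While NotEqual (Reg 21) (Const 0) (seqs [Load 22 6 (Reg 21), Load 23 14 (Reg 22),
         Store 14 (Reg 21) (Reg 23), Store 14 (Reg 22) (Reg 21), Load 21 13 (Reg 21)]),
       inc 20]"
  let ?tail2 = "seqs [Move 20 (Const 1), Move 21 (Const 1), While LessEq (Reg 20) (Reg 0) ?b3,
      Store 2 (Const 1) (Const (-1)), Store 2 (Reg 1) (Const (-1))]"
  have fin1: "wp w (seqs [Move 20 (Const 0), Store 14 (Const 1) (Const 0), While LessEq (Reg 20) (Reg 0) ?b2, ?tail2]) Q s1 (t1 - 1)"
    if I: "I1 s1 t1" and c: "\<not> compare_val LessEq (operand_val w s1 (Reg 20)) (operand_val w s1 (Reg 0))" for s1 t1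
  proof -
    have fr: "?fr s1" using I unfolding I1_def by blast
    have "{2..<regs s1 20} = {2..n}" using I c frD[OF fr] unfolding I1_def by auto
    then have bk: "buckets (arrays s1 12) (arrays s1 13) lpf {2..n}" using I unfolding I1_def by simp
    define s2 where "s2 = set_cell 14 1 0 (set_reg 20 0 s1)"
    have b2: "base s2" unfolding base_def s2_def using fr bk by (simp add: wp_simps)
    have e: "{x \<in> {2..n}. lpf x < 0} = {}" using lpf_nonneg by (auto simp: not_less)
    have "inv s2 {1}" unfolding inv_def s2_def
      by (intro exI[of _ "[1]"]) (auto simp: wp_simps trie_list_single)
    then have "inv s2 (insert 1 {x \<in> {2..n}. lpf x < 0})" unfolding e .
    moreover have "regs s2 20 = 0" unfolding s2_def by (simp add: wp_simps)
    moreover have "t1 \<ge> t - 1 - 6 * n" using I c frD[OF fr] n_pos unfolding I1_def by auto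
    ultimately have "I2 s2 (t1 - 3)" unfolding I2_def using b2 n_pos e by simp
    then have "wp w (While LessEq (Reg 20) (Reg 0) ?b2) (wp w ?tail2 Q) s2 (t1 - 3)"
    proof (rule wp_While[where I=I2])
      show "0 \<le> t'" if "I2 s' t'" for s' t'
        using that t n_pos cardn[of "\<lambda>x. lpf x < regs s' 20"] unfolding I2_def by linarith
    qed (use step2 fin2 in blast)+
    then show ?thesis unfolding s2_def seqs.simps(2,3) by (simp add: wp_Seq wp_Move wp_Store regs_set_reg)
  qed
  have I0: "I1 (set_reg 20 2 s) (t - 1)"
    unfolding I1_def using buckets_empty[of "arrays s 13" lpf] zero by (simp add: wp_simps)
  have "wp w (While LessEq (Reg 20) (Reg 0) (seqs [Load 21 5 (Reg 20), Load 22 12 (Reg 21),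
       Store 13 (Reg 20) (Reg 22), Store 12 (Reg 21) (Reg 20), inc 20]))
    (wp w (seqs [Move 20 (Const 0), Store 14 (Const 1) (Const 0), While LessEq (Reg 20) (Reg 0) ?b2, ?tail2]) Q)
    (set_reg 20 2 s) (t - 1)"
  proof (rule wp_While[where I=I1])
    show "0 \<le> t'" if "I1 s' t'" for s' t' using that t n_pos unfolding I1_def by auto
  qed (use I0 step1 fin1 in blast)+
  then show ?thesis unfolding make_order_def seqs.simps wp_Seq by (subst wp_Move) simp
qed

end

section \<open>Separators\<close>

definition segment :: "int \<Rightarrow> (int \<Rightarrow> int) \<Rightarrow> int \<Rightarrow> int \<Rightarrow> bool" where
  "segment n c s e \<longleftrightarrow> 1 \<le> s \<and> s \<le> e \<and> e \<le> n \<and> c s = -1 \<and> (\<forall>r. s < r \<and> r \<le> e \<longrightarrow> 0 \<le> c r) \<and> c (e + 1) = -1"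

text \<open>A block \<open>{l..r}\<close> of the segment \<open>{s..e}\<close> that is the leaf set of a subtree of the trie and
  contains between one and two thirds of the segment.\<close>

definition separator :: "(int \<Rightarrow> int) \<Rightarrow> int \<Rightarrow> int \<Rightarrow> int \<Rightarrow> int \<Rightarrow> bool" where
  "separator c s e l r \<longleftrightarrow> s \<le> l \<and> l \<le> r \<and> r \<le> e \<and>
     (\<forall>p. l < p \<and> p \<le> r \<longrightarrow> c l \<le> c p \<and> c (r + 1) \<le> c p) \<and>
     e - s + 1 \<le> 3 * (r - l + 1) \<and> (s < e \<longrightarrow> 3 * (r - l + 1) \<le> 2 * (e - s + 1))"

text \<open>\<open>{l0..r0}\<close> is the last subtree around the centre that was reached; \<open>{l..r}\<close> extends it to one
  side, towards the larger border value, by positions that are deeper in the trie than \<open>m\<close>.\<close>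

definition growing :: "(int \<Rightarrow> int) \<Rightarrow> int \<Rightarrow> int \<Rightarrow> int \<Rightarrow> int \<Rightarrow> int \<Rightarrow> int \<Rightarrow> int \<Rightarrow> bool" where
  "growing c s e l0 r0 l r m \<longleftrightarrow> s \<le> l \<and> l \<le> l0 \<and> l0 \<le> (s + e) div 2 \<and> (s + e) div 2 \<le> r0 \<and> r0 \<le> r \<and> r \<le> e \<and>
     m = max (c l0) (c (r0 + 1)) \<and> (\<forall>p. l0 < p \<and> p \<le> r0 \<longrightarrow> m \<le> c p) \<and>
     (s < e \<longrightarrow> 3 * (r0 - l0 + 1) \<le> 2 * (e - s + 1)) \<and>
     (l = l0 \<and> r = r0 \<or>
      l < l0 \<and> r = r0 \<and> c l0 = m \<and> (\<forall>p. l \<le> p \<and> p < l0 \<longrightarrow> m < c p) \<or>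
      l = l0 \<and> r0 < r \<and> c (r0 + 1) = m \<and> (\<forall>p. r0 + 1 < p \<and> p \<le> r + 1 \<longrightarrow> m < c p))"

lemma growing_init:
  assumes "segment n c s e"
  defines "a \<equiv> (s + e) div 2"
  shows "growing c s e a a a a (max (c a) (c (a + 1)))"
  using assms unfolding growing_def segment_def by auto

lemma growing_end:
  "growing c s e l0 r0 l r m \<Longrightarrow> e - s + 1 \<le> 3 * (r0 - l0 + 1) \<Longrightarrow> separator c s e l0 r0"
  unfolding growing_def separator_def by auto

text \<open>If both new border values are at most \<open>m\<close>, the widened block satisfies the
  border condition again. Should it exceed two thirds, the extension alone is taken: the core has
  less than a third, so more than a third remains, and the extension lies on one side of the centre,
  so it has at most a half. It satisfies the border condition because its inner values exceed
  \<open>m\<close> while those at its two ends do not.\<close>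

lemma growing_left:
  assumes seg: "segment n c s e" and g: "growing c s e l0 r0 l r m"
    and small: "3 * (r0 - l0 + 1) < e - s + 1" and side: "c (r + 1) \<le> c l"
  defines "l' \<equiv> l - 1"
  defines "m' \<equiv> max (c l') (c (r + 1))"
  shows "s \<le> l'"
    "m < m' \<Longrightarrow> growing c s e l0 r0 l' r m"
    "m' \<le> m \<Longrightarrow> 3 * (r - l' + 1) \<le> 2 * (e - s + 1) \<Longrightarrow> growing c s e l' r l' r m'"
    "m' \<le> m \<Longrightarrow> 2 * (e - s + 1) < 3 * (r - l' + 1) \<Longrightarrow> l' < l0 \<and> separator c s e l' (l0 - 1)"
proof -
  have sg: "1 \<le> s" "s \<le> e" "c s = -1" "c (e + 1) = -1" "\<And>p. s < p \<Longrightarrow> p \<le> e \<Longrightarrow> 0 \<le> c p"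
    using seg unfolding segment_def by auto
  have b: "s \<le> l" "l \<le> l0" "l0 \<le> (s + e) div 2" "(s + e) div 2 \<le> r0" "r0 \<le> r" "r \<le> e"
    and m: "m = max (c l0) (c (r0 + 1))" and ins: "\<And>p. l0 < p \<Longrightarrow> p \<le> r0 \<Longrightarrow> m \<le> c p"
    and disj: "l = l0 \<and> r = r0 \<or>
      l < l0 \<and> r = r0 \<and> c l0 = m \<and> (\<forall>p. l \<le> p \<and> p < l0 \<longrightarrow> m < c p) \<or>
      l = l0 \<and> r0 < r \<and> c (r0 + 1) = m \<and> (\<forall>p. r0 + 1 < p \<and> p \<le> r + 1 \<longrightarrow> m < c p)"
    and sz: "s < e \<longrightarrow> 3 * (r0 - l0 + 1) \<le> 2 * (e - s + 1)"
    using g unfolding growing_def by blast+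
  \<comment> \<open>An extension to the right continues to the right: its border value exceeds
    \<open>m\<close>, while \<open>c l \<le> m\<close>.\<close>
  have "\<not> (l = l0 \<and> r0 < r \<and> c (r0 + 1) = m \<and> (\<forall>p. r0 + 1 < p \<and> p \<le> r + 1 \<longrightarrow> m < c p))"
  proof
    assume a: "l = l0 \<and> r0 < r \<and> c (r0 + 1) = m \<and> (\<forall>p. r0 + 1 < p \<and> p \<le> r + 1 \<longrightarrow> m < c p)"
    then have "m < c (r + 1)" by auto
    moreover have "c l \<le> m" using a m by auto
    ultimately show False using side by simp
  qed
  then have r: "r = r0" and lm: "c l0 = m" and left: "\<And>p. l \<le> p \<Longrightarrow> p < l0 \<Longrightarrow> m < c p"
    using disj m side by auto
  have m1: "-1 \<le> m" using m sg(3) sg(5)[of l0] b by (cases "l0 = s") auto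
  \<comment> \<open>At \<open>s\<close> the value is the least one, so either an extension to the
    left is contradictory, or \<open>side\<close> forces \<open>r = e\<close> and the block is the
    whole segment, against \<open>small\<close>.\<close>
  have "l \<noteq> s"
  proof
    assume ls: "l = s"
    show False
    proof (cases "l < l0")
      case True then show False using left[of l] sg(3) m1 ls by auto
    next
      case False
      then have "c (r + 1) \<le> -1" using side ls sg(3) by simp
      then have "r = e" using sg(5)[of "r + 1"] b by fastforce
      then show False using small False ls r b by auto
    qed
  qed
  then show l's: "s \<le> l'" using b unfolding l'_def by simp
  have cr: "c (r + 1) \<le> m" using m r by simp
  have left': "m < c p" if "l' < p" "p < l0" for p using left[of p] that unfolding l'_def by auto
  show "m < m' \<Longrightarrow> growing c s e l0 r0 l' r m"
  proof -
    assume "m < m'"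
    then have "m < c l'" using cr unfolding m'_def by auto
    then have "\<forall>p. l' \<le> p \<and> p < l0 \<longrightarrow> m < c p" using left' by (metis order_le_less)
    then have "l' < l0 \<and> r = r0 \<and> c l0 = m \<and> (\<forall>p. l' \<le> p \<and> p < l0 \<longrightarrow> m < c p)"
      using b r lm unfolding l'_def by simp
    moreover have "l' \<le> l0" using b unfolding l'_def by simp
    ultimately show ?thesis using b l's m ins sz unfolding growing_def by blast
  qed
  have inside: "m \<le> c p" if "l' < p" "p \<le> r" for p
    using left'[of p] ins[of p] lm r that by (cases "p < l0"; cases "p = l0") auto
  show "growing c s e l' r l' r m'" if "m' \<le> m" "3 * (r - l' + 1) \<le> 2 * (e - s + 1)"
  proof -
    have "\<forall>p. l' < p \<and> p \<le> r \<longrightarrow> m' \<le> c p" using inside that(1) by force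
    moreover have "l' \<le> (s + e) div 2" "(s + e) div 2 \<le> r" using b unfolding l'_def by auto
    ultimately show ?thesis using that b l's unfolding growing_def m'_def by simp
  qed
  show "l' < l0 \<and> separator c s e l' (l0 - 1)" if "m' \<le> m" "2 * (e - s + 1) < 3 * (r - l' + 1)"
  proof -
    have "c l' \<le> m" using that unfolding m'_def by simp
    then have "\<forall>p. l' < p \<and> p \<le> l0 - 1 \<longrightarrow> c l' \<le> c p \<and> c (l0 - 1 + 1) \<le> c p"
      using left' lm by force
    then show ?thesis using that b l's small r unfolding separator_def l'_def by auto
  qed
qed

text \<open>The mirror image of \<open>growing_left\<close>. Here \<open>side\<close> is strict, so
  ties go to the left; strictness also keeps \<open>r\<close> away from the end of the segment,
  behind which the least value -1 stands.\<close>

lemma growing_right: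
  assumes seg: "segment n c s e" and g: "growing c s e l0 r0 l r m"
    and small: "3 * (r0 - l0 + 1) < e - s + 1" and side: "c l < c (r + 1)"
  defines "r' \<equiv> r + 1"
  defines "m' \<equiv> max (c l) (c (r' + 1))"
  shows "r' \<le> e"
    "m < m' \<Longrightarrow> growing c s e l0 r0 l r' m"
    "m' \<le> m \<Longrightarrow> 3 * (r' - l + 1) \<le> 2 * (e - s + 1) \<Longrightarrow> growing c s e l r' l r' m'"
    "m' \<le> m \<Longrightarrow> 2 * (e - s + 1) < 3 * (r' - l + 1) \<Longrightarrow> \<not> l < l0 \<and> separator c s e (r0 + 1) r'"
proof -
  have sg: "1 \<le> s" "s \<le> e" "c s = -1" "c (e + 1) = -1" "\<And>p. s < p \<Longrightarrow> p \<le> e \<Longrightarrow> 0 \<le> c p"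
    using seg unfolding segment_def by auto
  have b: "s \<le> l" "l \<le> l0" "l0 \<le> (s + e) div 2" "(s + e) div 2 \<le> r0" "r0 \<le> r" "r \<le> e"
    and m: "m = max (c l0) (c (r0 + 1))" and ins: "\<And>p. l0 < p \<Longrightarrow> p \<le> r0 \<Longrightarrow> m \<le> c p"
    and disj: "l = l0 \<and> r = r0 \<or>
      l < l0 \<and> r = r0 \<and> c l0 = m \<and> (\<forall>p. l \<le> p \<and> p < l0 \<longrightarrow> m < c p) \<or>
      l = l0 \<and> r0 < r \<and> c (r0 + 1) = m \<and> (\<forall>p. r0 + 1 < p \<and> p \<le> r + 1 \<longrightarrow> m < c p)"
    and sz: "s < e \<longrightarrow> 3 * (r0 - l0 + 1) \<le> 2 * (e - s + 1)"
    using g unfolding growing_def by blast+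
  have "\<not> (l < l0 \<and> r = r0 \<and> c l0 = m \<and> (\<forall>p. l \<le> p \<and> p < l0 \<longrightarrow> m < c p))"
  proof
    assume a: "l < l0 \<and> r = r0 \<and> c l0 = m \<and> (\<forall>p. l \<le> p \<and> p < l0 \<longrightarrow> m < c p)"
    then have "m < c l" by auto
    moreover have "c (r + 1) \<le> m" using a m by auto
    ultimately show False using side by simp
  qed
  then have l: "l = l0" and lm: "c (r0 + 1) = m" and right: "\<And>p. r0 + 1 < p \<Longrightarrow> p \<le> r + 1 \<Longrightarrow> m < c p"
    using disj m side by auto
  have "-1 \<le> c l" using sg(3) sg(5)[of l] b by (cases "l = s") auto
  then have "r \<noteq> e" using side sg(4) by auto
  then show r'e: "r' \<le> e" using b unfolding r'_def by simp
  have cl: "c l \<le> m" using m l by simp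
  have right': "m < c p" if "r0 + 1 < p" "p \<le> r'" for p using right[of p] that unfolding r'_def by auto
  show "m < m' \<Longrightarrow> growing c s e l0 r0 l r' m"
  proof -
    assume "m < m'"
    then have "m < c (r' + 1)" using cl unfolding m'_def by auto
    then have "\<forall>p. r0 + 1 < p \<and> p \<le> r' + 1 \<longrightarrow> m < c p" using right' by (metis order_le_less zle_add1_eq_le)
    then have "l = l0 \<and> r0 < r' \<and> c (r0 + 1) = m \<and> (\<forall>p. r0 + 1 < p \<and> p \<le> r' + 1 \<longrightarrow> m < c p)"
      using b l lm unfolding r'_def by simp
    moreover have "r0 \<le> r'" using b unfolding r'_def by simp
    ultimately show ?thesis using b r'e m ins sz unfolding growing_def by blast
  qed
  have inside: "m \<le> c p" if "l < p" "p \<le> r'" for p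
    using right'[of p] ins[of p] lm l that by (cases "p \<le> r0"; cases "p = r0 + 1") auto
  show "growing c s e l r' l r' m'" if "m' \<le> m" "3 * (r' - l + 1) \<le> 2 * (e - s + 1)"
  proof -
    have "\<forall>p. l < p \<and> p \<le> r' \<longrightarrow> m' \<le> c p" using inside that(1) by force
    moreover have "l \<le> (s + e) div 2" "(s + e) div 2 \<le> r'" using b unfolding r'_def by auto
    ultimately show ?thesis using that b r'e l unfolding growing_def m'_def by simp
  qed
  show "\<not> l < l0 \<and> separator c s e (r0 + 1) r'" if "m' \<le> m" "2 * (e - s + 1) < 3 * (r' - l + 1)"
  proof -
    have "c (r' + 1) \<le> m" using that unfolding m'_def by simp
    then have "\<forall>p. r0 + 1 < p \<and> p \<le> r' \<longrightarrow> c (r0 + 1) \<le> c p \<and> c (r' + 1) \<le> c p"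
      using right' lm by force
    then show ?thesis using that b r'e small l unfolding separator_def r'_def by auto
  qed
qed

text \<open>\<open>ord'\<close> and \<open>c'\<close> describe the segment after the separator \<open>{l..r}\<close> was moved to its front. \<open>sg\<close>
  identifies the segment of an element; \<open>D\<close> is \<open>-1\<close> on the separator and the length of the match with all
  of its elements elsewhere.\<close>

definition split_at :: "(int \<Rightarrow> int) \<Rightarrow> (int \<Rightarrow> int) \<Rightarrow> int \<Rightarrow> int \<Rightarrow> int \<Rightarrow> int \<Rightarrow>
    (int \<Rightarrow> int) \<Rightarrow> (int \<Rightarrow> int) \<Rightarrow> (int \<Rightarrow> int) \<Rightarrow> (int \<Rightarrow> int) \<Rightarrow> bool" where
  "split_at ord c s e l r ord' c' D sg \<longleftrightarrow>
     (\<forall>q. l \<le> q \<and> q \<le> r \<longrightarrow> ord' (q - l + s) = ord q \<and> c' (q - l + s) = (if q = l then -1 else c q) \<and>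
        D (ord q) = -1 \<and> sg (ord q) = s) \<and>
     (\<forall>p. s \<le> p \<and> p < l \<longrightarrow> ord' (p + (r - l + 1)) = ord p \<and> c' (p + (r - l + 1)) = c p \<and>
        (\<forall>m. m \<le> D (ord p) \<longleftrightarrow> (\<forall>q. p < q \<and> q \<le> l \<longrightarrow> m \<le> c q)) \<and> sg (ord p) = s) \<and>
     (\<forall>p. r < p \<and> p \<le> e \<longrightarrow> ord' p = ord p \<and> c' p = (if p = r + 1 then min (c l) (c p) else c p) \<and>
        (\<forall>m. m \<le> D (ord p) \<longleftrightarrow> (\<forall>q. r < q \<and> q \<le> p \<longrightarrow> m \<le> c q)) \<and> sg (ord p) = s)"

text \<open>Being in a common segment is put as a relation between elements rather than places, so
  that it can be compared before and after a reordering.\<close>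

definition grouped :: "int \<Rightarrow> (int \<Rightarrow> int) \<Rightarrow> (int \<Rightarrow> int) \<Rightarrow> int \<Rightarrow> int \<Rightarrow> bool" where
  "grouped n ord c x y \<longleftrightarrow> (\<exists>p q. 1 \<le> p \<and> p \<le> n \<and> 1 \<le> q \<and> q \<le> n \<and> ord p = x \<and> ord q = y \<and>
     (\<forall>r. min p q < r \<and> r \<le> max p q \<longrightarrow> 0 \<le> c r))"

lemma grouped_singletons:
  assumes "\<And>p. 1 \<le> p \<Longrightarrow> p \<le> n \<Longrightarrow> c p = -1" "grouped n ord c x y"
  shows "x = y"
proof -
  obtain p q where pq: "1 \<le> p" "p \<le> n" "1 \<le> q" "q \<le> n" "ord p = x" "ord q = y"
     "\<forall>r. min p q < r \<and> r \<le> max p q \<longrightarrow> 0 \<le> c r" using assms(2) unfolding grouped_def by blast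
  have "p = q"
  proof (rule ccontr)
    assume "p \<noteq> q"
    then have "0 \<le> c (max p q)" using pq by auto
    moreover have "c (max p q) = -1" using assms(1)[of "max p q"] pq by auto
    ultimately show False by simp
  qed
  then show ?thesis using pq by simp
qed

section \<open>Segments as blocks between two borders\<close>

context matching begin

lemma segment_at:
  assumes ok: "segments_ok ord c" and p: "1 \<le> p" "p \<le> n"
  obtains s f where "segment n c s f" "s \<le> p" "p \<le> f"
proof -
  let ?S = "{s. 1 \<le> s \<and> s \<le> p \<and> c s = -1}" and ?E = "{e. p \<le> e \<and> e \<le> n \<and> c (e + 1) = -1}"
  have cb: "\<And>p. 1 \<le> p \<Longrightarrow> p \<le> n \<Longrightarrow> -1 \<le> c p" and c1: "c 1 = -1" "c (n + 1) = -1"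
    using ok unfolding segments_ok_def by auto
  have fS: "finite ?S" by (rule finite_subset[of _ "{1..p}"]) auto
  have fE: "finite ?E" by (rule finite_subset[of _ "{p..n}"]) auto
  have "1 \<in> ?S" using p c1 by auto
  then have S: "Max ?S \<in> ?S" using fS by (intro Max_in) auto
  have "n \<in> ?E" using p c1 by auto
  then have E: "Min ?E \<in> ?E" using fE by (intro Min_in) auto
  have "0 \<le> c r" if r: "Max ?S < r" "r \<le> Min ?E" for r
  proof (rule ccontr)
    assume "\<not> 0 \<le> c r"
    then have cr: "c r = -1" using cb[of r] r S E by auto
    show False
    proof (cases "r \<le> p")
      case True
      then have "r \<le> Max ?S" using fS cr r S by (intro Max_ge) auto
      then show False using r by simp
    next
      case False
      then have "Min ?E \<le> r - 1" using fE cr r E by (intro Min_le) auto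
      then show False using r by simp
    qed
  qed
  then have "segment n c (Max ?S) (Min ?E)" using S E unfolding segment_def by auto
  then show ?thesis using that S E by auto
qed

lemma segment_unique:
  assumes "segment n c s f" "segment n c s' f'" "s \<le> p" "p \<le> f" "s' \<le> p" "p \<le> f'"
  shows "s = s' \<and> f = f'"
proof -
  have a: "c s = -1" "\<And>r. s < r \<Longrightarrow> r \<le> f \<Longrightarrow> 0 \<le> c r" "c (f + 1) = -1"
    and b: "c s' = -1" "\<And>r. s' < r \<Longrightarrow> r \<le> f' \<Longrightarrow> 0 \<le> c r" "c (f' + 1) = -1"
    using assms unfolding segment_def by auto
  have "\<not> s < s'" using a(2)[of s'] b(1) assms by auto
  moreover have "\<not> s' < s" using b(2)[of s] a(1) assms by auto
  moreover have "\<not> f < f'" using b(2)[of "f + 1"] a(3) assms by auto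
  moreover have "\<not> f' < f" using a(2)[of "f' + 1"] b(3) assms by auto
  ultimately show ?thesis by auto
qed

end

text \<open>One round of splitting, seen as a relation between the orders before and after it. A
  segment is addressed by its first place alone, which determines its end.\<close>

locale split_level = matching n e for n e +
  fixes ord c ord' c' D sg :: "int \<Rightarrow> int"
  assumes ok: "segments_ok ord c"
    and c'_end: "c' (n + 1) = -1"
    and split: "1 \<le> s \<Longrightarrow> s \<le> n \<Longrightarrow> c s = -1 \<Longrightarrow>
      \<exists>f l r. segment n c s f \<and> separator c s f l r \<and> split_at ord c s f l r ord' c' D sg"
begin

lemma ord_bij: "bij_betw ord {1..n} {1..n}"
  and c_bounds: "1 \<le> p \<Longrightarrow> p \<le> n \<Longrightarrow> -1 \<le> c p \<and> c p \<le> n"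
  and ev_ord: "1 \<le> p \<Longrightarrow> p < q \<Longrightarrow> q \<le> n \<Longrightarrow> 0 \<le> m \<Longrightarrow> (\<And>r. p < r \<Longrightarrow> r \<le> q \<Longrightarrow> 0 \<le> c r) \<Longrightarrow>
      ev m (ord p) (ord q) \<longleftrightarrow> (\<forall>r. p < r \<and> r \<le> q \<longrightarrow> m \<le> c r)"
  using ok unfolding segments_ok_def by auto

lemma ord_range: "1 \<le> p \<Longrightarrow> p \<le> n \<Longrightarrow> 1 \<le> ord p \<and> ord p \<le> n"
  using ord_bij unfolding bij_betw_def by auto

lemma ord_surj: "1 \<le> x \<Longrightarrow> x \<le> n \<Longrightarrow> \<exists>p. 1 \<le> p \<and> p \<le> n \<and> ord p = x"
proof -
  assume "1 \<le> x" "x \<le> n"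
  then have "x \<in> ord ` {1..n}" using ord_bij unfolding bij_betw_def by simp
  then show ?thesis by auto
qed

definition parts :: "int \<Rightarrow> int \<Rightarrow> int \<Rightarrow> int \<Rightarrow> bool" where
  "parts s f l r \<longleftrightarrow> segment n c s f \<and> separator c s f l r \<and> split_at ord c s f l r ord' c' D sg"

text \<open>The inverse of the reordering: the old place of what stands at \<open>q\<close> after
  the round. The separator comes first, then what was to its left, then what was to its right and
  did not move.\<close>

definition source :: "int \<Rightarrow> int \<Rightarrow> int \<Rightarrow> int \<Rightarrow> int" where
  "source s l r q = (if q < s + (r - l + 1) then q - s + l else if q \<le> r then q - (r - l + 1) else q)"

lemma parts_at:
  assumes "1 \<le> p" "p \<le> n"
  obtains s f l r where "parts s f l r" "s \<le> p" "p \<le> f"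
proof -
  obtain s f where sf: "segment n c s f" "s \<le> p" "p \<le> f" using segment_at[OF ok assms] by blast
  then have "1 \<le> s" "s \<le> n" "c s = -1" unfolding segment_def by auto
  then obtain f' l r where f': "segment n c s f'" "separator c s f' l r" "split_at ord c s f' l r ord' c' D sg"
    using split by blast
  have "f' = f" using segment_unique[OF sf(1) f'(1), of s] sf f' unfolding segment_def by auto
  then show ?thesis using that sf f' unfolding parts_def by blast
qed

lemma partsD:
  assumes "parts s f l r"
  shows "1 \<le> s" "s \<le> l" "l \<le> r" "r \<le> f" "f \<le> n" "c s = -1" "c (f + 1) = -1"
    "\<And>p. s < p \<Longrightarrow> p \<le> f \<Longrightarrow> 0 \<le> c p"
    "\<And>p. l < p \<Longrightarrow> p \<le> r \<Longrightarrow> c l \<le> c p \<and> c (r + 1) \<le> c p"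
  using assms unfolding parts_def segment_def separator_def by auto

lemma parts_new:
  assumes P: "parts s f l r" and q: "s \<le> q" "q \<le> f"
  defines "p \<equiv> source s l r q"
  shows "s \<le> p" "p \<le> f" "ord' q = ord p" "q < s + (r - l + 1) \<longleftrightarrow> l \<le> p \<and> p \<le> r"
    "c' q = (if p = l then -1 else if p = r + 1 then min (c l) (c p) else c p)"
proof -
  note d = partsD[OF P]
  have sp: "split_at ord c s f l r ord' c' D sg" using P unfolding parts_def by blast
  consider "q < s + (r - l + 1)" | "s + (r - l + 1) \<le> q" "q \<le> r" | "s + (r - l + 1) \<le> q" "r < q" by linarith
  then have "s \<le> p \<and> p \<le> f \<and> ord' q = ord p \<and> (q < s + (r - l + 1) \<longleftrightarrow> l \<le> p \<and> p \<le> r) \<and>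
     c' q = (if p = l then -1 else if p = r + 1 then min (c l) (c p) else c p)"
  proof cases
    case 1
    then have p: "p = q - s + l" unfolding p_def source_def by simp
    have "ord' (p - l + s) = ord p \<and> c' (p - l + s) = (if p = l then -1 else c p)"
    proof -
      have "l \<le> p" "p \<le> r" using 1 p q by auto
      then show ?thesis using sp unfolding split_at_def by blast
    qed
    then show ?thesis using 1 p d q by auto
  next
    case 2
    then have p: "p = q - (r - l + 1)" unfolding p_def source_def by simp
    then have pl: "s \<le> p" "p < l" using 2 by auto
    then have "ord' (p + (r - l + 1)) = ord p \<and> c' (p + (r - l + 1)) = c p"
      using sp unfolding split_at_def by blast
    then show ?thesis using 2 p pl d q by auto
  next
    case 3
    then have p: "p = q" unfolding p_def source_def using d by auto
    have "ord' p = ord p \<and> c' p = (if p = r + 1 then min (c l) (c p) else c p)"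
      using sp 3 p q unfolding split_at_def by blast
    then show ?thesis using 3 p d q by auto
  qed
  then show "s \<le> p" "p \<le> f" "ord' q = ord p" "q < s + (r - l + 1) \<longleftrightarrow> l \<le> p \<and> p \<le> r"
    "c' q = (if p = l then -1 else if p = r + 1 then min (c l) (c p) else c p)" by auto
qed

lemma parts_dest:
  assumes P: "parts s f l r" and p: "s \<le> p" "p \<le> f"
  obtains q where "s \<le> q" "q \<le> f" "source s l r q = p"
proof -
  note d = partsD[OF P]
  consider "p < l" | "l \<le> p" "p \<le> r" | "r < p" by linarith
  then show ?thesis
  proof cases
    case 1 then show ?thesis using that[of "p + (r - l + 1)"] d p unfolding source_def by auto
  next
    case 2 then show ?thesis using that[of "p - l + s"] d p unfolding source_def by auto
  next
    case 3 then show ?thesis using that[of p] d p unfolding source_def by auto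
  qed
qed

lemma parts_D:
  assumes P: "parts s f l r" and p: "s \<le> p" "p \<le> f"
  shows "sg (ord p) = s" "D (ord p) = -1 \<longleftrightarrow> l \<le> p \<and> p \<le> r" "\<not> (l \<le> p \<and> p \<le> r) \<Longrightarrow> 0 \<le> D (ord p)"
    "p < l \<Longrightarrow> m \<le> D (ord p) \<longleftrightarrow> (\<forall>q. p < q \<and> q \<le> l \<longrightarrow> m \<le> c q)"
    "r < p \<Longrightarrow> m \<le> D (ord p) \<longleftrightarrow> (\<forall>q. r < q \<and> q \<le> p \<longrightarrow> m \<le> c q)"
proof -
  note d = partsD[OF P]
  have sp: "split_at ord c s f l r ord' c' D sg" using P unfolding parts_def by blast
  show "sg (ord p) = s"
  proof -
    consider "p < l" | "l \<le> p" "p \<le> r" | "r < p" by linarith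
    then show ?thesis using sp p unfolding split_at_def by cases blast+
  qed
  have lo: "p < l \<Longrightarrow> \<forall>m. m \<le> D (ord p) \<longleftrightarrow> (\<forall>q. p < q \<and> q \<le> l \<longrightarrow> m \<le> c q)"
    using sp[unfolded split_at_def, THEN conjunct2, THEN conjunct1, THEN spec, of p] p(1) by blast
  have hi: "r < p \<Longrightarrow> \<forall>m. m \<le> D (ord p) \<longleftrightarrow> (\<forall>q. r < q \<and> q \<le> p \<longrightarrow> m \<le> c q)"
    using sp[unfolded split_at_def, THEN conjunct2, THEN conjunct2, THEN spec, of p] p(2) by blast
  show "p < l \<Longrightarrow> m \<le> D (ord p) \<longleftrightarrow> (\<forall>q. p < q \<and> q \<le> l \<longrightarrow> m \<le> c q)" using lo by blast
  show "r < p \<Longrightarrow> m \<le> D (ord p) \<longleftrightarrow> (\<forall>q. r < q \<and> q \<le> p \<longrightarrow> m \<le> c q)" using hi by blast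
  have "0 \<le> D (ord p)" if "p < l"
  proof -
    have "0 \<le> c q" if "p < q" "q \<le> l" for q by (rule d(8)) (use that p d(3,4) in linarith)+
    then show ?thesis using lo[OF that, rule_format, of 0] by blast
  qed
  moreover have "0 \<le> D (ord p)" if "r < p"
  proof -
    have "0 \<le> c q" if "r < q" "q \<le> p" for q by (rule d(8)) (use that p d(2,3) in linarith)+
    then show ?thesis using hi[OF that, rule_format, of 0] by blast
  qed
  moreover have "D (ord p) = -1" if "l \<le> p" "p \<le> r" using sp that unfolding split_at_def by blast
  ultimately have "(l \<le> p \<and> p \<le> r \<and> D (ord p) = -1) \<or> (\<not> (l \<le> p \<and> p \<le> r) \<and> 0 \<le> D (ord p))"
    by (meson not_le)
  then show "D (ord p) = -1 \<longleftrightarrow> l \<le> p \<and> p \<le> r" "\<not> (l \<le> p \<and> p \<le> r) \<Longrightarrow> 0 \<le> D (ord p)"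
    by auto
qed

text \<open>The separator and the rest each start with a border. If the separator was not in front,
  the rest begins with the old first element and its -1; otherwise it begins at
  \<open>r + 1\<close>, where the minimum with \<open>c l\<close> is -1.\<close>

lemma parts_c'_nonneg:
  assumes P: "parts s f l r" and q: "s \<le> q" "q \<le> f"
  shows "0 \<le> c' q \<longleftrightarrow> q \<noteq> s \<and> q \<noteq> s + (r - l + 1)"
proof -
  note d = partsD[OF P] and new = parts_new[OF P q]
  let ?p = "source s l r q"
  have cp: "0 \<le> c ?p \<longleftrightarrow> ?p \<noteq> s" using d(6) d(8)[of ?p] new(1,2) by fastforce
  have cl: "0 \<le> c l \<longleftrightarrow> l \<noteq> s" using d(6) d(8)[of l] d(2,3,4) by fastforce
  consider "q < s + (r - l + 1)" "?p = q - s + l" | "s + (r - l + 1) \<le> q" "q \<le> r" "?p = q - (r - l + 1)"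
    | "s + (r - l + 1) \<le> q" "r < q" "?p = q"
    unfolding source_def by (cases "q < s + (r - l + 1)"; cases "q \<le> r") auto
  then show ?thesis
  proof cases
    case 1 then show ?thesis using new(5) cp d(2-4) q by auto
  next
    case 2 then show ?thesis using new(5) cp d(2-4) q by auto
  next
    case 3 then show ?thesis using new(5) cp cl d(2-4) q by (auto simp: min_le_iff_disj)
  qed
qed

lemma c'_start: "1 \<le> s \<Longrightarrow> s \<le> n \<Longrightarrow> c s = -1 \<Longrightarrow> c' s < 0"
proof -
  assume s: "1 \<le> s" "s \<le> n" "c s = -1"
  then obtain f l r where "parts s f l r" using split unfolding parts_def by blast
  then show "c' s < 0" using parts_c'_nonneg[of s f l r s] partsD[of s f l r] by auto
qed

text \<open>The next old segment starts with a border again, and so does the rest behind the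
  separator; neither can be entered without crossing a border. Claims about new segments thus reduce
  to one part of one old segment.\<close>

lemma new_stretch:
  assumes pq: "1 \<le> p" "p \<le> q" "q \<le> n" and nn: "\<And>r. p < r \<Longrightarrow> r \<le> q \<Longrightarrow> 0 \<le> c' r"
  obtains s f l r where "parts s f l r" "s \<le> p" "q \<le> f"
    "q < s + (r - l + 1) \<or> s + (r - l + 1) \<le> p"
proof -
  obtain s f l r where P: "parts s f l r" "s \<le> p" "p \<le> f" by (rule parts_at[of p]) (use pq in auto)
  note d = partsD[OF P(1)]
  have qf: "q \<le> f"
  proof (rule ccontr)
    assume "\<not> q \<le> f"
    then have "0 \<le> c' (f + 1)" "f + 1 \<le> n" using nn[of "f + 1"] P pq by auto
    then show False using c'_start[of "f + 1"] d by auto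
  qed
  have "q < s + (r - l + 1) \<or> s + (r - l + 1) \<le> p"
  proof (rule ccontr)
    assume a: "\<not> ?thesis"
    then have "0 \<le> c' (s + (r - l + 1))" using nn[of "s + (r - l + 1)"] by auto
    then show False using parts_c'_nonneg[OF P(1), of "s + (r - l + 1)"] a P qf by auto
  qed
  then show ?thesis using that P qf by blast
qed

lemma ord'_bij: "bij_betw ord' {1..n} {1..n}"
proof -
  have "ord' q \<in> {1..n}" if "q \<in> {1..n}" for q
  proof -
    have "1 \<le> q" "q \<le> n" using that by auto
    then obtain s f l r where P: "parts s f l r" "s \<le> q" "q \<le> f" by (rule parts_at)
    then show ?thesis using parts_new[OF P] ord_range[of "source s l r q"] partsD[OF P(1)] by auto
  qed
  moreover have "x \<in> ord' ` {1..n}" if "x \<in> {1..n}" for x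
  proof -
    obtain p where p: "1 \<le> p" "p \<le> n" "ord p = x" using ord_surj[of x] \<open>x \<in> {1..n}\<close> by auto
    obtain s f l r where P: "parts s f l r" "s \<le> p" "p \<le> f" by (rule parts_at[of p]) (use p in auto)
    obtain q where q: "s \<le> q" "q \<le> f" "source s l r q = p" using parts_dest[OF P] by blast
    then have "ord' q = x" using parts_new[OF P(1) q(1,2)] p by simp
    then show ?thesis using q partsD[OF P(1)] by force
  qed
  ultimately have im: "ord' ` {1..n} = {1..n}" by blast
  then have "inj_on ord' {1..n}" by (intro eq_card_imp_inj_on) auto
  then show ?thesis using im unfolding bij_betw_def by blast
qed

text \<open>Inside the separator, or on one side of it, places are only shifted. Across the gap the
  removed values matter through \<open>min (c l) (c (r + 1))\<close> alone, because the inner values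
  of the separator are at least both border values.\<close>

lemma segments_ok': "segments_ok ord' c'"
  unfolding segments_ok_def
proof (intro conjI allI impI)
  show "bij_betw ord' {1..n} {1..n}" by (rule ord'_bij)
  show c'b: "-1 \<le> c' p" "c' p \<le> n" if "1 \<le> p \<and> p \<le> n" for p
  proof -
    have "1 \<le> p" "p \<le> n" using that by auto
    then obtain s f l r where P: "parts s f l r" "s \<le> p" "p \<le> f" by (rule parts_at)
    note d = partsD[OF P(1)] and new = parts_new[OF P]
    have "-1 \<le> c' p \<and> c' p \<le> n"
      using new(5) c_bounds[of "source s l r p"] c_bounds[of l] new(1,2) d n_ge_1 by (auto simp: min_def)
    then show "-1 \<le> c' p" "c' p \<le> n" by auto
  qed
  show "c' 1 = -1" using c'_start[of 1] c'b[of 1] ok n_ge_1 unfolding segments_ok_def by auto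
  show "c' (n + 1) = -1" by (rule c'_end)
  fix p q m :: int
  assume a: "1 \<le> p \<and> p < q \<and> q \<le> n \<and> 0 \<le> m \<and> (\<forall>r. p < r \<and> r \<le> q \<longrightarrow> 0 \<le> c' r)"
  obtain s f l r where P: "parts s f l r" "s \<le> p" "q \<le> f"
    and side: "q < s + (r - l + 1) \<or> s + (r - l + 1) \<le> p"
    by (rule new_stretch[of p q]) (use a in auto)
  note d = partsD[OF P(1)]
  let ?a = "r - l + 1"
  have np: "ord' p = ord (source s l r p)" "ord' q = ord (source s l r q)"
    using parts_new(3)[OF P(1), of p] parts_new(3)[OF P(1), of q] P a by auto
  have nc: "c' x = (if source s l r x = l then -1 else if source s l r x = r + 1 then min (c l) (c (source s l r x)) else c (source s l r x))"
    if "p < x" "x \<le> q" for x using parts_new(5)[OF P(1), of x] P a that by auto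
  have E: "ev m (ord i) (ord j) \<longleftrightarrow> (\<forall>r. i < r \<and> r \<le> j \<longrightarrow> m \<le> c r)" if "s \<le> i" "i < j" "j \<le> f" for i j
    using ev_ord[of i j m] d that a by auto
  show "ev m (ord' p) (ord' q) \<longleftrightarrow> (\<forall>r. p < r \<and> r \<le> q \<longrightarrow> m \<le> c' r)"
  proof (cases "q < s + ?a")
    case True
    have src: "source s l r x = x - s + l" if "p \<le> x" "x \<le> q" for x using that True unfolding source_def by auto
    have c'x: "c' x = c (x - s + l)" if "p < x" "x \<le> q" for x
      using nc[OF that] src[of x] that True P d by auto
    have "ev m (ord' p) (ord' q) \<longleftrightarrow> (\<forall>y. p - s + l < y \<and> y \<le> q - s + l \<longrightarrow> m \<le> c y)"
      unfolding np using E[of "p - s + l" "q - s + l"] src[of p] src[of q] a P True d by auto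
    also have "\<dots> \<longleftrightarrow> (\<forall>x. p < x \<and> x \<le> q \<longrightarrow> m \<le> c (x - s + l))"
    proof (intro iffI allI impI)
      fix y assume h: "\<forall>x. p < x \<and> x \<le> q \<longrightarrow> m \<le> c (x - s + l)" and "p - s + l < y \<and> y \<le> q - s + l"
      then show "m \<le> c y" using h[rule_format, of "y + s - l"] by auto
    qed auto
    also have "\<dots> \<longleftrightarrow> (\<forall>x. p < x \<and> x \<le> q \<longrightarrow> m \<le> c' x)" using c'x by auto
    finally show ?thesis .
  next
    case False
    then have ps: "s + ?a \<le> p" using side by simp
    consider "q \<le> r" | "r < p" | "p \<le> r" "r < q" by linarith
    then show ?thesis
    proof cases
      case 1
      have src: "source s l r x = x - ?a" if "p \<le> x" "x \<le> q" for x using that ps 1 unfolding source_def by auto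
      have c'x: "c' x = c (x - ?a)" if "p < x" "x \<le> q" for x
        using nc[OF that] src[of x] that 1 P d by auto
      have "ev m (ord' p) (ord' q) \<longleftrightarrow> (\<forall>y. p - ?a < y \<and> y \<le> q - ?a \<longrightarrow> m \<le> c y)"
        unfolding np using E[of "p - ?a" "q - ?a"] src[of p] src[of q] a P ps 1 d by auto
      also have "\<dots> \<longleftrightarrow> (\<forall>x. p < x \<and> x \<le> q \<longrightarrow> m \<le> c (x - ?a))"
      proof (intro iffI allI impI)
        fix y assume h: "\<forall>x. p < x \<and> x \<le> q \<longrightarrow> m \<le> c (x - ?a)" and "p - ?a < y \<and> y \<le> q - ?a"
        then show "m \<le> c y" using h[rule_format, of "y + ?a"] by auto
      qed auto
      also have "\<dots> \<longleftrightarrow> (\<forall>x. p < x \<and> x \<le> q \<longrightarrow> m \<le> c' x)" using c'x by auto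
      finally show ?thesis .
    next
      case 2
      have src: "source s l r x = x" if "p \<le> x" "x \<le> q" for x using that ps 2 unfolding source_def by auto
      have c'x: "c' x = c x" if "p < x" "x \<le> q" for x
        using nc[OF that] src[of x] that 2 P d by auto
      show ?thesis unfolding np using E[of p q] src[of p] src[of q] a P c'x by auto
    next
      case 3
      have srp: "source s l r p = p - ?a" "source s l r q = q" using ps 3 unfolding source_def by auto
      have c1: "c' x = c (x - ?a)" if "p < x" "x \<le> r" for x
      proof -
        have "source s l r x = x - ?a" using that ps unfolding source_def by auto
        then show ?thesis using nc[of x] that 3 d by auto
      qed
      have c2: "c' x = c x" if "r + 1 < x" "x \<le> q" for x
      proof -
        have "source s l r x = x" using that ps 3 unfolding source_def by auto
        then show ?thesis using nc[of x] that 3 d by auto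
      qed
      have c3: "c' (r + 1) = min (c l) (c (r + 1))"
      proof -
        have "source s l r (r + 1) = r + 1" using ps 3 unfolding source_def by auto
        then show ?thesis using nc[of "r + 1"] 3 d by auto
      qed
      have "ev m (ord' p) (ord' q) \<longleftrightarrow> (\<forall>y. p - ?a < y \<and> y \<le> q \<longrightarrow> m \<le> c y)"
        unfolding np srp using E[of "p - ?a" q] a P ps 3 d by auto
      also have "\<dots> \<longleftrightarrow> (\<forall>x. p < x \<and> x \<le> q \<longrightarrow> m \<le> c' x)"
      proof
        assume h: "\<forall>y. p - ?a < y \<and> y \<le> q \<longrightarrow> m \<le> c y"
        show "\<forall>x. p < x \<and> x \<le> q \<longrightarrow> m \<le> c' x"
        proof (intro allI impI)
          fix x assume x: "p < x \<and> x \<le> q"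
          consider "x \<le> r" | "x = r + 1" | "r + 1 < x" by linarith
          then show "m \<le> c' x"
          proof cases
            case 1 then show ?thesis using c1[of x] h[rule_format, of "x - ?a"] x 3 d by auto
          next
            case 2 then show ?thesis using c3 h[rule_format, of l] h[rule_format, of "r + 1"] x 3 d by auto
          next
            case 3 then show ?thesis using c2[of x] h[rule_format, of x] x d by auto
          qed
        qed
      next
        assume h: "\<forall>x. p < x \<and> x \<le> q \<longrightarrow> m \<le> c' x"
        have m3: "m \<le> c l" "m \<le> c (r + 1)" using h[rule_format, of "r + 1"] c3 3 by auto
        show "\<forall>y. p - ?a < y \<and> y \<le> q \<longrightarrow> m \<le> c y"
        proof (intro allI impI)
          fix y assume y: "p - ?a < y \<and> y \<le> q"
          consider "y < l" | "y = l" | "l < y" "y \<le> r" | "y = r + 1" | "r + 1 < y" by linarith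
          then show "m \<le> c y"
          proof cases
            case 1 then show ?thesis using c1[of "y + ?a"] h[rule_format, of "y + ?a"] y 3 d by auto
          next
            case 3 then show ?thesis using d(9)[of y] m3 by auto
          next
            case 5 then show ?thesis using c2[of y] h[rule_format, of y] y 3 \<open>p \<le> r\<close> by auto
          qed (use m3 in auto)
        qed
      qed
      finally show ?thesis .
    qed
  qed
qed

text \<open>Together with \<open>new_group_iff\<close> this expresses the separation of a pair by
  \<open>sg\<close> and \<open>D\<close>, so that the counting need not refer to the order.\<close>

lemma same_group_iff:
  assumes x: "1 \<le> x" "x \<le> n" "1 \<le> y" "y \<le> n"
  shows "grouped n ord c x y \<longleftrightarrow> sg x = sg y"
proof
  assume "grouped n ord c x y"
  then obtain p q where pq: "1 \<le> p" "p \<le> n" "1 \<le> q" "q \<le> n" "ord p = x" "ord q = y"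
    and st: "\<And>r. min p q < r \<Longrightarrow> r \<le> max p q \<Longrightarrow> 0 \<le> c r" unfolding grouped_def by blast
  obtain s f l r where P: "parts s f l r" "s \<le> p" "p \<le> f" by (rule parts_at[of p]) (use pq in auto)
  note d = partsD[OF P(1)]
  have "s \<le> q" using st[of s] d P by (cases "q < s") auto
  moreover have "q \<le> f" using st[of "f + 1"] d P by (cases "f < q") auto
  ultimately have "sg (ord q) = s" using parts_D(1)[OF P(1)] by blast
  moreover have "sg (ord p) = s" using parts_D(1)[OF P(1)] P by blast
  ultimately show "sg x = sg y" using pq by simp
next
  assume s: "sg x = sg y"
  obtain p where p: "1 \<le> p" "p \<le> n" "ord p = x" using ord_surj x by blast
  obtain q where q: "1 \<le> q" "q \<le> n" "ord q = y" using ord_surj x by blast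
  obtain s f l r where P: "parts s f l r" "s \<le> p" "p \<le> f" by (rule parts_at[of p]) (use p in auto)
  obtain s' f' l' r' where P': "parts s' f' l' r'" "s' \<le> q" "q \<le> f'" by (rule parts_at[of q]) (use q in auto)
  have "s = s'" using parts_D(1)[OF P] parts_D(1)[OF P'] s p q by simp
  then have "f = f'" using segment_unique[of c s f s' f' s] P(1) P'(1) partsD[OF P(1)] partsD[OF P'(1)] unfolding parts_def by auto
  then have "0 \<le> c z" if "min p q < z" "z \<le> max p q" for z
    using partsD(8)[OF P(1), of z] that P P' \<open>s = s'\<close> by auto
  then show "grouped n ord c x y" unfolding grouped_def using p q by blast
qed

lemma new_group_iff:
  assumes x: "1 \<le> x" "x \<le> n" "1 \<le> y" "y \<le> n"
  shows "grouped n ord' c' x y \<longleftrightarrow> sg x = sg y \<and> (D x = -1 \<longleftrightarrow> D y = -1)"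
proof
  assume "grouped n ord' c' x y"
  then obtain p q where pq: "1 \<le> p" "p \<le> n" "1 \<le> q" "q \<le> n" "ord' p = x" "ord' q = y"
    and st: "\<And>r. min p q < r \<Longrightarrow> r \<le> max p q \<Longrightarrow> 0 \<le> c' r" unfolding grouped_def by blast
  obtain s f l r where P: "parts s f l r" "s \<le> min p q" "max p q \<le> f"
    and side: "max p q < s + (r - l + 1) \<or> s + (r - l + 1) \<le> min p q"
    by (rule new_stretch[of "min p q" "max p q"]) (use pq st in auto)
  have b: "s \<le> p" "p \<le> f" "s \<le> q" "q \<le> f" using P by auto
  note np = parts_new[OF P(1) b(1,2)] and nq = parts_new[OF P(1) b(3,4)]
  have "sg x = s" "sg y = s" using parts_D(1)[OF P(1) np(1,2)] parts_D(1)[OF P(1) nq(1,2)] np nq pq by auto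
  moreover have "D x = -1 \<longleftrightarrow> p < s + (r - l + 1)" using parts_D(2)[OF P(1) np(1,2)] np pq by auto
  moreover have "D y = -1 \<longleftrightarrow> q < s + (r - l + 1)" using parts_D(2)[OF P(1) nq(1,2)] nq pq by auto
  ultimately show "sg x = sg y \<and> (D x = -1 \<longleftrightarrow> D y = -1)" using side by auto
next
  assume a: "sg x = sg y \<and> (D x = -1 \<longleftrightarrow> D y = -1)"
  obtain p where p: "1 \<le> p" "p \<le> n" "ord p = x" using ord_surj x by blast
  obtain q where q: "1 \<le> q" "q \<le> n" "ord q = y" using ord_surj x by blast
  obtain s f l r where P: "parts s f l r" "s \<le> p" "p \<le> f" by (rule parts_at[of p]) (use p in auto)
  obtain s' f' l' r' where P': "parts s' f' l' r'" "s' \<le> q" "q \<le> f'" by (rule parts_at[of q]) (use q in auto)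
  have "s = s'" using parts_D(1)[OF P] parts_D(1)[OF P'] a p q by simp
  then have "f = f'" using segment_unique[of c s f s' f' s] P(1) P'(1) partsD[OF P(1)] partsD[OF P'(1)] unfolding parts_def by auto
  have qs: "s \<le> q" "q \<le> f" using P' \<open>s = s'\<close> \<open>f = f'\<close> by auto
  obtain p2 where p2: "s \<le> p2" "p2 \<le> f" "source s l r p2 = p" using parts_dest[OF P] by blast
  obtain q2 where q2: "s \<le> q2" "q2 \<le> f" "source s l r q2 = q" using parts_dest[OF P(1) qs] by blast
  note np = parts_new[OF P(1) p2(1,2)] and nq = parts_new[OF P(1) q2(1,2)]
  have o: "ord' p2 = x" "ord' q2 = y" using np(3) nq(3) p2(3) q2(3) p(3) q(3) by simp_all
  have "D x = -1 \<longleftrightarrow> p2 < s + (r - l + 1)" using parts_D(2)[OF P(1) np(1,2)] np p2 p by auto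
  moreover have "D y = -1 \<longleftrightarrow> q2 < s + (r - l + 1)" using parts_D(2)[OF P(1) nq(1,2)] nq q2 q by auto
  ultimately have side: "p2 < s + (r - l + 1) \<longleftrightarrow> q2 < s + (r - l + 1)" using a by auto
  have "0 \<le> c' z" if "min p2 q2 < z" "z \<le> max p2 q2" for z
    using parts_c'_nonneg[OF P(1), of z] that p2 q2 side by auto
  moreover have "1 \<le> p2" "p2 \<le> n" "1 \<le> q2" "q2 \<le> n" using p2 q2 partsD(1,5)[OF P(1)] by auto
  ultimately show "grouped n ord' c' x y" unfolding grouped_def using o by blast
qed

text \<open>The values on the way from an outer element into the separator include the border value,
  and those inside the separator are no smaller. So the minimum does not depend on which element of
  the separator is taken.\<close>

lemma cross_ev:
  assumes x: "1 \<le> x" "x \<le> n" "1 \<le> y" "y \<le> n" and s: "sg x = sg y" and D: "D x = -1" "D y \<noteq> -1"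
    and m: "0 \<le> m"
  shows "ev m x y \<longleftrightarrow> m \<le> D y"
proof -
  obtain p where p: "1 \<le> p" "p \<le> n" "ord p = x" using ord_surj x by blast
  obtain q where q: "1 \<le> q" "q \<le> n" "ord q = y" using ord_surj x by blast
  obtain s f l r where P: "parts s f l r" "s \<le> p" "p \<le> f" by (rule parts_at[of p]) (use p in auto)
  obtain s' f' l' r' where P': "parts s' f' l' r'" "s' \<le> q" "q \<le> f'" by (rule parts_at[of q]) (use q in auto)
  have "s = s'" using parts_D(1)[OF P] parts_D(1)[OF P'] \<open>sg x = sg y\<close> p q by simp
  then have "f = f'" using segment_unique[of c s f s' f' s] P(1) P'(1) partsD[OF P(1)] partsD[OF P'(1)] unfolding parts_def by auto
  have qs: "s \<le> q" "q \<le> f" using P' \<open>s = s'\<close> \<open>f = f'\<close> by auto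
  note d = partsD[OF P(1)]
  have pA: "l \<le> p" "p \<le> r" using parts_D(2)[OF P] D p by auto
  have "q < l \<or> r < q" using parts_D(2)[OF P(1) qs] D q by auto
  then show ?thesis
  proof
    assume ql: "q < l"
    have "ev m (ord q) (ord p) \<longleftrightarrow> (\<forall>z. q < z \<and> z \<le> p \<longrightarrow> m \<le> c z)"
      using ev_ord[of q p m] d qs pA ql m p q by auto
    also have "\<dots> \<longleftrightarrow> (\<forall>z. q < z \<and> z \<le> l \<longrightarrow> m \<le> c z)"
    proof (intro iffI allI impI)
      fix z assume h: "\<forall>z. q < z \<and> z \<le> l \<longrightarrow> m \<le> c z" and z: "q < z \<and> z \<le> p"
      show "m \<le> c z"
      proof (cases "z \<le> l")
        case False
        then show ?thesis using d(9)[of z] h[rule_format, of l] ql z pA by auto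
      qed (use h z in auto)
    qed (use pA in auto)
    also have "\<dots> \<longleftrightarrow> m \<le> D y" using parts_D(4)[OF P(1) qs ql] q by simp
    finally show ?thesis using ev_sym p q by blast
  next
    assume ql: "r < q"
    have "ev m (ord p) (ord q) \<longleftrightarrow> (\<forall>z. p < z \<and> z \<le> q \<longrightarrow> m \<le> c z)"
      using ev_ord[of p q m] d qs P pA ql m p q by auto
    also have "\<dots> \<longleftrightarrow> (\<forall>z. r < z \<and> z \<le> q \<longrightarrow> m \<le> c z)"
    proof (intro iffI allI impI)
      fix z assume h: "\<forall>z. r < z \<and> z \<le> q \<longrightarrow> m \<le> c z" and z: "p < z \<and> z \<le> q"
      show "m \<le> c z"
      proof (cases "r < z")
        case False
        then show ?thesis using d(9)[of z] h[rule_format, of "r + 1"] ql z pA by auto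
      qed (use h z in auto)
    qed (use pA in auto)
    also have "\<dots> \<longleftrightarrow> m \<le> D y" using parts_D(5)[OF P(1) qs ql] q by simp
    finally show ?thesis using p q by blast
  qed
qed

lemma D_range: "1 \<le> x \<Longrightarrow> x \<le> n \<Longrightarrow> D x = -1 \<or> 0 \<le> D x"
proof -
  assume x: "1 \<le> x" "x \<le> n"
  obtain p where p: "1 \<le> p" "p \<le> n" "ord p = x" using ord_surj x by blast
  obtain s f l r where P: "parts s f l r" "s \<le> p" "p \<le> f" by (rule parts_at[of p]) (use p in auto)
  show ?thesis using parts_D(2,3)[OF P] p by auto
qed

lemma sg_range: "1 \<le> x \<Longrightarrow> x \<le> n \<Longrightarrow> 1 \<le> sg x \<and> sg x \<le> n"
proof -
  assume x: "1 \<le> x" "x \<le> n"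
  obtain p where p: "1 \<le> p" "p \<le> n" "ord p = x" using ord_surj x by blast
  obtain s f l r where P: "parts s f l r" "s \<le> p" "p \<le> f" by (rule parts_at[of p]) (use p in auto)
  show ?thesis using parts_D(1)[OF P] p partsD[OF P(1)] by auto
qed

text \<open>Unless it is -1, \<open>D y\<close> is a match length with an actual element, here the
  first one of the separator, and hence cannot exceed the suffix at \<open>y\<close>. This keeps the
  key \<open>y + D y\<close> within the bucket array.\<close>

lemma D_bound: "1 \<le> y \<Longrightarrow> y \<le> n \<Longrightarrow> y + D y \<le> n + 1"
proof -
  assume y: "1 \<le> y" "y \<le> n"
  obtain q where q: "1 \<le> q" "q \<le> n" "ord q = y" using ord_surj y by blast
  obtain s f l r where P: "parts s f l r" "s \<le> q" "q \<le> f" by (rule parts_at[of q]) (use q in auto)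
  note d = partsD[OF P(1)]
  show ?thesis
  proof (cases "D y = -1")
    case False
    have lx: "s \<le> l" "l \<le> f" using d by auto
    have lr: "1 \<le> ord l" "ord l \<le> n" using ord_range[of l] d by auto
    have "sg (ord l) = sg y" "D (ord l) = -1" using parts_D(1)[OF P] parts_D(1,2)[OF P(1) lx] q d by auto
    then have "ev (D y) (ord l) y" using cross_ev[OF lr y, of "D y"] False D_range[OF y] by auto
    then show ?thesis using ev_bounds by blast
  qed (use y in auto)
qed

text \<open>A separator has at most two thirds of its segment and at least one third, so the rest
  has at most two thirds too. Stretches of one element are excluded, for they cannot shrink
  further.\<close>

lemma shrink:
  assumes size: "\<And>p q. 1 \<le> p \<Longrightarrow> p < q \<Longrightarrow> q \<le> n \<Longrightarrow> (\<And>r. p < r \<Longrightarrow> r \<le> q \<Longrightarrow> 0 \<le> c r) \<Longrightarrow>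
      (q - p + 1) * 3 ^ k \<le> 2 ^ k * n"
    and pq: "1 \<le> p" "p < q" "q \<le> n" and nn: "\<And>r. p < r \<Longrightarrow> r \<le> q \<Longrightarrow> 0 \<le> c' r"
  shows "(q - p + 1) * 3 ^ Suc k \<le> 2 ^ Suc k * n"
proof -
  obtain s f l r where P: "parts s f l r" "s \<le> p" "q \<le> f"
    and side: "q < s + (r - l + 1) \<or> s + (r - l + 1) \<le> p"
    by (rule new_stretch[of p q]) (use pq nn in auto)
  note d = partsD[OF P(1)]
  have sep: "f - s + 1 \<le> 3 * (r - l + 1)" "s < f \<longrightarrow> 3 * (r - l + 1) \<le> 2 * (f - s + 1)"
    using P(1) unfolding parts_def separator_def by auto
  have sf: "s < f" using P pq by auto
  have "(f - s + 1) * 3 ^ k \<le> 2 ^ k * n" using size[of s f] d sf by auto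
  moreover have "3 * (q - p + 1) \<le> 2 * (f - s + 1)" using side sep sf P by auto
  then have "3 * (q - p + 1) * 3 ^ k \<le> 2 * (f - s + 1) * 3 ^ k" by (intro mult_right_mono) auto
  ultimately show ?thesis by (simp add: algebra_simps)
qed

end

section \<open>Splitting all segments in linear time\<close>

text \<open>Arrays 1 to 4 hold \<open>ord\<close>, \<open>c\<close>, \<open>D\<close> and \<open>sg\<close>, and arrays 15 and 16 collect \<open>ord'\<close> and \<open>c'\<close>.
  A segment lies between registers 20 and 21, its separator between registers 22 and 23.\<close>

definition find_end :: prog where
  "find_end = seqs [Move 21 (Reg 20), Op 30 Add (Reg 21) (Const 1), Load 31 2 (Reg 30),
     While LessEq (Const 0) (Reg 31) (seqs [Move 21 (Reg 30), inc 30, Load 31 2 (Reg 30)])]"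

text \<open>The comparison of registers 24 and 22 finds out which side was being extended. This is
  the purpose of the conjuncts on \<open>l0\<close> in the last claims of
  \<open>growing_left\<close> and \<open>growing_right\<close>.\<close>

definition separator_choose :: prog where
  "separator_choose = (
     If LessEq (Reg 34) (Reg 26)
       (seqs [Op 35 Sub (Reg 25) (Reg 24), inc 35, Op 35 Mult (Reg 35) (Const 3),
         If LessEq (Reg 35) (Reg 28) (seqs [Move 22 (Reg 24), Move 23 (Reg 25), Move 26 (Reg 34)])
          (If Less (Reg 24) (Reg 22) (seqs [Op 23 Sub (Reg 22) (Const 1), Move 22 (Reg 24)])
            (seqs [Op 22 Add (Reg 23) (Const 1), Move 23 (Reg 25)])),
         Op 29 Sub (Reg 23) (Reg 22), inc 29, Op 29 Mult (Reg 29) (Const 3)])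
       Skip)"

definition separator_step :: prog where
  "separator_step = seqs [
     If LessEq (Reg 33) (Reg 32) (dec 24) (inc 25),
     Load 32 2 (Reg 24), Op 30 Add (Reg 25) (Const 1), Load 33 2 (Reg 30),
     Move 34 (Reg 32), If Less (Reg 34) (Reg 33) (Move 34 (Reg 33)) Skip, separator_choose]"

definition find_separator :: prog where
  "find_separator = seqs [
     Op 27 Sub (Reg 21) (Reg 20), inc 27, Op 28 Add (Reg 27) (Reg 27),
     Op 22 Add (Reg 20) (Reg 21), Op 22 Div (Reg 22) (Const 2),
     Move 23 (Reg 22), Move 24 (Reg 22), Move 25 (Reg 22),
     Load 32 2 (Reg 24), Op 30 Add (Reg 25) (Const 1), Load 33 2 (Reg 30),
     Move 26 (Reg 32), If Less (Reg 26) (Reg 33) (Move 26 (Reg 33)) Skip, Move 29 (Const 3),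
     While Less (Reg 29) (Reg 27) separator_step]"

definition move_block :: prog where
  "move_block = seqs [Move 30 (Reg 22), Move 31 (Reg 20),
     While LessEq (Reg 30) (Reg 23) (seqs [Load 32 1 (Reg 30), Load 33 2 (Reg 30),
       Store 15 (Reg 31) (Reg 32), Store 16 (Reg 31) (Reg 33), Store 3 (Reg 32) (Const (-1)),
       Store 4 (Reg 32) (Reg 20), inc 30, inc 31])]"

text \<open>Walking outwards, register 34 holds the minimum of the values met so far, which becomes
  \<open>D\<close>. The value at a place describes the match with its left neighbour; on this side
  it therefore enters the minimum only after \<open>D\<close> was stored, whereas
  \<open>move_right\<close> includes it before.\<close>

definition move_left :: prog where
  "move_left = seqs [Op 30 Sub (Reg 22) (Const 1), Move 31 (Reg 23), Load 34 2 (Reg 22),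
     While LessEq (Reg 20) (Reg 30) (seqs [Load 32 1 (Reg 30), Load 33 2 (Reg 30),
       Store 15 (Reg 31) (Reg 32), Store 16 (Reg 31) (Reg 33), Store 3 (Reg 32) (Reg 34),
       Store 4 (Reg 32) (Reg 20), If Less (Reg 33) (Reg 34) (Move 34 (Reg 33)) Skip, dec 30, dec 31])]"

definition move_right :: prog where
  "move_right = seqs [Op 30 Add (Reg 23) (Const 1), Load 34 2 (Reg 30),
     While LessEq (Reg 30) (Reg 21) (seqs [Load 32 1 (Reg 30), Load 33 2 (Reg 30),
       If Less (Reg 33) (Reg 34) (Move 34 (Reg 33)) Skip,
       Store 15 (Reg 30) (Reg 32), Store 16 (Reg 30) (Reg 33), Store 3 (Reg 32) (Reg 34),
       Store 4 (Reg 32) (Reg 20), inc 30])]"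

definition fix_borders :: prog where
  "fix_borders = seqs [Store 16 (Reg 20) (Const (-1)), Op 30 Add (Reg 23) (Const 1),
     If LessEq (Reg 30) (Reg 21) (seqs [Load 32 2 (Reg 22), Load 33 2 (Reg 30),
       If Less (Reg 32) (Reg 33) (Store 16 (Reg 30) (Reg 32)) Skip]) Skip]"

definition split_segment :: prog where
  "split_segment = seqs [find_end, find_separator, move_block, move_left, move_right, fix_borders]"

text \<open>Register 5 reports whether some segment still had two elements before this round. The
  new order is collected in arrays of its own, so that no entry is overwritten before it was
  moved.\<close>

definition split_all :: prog where
  "split_all = seqs [Move 20 (Const 1), Move 5 (Const 0),
     While LessEq (Reg 20) (Reg 0) (seqs [split_segment,
       If Less (Reg 20) (Reg 21) (Move 5 (Const 1)) Skip, Op 20 Add (Reg 21) (Const 1)]),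
     Move 20 (Const 1),
     While LessEq (Reg 20) (Reg 0) (seqs [Load 21 15 (Reg 20), Store 1 (Reg 20) (Reg 21),
       Load 21 16 (Reg 20), Store 2 (Reg 20) (Reg 21), inc 20])]"

text \<open>The state of a split in progress: the elements in \<open>{l..<i}\<close>, \<open>{j<..<l}\<close> and \<open>{r<..<k}\<close> have
  been moved, but the borders in \<open>c'\<close> are those of \<open>split_at\<close> only after a final correction.\<close>

definition filled :: "(int \<Rightarrow> int) \<Rightarrow> (int \<Rightarrow> int) \<Rightarrow> int \<Rightarrow> int \<Rightarrow> int \<Rightarrow> int \<Rightarrow> int \<Rightarrow> int \<Rightarrow> int \<Rightarrow>
    (int \<Rightarrow> int) \<Rightarrow> (int \<Rightarrow> int) \<Rightarrow> (int \<Rightarrow> int) \<Rightarrow> (int \<Rightarrow> int) \<Rightarrow> bool" where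
  "filled ord c s e l r i j k ord' c' D sg \<longleftrightarrow>
     (\<forall>q. l \<le> q \<and> q < i \<longrightarrow> ord' (q - l + s) = ord q \<and> c' (q - l + s) = c q \<and>
        D (ord q) = -1 \<and> sg (ord q) = s) \<and>
     (\<forall>p. j < p \<and> p < l \<longrightarrow> ord' (p + (r - l + 1)) = ord p \<and> c' (p + (r - l + 1)) = c p \<and>
        (\<forall>m. m \<le> D (ord p) \<longleftrightarrow> (\<forall>q. p < q \<and> q \<le> l \<longrightarrow> m \<le> c q)) \<and> sg (ord p) = s) \<and>
     (\<forall>p. r < p \<and> p < k \<longrightarrow> ord' p = ord p \<and> c' p = c p \<and>
        (\<forall>m. m \<le> D (ord p) \<longleftrightarrow> (\<forall>q. r < q \<and> q \<le> p \<longrightarrow> m \<le> c q)) \<and> sg (ord p) = s)"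

lemma filledI:
  assumes "\<And>q. l \<le> q \<Longrightarrow> q < i \<Longrightarrow> ord' (q - l + s) = ord q \<and> c' (q - l + s) = c q \<and> D (ord q) = -1 \<and> sg (ord q) = s"
    "\<And>p. j < p \<Longrightarrow> p < l \<Longrightarrow> ord' (p + (r - l + 1)) = ord p \<and> c' (p + (r - l + 1)) = c p \<and>
        (\<forall>m. m \<le> D (ord p) \<longleftrightarrow> (\<forall>q. p < q \<and> q \<le> l \<longrightarrow> m \<le> c q)) \<and> sg (ord p) = s"
    "\<And>p. r < p \<Longrightarrow> p < k \<Longrightarrow> ord' p = ord p \<and> c' p = c p \<and>
        (\<forall>m. m \<le> D (ord p) \<longleftrightarrow> (\<forall>q. r < q \<and> q \<le> p \<longrightarrow> m \<le> c q)) \<and> sg (ord p) = s"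
  shows "filled ord c s e l r i j k ord' c' D sg"
  unfolding filled_def
  apply (rule conjI[OF _ conjI]; intro allI impI; elim conjE)
  subgoal by (rule assms(1))
  subgoal by (rule assms(2))
  subgoal by (rule assms(3))
  done

lemma filledD:
  assumes "filled ord c s e l r i j k ord' c' D sg"
  shows "l \<le> q \<Longrightarrow> q < i \<Longrightarrow> ord' (q - l + s) = ord q \<and> c' (q - l + s) = c q \<and> D (ord q) = -1 \<and> sg (ord q) = s"
    "j < p \<Longrightarrow> p < l \<Longrightarrow> ord' (p + (r - l + 1)) = ord p \<and> c' (p + (r - l + 1)) = c p \<and>
        (\<forall>m. m \<le> D (ord p) \<longleftrightarrow> (\<forall>q. p < q \<and> q \<le> l \<longrightarrow> m \<le> c q)) \<and> sg (ord p) = s"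
    "r < p \<Longrightarrow> p < k \<Longrightarrow> ord' p = ord p \<and> c' p = c p \<and>
        (\<forall>m. m \<le> D (ord p) \<longleftrightarrow> (\<forall>q. r < q \<and> q \<le> p \<longrightarrow> m \<le> c q)) \<and> sg (ord p) = s"
proof -
  note f = assms[unfolded filled_def]
  show "l \<le> q \<Longrightarrow> q < i \<Longrightarrow> ord' (q - l + s) = ord q \<and> c' (q - l + s) = c q \<and> D (ord q) = -1 \<and> sg (ord q) = s"
    by (rule f[THEN conjunct1, THEN spec, THEN mp, OF conjI])
  show "j < p \<Longrightarrow> p < l \<Longrightarrow> ord' (p + (r - l + 1)) = ord p \<and> c' (p + (r - l + 1)) = c p \<and>
        (\<forall>m. m \<le> D (ord p) \<longleftrightarrow> (\<forall>q. p < q \<and> q \<le> l \<longrightarrow> m \<le> c q)) \<and> sg (ord p) = s"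
    by (rule f[THEN conjunct2, THEN conjunct1, THEN spec, THEN mp, OF conjI])
  show "r < p \<Longrightarrow> p < k \<Longrightarrow> ord' p = ord p \<and> c' p = c p \<and>
        (\<forall>m. m \<le> D (ord p) \<longleftrightarrow> (\<forall>q. r < q \<and> q \<le> p \<longrightarrow> m \<le> c q)) \<and> sg (ord p) = s"
    by (rule f[THEN conjunct2, THEN conjunct2, THEN spec, THEN mp, OF conjI])
qed

context
  fixes ord c :: "int \<Rightarrow> int" and s e l r :: int
  assumes b: "s \<le> l" "l \<le> r" "r \<le> e"
    and inj: "\<And>p q. s \<le> p \<Longrightarrow> p \<le> e \<Longrightarrow> s \<le> q \<Longrightarrow> q \<le> e \<Longrightarrow> ord p = ord q \<Longrightarrow> p = q"
begin

lemma filled_block: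
  assumes f: "filled ord c s e l r i (l - 1) (r + 1) ord' c' D sg" and i: "l \<le> i" "i \<le> r"
  shows "filled ord c s e l r (i + 1) (l - 1) (r + 1) (ord'(i - l + s := ord i)) (c'(i - l + s := c i))
     (D(ord i := -1)) (sg(ord i := s))"
proof (rule filledI)
  fix q assume q: "l \<le> q" "q < i + 1"
  show "(ord'(i - l + s := ord i)) (q - l + s) = ord q \<and> (c'(i - l + s := c i)) (q - l + s) = c q \<and>
      (D(ord i := -1)) (ord q) = -1 \<and> (sg(ord i := s)) (ord q) = s"
  proof (cases "q = i")
    case False
    then have "ord q \<noteq> ord i" using inj[of q i] q i b by auto
    then show ?thesis using filledD(1)[OF f, of q] q False by auto
  qed simp
qed auto

lemma filled_left:
  assumes f: "filled ord c s e l r (r + 1) j (r + 1) ord' c' D sg" and j: "s \<le> j" "j < l"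
    and v: "\<And>m. m \<le> v \<longleftrightarrow> (\<forall>q. j < q \<and> q \<le> l \<longrightarrow> m \<le> c q)"
  defines "y \<equiv> j + (r - l + 1)"
  shows "filled ord c s e l r (r + 1) (j - 1) (r + 1) (ord'(y := ord j)) (c'(y := c j))
     (D(ord j := v)) (sg(ord j := s))"
proof (rule filledI)
  fix q assume q: "l \<le> q" "q < r + 1"
  then have "ord q \<noteq> ord j" "q - l + s \<noteq> y" using inj[of q j] j b unfolding y_def by auto
  then show "(ord'(y := ord j)) (q - l + s) = ord q \<and> (c'(y := c j)) (q - l + s) = c q \<and>
      (D(ord j := v)) (ord q) = -1 \<and> (sg(ord j := s)) (ord q) = s"
    using filledD(1)[OF f, of q] q by auto
next
  fix p assume p: "j - 1 < p" "p < l"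
  show "(ord'(y := ord j)) (p + (r - l + 1)) = ord p \<and> (c'(y := c j)) (p + (r - l + 1)) = c p \<and>
     (\<forall>m. m \<le> (D(ord j := v)) (ord p) \<longleftrightarrow> (\<forall>q. p < q \<and> q \<le> l \<longrightarrow> m \<le> c q)) \<and> (sg(ord j := s)) (ord p) = s"
  proof (cases "p = j")
    case True
    then show ?thesis using v unfolding y_def by simp
  next
    case False
    then have "ord p \<noteq> ord j" "p + (r - l + 1) \<noteq> y" using inj[of p j] j b p unfolding y_def by auto
    then show ?thesis using filledD(2)[OF f, of p] p False by simp
  qed
qed auto

lemma filled_right:
  assumes f: "filled ord c s e l r (r + 1) (s - 1) k ord' c' D sg" and k: "r < k" "k \<le> e"
    and v: "\<And>m. m \<le> v \<longleftrightarrow> (\<forall>q. r < q \<and> q \<le> k \<longrightarrow> m \<le> c q)"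
  shows "filled ord c s e l r (r + 1) (s - 1) (k + 1) (ord'(k := ord k)) (c'(k := c k))
     (D(ord k := v)) (sg(ord k := s))"
proof (rule filledI)
  fix q assume q: "l \<le> q" "q < r + 1"
  then have "ord q \<noteq> ord k" "q - l + s \<noteq> k" using inj[of q k] k b by auto
  then show "(ord'(k := ord k)) (q - l + s) = ord q \<and> (c'(k := c k)) (q - l + s) = c q \<and>
      (D(ord k := v)) (ord q) = -1 \<and> (sg(ord k := s)) (ord q) = s"
    using filledD(1)[OF f, of q] q by auto
next
  fix p assume p: "s - 1 < p" "p < l"
  then have "ord p \<noteq> ord k" "p + (r - l + 1) \<noteq> k" using inj[of p k] k b by auto
  then show "(ord'(k := ord k)) (p + (r - l + 1)) = ord p \<and> (c'(k := c k)) (p + (r - l + 1)) = c p \<and>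
     (\<forall>m. m \<le> (D(ord k := v)) (ord p) \<longleftrightarrow> (\<forall>q. p < q \<and> q \<le> l \<longrightarrow> m \<le> c q)) \<and> (sg(ord k := s)) (ord p) = s"
    using filledD(2)[OF f, of p] p by simp
next
  fix p assume p: "r < p" "p < k + 1"
  show "(ord'(k := ord k)) p = ord p \<and> (c'(k := c k)) p = c p \<and>
     (\<forall>m. m \<le> (D(ord k := v)) (ord p) \<longleftrightarrow> (\<forall>q. r < q \<and> q \<le> p \<longrightarrow> m \<le> c q)) \<and> (sg(ord k := s)) (ord p) = s"
  proof (cases "p = k")
    case True
    then show ?thesis using v by simp
  next
    case False
    then have "ord p \<noteq> ord k" using inj[of p k] k b p by auto
    then show ?thesis using filledD(3)[OF f, of p] p False by simp
  qed
qed

text \<open>The moves copy all values; only the front of the separator and the place where its two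
  neighbours close up need other ones. If nothing lies to the right, the latter place is outside the
  segment and is kept.\<close>

lemma split_at_filled:
  assumes f: "filled ord c s e l r (r + 1) (s - 1) (e + 1) ord' c' D sg"
  shows "split_at ord c s e l r ord' ((c'(s := -1)) (r + 1 := (if r < e then min (c l) (c (r + 1)) else c' (r + 1)))) D sg"
  unfolding split_at_def
proof (intro conjI allI impI; elim conjE)
  fix q assume q: "l \<le> q" "q \<le> r"
  then have "q - l + s \<noteq> r + 1" "q - l + s = s \<longleftrightarrow> q = l" using b by auto
  then show "((c'(s := -1)) (r + 1 := (if r < e then min (c l) (c (r + 1)) else c' (r + 1)))) (q - l + s) = (if q = l then -1 else c q)"
    using filledD(1)[OF f, of q] q by simp
next
  fix p assume p: "s \<le> p" "p < l"
  then show "((c'(s := -1)) (r + 1 := (if r < e then min (c l) (c (r + 1)) else c' (r + 1)))) (p + (r - l + 1)) = c p"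
    using filledD(2)[OF f, of p] b by simp
next
  fix p assume p: "r < p" "p \<le> e"
  then show "((c'(s := -1)) (r + 1 := (if r < e then min (c l) (c (r + 1)) else c' (r + 1)))) p =
      (if p = r + 1 then min (c l) (c p) else c p)"
    using filledD(3)[OF f, of p] b by simp
qed (use filledD[OF f] in auto)

end

text \<open>Needed for the progress over the segments, where later splits touch other places and
  elements only, and for the final copy of the new order into arrays 1 and 2.\<close>

lemma split_at_cong:
  assumes "split_at ord c s e l r ord' c' D sg" "s \<le> l" "l \<le> r" "r \<le> e"
    and o: "\<And>q. s \<le> q \<Longrightarrow> q \<le> e \<Longrightarrow> ord'' q = ord' q \<and> c'' q = c' q"
    and d: "\<And>q. s \<le> q \<Longrightarrow> q \<le> e \<Longrightarrow> D' (ord q) = D (ord q) \<and> sg' (ord q) = sg (ord q)"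
  shows "split_at ord c s e l r ord'' c'' D' sg'"
proof -
  have A: "ord'' (q - l + s) = ord' (q - l + s) \<and> c'' (q - l + s) = c' (q - l + s) \<and> D' (ord q) = D (ord q) \<and> sg' (ord q) = sg (ord q)"
    if "l \<le> q \<and> q \<le> r" for q using o[of "q - l + s"] d[of q] that assms(2-4) by auto
  have B: "ord'' (p + (r - l + 1)) = ord' (p + (r - l + 1)) \<and> c'' (p + (r - l + 1)) = c' (p + (r - l + 1)) \<and>
      D' (ord p) = D (ord p) \<and> sg' (ord p) = sg (ord p)"
    if "s \<le> p \<and> p < l" for p using o[of "p + (r - l + 1)"] d[of p] that assms(2-4) by auto
  have C: "ord'' p = ord' p \<and> c'' p = c' p \<and> D' (ord p) = D (ord p) \<and> sg' (ord p) = sg (ord p)"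
    if "r < p \<and> p \<le> e" for p using o[of p] d[of p] that assms(2-4) by auto
  show ?thesis using assms(1) unfolding split_at_def by (simp add: A B C)
qed

section \<open>Finding the end of a segment and its separator\<close>

context ram begin

lemma wp_find_end:
  assumes c: "\<And>p. 1 \<le> p \<Longrightarrow> p \<le> n \<Longrightarrow> -1 \<le> arrays s 2 p" "arrays s 2 (n + 1) = -1" "arrays s 2 i = -1"
    and i: "regs s 20 = i" "1 \<le> i" "i \<le> n"
    and t: "4 * (n - i) + 6 \<le> t"
    and Q: "\<And>s' t'. same_outside {21,30,31} {} s s' \<Longrightarrow> segment n (arrays s 2) i (regs s' 21) \<Longrightarrow>
      t' \<ge> t - (4 * (regs s' 21 - i) + 4) \<Longrightarrow> Q s' t'"
  shows "wp w find_end Q s t"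
proof -
  let ?c = "arrays s 2"
  define I where "I = (\<lambda>s' t'. same_outside {21,30,31} {} s s' \<and> i \<le> regs s' 21 \<and> regs s' 21 \<le> n \<and>
     regs s' 30 = regs s' 21 + 1 \<and> regs s' 31 = ?c (regs s' 21 + 1) \<and>
     (\<forall>p. i < p \<and> p \<le> regs s' 21 \<longrightarrow> 0 \<le> ?c p) \<and> t' \<ge> t - (4 * (regs s' 21 - i) + 3))"
  have step: "wp w (seqs [Move 21 (Reg 30), inc 30, Load 31 2 (Reg 30)]) I s' (t' - 1)"
    if I: "I s' t'" and cc: "compare_val LessEq (operand_val w s' (Const 0)) (operand_val w s' (Reg 31))" for s' t'
  proof -
    let ?e = "regs s' 21"
    have fr: "same_outside {21,30,31} {} s s'" using I unfolding I_def by blast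
    have ar: "arrays s' 2 = ?c" using same_outside_arrays[OF fr] by auto
    have r: "i \<le> ?e" "?e \<le> n" "regs s' 30 = ?e + 1" "regs s' 31 = ?c (?e + 1)" using I unfolding I_def by auto
    have nn: "0 \<le> ?c (?e + 1)" using cc r by simp
    then have en: "?e + 1 \<le> n" using c(2) r by (cases "?e = n") auto
    have "wrap w (?e + 1 + 1) = ?e + 1 + 1" "wrap w (?e + 2) = ?e + 2"
      using X_linear r i by (auto intro!: wrap_id)
    moreover have "\<forall>p. i < p \<and> p \<le> ?e + 1 \<longrightarrow> 0 \<le> ?c p"
    proof (intro allI impI)
      fix p assume "i < p \<and> p \<le> ?e + 1"
      then show "0 \<le> ?c p" using I nn unfolding I_def by (cases "p = ?e + 1") auto
    qed
    moreover have "t' \<ge> t - (4 * (?e - i) + 3)" using I unfolding I_def by blast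
    ultimately show ?thesis using fr r nn en ar unfolding I_def by (simp add: wp_simps)
  qed
  have fin: "Q s' (t' - 1)"
    if I: "I s' t'" and cc: "\<not> compare_val LessEq (operand_val w s' (Const 0)) (operand_val w s' (Reg 31))" for s' t'
  proof -
    let ?e = "regs s' 21"
    have fr: "same_outside {21,30,31} {} s s'" using I unfolding I_def by blast
    have r: "i \<le> ?e" "?e \<le> n" "regs s' 31 = ?c (?e + 1)" using I unfolding I_def by auto
    have "?c (?e + 1) < 0" using cc r by simp
    then have "?c (?e + 1) = -1" using c(1)[of "?e + 1"] c(2) r i by (cases "?e = n") auto
    then show ?thesis using I fr c i unfolding I_def segment_def by (intro Q) (auto simp: segment_def)
  qed
  have ws: "wrap w (i + 1) = i + 1" using X_linear i by (intro wrap_id) auto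
  have I0: "I (set_reg 31 (?c (i + 1)) (set_reg 30 (i + 1) (set_reg 21 i s))) (t - 3)"
    unfolding I_def using i by (simp add: wp_simps)
  have pos: "0 \<le> t'" if "I s' t'" for s' t' using that t i unfolding I_def by auto
  have "wp w (While LessEq (Const 0) (Reg 31) (seqs [Move 21 (Reg 30), inc 30, Load 31 2 (Reg 30)])) Q
     (set_reg 31 (?c (i + 1)) (set_reg 30 (i + 1) (set_reg 21 i s))) (t - 3)"
    by (rule wp_While[where I=I]) (use I0 pos step fin in blast)+
  then show ?thesis unfolding find_end_def using i ws by (simp add: wp_Seq wp_Move wp_Op wp_Load regs_set_reg arrays_set_reg)
qed

text \<open>Each pass widens the block by one place, so there are at most \<open>f - i\<close>
  passes. Sizes are tripled and compared with \<open>N\<close> and \<open>2 * N\<close> to avoid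
  fractions. An extension that is chosen as the separator has at least a third, which ends the
  loop.\<close>

lemma wp_find_separator:
  assumes seg: "segment n (arrays s 2) i f" and rg: "regs s 20 = i" "regs s 21 = f"
    and t: "30 * (f - i) + 30 \<le> t"
    and Q: "\<And>s' t'. same_outside ({22..30} \<union> {32..35}) {} s s' \<Longrightarrow>
      separator (arrays s 2) i f (regs s' 22) (regs s' 23) \<Longrightarrow> t' \<ge> t - (30 * (f - i) + 30) \<Longrightarrow> Q s' t'"
  shows "wp w find_separator Q s t"
proof -
  let ?c = "arrays s 2" and ?fr = "same_outside ({22..30} \<union> {32..35}) {} s"
  have sg: "1 \<le> i" "i \<le> f" "f \<le> n" using seg unfolding segment_def by auto
  define N where "N = f - i + 1"
  have N: "1 \<le> N" "N \<le> n" using sg unfolding N_def by auto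
  define I where "I = (\<lambda>s' t'. ?fr s' \<and> regs s' 27 = N \<and> regs s' 28 = 2 * N \<and>
    regs s' 29 = 3 * (regs s' 23 - regs s' 22 + 1) \<and>
    (separator ?c i f (regs s' 22) (regs s' 23) \<and> N \<le> regs s' 29 \<or>
     growing ?c i f (regs s' 22) (regs s' 23) (regs s' 24) (regs s' 25) (regs s' 26) \<and>
     regs s' 32 = ?c (regs s' 24) \<and> regs s' 33 = ?c (regs s' 25 + 1)) \<and>
    i \<le> regs s' 24 \<and> regs s' 24 \<le> regs s' 25 \<and> regs s' 25 \<le> f \<and>
    t' \<ge> t - 16 - 30 * (regs s' 25 - regs s' 24))"
  have step: "wp w separator_step I s1 (t1 - 1)"
    if I: "I s1 t1" and cc: "compare_val Less (operand_val w s1 (Reg 29)) (operand_val w s1 (Reg 27))" for s1 t1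
  proof -
    let ?lo = "regs s1 22" and ?ro = "regs s1 23" and ?l = "regs s1 24" and ?r = "regs s1 25" and ?m = "regs s1 26"
    have fr: "?fr s1" and r: "regs s1 27 = N" "regs s1 28 = 2 * N" "regs s1 29 = 3 * (?ro - ?lo + 1)"
      using I unfolding I_def by auto
    have small: "3 * (?ro - ?lo + 1) < N" using cc r by simp
    have g: "growing ?c i f ?lo ?ro ?l ?r ?m" and r2: "regs s1 32 = ?c ?l" "regs s1 33 = ?c (?r + 1)"
      and t1: "t1 \<ge> t - 16 - 30 * (?r - ?l)"
      using I small r unfolding I_def by auto
    have ar: "arrays s1 = arrays s" using same_outside_arrays[OF fr] by auto
    have gb: "i \<le> ?l" "?l \<le> ?lo" "?lo \<le> ?ro" "?ro \<le> ?r" "?r \<le> f" using g unfolding growing_def by auto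
    have wd: "wrap w (a - b) = a - b" "wrap w (a - b + 1) = a - b + 1" "wrap w (3 * (a - b + 1)) = 3 * (a - b + 1)"
       "wrap w (a - 1) = a - 1" "wrap w (a + 1) = a + 1"
      if "0 \<le> a" "a \<le> n" "0 \<le> b" "b \<le> n" for a b
      using X_linear that n_pos by (auto intro!: wrap_id)
    have wd3: "wrap w ((a - b + 1) * 3) = 3 * (a - b + 1)" if "0 \<le> a" "a \<le> n" "0 \<le> b" "b \<le> n" for a b
      using wd(3)[OF that] by (simp only: mult.commute)
    \<comment> \<open>Common to both directions: \<open>G1\<close> to \<open>G3\<close> are the
      three outcomes that \<open>growing_left\<close> and \<open>growing_right\<close> provide for
      the widened block.\<close>
    have choose: "wp w separator_choose I s2 t2"
      if fr2: "?fr s2" and q: "regs s2 22 = ?lo" "regs s2 23 = ?ro" "regs s2 24 = l2" "regs s2 25 = r2" "regs s2 26 = ?m"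
         "regs s2 27 = N" "regs s2 28 = 2 * N" "regs s2 29 = 3 * (?ro - ?lo + 1)"
         "regs s2 32 = ?c l2" "regs s2 33 = ?c (r2 + 1)" "regs s2 34 = m'"
      and b2: "i \<le> l2" "l2 \<le> ?lo" "?ro \<le> r2" "r2 \<le> f"
      and G1: "?m < m' \<Longrightarrow> growing ?c i f ?lo ?ro l2 r2 ?m"
      and G2: "m' \<le> ?m \<Longrightarrow> 3 * (r2 - l2 + 1) \<le> 2 * N \<Longrightarrow> growing ?c i f l2 r2 l2 r2 m'"
      and G3: "m' \<le> ?m \<Longrightarrow> 2 * N < 3 * (r2 - l2 + 1) \<Longrightarrow>
         (if l2 < ?lo then separator ?c i f l2 (?lo - 1) else separator ?c i f (?ro + 1) r2)"
      and t2: "t2 \<ge> t - 16 - 30 * (r2 - l2) + 14"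
      for s2 t2 l2 r2 m'
    proof (cases "m' \<le> ?m")
      case False
      then show ?thesis using G1 fr2 q b2 gb t2 unfolding separator_choose_def I_def
        by (simp add: wp_simps)
    next
      case le: True
      have rng: "0 \<le> r2" "r2 \<le> n" "0 \<le> l2" "l2 \<le> n" "0 \<le> ?lo" "?lo \<le> n" "0 \<le> ?ro" "?ro \<le> n"
        using b2 gb sg by auto
      show ?thesis
      proof (cases "3 * (r2 - l2 + 1) \<le> 2 * N")
        case True
        then show ?thesis using le G2 fr2 q b2 gb t2 wd[of r2 l2] wd3[of r2 l2] rng unfolding separator_choose_def I_def
          by (simp add: wp_simps)
      next
        case big: False
        show ?thesis
        proof (cases "l2 < ?lo")
          case True
          then have sp: "separator ?c i f l2 (?lo - 1)" using G3 le big by simp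
          then have "N \<le> 3 * (?lo - 1 - l2 + 1)" unfolding separator_def N_def by auto
          then show ?thesis using sp True le big fr2 q b2 gb t2 rng wd[of r2 l2] wd3[of r2 l2] wd[of "?lo - 1" l2] wd3[of "?lo - 1" l2]
              wd[of ?lo ?lo] sg unfolding separator_choose_def I_def
            by (simp add: wp_simps)
        next
          case False
          then have sp: "separator ?c i f (?ro + 1) r2" using G3 le big by simp
          then have "N \<le> 3 * (r2 - (?ro + 1) + 1)" "?ro + 1 \<le> r2" unfolding separator_def N_def by auto
          then show ?thesis using sp False le big fr2 q b2 gb t2 rng wd[of r2 l2] wd3[of r2 l2] wd[of r2 "?ro + 1"] wd3[of r2 "?ro + 1"]
              wd[of ?ro ?ro] sg unfolding separator_choose_def I_def
            by (simp add: wp_simps)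
        qed
      qed
    qed
    show ?thesis
    proof (cases "?c (?r + 1) \<le> ?c ?l")
      case True
      define l' where "l' = ?l - 1"
      define m' where "m' = max (?c l') (?c (?r + 1))"
      note L = growing_left[OF seg g _ True, folded N_def, OF small, folded l'_def, folded m'_def]
      have b2: "i \<le> l'" "l' \<le> ?lo" using L(1) gb unfolding l'_def by auto
      have t2: "t1 - 10 \<ge> t - 16 - 30 * (?r - l') + 14" using t1 unfolding l'_def by simp
      have ws: "wrap w (?l - 1) = l'" "wrap w (?r + 1) = ?r + 1"
        using wd(4)[of ?l ?l] wd(5)[of ?r ?r] gb sg unfolding l'_def by auto
      have G3: "m' \<le> ?m \<Longrightarrow> 2 * N < 3 * (?r - l' + 1) \<Longrightarrow>
         (if l' < ?lo then separator ?c i f l' (?lo - 1) else separator ?c i f (?ro + 1) ?r)" using L(4) by simp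
      have go: "wp w separator_choose I s2 t2"
        if "?fr s2" "\<forall>k\<in>{22,23,25,26,27,28,29}. regs s2 k = regs s1 k" "regs s2 24 = l'"
          "regs s2 32 = ?c l'" "regs s2 33 = ?c (?r + 1)" "regs s2 34 = m'" "t2 \<ge> t1 - 10" for s2 t2
        by (rule choose[of s2 l' ?r m']) (use that r b2 gb L(2,3) G3 t2 in auto)
      define u where "u = set_reg 34 (?c l') (set_reg 33 (?c (?r + 1)) (set_reg 30 (?r + 1) (set_reg 32 (?c l') (set_reg 24 l' s1))))"
      have u1: "wp w separator_choose I u (t1 - 9)" if "\<not> ?c l' < ?c (?r + 1)"
        by (rule go) (use fr that in \<open>auto simp: u_def m'_def wp_simps\<close>)
      have u2: "wp w separator_choose I (set_reg 34 (?c (?r + 1)) u) (t1 - 9)" if "?c l' < ?c (?r + 1)"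
        by (rule go) (use fr that in \<open>auto simp: u_def m'_def wp_simps\<close>)
      show ?thesis using True r2 ar u1 u2 unfolding separator_step_def u_def
        by (simp add: wp_Seq wp_Move wp_Op wp_Load wp_If wp_Skip regs_set_reg arrays_set_reg ws)
    next
      case right: False
      then have side: "?c ?l < ?c (?r + 1)" by simp
      define r' where "r' = ?r + 1"
      define m' where "m' = max (?c ?l) (?c (r' + 1))"
      note L = growing_right[OF seg g _ side, folded N_def, OF small, folded r'_def, folded m'_def]
      have b2: "r' \<le> f" "?ro \<le> r'" using L(1) gb unfolding r'_def by auto
      have t2: "t1 - 10 \<ge> t - 16 - 30 * (r' - ?l) + 14" using t1 unfolding r'_def by simp
      have ws: "wrap w (?r + 1) = r'" "wrap w (r' + 1) = r' + 1"
        using wd(5)[of ?r ?r] wd(5)[of r' r'] gb sg b2 unfolding r'_def by auto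
      have G3: "m' \<le> ?m \<Longrightarrow> 2 * N < 3 * (r' - ?l + 1) \<Longrightarrow>
         (if ?l < ?lo then separator ?c i f ?l (?lo - 1) else separator ?c i f (?ro + 1) r')" using L(4) by simp
      have go: "wp w separator_choose I s2 t2"
        if "?fr s2" "\<forall>k\<in>{22,23,24,26,27,28,29}. regs s2 k = regs s1 k" "regs s2 25 = r'"
          "regs s2 32 = ?c ?l" "regs s2 33 = ?c (r' + 1)" "regs s2 34 = m'" "t2 \<ge> t1 - 10" for s2 t2
        by (rule choose[of s2 ?l r' m']) (use that r b2 gb L(2,3) G3 t2 in auto)
      define u where "u = set_reg 34 (?c ?l) (set_reg 33 (?c (r' + 1)) (set_reg 30 (r' + 1) (set_reg 32 (?c ?l) (set_reg 25 r' s1))))"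
      have u1: "wp w separator_choose I u (t1 - 9)" if "\<not> ?c ?l < ?c (r' + 1)"
        by (rule go) (use fr that in \<open>auto simp: u_def m'_def wp_simps\<close>)
      have u2: "wp w separator_choose I (set_reg 34 (?c (r' + 1)) u) (t1 - 9)" if "?c ?l < ?c (r' + 1)"
        by (rule go) (use fr that in \<open>auto simp: u_def m'_def wp_simps\<close>)
      show ?thesis using right r2 ar u1 u2 unfolding separator_step_def u_def
        by (simp add: wp_Seq wp_Move wp_Op wp_Load wp_If wp_Skip regs_set_reg arrays_set_reg ws)
    qed
  qed
  have fin: "Q s' (t' - 1)"
    if I: "I s' t'" and cc: "\<not> compare_val Less (operand_val w s' (Reg 29)) (operand_val w s' (Reg 27))" for s' t'
  proof -
    have "regs s' 27 = N" "regs s' 29 = 3 * (regs s' 23 - regs s' 22 + 1)" using I unfolding I_def by auto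
    then have "separator ?c i f (regs s' 22) (regs s' 23)"
      using I cc growing_end[of ?c i f] unfolding I_def N_def by fastforce
    then show ?thesis using I unfolding I_def by (intro Q) auto
  qed
  have pos: "0 \<le> t'" if "I s' t'" for s' t' using that t sg unfolding I_def by auto
  define a where "a = (i + f) div 2"
  have ab: "i \<le> a" "a \<le> f" using sg unfolding a_def by auto
  have "wrap w (f - i) = f - i" "wrap w (i + f) = i + f" "wrap w a = a" "wrap w (a + 1) = a + 1"
    "wrap w N = N" "wrap w (2 * N) = 2 * N"
    using X_linear sg ab N by (auto intro!: wrap_id)
  then have ws: "wrap w (f - i) = f - i" "wrap w (f - i + 1) = N" "wrap w (N + N) = 2 * N" "wrap w (i + f) = i + f"
    "wrap w ((i + f) div 2) = a" "wrap w (a + 1) = a + 1" "wrap w (2 * N) = 2 * N"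
    unfolding a_def[symmetric] N_def[symmetric] mult_2[symmetric] by simp_all
  define s1 where "s1 = set_reg 33 (?c (a + 1)) (set_reg 30 (a + 1) (set_reg 32 (?c a)
    (set_reg 25 a (set_reg 24 a (set_reg 23 a (set_reg 22 a (set_reg 22 (i + f) (set_reg 28 (2 * N)
      (set_reg 27 N (set_reg 27 (f - i) s))))))))))"
  have gi: "growing ?c i f a a a a (max (?c a) (?c (a + 1)))" using growing_init[OF seg] unfolding a_def .
  have loop: "wp w (While Less (Reg 29) (Reg 27) separator_step) Q
     (set_reg 29 3 (set_reg 26 (max (?c a) (?c (a + 1))) s')) t'"
    if "s' = s1 \<or> (\<exists>v. s' = set_reg 26 v s1)" "t' \<ge> t - 16" for s' t'
  proof (rule wp_While[where I=I])
    show "I (set_reg 29 3 (set_reg 26 (max (?c a) (?c (a + 1))) s')) t'"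
      using gi ab that unfolding I_def s1_def by (auto simp: wp_simps)
  qed (use pos step fin in blast)+
  have l1: "?c a < ?c (a + 1) \<Longrightarrow> wp w (While Less (Reg 29) (Reg 27) separator_step) Q
     (set_reg 29 3 (set_reg 26 (?c (a + 1)) (set_reg 26 (?c a) s1))) (t - 15)"
    using loop[of "set_reg 26 (?c a) s1" "t - 15"] by (auto simp: max_def)
  have l2: "\<not> ?c a < ?c (a + 1) \<Longrightarrow> wp w (While Less (Reg 29) (Reg 27) separator_step) Q
     (set_reg 29 3 (set_reg 26 (?c a) s1)) (t - 15)"
    using loop[of s1 "t - 15"] by (auto simp: max_def)
  show ?thesis unfolding find_separator_def
    using rg l1 l2 unfolding s1_def
    by (simp add: wp_Seq wp_Move wp_Op wp_Load wp_If wp_Skip regs_set_reg arrays_set_reg ws)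
qed

end

text \<open>What a split does not disturb, so that the results for other segments remain valid.
  Arrays 15 and 16 are addressed by place, arrays 3 and 4 by element, hence the image under
  \<open>ord\<close>.\<close>

definition untouched :: "(int \<Rightarrow> int) \<Rightarrow> int \<Rightarrow> int \<Rightarrow> state \<Rightarrow> state \<Rightarrow> bool" where
  "untouched ord i f s s' \<longleftrightarrow>
     (\<forall>x. x < i \<or> f < x \<longrightarrow> arrays s' 15 x = arrays s 15 x \<and> arrays s' 16 x = arrays s 16 x) \<and>
     (\<forall>x. x \<notin> ord ` {i..f} \<longrightarrow> arrays s' 3 x = arrays s 3 x \<and> arrays s' 4 x = arrays s 4 x)"

lemma untouched_refl: "untouched ord i f s s"
  unfolding untouched_def by simp

lemma untouched_trans: "untouched ord i f s s' \<Longrightarrow> untouched ord i f s' s'' \<Longrightarrow> untouched ord i f s s''"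
  unfolding untouched_def by simp

lemma untouched_set_reg: "untouched ord i f s s' \<Longrightarrow> untouched ord i f s (set_reg r x s')"
  unfolding untouched_def by (simp add: arrays_set_reg)

lemma untouched_set_pos:
  "untouched ord i f s s' \<Longrightarrow> m = 15 \<or> m = 16 \<Longrightarrow> i \<le> y \<Longrightarrow> y \<le> f \<Longrightarrow> untouched ord i f s (set_cell m y v s')"
  unfolding untouched_def by (auto simp: arrays_set_cell)

lemma untouched_set_elem:
  "untouched ord i f s s' \<Longrightarrow> m = 3 \<or> m = 4 \<Longrightarrow> i \<le> q \<Longrightarrow> q \<le> f \<Longrightarrow> untouched ord i f s (set_cell m (ord q) v s')"
  unfolding untouched_def by (auto simp: arrays_set_cell)

section \<open>Moving the pieces of one segment\<close>

context ram begin

context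
  fixes ord c :: "int \<Rightarrow> int" and i f l r :: int
  assumes b: "1 \<le> i" "i \<le> l" "l \<le> r" "r \<le> f" "f \<le> n"
    and inj: "\<And>p q. i \<le> p \<Longrightarrow> p \<le> f \<Longrightarrow> i \<le> q \<Longrightarrow> q \<le> f \<Longrightarrow> ord p = ord q \<Longrightarrow> p = q"
begin

abbreviation "filled_in h j k s \<equiv> filled ord c i f l r h j k (arrays s 15) (arrays s 16) (arrays s 3) (arrays s 4)"

lemma wp_move_block:
  assumes ar: "arrays s 1 = ord" "arrays s 2 = c" and rg: "regs s 20 = i" "regs s 22 = l" "regs s 23 = r"
    and t: "9 * (r - l + 1) + 4 \<le> t"
    and Q: "\<And>s' t'. same_outside {30..33} {3,4,15,16} s s' \<Longrightarrow> untouched ord i f s s' \<Longrightarrow>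
      filled_in (r + 1) (l - 1) (r + 1) s' \<Longrightarrow> t' \<ge> t - (9 * (r - l + 1) + 4) \<Longrightarrow> Q s' t'"
  shows "wp w move_block Q s t"
proof -
  let ?fr = "same_outside {30..33} {3,4,15,16} s"
  define I where "I = (\<lambda>s' t'. ?fr s' \<and> untouched ord i f s s' \<and> l \<le> regs s' 30 \<and> regs s' 30 \<le> r + 1 \<and>
     regs s' 31 = regs s' 30 - l + i \<and> filled_in (regs s' 30) (l - 1) (r + 1) s' \<and>
     t' \<ge> t - 2 - 9 * (regs s' 30 - l))"
  let ?body = "seqs [Load 32 1 (Reg 30), Load 33 2 (Reg 30),
       Store 15 (Reg 31) (Reg 32), Store 16 (Reg 31) (Reg 33), Store 3 (Reg 32) (Const (-1)),
       Store 4 (Reg 32) (Reg 20), inc 30, inc 31]"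
  have step: "wp w ?body I s' (t' - 1)"
    if I: "I s' t'" and cc: "compare_val LessEq (operand_val w s' (Reg 30)) (operand_val w s' (Reg 23))" for s' t'
  proof -
    have fr: "?fr s'" using I unfolding I_def by blast
    have a: "arrays s' 1 = ord" "arrays s' 2 = c" and rs: "regs s' 20 = i" "regs s' 23 = r"
      using same_outside_arrays[OF fr] same_outside_regs[OF fr] ar rg by auto
    define q where "q = regs s' 30"
    have q: "l \<le> q" "q \<le> r" "regs s' 31 = q - l + i" and u: "untouched ord i f s s'"
      and fl: "filled_in q (l - 1) (r + 1) s'" and t': "t' \<ge> t - 2 - 9 * (q - l)"
      using I cc rs unfolding I_def q_def by auto
    have ws: "wrap w (q + 1) = q + 1" "wrap w (q - l + i + 1) = q - l + i + 1"
      using X_linear q b by (auto intro!: wrap_id)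
    have F: "filled ord c i f l r (q + 1) (l - 1) (r + 1) ((arrays s' 15)(q - l + i := ord q))
        ((arrays s' 16)(q - l + i := c q)) ((arrays s' 3)(ord q := -1)) ((arrays s' 4)(ord q := i))"
      by (rule filled_block[OF b(2,3,4) _ fl q(1,2)]) (rule inj)
    let ?y = "q - l + i"
    define s2 where "s2 = set_reg 31 (?y + 1) (set_reg 30 (q + 1) (set_cell 4 (ord q) i (set_cell 3 (ord q) (-1)
      (set_cell 16 ?y (c q) (set_cell 15 ?y (ord q) (set_reg 33 (c q) (set_reg 32 (ord q) s')))))))"
    have fr2: "?fr s2" using fr by (simp add: s2_def wp_simps)
    have u2: "untouched ord i f s s2" unfolding s2_def
      by (intro untouched_set_reg untouched_set_elem untouched_set_pos u) (use q b in auto)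
    have "arrays s2 15 = (arrays s' 15)(?y := ord q)" "arrays s2 16 = (arrays s' 16)(?y := c q)"
      "arrays s2 3 = (arrays s' 3)(ord q := -1)" "arrays s2 4 = (arrays s' 4)(ord q := i)"
      by (simp_all add: s2_def arrays_set_cell arrays_set_reg)
    then have F2: "filled_in (q + 1) (l - 1) (r + 1) s2" using F by (simp only:)
    have r2: "regs s2 30 = q + 1" "regs s2 31 = q + 1 - l + i" by (simp_all add: s2_def wp_simps)
    have "I s2 (t' - 9)" unfolding I_def r2 using fr2 u2 F2 q t' by simp
    then show ?thesis using q rs a ws unfolding s2_def
      by (simp add: wp_Seq wp_Op wp_Load wp_Store regs_set_reg regs_set_cell arrays_set_reg arrays_set_cell q_def[symmetric])
  qed
  have pos: "0 \<le> t'" if "I s' t'" for s' t' using that t b unfolding I_def by auto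
  have fin: "Q s' (t' - 1)"
    if I: "I s' t'" and cc: "\<not> compare_val LessEq (operand_val w s' (Reg 30)) (operand_val w s' (Reg 23))" for s' t'
  proof -
    have fr: "?fr s'" using I unfolding I_def by blast
    have "regs s' 30 = r + 1" using I cc same_outside_regs[OF fr, of 23] rg unfolding I_def by auto
    then show ?thesis using I unfolding I_def by (intro Q) auto
  qed
  have I0: "I (set_reg 31 i (set_reg 30 l s)) (t - 2)"
    unfolding I_def using b by (auto simp: wp_simps untouched_set_reg untouched_refl intro!: filledI)
  have "wp w (While LessEq (Reg 30) (Reg 23) ?body) Q (set_reg 31 i (set_reg 30 l s)) (t - 2)"
    by (rule wp_While[where I=I]) (use I0 pos step fin in blast)+
  then show ?thesis unfolding move_block_def using rg by (simp add: wp_Seq wp_Move regs_set_reg)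
qed

lemma wp_move_left:
  assumes ar: "arrays s 1 = ord" "arrays s 2 = c" and rg: "regs s 20 = i" "regs s 22 = l" "regs s 23 = r"
    and fl0: "filled_in (r + 1) (l - 1) (r + 1) s"
    and t: "11 * (l - i) + 5 \<le> t"
    and Q: "\<And>s' t'. same_outside {30..34} {3,4,15,16} s s' \<Longrightarrow> untouched ord i f s s' \<Longrightarrow>
      filled_in (r + 1) (i - 1) (r + 1) s' \<Longrightarrow> t' \<ge> t - (11 * (l - i) + 5) \<Longrightarrow> Q s' t'"
  shows "wp w move_left Q s t"
proof -
  let ?fr = "same_outside {30..34} {3,4,15,16} s"
  define I where "I = (\<lambda>s' t'. ?fr s' \<and> untouched ord i f s s' \<and> i - 1 \<le> regs s' 30 \<and> regs s' 30 \<le> l - 1 \<and>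
     regs s' 31 = regs s' 30 + (r - l + 1) \<and> filled_in (r + 1) (regs s' 30) (r + 1) s' \<and>
     (\<forall>m. m \<le> regs s' 34 \<longleftrightarrow> (\<forall>q. regs s' 30 < q \<and> q \<le> l \<longrightarrow> m \<le> c q)) \<and>
     t' \<ge> t - 3 - 11 * (l - 1 - regs s' 30))"
  let ?body = "seqs [Load 32 1 (Reg 30), Load 33 2 (Reg 30),
       Store 15 (Reg 31) (Reg 32), Store 16 (Reg 31) (Reg 33), Store 3 (Reg 32) (Reg 34),
       Store 4 (Reg 32) (Reg 20), If Less (Reg 33) (Reg 34) (Move 34 (Reg 33)) Skip, dec 30, dec 31]"
  have step: "wp w ?body I s' (t' - 1)"
    if I: "I s' t'" and cc: "compare_val LessEq (operand_val w s' (Reg 20)) (operand_val w s' (Reg 30))" for s' t'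
  proof -
    have fr: "?fr s'" using I unfolding I_def by blast
    have a: "arrays s' 1 = ord" "arrays s' 2 = c" and rs: "regs s' 20 = i"
      using same_outside_arrays[OF fr] same_outside_regs[OF fr] ar rg by auto
    define j where "j = regs s' 30"
    define v where "v = regs s' 34"
    have j: "i \<le> j" "j < l" "regs s' 31 = j + (r - l + 1)" and u: "untouched ord i f s s'"
      and fl: "filled_in (r + 1) j (r + 1) s'" and t': "t' \<ge> t - 3 - 11 * (l - 1 - j)"
      and v: "\<forall>m. m \<le> v \<longleftrightarrow> (\<forall>q. j < q \<and> q \<le> l \<longrightarrow> m \<le> c q)"
      using I cc rs unfolding I_def j_def v_def by auto
    have ws: "wrap w (j - 1) = j - 1" "wrap w (j + (r - l + 1) - 1) = j - 1 + (r - l + 1)"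
       "wrap w (j + (r - l)) = j - 1 + (r - l + 1)"
      using X_linear j b by (auto intro!: wrap_id)
    have F: "filled ord c i f l r (r + 1) (j - 1) (r + 1) ((arrays s' 15)(j + (r - l + 1) := ord j))
        ((arrays s' 16)(j + (r - l + 1) := c j)) ((arrays s' 3)(ord j := v)) ((arrays s' 4)(ord j := i))"
      by (rule filled_left[OF b(2,3,4) _ fl j(1,2) v[rule_format]]) (rule inj)
    have vn: "m \<le> min (c j) v \<longleftrightarrow> (\<forall>q. j - 1 < q \<and> q \<le> l \<longrightarrow> m \<le> c q)" for m
    proof -
      have "m \<le> min (c j) v \<longleftrightarrow> m \<le> c j \<and> (\<forall>q. j < q \<and> q \<le> l \<longrightarrow> m \<le> c q)" using v by auto
      also have "\<dots> \<longleftrightarrow> (\<forall>q. j - 1 < q \<and> q \<le> l \<longrightarrow> m \<le> c q)"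
      proof (intro iffI allI impI)
        fix q assume h: "m \<le> c j \<and> (\<forall>q. j < q \<and> q \<le> l \<longrightarrow> m \<le> c q)" and "j - 1 < q \<and> q \<le> l"
        then show "m \<le> c q" by (cases "q = j") auto
      qed (use j in auto)
      finally show ?thesis .
    qed
    let ?y = "j + (r - l + 1)"
    define s1 where "s1 = set_cell 4 (ord j) i (set_cell 3 (ord j) v
      (set_cell 16 ?y (c j) (set_cell 15 ?y (ord j) (set_reg 33 (c j) (set_reg 32 (ord j) s')))))"
    have fr1: "?fr s1" using fr by (simp add: s1_def wp_simps)
    have u1: "untouched ord i f s s1" unfolding s1_def
      by (intro untouched_set_reg untouched_set_elem untouched_set_pos u) (use j b in auto)
    have F1: "filled_in (r + 1) (j - 1) (r + 1) s1"
      using F by (simp add: s1_def wp_simps del: fun_upd_apply)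
    have go: "I (set_reg 31 (j - 1 + (r - l + 1)) (set_reg 30 (j - 1) s2)) (t' - 11)"
      "I (set_reg 31 (j - 1 + (r - l + 1)) (set_reg 30 (j - 1) s2)) (t' - 10)"
      if "s2 = s1 \<and> \<not> c j < v \<or> s2 = set_reg 34 (c j) s1 \<and> c j < v" for s2
    proof -
      have x: "?fr s2" "untouched ord i f s s2" "filled_in (r + 1) (j - 1) (r + 1) s2"
        using that fr1 u1 F1 by (auto simp: wp_simps untouched_set_reg)
      have "regs s2 34 = min (c j) v" using that by (auto simp: s1_def v_def wp_simps)
      then show "I (set_reg 31 (j - 1 + (r - l + 1)) (set_reg 30 (j - 1) s2)) (t' - 11)"
        "I (set_reg 31 (j - 1 + (r - l + 1)) (set_reg 30 (j - 1) s2)) (t' - 10)"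
        unfolding I_def using x j t' vn by (simp_all add: wp_simps untouched_set_reg)
    qed
    show ?thesis
    proof (cases "c j < v")
      case True
      then show ?thesis using go[of "set_reg 34 (c j) s1"] j rs a ws unfolding s1_def
        by (simp add: wp_Seq wp_Op wp_Load wp_Store wp_If wp_Move wp_Skip regs_set_reg regs_set_cell arrays_set_reg arrays_set_cell j_def[symmetric] v_def[symmetric])
    next
      case False
      then show ?thesis using go[of s1] j rs a ws unfolding s1_def
        by (simp add: wp_Seq wp_Op wp_Load wp_Store wp_If wp_Move wp_Skip regs_set_reg regs_set_cell arrays_set_reg arrays_set_cell j_def[symmetric] v_def[symmetric])
    qed
  qed
  have pos: "0 \<le> t'" if "I s' t'" for s' t' using that t b unfolding I_def by auto
  have fin: "Q s' (t' - 1)"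
    if I: "I s' t'" and cc: "\<not> compare_val LessEq (operand_val w s' (Reg 20)) (operand_val w s' (Reg 30))" for s' t'
  proof -
    have fr: "?fr s'" using I unfolding I_def by blast
    have "regs s' 30 = i - 1" using I cc same_outside_regs[OF fr, of 20] rg unfolding I_def by auto
    then show ?thesis using I unfolding I_def by (intro Q) auto
  qed
  have w1: "wrap w (l - 1) = l - 1" using X_linear b by (intro wrap_id) auto
  have vl: "(\<forall>q. l - 1 < q \<and> q \<le> l \<longrightarrow> m \<le> c q) \<longleftrightarrow> m \<le> c l" for m
  proof
    assume "m \<le> c l"
    then show "\<forall>q. l - 1 < q \<and> q \<le> l \<longrightarrow> m \<le> c q" by (metis zle_diff1_eq not_less order_antisym_conv)
  qed auto
  have I0: "I (set_reg 34 (c l) (set_reg 31 r (set_reg 30 (l - 1) s))) (t - 3)"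
    unfolding I_def using b fl0 vl by (simp add: wp_simps untouched_set_reg untouched_refl)
  have "wp w (While LessEq (Reg 20) (Reg 30) ?body) Q (set_reg 34 (c l) (set_reg 31 r (set_reg 30 (l - 1) s))) (t - 3)"
    by (rule wp_While[where I=I]) (use I0 pos step fin in blast)+
  then show ?thesis unfolding move_left_def using rg w1 ar
    by (simp add: wp_Seq wp_Move wp_Op wp_Load regs_set_reg arrays_set_reg)
qed

lemma wp_move_right:
  assumes ar: "arrays s 1 = ord" "arrays s 2 = c" and rg: "regs s 20 = i" "regs s 21 = f" "regs s 23 = r"
    and fl0: "filled_in (r + 1) (i - 1) (r + 1) s"
    and t: "11 * (f - r) + 5 \<le> t"
    and Q: "\<And>s' t'. same_outside {30..34} {3,4,15,16} s s' \<Longrightarrow> untouched ord i f s s' \<Longrightarrow>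
      filled_in (r + 1) (i - 1) (f + 1) s' \<Longrightarrow> t' \<ge> t - (11 * (f - r) + 5) \<Longrightarrow> Q s' t'"
  shows "wp w move_right Q s t"
proof -
  let ?fr = "same_outside {30..34} {3,4,15,16} s"
  \<comment> \<open>Before the first pass the minimum would range over no values and is not a
    number, hence the separate case with the initial \<open>c (r + 1)\<close>.\<close>
  define I where "I = (\<lambda>s' t'. ?fr s' \<and> untouched ord i f s s' \<and> r + 1 \<le> regs s' 30 \<and> regs s' 30 \<le> f + 1 \<and>
     filled_in (r + 1) (i - 1) (regs s' 30) s' \<and>
     (regs s' 30 = r + 1 \<and> regs s' 34 = c (r + 1) \<or> r + 1 < regs s' 30 \<and>
     (\<forall>m. m \<le> regs s' 34 \<longleftrightarrow> (\<forall>q. r < q \<and> q < regs s' 30 \<longrightarrow> m \<le> c q))) \<and>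
     t' \<ge> t - 2 - 11 * (regs s' 30 - (r + 1)))"
  let ?body = "seqs [Load 32 1 (Reg 30), Load 33 2 (Reg 30),
       If Less (Reg 33) (Reg 34) (Move 34 (Reg 33)) Skip,
       Store 15 (Reg 30) (Reg 32), Store 16 (Reg 30) (Reg 33), Store 3 (Reg 32) (Reg 34),
       Store 4 (Reg 32) (Reg 20), inc 30]"
  have step: "wp w ?body I s' (t' - 1)"
    if I: "I s' t'" and cc: "compare_val LessEq (operand_val w s' (Reg 30)) (operand_val w s' (Reg 21))" for s' t'
  proof -
    have fr: "?fr s'" using I unfolding I_def by blast
    have a: "arrays s' 1 = ord" "arrays s' 2 = c" and rs: "regs s' 20 = i" "regs s' 21 = f"
      using same_outside_arrays[OF fr] same_outside_regs[OF fr] ar rg by auto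
    define k where "k = regs s' 30"
    define v where "v = regs s' 34"
    have k: "r < k" "k \<le> f" and u: "untouched ord i f s s'"
      and fl: "filled_in (r + 1) (i - 1) k s'" and t': "t' \<ge> t - 2 - 11 * (k - (r + 1))"
      and v: "k = r + 1 \<and> v = c (r + 1) \<or> r + 1 < k \<and> (\<forall>m. m \<le> v \<longleftrightarrow> (\<forall>q. r < q \<and> q < k \<longrightarrow> m \<le> c q))"
      using I cc rs unfolding I_def k_def v_def by auto
    have ws: "wrap w (k + 1) = k + 1" using X_linear k b by (auto intro!: wrap_id)
    have vn: "m \<le> min (c k) v \<longleftrightarrow> (\<forall>q. r < q \<and> q \<le> k \<longrightarrow> m \<le> c q)" for m
    proof -
      have "m \<le> min (c k) v \<longleftrightarrow> m \<le> c k \<and> (\<forall>q. r < q \<and> q < k \<longrightarrow> m \<le> c q)" using v by auto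
      also have "\<dots> \<longleftrightarrow> (\<forall>q. r < q \<and> q \<le> k \<longrightarrow> m \<le> c q)"
      proof (intro iffI allI impI)
        fix q assume h: "m \<le> c k \<and> (\<forall>q. r < q \<and> q < k \<longrightarrow> m \<le> c q)" and "r < q \<and> q \<le> k"
        then show "m \<le> c q" by (cases "q = k") auto
      qed (use k in auto)
      finally show ?thesis .
    qed
    have F: "filled ord c i f l r (r + 1) (i - 1) (k + 1) ((arrays s' 15)(k := ord k))
        ((arrays s' 16)(k := c k)) ((arrays s' 3)(ord k := min (c k) v)) ((arrays s' 4)(ord k := i))"
      by (rule filled_right[OF b(2,3,4) _ fl k(1,2) vn]) (rule inj)
    have v': "\<forall>m. m \<le> min (c k) v \<longleftrightarrow> (\<forall>q. r < q \<and> q < k + 1 \<longrightarrow> m \<le> c q)" using vn by auto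
    define upd where "upd = (\<lambda>z. set_reg 30 (k + 1) (set_cell 4 (ord k) i (set_cell 3 (ord k) (min (c k) v)
      (set_cell 16 k (c k) (set_cell 15 k (ord k) z)))))"
    have go: "I (upd z) (t' - 10)" "I (upd z) (t' - 9)"
      if z: "z = set_reg 33 (c k) (set_reg 32 (ord k) s') \<and> \<not> c k < v \<or>
          z = set_reg 34 (c k) (set_reg 33 (c k) (set_reg 32 (ord k) s')) \<and> c k < v" for z
    proof -
      have az: "arrays z = arrays s'" and frz: "?fr z" and uz: "untouched ord i f s z"
        and vz: "regs z 34 = min (c k) v"
        using z fr u by (auto simp: wp_simps untouched_set_reg v_def)
      have x: "?fr (upd z)" using frz by (simp add: upd_def wp_simps)
      have u2: "untouched ord i f s (upd z)" unfolding upd_def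
        by (intro untouched_set_reg untouched_set_elem untouched_set_pos uz) (use k b in auto)
      have "arrays (upd z) 15 = (arrays s' 15)(k := ord k)" "arrays (upd z) 16 = (arrays s' 16)(k := c k)"
        "arrays (upd z) 3 = (arrays s' 3)(ord k := min (c k) v)" "arrays (upd z) 4 = (arrays s' 4)(ord k := i)"
        by (simp_all add: upd_def az arrays_set_cell arrays_set_reg)
      then have F2: "filled_in (r + 1) (i - 1) (k + 1) (upd z)" using F by (simp only:)
      have "regs (upd z) 30 = k + 1" "regs (upd z) 34 = min (c k) v" using vz by (simp_all add: upd_def wp_simps)
      then show "I (upd z) (t' - 10)" "I (upd z) (t' - 9)"
        unfolding I_def using x u2 F2 k t' v' by simp_all
    qed
    show ?thesis
    proof (cases "c k < v")
      case True
      then have mn: "min (c k) v = c k" by simp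
      show ?thesis using True go[of "set_reg 34 (c k) (set_reg 33 (c k) (set_reg 32 (ord k) s'))"] k rs a ws unfolding upd_def mn
        by (simp add: wp_Seq wp_Op wp_Load wp_Store wp_If wp_Move wp_Skip regs_set_reg regs_set_cell arrays_set_reg arrays_set_cell k_def[symmetric] v_def[symmetric])
    next
      case False
      then have mn: "min (c k) v = v" by simp
      show ?thesis using False go[of "set_reg 33 (c k) (set_reg 32 (ord k) s')"] k rs a ws unfolding upd_def mn
        by (simp add: wp_Seq wp_Op wp_Load wp_Store wp_If wp_Move wp_Skip regs_set_reg regs_set_cell arrays_set_reg arrays_set_cell k_def[symmetric] v_def[symmetric])
    qed
  qed
  have pos: "0 \<le> t'" if "I s' t'" for s' t' using that t b unfolding I_def by auto
  have fin: "Q s' (t' - 1)"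
    if I: "I s' t'" and cc: "\<not> compare_val LessEq (operand_val w s' (Reg 30)) (operand_val w s' (Reg 21))" for s' t'
  proof -
    have fr: "?fr s'" using I unfolding I_def by blast
    have "regs s' 30 = f + 1" using I cc same_outside_regs[OF fr, of 21] rg unfolding I_def by auto
    then show ?thesis using I unfolding I_def by (intro Q) auto
  qed
  have w1: "wrap w (r + 1) = r + 1" using X_linear b by (intro wrap_id) auto
  have I0: "I (set_reg 34 (c (r + 1)) (set_reg 30 (r + 1) s)) (t - 2)"
    unfolding I_def using b fl0 by (simp add: wp_simps untouched_set_reg untouched_refl)
  have "wp w (While LessEq (Reg 30) (Reg 21) ?body) Q (set_reg 34 (c (r + 1)) (set_reg 30 (r + 1) s)) (t - 2)"
    by (rule wp_While[where I=I]) (use I0 pos step fin in blast)+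
  then show ?thesis unfolding move_right_def using rg w1 ar
    by (simp add: wp_Seq wp_Move wp_Op wp_Load regs_set_reg arrays_set_reg)
qed

lemma wp_fix_borders:
  assumes ar: "arrays s 1 = ord" "arrays s 2 = c" and rg: "regs s 20 = i" "regs s 21 = f" "regs s 22 = l" "regs s 23 = r"
    and fl0: "filled_in (r + 1) (i - 1) (f + 1) s"
    and Q: "\<And>s' t'. same_outside {30..34} {3,4,15,16} s s' \<Longrightarrow> untouched ord i f s s' \<Longrightarrow>
      split_at ord c i f l r (arrays s' 15) (arrays s' 16) (arrays s' 3) (arrays s' 4) \<Longrightarrow> t' \<ge> t - 8 \<Longrightarrow> Q s' t'"
  shows "wp w fix_borders Q s t"
proof -
  have w1: "wrap w (r + 1) = r + 1" using X_linear b by (intro wrap_id) auto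
  have F: "split_at ord c i f l r (arrays s 15) (((arrays s 16)(i := -1))
      (r + 1 := (if r < f then min (c l) (c (r + 1)) else arrays s 16 (r + 1)))) (arrays s 3) (arrays s 4)"
    by (rule split_at_filled[OF b(2,3,4) _ fl0]) (rule inj)
  have cr: "arrays s 16 (r + 1) = c (r + 1)" if "r < f" using filledD(3)[OF fl0, of "r + 1"] that by auto
  have ne: "r + 1 \<noteq> i" using b by auto
  have b1: "untouched ord i f s (set_reg 30 (r + 1) (set_cell 16 i (-1) s))"
    using b by (intro untouched_set_reg untouched_set_pos untouched_refl) auto
  show ?thesis
  proof (cases "r < f")
    case True
    define s1 where "s1 = set_reg 33 (c (r + 1)) (set_reg 32 (c l) (set_reg 30 (r + 1) (set_cell 16 i (-1) s)))"
    have u1: "untouched ord i f s s1" unfolding s1_def by (intro untouched_set_reg[OF untouched_set_reg[OF b1]])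
    have f1: "same_outside {30..34} {3,4,15,16} s s1" unfolding s1_def by (simp add: wp_simps)
    show ?thesis
    proof (cases "c l < c (r + 1)")
      case T: True
      have mn: "(if r < f then min (c l) (c (r + 1)) else arrays s 16 (r + 1)) = c l" using True T by simp
      have "Q (set_cell 16 (r + 1) (c l) s1) (t - 7)"
      proof (rule Q)
        show "same_outside {30..34} {3,4,15,16} s (set_cell 16 (r + 1) (c l) s1)" using f1 by (simp add: wp_simps)
        show "untouched ord i f s (set_cell 16 (r + 1) (c l) s1)"
          by (rule untouched_set_pos[OF u1]) (use True b in auto)
        have "arrays (set_cell 16 (r + 1) (c l) s1) 15 = arrays s 15" "arrays (set_cell 16 (r + 1) (c l) s1) 3 = arrays s 3"
          "arrays (set_cell 16 (r + 1) (c l) s1) 4 = arrays s 4"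
          "arrays (set_cell 16 (r + 1) (c l) s1) 16 = ((arrays s 16)(i := -1))(r + 1 := c l)"
          by (simp_all add: s1_def arrays_set_cell arrays_set_reg)
        then show "split_at ord c i f l r (arrays (set_cell 16 (r + 1) (c l) s1) 15) (arrays (set_cell 16 (r + 1) (c l) s1) 16)
            (arrays (set_cell 16 (r + 1) (c l) s1) 3) (arrays (set_cell 16 (r + 1) (c l) s1) 4)"
          using F[unfolded mn] by (simp only:)
      qed simp
      then show ?thesis using True T rg w1 ar unfolding fix_borders_def s1_def
        by (simp add: wp_Seq wp_Move wp_Op wp_Load wp_Store wp_If regs_set_reg arrays_set_reg regs_set_cell arrays_set_cell)
    next
      case Fa: False
      have eq: "((arrays s 16)(i := -1)) (r + 1 := (if r < f then min (c l) (c (r + 1)) else arrays s 16 (r + 1))) = (arrays s 16)(i := -1)"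
        using Fa True cr ne by (auto simp: fun_eq_iff)
      have "Q s1 (t - 7)"
        by (rule Q[OF f1 u1]) (use F[unfolded eq] in \<open>simp_all add: wp_simps s1_def\<close>)
      then show ?thesis using True Fa rg w1 ar unfolding fix_borders_def s1_def
        by (simp add: wp_Seq wp_Move wp_Op wp_Load wp_Store wp_If wp_Skip regs_set_reg arrays_set_reg regs_set_cell arrays_set_cell)
    qed
  next
    case False
    have eq: "((arrays s 16)(i := -1)) (r + 1 := (if r < f then min (c l) (c (r + 1)) else arrays s 16 (r + 1))) = (arrays s 16)(i := -1)"
      using False ne by (auto simp: fun_eq_iff)
    have "Q (set_reg 30 (r + 1) (set_cell 16 i (-1) s)) (t - 4)"
      by (rule Q[OF _ b1]) (use F[unfolded eq] in \<open>simp_all add: wp_simps\<close>)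
    then show ?thesis using False rg w1 ar unfolding fix_borders_def
      by (simp add: wp_Seq wp_Move wp_Op wp_Store wp_If wp_Skip regs_set_reg arrays_set_reg regs_set_cell arrays_set_cell)
  qed
qed

end

lemma wp_split_segment:
  assumes ar: "arrays s 1 = ord" "arrays s 2 = c"
    and c: "\<And>p. 1 \<le> p \<Longrightarrow> p \<le> n \<Longrightarrow> -1 \<le> c p" "c (n + 1) = -1" "c i = -1"
    and inj: "\<And>p q. 1 \<le> p \<Longrightarrow> p \<le> n \<Longrightarrow> 1 \<le> q \<Longrightarrow> q \<le> n \<Longrightarrow> ord p = ord q \<Longrightarrow> p = q"
    and i: "regs s 20 = i" "1 \<le> i" "i \<le> n"
    and t: "70 * (n - i + 1) \<le> t"
    and Q: "\<And>s' t' f l r. same_outside {21..35} {3,4,15,16} s s' \<Longrightarrow> untouched ord i f s s' \<Longrightarrow>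
      regs s' 21 = f \<Longrightarrow> segment n c i f \<Longrightarrow> separator c i f l r \<Longrightarrow>
      split_at ord c i f l r (arrays s' 15) (arrays s' 16) (arrays s' 3) (arrays s' 4) \<Longrightarrow>
      t' \<ge> t - 70 * (f - i + 1) \<Longrightarrow> Q s' t'"
  shows "wp w split_segment Q s t"
  unfolding split_segment_def seqs.simps wp_Seq
proof (rule wp_find_end)
  show "1 \<le> i" "i \<le> n" "regs s 20 = i" by fact+
  show "4 * (n - i) + 6 \<le> t" using t i by simp
  show "arrays s 2 (n + 1) = -1" "arrays s 2 i = -1" using ar c by auto
  show "-1 \<le> arrays s 2 p" if "1 \<le> p" "p \<le> n" for p using that ar c by auto
  fix s1 t1 assume fr1: "same_outside {21, 30, 31} {} s s1" and seg: "segment n (arrays s 2) i (regs s1 21)"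
    and t1: "t - (4 * (regs s1 21 - i) + 4) \<le> t1"
  define f where "f = regs s1 21"
  have sg: "segment n c i f" using seg ar unfolding f_def by simp
  have fb: "i \<le> f" "f \<le> n" using sg unfolding segment_def by auto
  have a1: "arrays s1 = arrays s" using same_outside_arrays[OF fr1] by auto
  have t70: "70 * (f - i + 1) \<le> t" using t fb by simp
  show "wp w find_separator (wp w move_block (wp w move_left (wp w move_right (wp w fix_borders Q)))) s1 t1"
  proof (rule wp_find_separator)
    show "segment n (arrays s1 2) i f" using sg ar a1 by simp
    show "regs s1 20 = i" using same_outside_regs[OF fr1, of 20] i by simp
    show "regs s1 21 = f" unfolding f_def by simp
    show "30 * (f - i) + 30 \<le> t1" using t1 t70 fb unfolding f_def by simp
    fix s2 t2 assume fr2: "same_outside ({22..30} \<union> {32..35}) {} s1 s2"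
      and sep0: "separator (arrays s1 2) i f (regs s2 22) (regs s2 23)" and t2: "t1 - (30 * (f - i) + 30) \<le> t2"
    define l where "l = regs s2 22"
    define r where "r = regs s2 23"
    have sep: "separator c i f l r" using sep0 ar a1 unfolding l_def r_def by simp
    have b: "1 \<le> i" "i \<le> l" "l \<le> r" "r \<le> f" "f \<le> n" using sep fb i unfolding separator_def by auto
    have inj': "\<And>p q. i \<le> p \<Longrightarrow> p \<le> f \<Longrightarrow> i \<le> q \<Longrightarrow> q \<le> f \<Longrightarrow> ord p = ord q \<Longrightarrow> p = q"
      using inj b by auto
    have a2: "arrays s2 1 = ord" "arrays s2 2 = c" using same_outside_arrays[OF fr2] a1 ar by auto
    have r2: "regs s2 20 = i" "regs s2 21 = f"
      using same_outside_regs[OF fr2] same_outside_regs[OF fr1] i unfolding f_def by auto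
    have t2': "t2 \<ge> t - 34 * (f - i) - 34" using t2 t1 unfolding f_def by simp
    have as2: "arrays s2 = arrays s" using same_outside_arrays[OF fr2] a1 by auto
    have fr02: "same_outside {21..35} {3,4,15,16} s s2"
      by (rule same_outside_trans[OF fr1 fr2]) auto
    have u02: "untouched ord i f s s2" using as2 unfolding untouched_def by simp
    show "wp w move_block (wp w move_left (wp w move_right (wp w fix_borders Q))) s2 t2"
    proof (rule wp_move_block[OF b inj' a2 r2(1) l_def[symmetric] r_def[symmetric]])
      show "9 * (r - l + 1) + 4 \<le> t2" using t2' t70 b by simp
      fix s3 t3 assume fr3: "same_outside {30..33} {3, 4, 15, 16} s2 s3" and u3: "untouched ord i f s2 s3"
        and fl3: "filled ord c i f l r (r + 1) (l - 1) (r + 1) (arrays s3 15) (arrays s3 16) (arrays s3 3) (arrays s3 4)"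
        and t3: "t2 - (9 * (r - l + 1) + 4) \<le> t3"
      have a3: "arrays s3 1 = ord" "arrays s3 2 = c" using same_outside_arrays[OF fr3] a2 by auto
      have r3: "regs s3 20 = i" "regs s3 21 = f" "regs s3 22 = l" "regs s3 23 = r"
        using same_outside_regs[OF fr3] r2 unfolding l_def r_def by auto
      show "wp w move_left (wp w move_right (wp w fix_borders Q)) s3 t3"
      proof (rule wp_move_left[OF b inj' a3 r3(1,3,4) fl3])
        show "11 * (l - i) + 5 \<le> t3" using t3 t2' t70 b by simp
        fix s4 t4 assume fr4: "same_outside {30..34} {3, 4, 15, 16} s3 s4" and u4: "untouched ord i f s3 s4"
          and fl4: "filled ord c i f l r (r + 1) (i - 1) (r + 1) (arrays s4 15) (arrays s4 16) (arrays s4 3) (arrays s4 4)"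
          and t4: "t3 - (11 * (l - i) + 5) \<le> t4"
        have a4: "arrays s4 1 = ord" "arrays s4 2 = c" using same_outside_arrays[OF fr4] a3 by auto
        have r4: "regs s4 20 = i" "regs s4 21 = f" "regs s4 22 = l" "regs s4 23 = r"
          using same_outside_regs[OF fr4] r3 by auto
        show "wp w move_right (wp w fix_borders Q) s4 t4"
        proof (rule wp_move_right[OF b inj' a4 r4(1,2,4) fl4])
          show "11 * (f - r) + 5 \<le> t4" using t4 t3 t2' t70 b by simp
          fix s5 t5 assume fr5: "same_outside {30..34} {3, 4, 15, 16} s4 s5" and u5: "untouched ord i f s4 s5"
            and fl5: "filled ord c i f l r (r + 1) (i - 1) (f + 1) (arrays s5 15) (arrays s5 16) (arrays s5 3) (arrays s5 4)"
            and t5: "t4 - (11 * (f - r) + 5) \<le> t5"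
          have a5: "arrays s5 1 = ord" "arrays s5 2 = c" using same_outside_arrays[OF fr5] a4 by auto
          have r5: "regs s5 20 = i" "regs s5 21 = f" "regs s5 22 = l" "regs s5 23 = r"
            using same_outside_regs[OF fr5] r4 by auto
          show "wp w fix_borders Q s5 t5"
          proof (rule wp_fix_borders[OF b inj' a5 r5 fl5])
            fix s6 t6 assume fr6: "same_outside {30..34} {3, 4, 15, 16} s5 s6" and u6: "untouched ord i f s5 s6"
              and sp: "split_at ord c i f l r (arrays s6 15) (arrays s6 16) (arrays s6 3) (arrays s6 4)" and t6: "t5 - 8 \<le> t6"
            have f3: "same_outside {21..35} {3,4,15,16} s s3" by (rule same_outside_trans[OF fr02 fr3]) auto
            have f4: "same_outside {21..35} {3,4,15,16} s s4" by (rule same_outside_trans[OF f3 fr4]) auto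
            have f5: "same_outside {21..35} {3,4,15,16} s s5" by (rule same_outside_trans[OF f4 fr5]) auto
            have fr: "same_outside {21..35} {3,4,15,16} s s6" by (rule same_outside_trans[OF f5 fr6]) auto
            have u: "untouched ord i f s s6" using u02 u3 u4 u5 u6 untouched_trans by blast
            have r6: "regs s6 21 = f" using same_outside_regs[OF fr6] r5 by auto
            have "t - 70 * (f - i + 1) \<le> t6" using t6 t5 t4 t3 t2' b by (simp add: algebra_simps)
            then show "Q s6 t6" by (rule Q[OF fr u r6 sg sep sp])
          qed
        qed
      qed
    qed
  qed
qed

end

section \<open>A full round over all segments\<close>

context ram_matching begin

lemma wp_split_all:
  assumes ok: "segments_ok (arrays s 1) (arrays s 2)"
    and rg: "regs s 0 = n" "regs s 1 = n + 1"
    and t: "90 * n + 20 \<le> t"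
    and Q: "\<And>s' t'. same_outside ({5} \<union> {20..35}) {1,2,3,4,15,16} s s' \<Longrightarrow>
      split_level n e (arrays s 1) (arrays s 2) (arrays s' 1) (arrays s' 2) (arrays s' 3) (arrays s' 4) \<Longrightarrow>
      regs s' 5 = 0 \<or> regs s' 5 = 1 \<Longrightarrow>
      (regs s' 5 = 0 \<longleftrightarrow> (\<forall>p. 1 \<le> p \<and> p \<le> n \<longrightarrow> arrays s 2 p = -1)) \<Longrightarrow>
      t' \<ge> t - (90 * n + 20) \<Longrightarrow> Q s' t'"
  shows "wp w split_all Q s t"
proof -
  let ?ord = "arrays s 1" and ?c = "arrays s 2"
  have cb: "\<And>p. 1 \<le> p \<Longrightarrow> p \<le> n \<Longrightarrow> -1 \<le> ?c p" "?c (n + 1) = -1" "?c 1 = -1"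
    and bij: "bij_betw ?ord {1..n} {1..n}" using ok unfolding segments_ok_def by auto
  have inj: "\<And>p q. 1 \<le> p \<Longrightarrow> p \<le> n \<Longrightarrow> 1 \<le> q \<Longrightarrow> q \<le> n \<Longrightarrow> ?ord p = ?ord q \<Longrightarrow> p = q"
    using bij unfolding bij_betw_def inj_on_def by auto
  let ?fr = "same_outside ({5} \<union> {20..35}) {3,4,15,16} s"
  define splitted where "splitted = (\<lambda>(s'::state) i f l r. segment n ?c i f \<and> separator ?c i f l r \<and>
     split_at ?ord ?c i f l r (arrays s' 15) (arrays s' 16) (arrays s' 3) (arrays s' 4))"
  define I where "I = (\<lambda>s' t'. ?fr s' \<and> 1 \<le> regs s' 20 \<and> regs s' 20 \<le> n + 1 \<and> ?c (regs s' 20) = -1 \<and>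
     (\<forall>i. 1 \<le> i \<and> i < regs s' 20 \<and> ?c i = -1 \<longrightarrow> (\<exists>f l r. f < regs s' 20 \<and> splitted s' i f l r)) \<and>
     (regs s' 5 = 0 \<or> regs s' 5 = 1) \<and>
     (regs s' 5 = 0 \<longleftrightarrow> (\<forall>p. 1 \<le> p \<and> p < regs s' 20 \<longrightarrow> ?c p = -1)) \<and>
     t' \<ge> t - 2 - 80 * (regs s' 20 - 1))"
  let ?body = "seqs [split_segment, If Less (Reg 20) (Reg 21) (Move 5 (Const 1)) Skip, Op 20 Add (Reg 21) (Const 1)]"
  have step: "wp w ?body I s' (t' - 1)"
    if I: "I s' t'" and cc: "compare_val LessEq (operand_val w s' (Reg 20)) (operand_val w s' (Reg 0))" for s' t'
  proof -
    define i where "i = regs s' 20"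
    have fr: "?fr s'" using I unfolding I_def by blast
    have rs: "regs s' 0 = n" and a: "arrays s' 1 = ?ord" "arrays s' 2 = ?c"
      using same_outside_regs[OF fr] same_outside_arrays[OF fr] rg by auto
    have i: "1 \<le> i" "i \<le> n" "?c i = -1" and t': "t' \<ge> t - 2 - 80 * (i - 1)"
      and dn: "\<And>j. 1 \<le> j \<Longrightarrow> j < i \<Longrightarrow> ?c j = -1 \<Longrightarrow> \<exists>f l r. f < i \<and> splitted s' j f l r"
      and any: "regs s' 5 = 0 \<or> regs s' 5 = 1" "regs s' 5 = 0 \<longleftrightarrow> (\<forall>p. 1 \<le> p \<and> p < i \<longrightarrow> ?c p = -1)"
      using I cc rs unfolding I_def i_def by auto
    show ?thesis unfolding seqs.simps wp_Seq
    proof (rule wp_split_segment[OF a cb(1,2) i(3) inj i_def[symmetric] i(1,2)])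
      show "70 * (n - i + 1) \<le> t' - 1" using t' t i by simp
      fix s2 t2 f l r
      assume fr2: "same_outside {21..35} {3, 4, 15, 16} s' s2" and u: "untouched ?ord i f s' s2" and r2: "regs s2 21 = f"
        and sg: "segment n ?c i f" and sep: "separator ?c i f l r"
        and sp: "split_at ?ord ?c i f l r (arrays s2 15) (arrays s2 16) (arrays s2 3) (arrays s2 4)"
        and t2: "t' - 1 - 70 * (f - i + 1) \<le> t2"
      have fb: "i \<le> f" "f \<le> n" "?c (f + 1) = -1" "\<And>p. i < p \<Longrightarrow> p \<le> f \<Longrightarrow> 0 \<le> ?c p" using sg unfolding segment_def by auto
      have r5: "regs s2 5 = regs s' 5" "regs s2 20 = i" using same_outside_regs[OF fr2] i_def by auto
      have frs: "?fr s2" by (rule same_outside_trans[OF fr fr2]) auto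
      \<comment> \<open>The results for earlier segments survive: their places lie below
        \<open>i\<close>, and by injectivity their elements differ from those of the segment just
        split.\<close>
      have dn2: "\<exists>f' l r. f' < f + 1 \<and> splitted s2 j f' l r" if j: "1 \<le> j" "j < f + 1" "?c j = -1" for j
      proof (cases "j < i")
        case True
        then obtain f' l' r' where d: "f' < i" "splitted s' j f' l' r'" using dn j by blast
        have "split_at ?ord ?c j f' l' r' (arrays s2 15) (arrays s2 16) (arrays s2 3) (arrays s2 4)"
        proof (rule split_at_cong)
          show "split_at ?ord ?c j f' l' r' (arrays s' 15) (arrays s' 16) (arrays s' 3) (arrays s' 4)" using d unfolding splitted_def by blast
          show "j \<le> l'" "l' \<le> r'" "r' \<le> f'" using d unfolding splitted_def separator_def by auto
          fix q assume q: "j \<le> q" "q \<le> f'"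
          then have "q < i" using d by simp
          then show "arrays s2 15 q = arrays s' 15 q \<and> arrays s2 16 q = arrays s' 16 q"
            using u unfolding untouched_def by auto
          have "?ord q \<notin> ?ord ` {i..f}"
          proof
            assume "?ord q \<in> ?ord ` {i..f}"
            then obtain z where z: "i \<le> z" "z \<le> f" "?ord q = ?ord z" by auto
            then have "q = z" using inj[of q z] q j i fb \<open>q < i\<close> by auto
            then show False using z \<open>q < i\<close> by simp
          qed
          then show "arrays s2 3 (?ord q) = arrays s' 3 (?ord q) \<and> arrays s2 4 (?ord q) = arrays s' 4 (?ord q)"
            using u unfolding untouched_def by auto
        qed
        then show ?thesis using d fb unfolding splitted_def by (intro exI[of _ f'] exI[of _ l'] exI[of _ r']) auto
      next
        case False
        then have "j = i" using fb(4)[of j] j by force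
        then show ?thesis using sg sep sp unfolding splitted_def by (intro exI[of _ f] exI[of _ l] exI[of _ r]) auto
      qed
      have ws: "wrap w (f + 1) = f + 1" using X_linear fb i by (intro wrap_id) auto
      define v where "v = (if i < f then 1 else regs s' 5)"
      have any': "v = 0 \<or> v = 1" "v = 0 \<longleftrightarrow> (\<forall>p. 1 \<le> p \<and> p < f + 1 \<longrightarrow> ?c p = -1)"
      proof -
        show "v = 0 \<or> v = 1" unfolding v_def using any by auto
        show "v = 0 \<longleftrightarrow> (\<forall>p. 1 \<le> p \<and> p < f + 1 \<longrightarrow> ?c p = -1)"
        proof (cases "i < f")
          case True
          then have "?c f \<noteq> -1" using fb(4)[of f] by auto
          moreover have "1 \<le> f \<and> f < f + 1" using True i by simp
          ultimately have "\<not> (\<forall>p. 1 \<le> p \<and> p < f + 1 \<longrightarrow> ?c p = -1)" by blast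
          then show ?thesis using True unfolding v_def by simp
        next
          case False
          then have "f = i" using fb by simp
          then have "(\<forall>p. 1 \<le> p \<and> p < f + 1 \<longrightarrow> ?c p = -1) \<longleftrightarrow> (\<forall>p. 1 \<le> p \<and> p < i \<longrightarrow> ?c p = -1)"
            using i(3) by (auto simp: order_le_less)
          then show ?thesis using False any unfolding v_def by simp
        qed
      qed
      have splitted_reg: "splitted (set_reg a x z) = splitted z" for a x z unfolding splitted_def by (simp add: arrays_set_reg)
      have t3: "t2 - 3 \<ge> t - 2 - 80 * f" using t2 t' fb by simp
      have "I (set_reg 20 (f + 1) (if i < f then set_reg 5 1 s2 else s2)) (t2 - 3)"
        unfolding I_def using frs fb i dn2 any' t3 r5 unfolding v_def
        by (auto simp: wp_simps splitted_reg)
      then show "wp w (If Less (Reg 20) (Reg 21) (Move 5 (Const 1)) Skip) (wp w (Op 20 Add (Reg 21) (Const 1)) I) s2 t2"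
        using r5 r2 ws by (auto simp: wp_simps split: if_splits)
    qed
  qed
  have pos: "0 \<le> t'" if "I s' t'" for s' t' using that t unfolding I_def by auto
  let ?b2 = "seqs [Load 21 15 (Reg 20), Store 1 (Reg 20) (Reg 21), Load 21 16 (Reg 20), Store 2 (Reg 20) (Reg 21), inc 20]"
  have fin: "wp w (seqs [Move 20 (Const 1), While LessEq (Reg 20) (Reg 0) ?b2]) Q s1 (t1 - 1)"
    if I: "I s1 t1" and cc: "\<not> compare_val LessEq (operand_val w s1 (Reg 20)) (operand_val w s1 (Reg 0))" for s1 t1
  proof -
    have fr: "?fr s1" using I unfolding I_def by blast
    have a: "arrays s1 1 = ?ord" "arrays s1 2 = ?c" and rs: "regs s1 0 = n"
      using same_outside_regs[OF fr] same_outside_arrays[OF fr] rg by auto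
    have v: "regs s1 20 = n + 1" using I cc rs unfolding I_def by auto
    have dn: "\<exists>f l r. splitted s1 j f l r" if "1 \<le> j" "j \<le> n" "?c j = -1" for j
    proof -
      have "\<forall>i. 1 \<le> i \<and> i < regs s1 20 \<and> ?c i = -1 \<longrightarrow> (\<exists>f l r. f < regs s1 20 \<and> splitted s1 i f l r)"
        using I unfolding I_def by blast
      then show ?thesis using that v by fastforce
    qed
    have any: "regs s1 5 = 0 \<or> regs s1 5 = 1" "regs s1 5 = 0 \<longleftrightarrow> (\<forall>p. 1 \<le> p \<and> p \<le> n \<longrightarrow> ?c p = -1)"
      and t1: "t1 \<ge> t - 2 - 80 * n"
      using I v unfolding I_def by auto
    define K where "K = (\<lambda>s' t'. 1 \<le> regs s' 20 \<and> regs s' 20 \<le> n + 1 \<and> same_outside {20,21} {1,2} s1 s' \<and>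
       arrays s' 2 (n + 1) = -1 \<and>
       (\<forall>p. 1 \<le> p \<and> p < regs s' 20 \<longrightarrow> arrays s' 1 p = arrays s1 15 p \<and> arrays s' 2 p = arrays s1 16 p) \<and>
       t' \<ge> t1 - 3 - 6 * (regs s' 20 - 1))"
    have K0: "K (set_reg 20 1 s1) (t1 - 2)" unfolding K_def using n_pos a cb by (simp add: wp_simps)
    have stepK: "wp w ?b2 K s' (t' - 1)"
      if K: "K s' t'" and cc: "compare_val LessEq (operand_val w s' (Reg 20)) (operand_val w s' (Reg 0))" for s' t'
    proof -
      have f: "same_outside {20,21} {1,2} s1 s'" using K unfolding K_def by blast
      have p: "1 \<le> regs s' 20" "regs s' 20 \<le> n" using K cc same_outside_regs[OF f, of 0] rs unfolding K_def by auto
      have ws: "wrap w (regs s' 20 + 1) = regs s' 20 + 1" using X_linear p by (intro wrap_id) auto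
      have ar': "arrays s' 15 = arrays s1 15" "arrays s' 16 = arrays s1 16" using same_outside_arrays[OF f] by auto
      show ?thesis using K p ar' unfolding K_def by (auto simp: wp_simps ws)
    qed
    have posK: "0 \<le> t'" if "K s' t'" for s' t' using that t t1 n_pos unfolding K_def by auto
    have finK: "Q s' (t' - 1)"
      if K: "K s' t'" and cc: "\<not> compare_val LessEq (operand_val w s' (Reg 20)) (operand_val w s' (Reg 0))" for s' t'
    proof -
      have f: "same_outside {20,21} {1,2} s1 s'" using K unfolding K_def by blast
      have p: "regs s' 20 = n + 1" using K cc same_outside_regs[OF f, of 0] rs unfolding K_def by auto
      have new: "\<And>p. 1 \<le> p \<Longrightarrow> p \<le> n \<Longrightarrow> arrays s' 1 p = arrays s1 15 p \<and> arrays s' 2 p = arrays s1 16 p"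
        "arrays s' 2 (n + 1) = -1" and t': "t' \<ge> t1 - 3 - 6 * n"
        using K p unfolding K_def by auto
      have ar': "arrays s' 3 = arrays s1 3" "arrays s' 4 = arrays s1 4" using same_outside_arrays[OF f] by auto
      have "split_level n e ?ord ?c (arrays s' 1) (arrays s' 2) (arrays s' 3) (arrays s' 4)"
      proof (unfold_locales)
        show "segments_ok ?ord ?c" by (rule ok)
        show "arrays s' 2 (n + 1) = -1" by (rule new)
        fix j assume j: "1 \<le> j" "j \<le> n" "?c j = -1"
        then obtain f l r where d: "splitted s1 j f l r" using dn by blast
        have sf: "f \<le> n" using d unfolding splitted_def segment_def by auto
        have "split_at ?ord ?c j f l r (arrays s' 1) (arrays s' 2) (arrays s' 3) (arrays s' 4)"
        proof (rule split_at_cong)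
          show "split_at ?ord ?c j f l r (arrays s1 15) (arrays s1 16) (arrays s1 3) (arrays s1 4)" using d unfolding splitted_def by blast
          show "j \<le> l" "l \<le> r" "r \<le> f" using d unfolding splitted_def separator_def by auto
        qed (use new sf j ar' in auto)
        then show "\<exists>f l r. segment n ?c j f \<and> separator ?c j f l r \<and>
            split_at ?ord ?c j f l r (arrays s' 1) (arrays s' 2) (arrays s' 3) (arrays s' 4)"
          using d unfolding splitted_def by blast
      qed
      moreover have "same_outside ({5} \<union> {20..35}) {1,2,3,4,15,16} s s'"
        by (rule same_outside_trans[OF fr f]) auto
      moreover have "regs s' 5 = regs s1 5" using same_outside_regs[OF f] by auto
      ultimately show ?thesis using any t' t1 n_pos by (intro Q) auto
    qed
    have "wp w (While LessEq (Reg 20) (Reg 0) ?b2) Q (set_reg 20 1 s1) (t1 - 2)"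
      by (rule wp_While[where I=K]) (use K0 posK stepK finK in blast)+
    then show ?thesis by (simp add: wp_Seq wp_Move)
  qed
  have I0: "I (set_reg 5 0 (set_reg 20 1 s)) (t - 2)"
    unfolding I_def using n_pos cb by (auto simp: wp_simps)
  have "wp w (While LessEq (Reg 20) (Reg 0) ?body) (wp w (seqs [Move 20 (Const 1), While LessEq (Reg 20) (Reg 0) ?b2]) Q)
      (set_reg 5 0 (set_reg 20 1 s)) (t - 2)"
    by (rule wp_While[where I=I]) (use I0 pos step fin in blast)+
  then show ?thesis unfolding split_all_def seqs.simps wp_Seq by (subst wp_Move, subst wp_Move) simp
qed

end

section \<open>Rank sweeps\<close>

text \<open>The rank of \<open>v\<close> in the separator of segment \<open>i\<close>, since
  \<open>D\<close> is -1 exactly on separators.\<close>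

definition rank_in :: "int \<Rightarrow> (int \<Rightarrow> int) \<Rightarrow> (int \<Rightarrow> int) \<Rightarrow> int \<Rightarrow> int \<Rightarrow> int" where
  "rank_in n D sg i v = int (card {a. 1 \<le> a \<and> a \<le> n \<and> D a = -1 \<and> sg a = i \<and> a \<le> v})"

lemma rank_in_bounds: "0 \<le> n \<Longrightarrow> 0 \<le> rank_in n D sg i v \<and> rank_in n D sg i v \<le> n"
proof -
  assume "0 \<le> n"
  have "card {a. 1 \<le> a \<and> a \<le> n \<and> D a = -1 \<and> sg a = i \<and> a \<le> v} \<le> card {1..n}"
    by (rule card_mono) auto
  then show ?thesis using \<open>0 \<le> n\<close> unfolding rank_in_def by simp
qed

lemma rank_in_zero: "rank_in n D sg i 0 = 0"
proof -
  have "{a. 1 \<le> a \<and> a \<le> n \<and> D a = -1 \<and> sg a = i \<and> a \<le> 0} = {}" by auto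
  then show ?thesis unfolding rank_in_def by (simp only: card.empty)
qed

lemma rank_in_step:
  "rank_in n D sg i v = rank_in n D sg i (v - 1) + (if 1 \<le> v \<and> v \<le> n \<and> D v = -1 \<and> sg v = i then 1 else 0)"
proof (cases "1 \<le> v \<and> v \<le> n \<and> D v = -1 \<and> sg v = i")
  case True
  have "{a. 1 \<le> a \<and> a \<le> n \<and> D a = -1 \<and> sg a = i \<and> a \<le> v} =
     insert v {a. 1 \<le> a \<and> a \<le> n \<and> D a = -1 \<and> sg a = i \<and> a \<le> v - 1}" using True by auto
  moreover have "finite {a. 1 \<le> a \<and> a \<le> n \<and> D a = -1 \<and> sg a = i \<and> a \<le> v - 1}"
    by (rule finite_subset[of _ "{1..n}"]) auto
  ultimately show ?thesis using True unfolding rank_in_def by simp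
next
  case False
  then have "{a. 1 \<le> a \<and> a \<le> n \<and> D a = -1 \<and> sg a = i \<and> a \<le> v} =
      {a. 1 \<le> a \<and> a \<le> n \<and> D a = -1 \<and> sg a = i \<and> a \<le> v - 1}"
    by (auto simp: order_le_less)
  then show ?thesis using False unfolding rank_in_def by (simp only: if_False)
qed

lemma rank_in_interval:
  "int (card {a. 1 \<le> a \<and> a \<le> n \<and> D a = -1 \<and> sg a = i \<and> lo < a \<and> a \<le> hi}) =
     rank_in n D sg i hi - rank_in n D sg i (min lo hi)"
proof -
  let ?A = "{a. 1 \<le> a \<and> a \<le> n \<and> D a = -1 \<and> sg a = i \<and> a \<le> hi}"
  let ?B = "{a. 1 \<le> a \<and> a \<le> n \<and> D a = -1 \<and> sg a = i \<and> a \<le> min lo hi}"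
  have "{a. 1 \<le> a \<and> a \<le> n \<and> D a = -1 \<and> sg a = i \<and> lo < a \<and> a \<le> hi} = ?A - ?B" by auto
  moreover have "finite ?A" by (rule finite_subset[of _ "{1..n}"]) auto
  moreover have "?B \<subseteq> ?A" by auto
  ultimately show ?thesis unfolding rank_in_def
    by (simp only: card_Diff_subset finite_subset card_mono of_nat_diff)
qed

text \<open>The elements outside the separators are put into buckets by the key that \<open>kp\<close> computes. A sweep
  over the positions then keeps the current rank of every separator in array 17 and adds it to register 4
  (or subtracts it) for every element of the bucket.\<close>

definition rank_pass :: "prog \<Rightarrow> binop \<Rightarrow> prog" where
  "rank_pass kp f = seqs [
     Store 3 (Reg 1) (Const 0), Move 20 (Const 0),
     While LessEq (Reg 20) (Reg 1) (seqs [Store 12 (Reg 20) (Const 0), Store 17 (Reg 20) (Const 0), inc 20]),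
     Move 20 (Const 1),
     While LessEq (Reg 20) (Reg 0) (seqs [Load 22 3 (Reg 20),
       If LessEq (Const 0) (Reg 22) (seqs [kp, Load 23 12 (Reg 21), Store 13 (Reg 20) (Reg 23),
         Store 12 (Reg 21) (Reg 20)]) Skip, inc 20]),
     Move 20 (Const 1),
     While LessEq (Reg 20) (Reg 1) (seqs [Load 22 3 (Reg 20),
       If Equal (Reg 22) (Const (-1)) (seqs [Load 23 4 (Reg 20), Load 24 17 (Reg 23), inc 24,
         Store 17 (Reg 23) (Reg 24)]) Skip,
       Load 21 12 (Reg 20),
       While NotEqual (Reg 21) (Const 0) (seqs [Load 23 4 (Reg 21), Load 24 17 (Reg 23),
         Op 4 f (Reg 4) (Reg 24), Load 21 13 (Reg 21)]),
       inc 20])]"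

context ram begin

text \<open>\<open>buckets\<close> speaks of all keys, but a sweep clears only the cells from 0 to
  \<open>n + 1\<close>; the others are masked.\<close>

definition window :: "(int \<Rightarrow> int) \<Rightarrow> int \<Rightarrow> int" where
  "window g v = (if 0 \<le> v \<and> v \<le> n + 1 then g v else 0)"

lemma window_upd: "0 \<le> k \<Longrightarrow> k \<le> n + 1 \<Longrightarrow> window (g(k := x)) = (window g)(k := x)"
  unfolding window_def by auto

text \<open>Queries are answered in the order of their keys, so one counter per separator takes the
  place of a rank structure. A sweep changes the sum by at most \<open>(n + 2) * (n + 2)\<close>,
  which together with the bound on \<open>acc\<close> excludes overflow.\<close>

lemma wp_rank_pass:
  fixes sgn :: int
  assumes rg: "regs s 0 = n" "regs s 1 = n + 1"
    and f: "f = Add \<and> sgn = 1 \<or> f = Sub \<and> sgn = -1"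
    and D: "\<And>x. 1 \<le> x \<Longrightarrow> x \<le> n \<Longrightarrow> arrays s 3 x = D x" "\<And>x. 1 \<le> x \<Longrightarrow> x \<le> n \<Longrightarrow> D x = -1 \<or> 0 \<le> D x"
    and sg: "\<And>x. 1 \<le> x \<Longrightarrow> x \<le> n \<Longrightarrow> arrays s 4 x = sg x \<and> 1 \<le> sg x \<and> sg x \<le> n"
    and acc: "regs s 4 = acc" "\<bar>acc\<bar> \<le> 20 * (n + 2) * (n + 2)"
    and key: "\<And>x. 1 \<le> x \<Longrightarrow> x \<le> n \<Longrightarrow> 0 \<le> D x \<Longrightarrow> 0 \<le> key x \<and> key x \<le> n + 1"
    and kp: "\<And>x s1 t1 Q1. same_outside ({4} \<union> {20..26}) {3,12,13,17} s s1 \<Longrightarrow> regs s1 20 = x \<Longrightarrow>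
      regs s1 22 = D x \<Longrightarrow> 1 \<le> x \<Longrightarrow> x \<le> n \<Longrightarrow> 0 \<le> D x \<Longrightarrow>
      (\<And>s2 t2. same_outside {21,25} {} s1 s2 \<Longrightarrow> regs s2 21 = key x \<Longrightarrow> t2 \<ge> t1 - 10 \<Longrightarrow> Q1 s2 t2) \<Longrightarrow>
      wp w kp Q1 s1 t1"
    and t: "50 * n + 50 \<le> t"
    and Q: "\<And>s' t'. same_outside ({4} \<union> {20..26}) {3,12,13,17} s s' \<Longrightarrow>
      (\<And>x. 1 \<le> x \<Longrightarrow> x \<le> n \<Longrightarrow> arrays s' 3 x = D x) \<Longrightarrow>
      regs s' 4 = acc + sgn * (\<Sum>x\<in>{x. 1 \<le> x \<and> x \<le> n \<and> 0 \<le> D x}. rank_in n D sg (sg x) (key x)) \<Longrightarrow>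
      t' \<ge> t - (50 * n + 50) \<Longrightarrow> Q s' t'"
  shows "wp w (rank_pass kp f) Q s t"
proof -
  let ?fr = "same_outside ({4} \<union> {20..26}) {3,12,13,17} s"
  define B where "B = {x. 1 \<le> x \<and> x \<le> n \<and> 0 \<le> D x}"
  have finB: "finite B" unfolding B_def by (rule finite_subset[of _ "{1..n}"]) auto
  have cardB: "int (card {x \<in> B. P x}) \<le> n" for P
  proof -
    have "card {x \<in> B. P x} \<le> card {1..n}" by (rule card_mono) (auto simp: B_def)
    then show ?thesis using n_pos by simp
  qed
  have frD: "regs s' 0 = n" "regs s' 1 = n + 1" "arrays s' 4 = arrays s 4" if "?fr s'" for s'
    using same_outside_regs[OF that] same_outside_arrays[OF that] rg by auto
  \<comment> \<open>The inner loops are charged to the queries answered so far, of which there are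
    at most \<open>n\<close> in all.\<close>
  define N where "N = (\<lambda>v. int (card {x \<in> B. 1 \<le> key x \<and> key x < v}))"
  have N_le: "N v \<le> n" for v unfolding N_def by (rule cardB)
  define base where "base = (\<lambda>s'::state. ?fr s' \<and> (\<forall>x. 1 \<le> x \<and> x \<le> n \<longrightarrow> arrays s' 3 x = D x) \<and> arrays s' 3 (n + 1) = 0)"
  have base_reg: "base (set_reg r x s')" if "base s'" "r \<in> {4} \<union> {20..26}" for r x s'
    using that unfolding base_def by (auto simp: wp_simps)
  have base_cell: "base (set_cell m p x s')" if "base s'" "m \<in> {12,13,17}" for m p x s'
    using that unfolding base_def by (auto simp: wp_simps)
  have base_fr: "?fr s'" if "base s'" for s' using that unfolding base_def by blast
  let ?C = "rank_in n D sg"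
  have Cb: "0 \<le> ?C i v" "?C i v \<le> n" for i v using rank_in_bounds[of n] n_pos by auto
  have sumb: "\<bar>sgn * (\<Sum>x\<in>S. ?C (sg x) (key x))\<bar> \<le> (n + 2) * (n + 2)" if "S \<subseteq> B" for S
  proof -
    have "(\<Sum>x\<in>S. ?C (sg x) (key x)) \<le> (\<Sum>x\<in>S. n)" by (rule sum_mono) (use Cb in auto)
    also have "\<dots> = int (card S) * n" by simp
    also have "\<dots> \<le> n * n"
    proof (rule mult_right_mono)
      have "card S \<le> card {1..n}" by (rule card_mono) (use that in \<open>auto simp: B_def\<close>)
      then show "int (card S) \<le> n" using n_pos by simp
    qed (use n_pos in simp)
    also have "\<dots> \<le> (n + 2) * (n + 2)" by (rule mult_mono) (use n_pos in auto)
    finally have "(\<Sum>x\<in>S. ?C (sg x) (key x)) \<le> (n + 2) * (n + 2)" .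
    moreover have "0 \<le> (\<Sum>x\<in>S. ?C (sg x) (key x))" by (rule sum_nonneg) (use Cb in auto)
    ultimately show ?thesis using f by auto
  qed
  define I1 where "I1 = (\<lambda>s' t'. base s' \<and> regs s' 4 = acc \<and> 0 \<le> regs s' 20 \<and> regs s' 20 \<le> n + 2 \<and>
     (\<forall>v. 0 \<le> v \<and> v < regs s' 20 \<longrightarrow> arrays s' 12 v = 0 \<and> arrays s' 17 v = 0) \<and>
     t' \<ge> t - 2 - 4 * regs s' 20)"
  define I2 where "I2 = (\<lambda>s' t'. base s' \<and> regs s' 4 = acc \<and> 1 \<le> regs s' 20 \<and> regs s' 20 \<le> n + 1 \<and>
     (\<forall>v. 0 \<le> v \<and> v \<le> n + 1 \<longrightarrow> arrays s' 17 v = 0) \<and>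
     buckets (window (arrays s' 12)) (arrays s' 13) key {x \<in> B. x < regs s' 20} \<and>
     t' \<ge> t - 4 * n - 14 - 18 * (regs s' 20 - 1))"
  define I3 where "I3 = (\<lambda>s' t'. base s' \<and> 1 \<le> regs s' 20 \<and> regs s' 20 \<le> n + 2 \<and>
     (\<forall>i. 1 \<le> i \<and> i \<le> n \<longrightarrow> arrays s' 17 i = ?C i (regs s' 20 - 1)) \<and>
     buckets (window (arrays s' 12)) (arrays s' 13) key B \<and>
     regs s' 4 = acc + sgn * (\<Sum>x\<in>{x \<in> B. 1 \<le> key x \<and> key x < regs s' 20}. ?C (sg x) (key x)) \<and>
     t' \<ge> t - 22 * n - 16 - 10 * (regs s' 20 - 1) - 5 * N (regs s' 20))"
  let ?b1 = "seqs [Store 12 (Reg 20) (Const 0), Store 17 (Reg 20) (Const 0), inc 20]"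
  let ?b2 = "seqs [Load 22 3 (Reg 20),
       If LessEq (Const 0) (Reg 22) (seqs [kp, Load 23 12 (Reg 21), Store 13 (Reg 20) (Reg 23),
         Store 12 (Reg 21) (Reg 20)]) Skip, inc 20]"
  let ?inner = "seqs [Load 23 4 (Reg 21), Load 24 17 (Reg 23),
         Op 4 f (Reg 4) (Reg 24), Load 21 13 (Reg 21)]"
  let ?b3 = "seqs [Load 22 3 (Reg 20),
       If Equal (Reg 22) (Const (-1)) (seqs [Load 23 4 (Reg 20), Load 24 17 (Reg 23), inc 24,
         Store 17 (Reg 23) (Reg 24)]) Skip,
       Load 21 12 (Reg 20), While NotEqual (Reg 21) (Const 0) ?inner, inc 20]"
  have step1: "wp w ?b1 I1 s' (t' - 1)"
    if I: "I1 s' t'" and cc: "compare_val LessEq (operand_val w s' (Reg 20)) (operand_val w s' (Reg 1))" for s' t'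
  proof -
    have b: "base s'" using I unfolding I1_def by blast
    have v: "0 \<le> regs s' 20" "regs s' 20 \<le> n + 1" using I cc frD[OF base_fr[OF b]] unfolding I1_def by auto
    have ws: "wrap w (regs s' 20 + 1) = regs s' 20 + 1" using X_linear v n_pos by (intro wrap_id) auto
    show ?thesis using I v unfolding I1_def
      by (auto simp: wp_Seq wp_Store wp_Op regs_set_reg arrays_set_reg regs_set_cell arrays_set_cell ws base_reg base_cell)
  qed
  have step2: "wp w ?b2 I2 s' (t' - 1)"
    if I: "I2 s' t'" and cc: "compare_val LessEq (operand_val w s' (Reg 20)) (operand_val w s' (Reg 0))" for s' t'
  proof -
    define x where "x = regs s' 20"
    have b: "base s'" and x1: "1 \<le> x" and r4: "regs s' 4 = acc"
      and z: "\<forall>v. 0 \<le> v \<and> v \<le> n + 1 \<longrightarrow> arrays s' 17 v = 0"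
      and bk: "buckets (window (arrays s' 12)) (arrays s' 13) key {y \<in> B. y < x}"
      and t': "t' \<ge> t - 4 * n - 14 - 18 * (x - 1)"
      using I unfolding I2_def x_def by auto
    note fr = base_fr[OF b]
    have x: "x \<le> n" using cc frD[OF fr] unfolding x_def by simp
    have Dx: "arrays s' 3 x = D x" using b x1 x unfolding base_def by auto
    have ws: "wrap w (x + 1) = x + 1" using X_linear x x1 by (intro wrap_id) auto
    show ?thesis
    proof (cases "0 \<le> D x")
      case False
      then have "{y \<in> B. y < x + 1} = {y \<in> B. y < x}" unfolding B_def by (auto simp: order_le_less)
      then show ?thesis using False b x1 x r4 z bk t' Dx unfolding I2_def x_def[symmetric]
        by (simp add: wp_simps ws base_reg x_def[symmetric])
    next
      case True
      have xB: "insert x {y \<in> B. y < x} = {y \<in> B. y < x + 1}" using True x1 x unfolding B_def by (auto simp: order_le_less)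
      have kx: "0 \<le> key x" "key x \<le> n + 1" using key True x1 x by auto
      have "wp w kp (wp w (seqs [Load 23 12 (Reg 21), Store 13 (Reg 20) (Reg 23), Store 12 (Reg 21) (Reg 20)]) (wp w (inc 20) I2))
         (set_reg 22 (D x) s') (t' - 3)"
      proof (rule kp[of _ x])
        show "?fr (set_reg 22 (D x) s')" using fr by (simp add: wp_simps)
        show "regs (set_reg 22 (D x) s') 20 = x" by (simp add: regs_set_reg x_def)
        fix s2 t2 assume fr2: "same_outside {21, 25} {} (set_reg 22 (D x) s') s2" and k: "regs s2 21 = key x"
          and t2: "t' - 3 - 10 \<le> t2"
        have a2: "arrays s2 = arrays s'" using same_outside_arrays[OF fr2] by (auto simp: arrays_set_reg)
        have r2: "regs s2 20 = x" "regs s2 4 = acc" using same_outside_regs[OF fr2] r4 x_def by (auto simp: regs_set_reg)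
        have "?fr (set_reg 22 (D x) s')" using fr by (simp add: wp_simps)
        then have "?fr s2" by (rule same_outside_trans[OF _ fr2]) auto
        then have b2: "base s2" using b a2 unfolding base_def by simp
        define s3 where "s3 = set_reg 20 (x + 1) (set_cell 12 (key x) x (set_cell 13 x (arrays s' 12 (key x))
            (set_reg 23 (arrays s' 12 (key x)) s2)))"
        have b3: "base s3" unfolding s3_def using b2 by (intro base_reg base_cell) auto
        have wk: "window (arrays s' 12) (key x) = arrays s' 12 (key x)" using kx unfolding window_def by simp
        have "buckets ((window (arrays s' 12))(key x := x)) ((arrays s' 13)(x := window (arrays s' 12) (key x))) key (insert x {y \<in> B. y < x})"
          by (rule buckets_push[OF bk]) (use x1 in auto)
        then have bk3: "buckets (window (arrays s3 12)) (arrays s3 13) key {y \<in> B. y < x + 1}"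
          unfolding xB wk window_upd[OF kx, symmetric]
          by (simp add: s3_def arrays_set_reg arrays_set_cell a2 del: fun_upd_apply)
        have "I2 s3 (t2 - 4)" unfolding I2_def using b3 bk3 t2 t' x1 x z r2 kx a2
          by (simp add: s3_def wp_simps)
        then show "wp w (seqs [Load 23 12 (Reg 21), Store 13 (Reg 20) (Reg 23), Store 12 (Reg 21) (Reg 20)]) (wp w (inc 20) I2) s2 t2"
          unfolding s3_def using r2 k a2 ws
          by (simp add: wp_Seq wp_Load wp_Store wp_Op regs_set_reg arrays_set_reg regs_set_cell arrays_set_cell)
      qed (use x1 x True in \<open>auto simp: regs_set_reg\<close>)
      then show ?thesis using True Dx
        by (simp add: wp_Seq wp_Load wp_If regs_set_reg x_def[symmetric])
    qed
  qed
  have step3: "wp w ?b3 I3 s' (t' - 1)"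
    if I: "I3 s' t'" and cc: "compare_val LessEq (operand_val w s' (Reg 20)) (operand_val w s' (Reg 1))" for s' t'
  proof -
    define v where "v = regs s' 20"
    let ?A = "\<Sum>x\<in>{x \<in> B. 1 \<le> key x \<and> key x < v}. ?C (sg x) (key x)"
    have b: "base s'" and v1: "1 \<le> v" and r4: "regs s' 4 = acc + sgn * ?A"
      and cnt: "\<forall>i. 1 \<le> i \<and> i \<le> n \<longrightarrow> arrays s' 17 i = ?C i (v - 1)"
      and bk: "buckets (window (arrays s' 12)) (arrays s' 13) key B"
      and t': "t' \<ge> t - 22 * n - 16 - 10 * (v - 1) - 5 * N (v)"
      using I unfolding I3_def v_def by auto
    note fr = base_fr[OF b]
    have v: "v \<le> n + 1" using cc frD[OF fr] unfolding v_def by simp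
    obtain bs where bs: "chain (arrays s' 13) (window (arrays s' 12) v) bs" "distinct bs" "set bs = {x \<in> B. key x = v}"
      using buckets_chain[OF bk] by blast
    have ch: "chain (arrays s' 13) (arrays s' 12 v) bs" using bs(1) v v1 unfolding window_def by simp
    have split: "{x \<in> B. 1 \<le> key x \<and> key x < v + 1} = {x \<in> B. 1 \<le> key x \<and> key x < v} \<union> set bs"
      unfolding bs(3) using v1 by auto
    have disj: "{x \<in> B. 1 \<le> key x \<and> key x < v} \<inter> set bs = {}" unfolding bs(3) by auto
    have fin1: "finite {x \<in> B. 1 \<le> key x \<and> key x < v}" using finB by simp
    have cs: "N (v + 1) = N (v) + int (length bs)"
      unfolding N_def split by (subst card_Un_disjoint[OF fin1 _ disj]) (simp_all add: distinct_card[OF bs(2)])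
    have tl: "t' - 10 - 5 * int (length bs) \<ge> t - 22 * n - 16 - 10 * v - 5 * N (v + 1)"
      unfolding cs using t' by (simp add: algebra_simps)
    define K where "K = (\<lambda>s2 t2. \<exists>ds cs'. bs = ds @ cs' \<and> chain (arrays s' 13) (regs s2 21) cs' \<and>
       base s2 \<and> regs s2 20 = v \<and> arrays s2 13 = arrays s' 13 \<and> arrays s2 12 = arrays s' 12 \<and>
       (\<forall>i. 1 \<le> i \<and> i \<le> n \<longrightarrow> arrays s2 17 i = ?C i v) \<and>
       regs s2 4 = acc + sgn * (?A + (\<Sum>x\<in>set ds. ?C (sg x) (key x))) \<and>
       t2 \<ge> t' - 8 - 5 * int (length ds))"
    have stepK: "wp w ?inner K s2 (t2 - 1)"
      if Kk: "K s2 t2" and c2: "compare_val NotEqual (operand_val w s2 (Reg 21)) (operand_val w s2 (Const 0))" for s2 t2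
    proof -
      obtain ds cs' where dc: "bs = ds @ cs'" "chain (arrays s' 13) (regs s2 21) cs'"
        and b2: "base s2" and r2: "regs s2 20 = v" and a2: "arrays s2 13 = arrays s' 13" "arrays s2 12 = arrays s' 12"
        and cnt2: "\<forall>i. 1 \<le> i \<and> i \<le> n \<longrightarrow> arrays s2 17 i = ?C i v"
        and r24: "regs s2 4 = acc + sgn * (?A + (\<Sum>x\<in>set ds. ?C (sg x) (key x)))"
        and t2: "t2 \<ge> t' - 8 - 5 * int (length ds)"
        using Kk[unfolded K_def] by (elim exE conjE) rule
      obtain x cs2 where cs2: "cs' = x # cs2" using dc c2 by (cases cs') auto
      have rx: "regs s2 21 = x" "chain (arrays s' 13) (arrays s' 13 x) cs2" using dc cs2 by auto
      have xB: "x \<in> B" "key x = v" using bs(3) dc cs2 by auto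
      have xd: "x \<notin> set ds" using bs(2) dc cs2 by auto
      have xr: "1 \<le> x" "x \<le> n" using xB unfolding B_def by auto
      have sx: "arrays s2 4 x = sg x" "1 \<le> sg x" "sg x \<le> n" using sg xr frD[OF base_fr[OF b2]] by auto
      have c17: "arrays s2 17 (sg x) = ?C (sg x) v" using cnt2 sx by auto
      let ?new = "acc + sgn * (?A + (\<Sum>x\<in>set (ds @ [x]). ?C (sg x) (key x)))"
      have sm: "(\<Sum>x\<in>set (ds @ [x]). ?C (sg x) (key x)) = (\<Sum>x\<in>set ds. ?C (sg x) (key x)) + ?C (sg x) v"
        using xd xB by simp
      have eqn: "?A + (\<Sum>x\<in>set (ds @ [x]). ?C (sg x) (key x)) = (\<Sum>x\<in>{x \<in> B. 1 \<le> key x \<and> key x < v} \<union> set (ds @ [x]). ?C (sg x) (key x))"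
        by (rule sum.union_disjoint[symmetric]) (use fin1 disj dc cs2 in auto)
      have sub: "{x \<in> B. 1 \<le> key x \<and> key x < v} \<union> set (ds @ [x]) \<subseteq> B" using bs(3) dc cs2 by auto
      have "\<bar>sgn * (?A + (\<Sum>x\<in>set (ds @ [x]). ?C (sg x) (key x)))\<bar> \<le> (n + 2) * (n + 2)"
        unfolding eqn by (rule sumb[OF sub])
      then have nb: "\<bar>?new\<bar> \<le> 21 * (n + 2) * (n + 2)" using acc(2) by (simp add: algebra_simps)
      have X21: "21 * (n + 2) * (n + 2) < X"
      proof -
        have "0 \<le> (n + 2) * (n + 2)" using n_pos by auto
        then show ?thesis using X_big by linarith
      qed
      have wnew: "wrap w ?new = ?new" by (rule wrap_id) (use nb X21 in linarith)+
      have upd: "wrap w (binop_val f (acc + sgn * (?A + (\<Sum>x\<in>set ds. ?C (sg x) (key x)))) (?C (sg x) v)) = ?new"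
        using f wnew sm by (auto simp: algebra_simps)
      define s3 where "s3 = set_reg 21 (arrays s' 13 x) (set_reg 4 ?new (set_reg 24 (?C (sg x) v) (set_reg 23 (sg x) s2)))"
      have b3: "base s3" unfolding s3_def using b2 by (intro base_reg) auto
      have "K s3 (t2 - 5)" unfolding K_def
      proof (intro exI conjI)
        show "bs = (ds @ [x]) @ cs2" using dc cs2 by simp
        show "chain (arrays s' 13) (regs s3 21) cs2" using rx by (simp add: s3_def regs_set_reg)
        show "base s3" by (rule b3)
        show "t' - 8 - 5 * int (length (ds @ [x])) \<le> t2 - 5" using t2 by simp
        show "regs s3 4 = ?new" by (simp add: s3_def regs_set_reg)
      qed (use r2 a2 cnt2 in \<open>auto simp: s3_def regs_set_reg arrays_set_reg\<close>)
      then show ?thesis unfolding s3_def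
        by (simp add: wp_Seq wp_Load wp_Op regs_set_reg arrays_set_reg rx(1) sx(1) c17 r24 upd a2)
    qed
    have posK: "0 \<le> t2" if "K s2 t2" for s2 t2
    proof -
      from that[unfolded K_def] obtain ds cs' where "bs = ds @ cs'" "t2 \<ge> t' - 8 - 5 * int (length ds)"
        by (elim conjE exE)
      then have "t2 \<ge> t' - 8 - 5 * int (length bs)" by simp
      then show ?thesis using tl N_le[of "v + 1"] t v n_pos by linarith
    qed
    have finK: "wp w (inc 20) I3 s2 (t2 - 1)"
      if Kk: "K s2 t2" and c2: "\<not> compare_val NotEqual (operand_val w s2 (Reg 21)) (operand_val w s2 (Const 0))" for s2 t2
    proof -
      obtain ds cs' where dc: "bs = ds @ cs'" "chain (arrays s' 13) (regs s2 21) cs'"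
        and b2: "base s2" and r2: "regs s2 20 = v" and a2: "arrays s2 13 = arrays s' 13" "arrays s2 12 = arrays s' 12"
        and cnt2: "\<forall>i. 1 \<le> i \<and> i \<le> n \<longrightarrow> arrays s2 17 i = ?C i v"
        and r24: "regs s2 4 = acc + sgn * (?A + (\<Sum>x\<in>set ds. ?C (sg x) (key x)))"
        and t2: "t2 \<ge> t' - 8 - 5 * int (length ds)"
        using Kk[unfolded K_def] by (elim exE conjE) rule
      have "cs' = []" using dc c2 by (cases cs') auto
      then have ds: "ds = bs" using dc by simp
      have A2: "?A + (\<Sum>x\<in>set ds. ?C (sg x) (key x)) = (\<Sum>x\<in>{x \<in> B. 1 \<le> key x \<and> key x < v + 1}. ?C (sg x) (key x))"
        unfolding split ds by (rule sum.union_disjoint[symmetric]) (use fin1 disj in auto)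
      have ws: "wrap w (v + 1) = v + 1" using X_linear v v1 n_pos by (intro wrap_id) auto
      have tt: "t2 - 2 \<ge> t - 22 * n - 16 - 10 * v - 5 * N (v + 1)"
        using t2[unfolded ds] tl by linarith
      have "I3 (set_reg 20 (v + 1) s2) (t2 - 2)" unfolding I3_def
        using b2 bk a2 cnt2 r24[unfolded A2] tt v v1
        by (simp add: regs_set_reg arrays_set_reg base_reg)
      then show ?thesis by (simp add: wp_Op r2 ws)
    qed
    let ?tail = "seqs [Load 21 12 (Reg 20), While NotEqual (Reg 21) (Const 0) ?inner, inc 20]"
    have start: "wp w ?tail I3 s2 t2"
      if b2: "base s2" and r2: "regs s2 20 = v" "regs s2 4 = acc + sgn * ?A"
        and a2: "arrays s2 13 = arrays s' 13" "arrays s2 12 = arrays s' 12"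
        and cnt2: "\<forall>i. 1 \<le> i \<and> i \<le> n \<longrightarrow> arrays s2 17 i = ?C i v" and t2: "t2 \<ge> t' - 7" for s2 t2
    proof -
      have "K (set_reg 21 (arrays s' 12 v) s2) (t2 - 1)" unfolding K_def
        by (intro exI[of _ "[]"] exI[of _ bs]) (use that ch in \<open>simp add: regs_set_reg arrays_set_reg base_reg\<close>)
      then have "wp w (While NotEqual (Reg 21) (Const 0) ?inner) (wp w (inc 20) I3) (set_reg 21 (arrays s' 12 v) s2) (t2 - 1)"
      proof (rule wp_While[where I=K])
        show "0 \<le> t2" if "K s2 t2" for s2 t2 using posK[OF that] .
        show "wp w ?inner K s2 (t2 - 1)" if "K s2 t2" "compare_val NotEqual (operand_val w s2 (Reg 21)) (operand_val w s2 (Const 0))" for s2 t2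
          using stepK[OF that] .
        show "wp w (inc 20) I3 s2 (t2 - 1)" if "K s2 t2" "\<not> compare_val NotEqual (operand_val w s2 (Reg 21)) (operand_val w s2 (Const 0))" for s2 t2
          using finK[OF that] .
      qed
      then show ?thesis unfolding seqs.simps wp_Seq by (subst wp_Load) (simp add: r2 a2)
    qed
    \<comment> \<open>Keys reach \<open>n + 1\<close>, so the sweep visits that place too; the 0
      stored there keeps it from being taken for an element of a separator.\<close>
    have D3: "arrays s' 3 v = -1 \<longleftrightarrow> v \<le> n \<and> D v = -1"
      using b v v1 unfolding base_def by (cases "v = n + 1") auto
    show ?thesis
    proof (cases "v \<le> n \<and> D v = -1")
      case False
      have "?C i v = ?C i (v - 1)" for i using rank_in_step[of n D sg i v] False by auto
      then have "wp w ?tail I3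
          (set_reg 22 (arrays s' 3 v) s') (t' - 4)"
        by (intro start) (use b r4 cnt in \<open>auto simp: base_reg regs_set_reg arrays_set_reg v_def\<close>)
      then show ?thesis using False D3
        by (auto simp: wp_Seq wp_Load[of w 22] wp_If wp_Skip regs_set_reg v_def[symmetric])
    next
      case True
      have sv: "arrays s' 4 v = sg v" "1 \<le> sg v" "sg v \<le> n" using sg[of v] v1 True frD[OF fr] by auto
      have C2: "?C i v = ?C i (v - 1) + (if sg v = i then 1 else 0)" for i using rank_in_step[of n D sg i v] True v1 by auto
      have c17: "arrays s' 17 (sg v) = ?C (sg v) (v - 1)" using cnt sv by auto
      have ws: "wrap w (?C (sg v) (v - 1) + 1) = ?C (sg v) v"
        unfolding C2[of "sg v"] using X_linear Cb[of "sg v" "v - 1"] n_pos by (simp add: wrap_id)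
      define s2 where "s2 = set_cell 17 (sg v) (?C (sg v) v) (set_reg 24 (?C (sg v) v) (set_reg 24 (?C (sg v) (v - 1)) (set_reg 23 (sg v) (set_reg 22 (- 1) s'))))"
      have "wp w ?tail I3 s2 (t' - 7)"
      proof (rule start)
        show "base s2" unfolding s2_def using b by (intro base_cell base_reg) auto
        show "\<forall>i. 1 \<le> i \<and> i \<le> n \<longrightarrow> arrays s2 17 i = ?C i v"
          using cnt C2 by (auto simp: s2_def arrays_set_cell arrays_set_reg)
      qed (use r4 in \<open>simp_all add: s2_def regs_set_cell arrays_set_cell regs_set_reg arrays_set_reg v_def\<close>)
      then show ?thesis using True D3 sv(1) c17 ws unfolding s2_def
        by (simp add: wp_Seq wp_Load[of w 22] wp_Load[of w 23] wp_Load[of w 24] wp_Op[of w 24] wp_Store wp_If regs_set_reg arrays_set_reg v_def[symmetric])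
    qed
  qed
  have fin3: "Q s' (t' - 1)"
    if I: "I3 s' t'" and cc: "\<not> compare_val LessEq (operand_val w s' (Reg 20)) (operand_val w s' (Reg 1))" for s' t'
  proof -
    have b: "base s'" using I unfolding I3_def by blast
    have v: "regs s' 20 = n + 2" using I cc frD[OF base_fr[OF b]] unfolding I3_def by auto
    \<comment> \<open>Bucket 0 is never visited; its queries have rank zero.\<close>
    have sum0: "(\<Sum>x\<in>{x \<in> B. 1 \<le> key x \<and> key x < n + 2}. ?C (sg x) (key x)) = (\<Sum>x\<in>B. ?C (sg x) (key x))"
    proof (rule sum.mono_neutral_left[OF finB])
      show "\<forall>i\<in>B - {x \<in> B. 1 \<le> key x \<and> key x < n + 2}. ?C (sg i) (key i) = 0"
      proof
        fix i assume i: "i \<in> B - {x \<in> B. 1 \<le> key x \<and> key x < n + 2}"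
        then have "key i = 0" using key[of i] unfolding B_def by force
        then show "?C (sg i) (key i) = 0" by (simp add: rank_in_zero)
      qed
    qed auto
    have r4: "regs s' 4 = acc + sgn * (\<Sum>x\<in>B. ?C (sg x) (key x))" using I v sum0 unfolding I3_def by simp
    have "t' \<ge> t - 22 * n - 16 - 10 * (n + 2 - 1) - 5 * N (n + 2)"
      using I v unfolding I3_def by auto
    moreover have "5 * N (n + 2) \<le> 5 * n" using N_le[of "n + 2"] by simp
    ultimately have t': "t' \<ge> t - 37 * n - 26" by (simp add: algebra_simps)
    show ?thesis
    proof (rule Q)
      show "?fr s'" by (rule base_fr[OF b])
      show "arrays s' 3 x = D x" if "1 \<le> x" "x \<le> n" for x using b that unfolding base_def by blast
      show "regs s' 4 = acc + sgn * (\<Sum>x\<in>{x. 1 \<le> x \<and> x \<le> n \<and> 0 \<le> D x}. ?C (sg x) (key x))"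
        using r4 unfolding B_def .
      show "t - (50 * n + 50) \<le> t' - 1" using t' n_pos by linarith
    qed
  qed
  have fin2: "wp w (seqs [Move 20 (Const 1), While LessEq (Reg 20) (Reg 1) ?b3]) Q s' (t' - 1)"
    if I: "I2 s' t'" and cc: "\<not> compare_val LessEq (operand_val w s' (Reg 20)) (operand_val w s' (Reg 0))" for s' t'
  proof -
    have b: "base s'" using I unfolding I2_def by blast
    have v: "regs s' 20 = n + 1" using I cc frD[OF base_fr[OF b]] unfolding I2_def by auto
    have Beq: "{x \<in> B. x \<le> n} = B" unfolding B_def by auto
    have emp: "{x \<in> B. 1 \<le> key x \<and> key x < 1} = {}" by auto
    have "I3 (set_reg 20 1 s') (t' - 2)"
      unfolding I3_def using I v n_pos b unfolding I2_def
      by (simp add: regs_set_reg arrays_set_reg base_reg Beq emp rank_in_zero N_def)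
    then have "wp w (While LessEq (Reg 20) (Reg 1) ?b3) Q (set_reg 20 1 s') (t' - 2)"
    proof (rule wp_While[where I=I3])
      show "0 \<le> t2" if "I3 s2 t2" for s2 t2
      proof -
        have "regs s2 20 \<le> n + 2" "t2 \<ge> t - 22 * n - 16 - 10 * (regs s2 20 - 1) - 5 * N (regs s2 20)"
          using that unfolding I3_def by blast+
        moreover have "5 * N (regs s2 20) \<le> 5 * n" using N_le[of "regs s2 20"] by simp
        ultimately show ?thesis using t n_pos by (simp add: algebra_simps)
      qed
    qed (use step3 fin3 in blast)+
    then show ?thesis by (simp add: wp_Seq wp_Move)
  qed
  have fin1: "wp w (seqs [Move 20 (Const 1), While LessEq (Reg 20) (Reg 0) ?b2,
      Move 20 (Const 1), While LessEq (Reg 20) (Reg 1) ?b3]) Q s' (t' - 1)"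
    if I: "I1 s' t'" and cc: "\<not> compare_val LessEq (operand_val w s' (Reg 20)) (operand_val w s' (Reg 1))" for s' t'
  proof -
    have b: "base s'" using I unfolding I1_def by blast
    have v: "regs s' 20 = n + 2" using I cc frD[OF base_fr[OF b]] unfolding I1_def by auto
    have emp: "{x \<in> B. x < 1} = {}" unfolding B_def by auto
    have win: "window (arrays s' 12) = (\<lambda>_. 0)" using I v unfolding I1_def window_def by auto
    have "buckets (window (arrays s' 12)) (arrays s' 13) key {}" unfolding win by (rule buckets_empty)
    then have "I2 (set_reg 20 1 s') (t' - 2)"
      unfolding I2_def using I v n_pos b unfolding I1_def
      by (simp add: regs_set_reg arrays_set_reg base_reg emp)
    then have "wp w (While LessEq (Reg 20) (Reg 0) ?b2) (wp w (seqs [Move 20 (Const 1), While LessEq (Reg 20) (Reg 1) ?b3]) Q) (set_reg 20 1 s') (t' - 2)"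
    proof (rule wp_While[where I=I2])
      show "0 \<le> t2" if "I2 s2 t2" for s2 t2 using that t n_pos unfolding I2_def by auto
    qed (use step2 fin2 in blast)+
    then show ?thesis unfolding seqs.simps wp_Seq by (subst wp_Move) simp
  qed
  have b0: "base (set_reg 20 0 (set_cell 3 (n + 1) 0 s))"
    unfolding base_def using D by (simp add: wp_simps)
  have "I1 (set_reg 20 0 (set_cell 3 (n + 1) 0 s)) (t - 2)"
    unfolding I1_def using b0 acc n_pos by (simp add: regs_set_reg regs_set_cell)
  then have "wp w (While LessEq (Reg 20) (Reg 1) ?b1) (wp w (seqs [Move 20 (Const 1), While LessEq (Reg 20) (Reg 0) ?b2,
      Move 20 (Const 1), While LessEq (Reg 20) (Reg 1) ?b3]) Q) (set_reg 20 0 (set_cell 3 (n + 1) 0 s)) (t - 2)"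
  proof (rule wp_While[where I=I1])
    show "0 \<le> t2" if "I1 s2 t2" for s2 t2 using that t n_pos unfolding I1_def by auto
  qed (use step1 fin1 in blast)+
  then show ?thesis unfolding rank_pass_def seqs.simps wp_Seq
    by (subst wp_Store, subst wp_Move) (simp add: rg del: One_nat_def)
qed

end

section \<open>Counting pairs level by level\<close>

text \<open>A pair stands for a square at \<open>i\<close> with its second half at \<open>j\<close>,
  and \<open>th\<close> singles out first occurrences. The relation behind \<open>th\<close> may
  differ from the one behind \<open>e\<close>.\<close>

definition good_pairs :: "int \<Rightarrow> (int \<Rightarrow> int \<Rightarrow> int) \<Rightarrow> (int \<Rightarrow> int) \<Rightarrow> (int \<times> int) set" where
  "good_pairs n e th = {(i, j). 1 \<le> i \<and> i < j \<and> j \<le> n \<and> agree n e (j - i) i j \<and> th i \<le> j}"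

lemma finite_good_pairs: "finite (good_pairs n e th)"
  by (rule finite_subset[of _ "{1..n} \<times> {1..n}"]) (auto simp: good_pairs_def)

text \<open>The four key programs yield the interval ends of \<open>crossing_count\<close>: upper
  and lower end for the partners before \<open>b\<close>, then upper and lower end for those after
  it.\<close>

definition key_last :: "prog" where "key_last = Load 21 11 (Reg 20)"

definition key_before :: "prog" where
  "key_before = seqs [Load 25 11 (Reg 20), Op 21 Sub (Reg 20) (Reg 22), dec 21,
     If Less (Reg 21) (Const 0) (Move 21 (Const 0)) Skip,
     If Less (Reg 25) (Reg 21) (Move 21 (Reg 25)) Skip]"

definition key_reach :: "prog" where "key_reach = Op 21 Add (Reg 20) (Reg 22)"

definition key_start :: "prog" where
  "key_start = seqs [Load 25 10 (Reg 20), dec 25, Op 21 Add (Reg 20) (Reg 22),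
     If Less (Reg 25) (Reg 21) (Move 21 (Reg 25)) Skip]"

definition count_crossing :: prog where
  "count_crossing = seqs [rank_pass key_last Add, rank_pass key_before Sub,
     rank_pass key_reach Add, rank_pass key_start Sub]"

definition count_levels :: prog where
  "count_levels = seqs [Move 4 (Const 0), Move 5 (Const 1),
     While Equal (Reg 5) (Const 1) (seqs [split_all, count_crossing])]"

section \<open>The pairs that one round separates\<close>

context split_level begin

text \<open>The partners of \<open>b\<close> in the separator are the elements of \<open>{b - D b - 1<..M b}\<close> before \<open>b\<close>, and of
  \<open>{th b - 1<..b + D b}\<close> after \<open>b\<close>. The minima turn empty intervals into zero contributions.\<close>

lemma crossing_count:
  assumes th: "\<And>i. 1 \<le> i \<Longrightarrow> i \<le> n \<Longrightarrow> i < th i"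
    and M: "\<And>x i. 1 \<le> x \<Longrightarrow> x \<le> n \<Longrightarrow> 1 \<le> i \<Longrightarrow> i \<le> n \<Longrightarrow> i \<le> M x \<longleftrightarrow> th i \<le> x"
  defines "B \<equiv> {x. 1 \<le> x \<and> x \<le> n \<and> 0 \<le> D x}"
  defines "R \<equiv> rank_in n D sg"
  shows "int (card {(i, j) \<in> good_pairs n e th. \<not> grouped n ord' c' i j}) =
     int (card {(i, j) \<in> good_pairs n e th. \<not> grouped n ord c i j}) +
     (\<Sum>b\<in>B. R (sg b) (M b)) - (\<Sum>b\<in>B. R (sg b) (min (max 0 (b - D b - 1)) (M b))) +
     (\<Sum>b\<in>B. R (sg b) (b + D b)) - (\<Sum>b\<in>B. R (sg b) (min (th b - 1) (b + D b)))"
proof -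
  let ?G = "good_pairs n e th"
  let ?U = "{(i, j) \<in> ?G. \<not> grouped n ord c i j}" and ?U' = "{(i, j) \<in> ?G. \<not> grouped n ord' c' i j}"
  let ?L = "{(i, j) \<in> ?G. sg i = sg j \<and> D i = -1 \<and> D j \<noteq> -1}"
  let ?H = "{(i, j) \<in> ?G. sg i = sg j \<and> D i \<noteq> -1 \<and> D j = -1}"
  have Grange: "1 \<le> i \<and> i \<le> n \<and> 1 \<le> j \<and> j \<le> n" if "(i, j) \<in> ?G" for i j
    using that unfolding good_pairs_def by auto
  have fin: "finite A" if "A \<subseteq> ?G" for A using finite_good_pairs that finite_subset by blast
  have finB: "finite B" unfolding B_def by (rule finite_subset[of _ "{1..n}"]) auto
  \<comment> \<open>A round separates a pair exactly if both members were in one segment and one of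
    them lies in its separator. The two new sets differ in whether this member is the first or the
    second.\<close>
  have U': "?U' = ?U \<union> (?L \<union> ?H)"
    using Grange same_group_iff new_group_iff by blast
  have "?U \<inter> (?L \<union> ?H) = {}" using Grange same_group_iff by blast
  then have c1: "card ?U' = card ?U + card (?L \<union> ?H)"
    unfolding U' by (intro card_Un_disjoint fin) auto
  have c2: "card (?L \<union> ?H) = card ?L + card ?H"
    by (intro card_Un_disjoint fin) auto
  let ?X = "\<lambda>b. {a. 1 \<le> a \<and> a \<le> n \<and> D a = -1 \<and> sg a = sg b \<and> max 0 (b - D b - 1) < a \<and> a \<le> M b}"
  let ?Y = "\<lambda>b. {a. 1 \<le> a \<and> a \<le> n \<and> D a = -1 \<and> sg a = sg b \<and> th b - 1 < a \<and> a \<le> b + D b}"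
  have finX: "finite (?X b)" "finite (?Y b)" for b by (rule finite_subset[of _ "{1..n}"], auto)+
  have LX: "?L = (\<lambda>(b, a). (a, b)) ` (SIGMA b:B. ?X b)"
  proof (intro equalityI subsetI)
    fix p assume "p \<in> ?L"
    then obtain a b where p: "p = (a, b)" "(a, b) \<in> ?G" "sg a = sg b" "D a = -1" "D b \<noteq> -1" by auto
    have r: "1 \<le> a" "a < b" "b \<le> n" "ev (b - a) a b" "th a \<le> b" using p(2) unfolding good_pairs_def by auto
    \<comment> \<open>By \<open>cross_ev\<close> the square condition depends on \<open>b\<close>
      only through \<open>D b\<close>, and \<open>M\<close> inverts the threshold, so both
      conditions become bounds on \<open>a\<close>.\<close>
    have "b - a \<le> D b" using cross_ev[of a b "b - a"] r p by auto
    moreover have "a \<le> M b" using M[of b a] r by auto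
    moreover have "0 \<le> D b" using D_range[of b] r p by auto
    ultimately have "(b, a) \<in> (SIGMA b:B. ?X b)" using r p unfolding B_def by auto
    then show "p \<in> (\<lambda>(b, a). (a, b)) ` (SIGMA b:B. ?X b)" using p(1) by force
  next
    fix p assume "p \<in> (\<lambda>(b, a). (a, b)) ` (SIGMA b:B. ?X b)"
    then obtain a b where p: "p = (a, b)" "b \<in> B" "a \<in> ?X b" by auto
    then have r: "1 \<le> b" "b \<le> n" "0 \<le> D b" "1 \<le> a" "a \<le> n" "D a = -1" "sg a = sg b" "b - D b - 1 < a" "a \<le> M b"
      unfolding B_def by auto
    have tb: "th a \<le> b" using M[of b a] r by auto
    \<comment> \<open>The order of the pair follows from \<open>a < th a \<le> b\<close>.\<close>
    then have ab: "a < b" using th[of a] r by auto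
    have "ev (b - a) a b" using cross_ev[of a b "b - a"] r ab by auto
    then show "p \<in> ?L" using p r tb ab unfolding good_pairs_def by auto
  qed
  have HY: "?H = (SIGMA b:B. ?Y b)"
  proof (intro equalityI subsetI)
    fix p assume "p \<in> ?H"
    then obtain a b where p: "p = (b, a)" "(b, a) \<in> ?G" "sg b = sg a" "D a = -1" "D b \<noteq> -1" by auto
    have r: "1 \<le> b" "b < a" "a \<le> n" "ev (a - b) b a" "th b \<le> a" using p(2) unfolding good_pairs_def by auto
    have "a - b \<le> D b" using cross_ev[of a b "a - b"] ev_sym r p by auto
    moreover have "0 \<le> D b" using D_range[of b] r p by auto
    ultimately show "p \<in> (SIGMA b:B. ?Y b)" using r p unfolding B_def by auto
  next
    fix p assume "p \<in> (SIGMA b:B. ?Y b)"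
    then obtain a b where p: "p = (b, a)" "b \<in> B" "a \<in> ?Y b" by auto
    then have r: "1 \<le> b" "b \<le> n" "0 \<le> D b" "1 \<le> a" "a \<le> n" "D a = -1" "sg a = sg b" "th b \<le> a" "a \<le> b + D b"
      unfolding B_def by auto
    have ab: "b < a" using th[of b] r by auto
    have "ev (a - b) b a" using cross_ev[of a b "a - b"] ev_sym r ab by auto
    then show "p \<in> ?H" using p r ab unfolding good_pairs_def by auto
  qed
  have "card ?L = card (SIGMA b:B. ?X b)"
    unfolding LX by (rule card_image) (auto simp: inj_on_def)
  then have cL: "int (card ?L) = (\<Sum>b\<in>B. int (card (?X b)))" using finB finX by simp
  have cH: "int (card ?H) = (\<Sum>b\<in>B. int (card (?Y b)))" unfolding HY using finB finX by simp
  have X: "int (card (?X b)) = R (sg b) (M b) - R (sg b) (min (max 0 (b - D b - 1)) (M b))" for b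
    unfolding R_def by (rule rank_in_interval)
  have Y: "int (card (?Y b)) = R (sg b) (b + D b) - R (sg b) (min (th b - 1) (b + D b))" for b
    unfolding R_def by (rule rank_in_interval)
  show ?thesis unfolding c1 c2 of_nat_add cL cH X Y sum_subtractf by simp
qed

end

section \<open>Running the rounds\<close>

context ram_matching begin

context
  fixes th M :: "int \<Rightarrow> int"
  assumes th: "\<And>i. 1 \<le> i \<Longrightarrow> i \<le> n \<Longrightarrow> i < th i \<and> th i \<le> n + 2"
    and M: "\<And>x i. 1 \<le> x \<Longrightarrow> x \<le> n \<Longrightarrow> 1 \<le> i \<Longrightarrow> i \<le> n \<Longrightarrow> i \<le> M x \<longleftrightarrow> th i \<le> x"
    and M_range: "\<And>x. 1 \<le> x \<Longrightarrow> x \<le> n \<Longrightarrow> 0 \<le> M x \<and> M x \<le> n"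
begin

lemma wp_count_crossing:
  assumes sl: "split_level n e ord c ord' c' D sg"
    and ar: "arrays s 3 = D" "arrays s 4 = sg"
      "\<And>x. 1 \<le> x \<Longrightarrow> x \<le> n \<Longrightarrow> arrays s 10 x = th x \<and> arrays s 11 x = M x"
    and rg: "regs s 0 = n" "regs s 1 = n + 1"
      "regs s 4 = int (card {(i, j) \<in> good_pairs n e th. \<not> grouped n ord c i j})"
    and t: "200 * n + 200 \<le> t"
    and Q: "\<And>s' t'. same_outside ({4} \<union> {20..26}) {3,12,13,17} s s' \<Longrightarrow>
      regs s' 4 = int (card {(i, j) \<in> good_pairs n e th. \<not> grouped n ord' c' i j}) \<Longrightarrow>
      t' \<ge> t - (200 * n + 200) \<Longrightarrow> Q s' t'"
  shows "wp w count_crossing Q s t"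
proof -
  interpret split_level n e ord c ord' c' D sg by (rule sl)
  let ?fr = "same_outside ({4} \<union> {20..26}) {3,12,13,17}"
  define B where "B = {x. 1 \<le> x \<and> x \<le> n \<and> 0 \<le> D x}"
  define S where "S = (\<lambda>key. \<Sum>x\<in>B. rank_in n D sg (sg x) (key x))"
  define acc where "acc = regs s 4"
  define k1 where "k1 = M"
  define k2 where "k2 = (\<lambda>b. min (max 0 (b - D b - 1)) (M b))"
  define k3 where "k3 = (\<lambda>b. b + D b)"
  define k4 where "k4 = (\<lambda>b. min (th b - 1) (b + D b))"
  have cc: "int (card {(i, j) \<in> good_pairs n e th. \<not> grouped n ord' c' i j}) = acc + S k1 - S k2 + S k3 - S k4"
    using crossing_count[of th M] th M unfolding acc_def rg S_def B_def k1_def k2_def k3_def k4_def by simp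
  have Db: "0 \<le> D x \<Longrightarrow> x + D x \<le> n + 1" if "1 \<le> x" "x \<le> n" for x using D_bound that by auto
  have Sb: "0 \<le> S k" "S k \<le> (n + 2) * (n + 2)" for k
  proof -
    have rb: "0 \<le> rank_in n D sg i v" "rank_in n D sg i v \<le> n" for i v using rank_in_bounds[of n] n_pos by auto
    show "0 \<le> S k" unfolding S_def by (rule sum_nonneg) (use rb in auto)
    have "S k \<le> (\<Sum>x\<in>B. n)" unfolding S_def by (rule sum_mono) (use rb in auto)
    also have "\<dots> = int (card B) * n" by simp
    also have "\<dots> \<le> n * n"
    proof (rule mult_right_mono)
      have "card B \<le> card {1..n}" by (rule card_mono) (auto simp: B_def)
      then show "int (card B) \<le> n" using n_pos by simp
    qed (use n_pos in simp)
    also have "\<dots> \<le> (n + 2) * (n + 2)" by (rule mult_mono) (use n_pos in auto)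
    finally show "S k \<le> (n + 2) * (n + 2)" .
  qed
  have accb: "0 \<le> acc" "acc \<le> (n + 2) * (n + 2)"
  proof -
    show "0 \<le> acc" unfolding acc_def rg by simp
    have "card {(i, j) \<in> good_pairs n e th. \<not> grouped n ord c i j} \<le> card ({1..n} \<times> {1..n})"
      by (rule card_mono) (auto simp: good_pairs_def)
    also have "\<dots> = nat n * nat n" by simp
    finally have "acc \<le> int (nat n * nat n)" unfolding acc_def rg by linarith
    also have "\<dots> = n * n" using n_pos by simp
    also have "\<dots> \<le> (n + 2) * (n + 2)" by (rule mult_mono) (use n_pos in auto)
    finally show "acc \<le> (n + 2) * (n + 2)" .
  qed
  \<comment> \<open>The count so far and each of the four sums are at most
    \<open>(n + 2) * (n + 2)\<close>, so five times this value bounds every intermediate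
    result.\<close>
  have bnd: "\<bar>a\<bar> \<le> 20 * (n + 2) * (n + 2)" if "\<bar>a\<bar> \<le> 5 * ((n + 2) * (n + 2))" for a
  proof -
    have "0 \<le> (n + 2) * (n + 2)" using n_pos by auto
    then show ?thesis using that by linarith
  qed
  have frs: "arrays s1 10 x = th x" "arrays s1 11 x = M x" if "?fr s s1" "1 \<le> x" "x \<le> n" for s1 x
    using same_outside_arrays[OF that(1)] ar(3)[OF that(2,3)] by auto
  have kp1: "wp w key_last Q1 s1 t1"
    if "?fr s s1" "regs s1 20 = x" "regs s1 22 = D x" "1 \<le> x" "x \<le> n" "0 \<le> D x"
      and q: "\<And>s2 t2. same_outside {21,25} {} s1 s2 \<Longrightarrow> regs s2 21 = k1 x \<Longrightarrow> t2 \<ge> t1 - 10 \<Longrightarrow> Q1 s2 t2"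
    for x s1 t1 Q1
    unfolding key_last_def using frs[OF that(1,4,5)] that(2) unfolding k1_def
    by (simp add: wp_Load) (rule q, auto simp: wp_simps k1_def)
  have kp2: "wp w key_before Q1 s1 t1"
    if f: "?fr s s1" "regs s1 20 = x" "regs s1 22 = D x" "1 \<le> x" "x \<le> n" "0 \<le> D x"
      and q: "\<And>s2 t2. same_outside {21,25} {} s1 s2 \<Longrightarrow> regs s2 21 = k2 x \<Longrightarrow> t2 \<ge> t1 - 10 \<Longrightarrow> Q1 s2 t2"
    for x s1 t1 Q1
  proof -
    have ws: "wrap w (x - D x) = x - D x" "wrap w (x - D x - 1) = x - D x - 1"
      using X_linear Db[OF f(4,5,6)] f by (auto intro!: wrap_id)
    show ?thesis unfolding key_before_def using frs[OF f(1,4,5)] f(2,3) ws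
      by (auto simp: wp_simps intro!: q) (auto simp: k2_def)
  qed
  have kp3: "wp w key_reach Q1 s1 t1"
    if f: "?fr s s1" "regs s1 20 = x" "regs s1 22 = D x" "1 \<le> x" "x \<le> n" "0 \<le> D x"
      and q: "\<And>s2 t2. same_outside {21,25} {} s1 s2 \<Longrightarrow> regs s2 21 = k3 x \<Longrightarrow> t2 \<ge> t1 - 10 \<Longrightarrow> Q1 s2 t2"
    for x s1 t1 Q1
  proof -
    have ws: "wrap w (x + D x) = x + D x"
      using X_linear Db[OF f(4,5,6)] f by (auto intro!: wrap_id)
    show ?thesis unfolding key_reach_def using f(2,3) ws
      by (auto simp: wp_simps k3_def intro!: q)
  qed
  have kp4: "wp w key_start Q1 s1 t1"
    if f: "?fr s s1" "regs s1 20 = x" "regs s1 22 = D x" "1 \<le> x" "x \<le> n" "0 \<le> D x"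
      and q: "\<And>s2 t2. same_outside {21,25} {} s1 s2 \<Longrightarrow> regs s2 21 = k4 x \<Longrightarrow> t2 \<ge> t1 - 10 \<Longrightarrow> Q1 s2 t2"
    for x s1 t1 Q1
  proof -
    have ws: "wrap w (x + D x) = x + D x" "wrap w (th x - 1) = th x - 1"
      using X_linear Db[OF f(4,5,6)] f th[OF f(4,5)] by (auto intro!: wrap_id)
    show ?thesis unfolding key_start_def using frs[OF f(1,4,5)] f(2,3) ws
      by (auto simp: wp_simps intro!: q) (auto simp: k4_def)
  qed
  have kr: "0 \<le> k1 x \<and> k1 x \<le> n + 1" "0 \<le> k2 x \<and> k2 x \<le> n + 1" "0 \<le> k3 x \<and> k3 x \<le> n + 1" "0 \<le> k4 x \<and> k4 x \<le> n + 1"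
    if "1 \<le> x" "x \<le> n" "0 \<le> D x" for x
    using M_range[OF that(1,2)] th[OF that(1,2)] Db[OF that] that unfolding k1_def k2_def k3_def k4_def by auto
  have pass: "wp w (rank_pass kp f) Q1 s1 t1"
    if fr: "?fr s s1" and D1: "\<And>x. 1 \<le> x \<Longrightarrow> x \<le> n \<Longrightarrow> arrays s1 3 x = D x"
      and a: "regs s1 4 = ac" "\<bar>ac\<bar> \<le> 5 * ((n + 2) * (n + 2))"
      and f: "f = Add \<and> sn = 1 \<or> f = Sub \<and> sn = -1"
      and kr: "\<And>x. 1 \<le> x \<Longrightarrow> x \<le> n \<Longrightarrow> 0 \<le> D x \<Longrightarrow> 0 \<le> k x \<and> k x \<le> n + 1"
      and kp: "\<And>x s1 t1 Q1. ?fr s s1 \<Longrightarrow> regs s1 20 = x \<Longrightarrow>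
        regs s1 22 = D x \<Longrightarrow> 1 \<le> x \<Longrightarrow> x \<le> n \<Longrightarrow> 0 \<le> D x \<Longrightarrow>
        (\<And>s2 t2. same_outside {21,25} {} s1 s2 \<Longrightarrow> regs s2 21 = k x \<Longrightarrow> t2 \<ge> t1 - 10 \<Longrightarrow> Q1 s2 t2) \<Longrightarrow>
        wp w kp Q1 s1 t1"
      and t1: "50 * n + 50 \<le> t1"
      and q: "\<And>s2 t2. ?fr s s2 \<Longrightarrow> (\<And>x. 1 \<le> x \<Longrightarrow> x \<le> n \<Longrightarrow> arrays s2 3 x = D x) \<Longrightarrow>
        regs s2 4 = ac + sn * S k \<Longrightarrow> t2 \<ge> t1 - (50 * n + 50) \<Longrightarrow> Q1 s2 t2"
    for kp f Q1 s1 t1 ac sn k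
  proof (rule wp_rank_pass[where D=D and sg=sg and key=k and acc=ac and sgn=sn, OF _ _ f D1])
    show "regs s1 0 = n" "regs s1 1 = n + 1" using same_outside_regs[OF fr] rg by auto
    show "\<And>x. 1 \<le> x \<Longrightarrow> x \<le> n \<Longrightarrow> D x = -1 \<or> 0 \<le> D x" using D_range by blast
    show "\<And>x. 1 \<le> x \<Longrightarrow> x \<le> n \<Longrightarrow> arrays s1 4 x = sg x \<and> 1 \<le> sg x \<and> sg x \<le> n"
      using same_outside_arrays[OF fr, of 4] ar sg_range by auto
    show "regs s1 4 = ac" by (rule a)
    show "\<bar>ac\<bar> \<le> 20 * (n + 2) * (n + 2)" by (rule bnd[OF a(2)])
    show "\<And>x. 1 \<le> x \<Longrightarrow> x \<le> n \<Longrightarrow> 0 \<le> D x \<Longrightarrow> 0 \<le> k x \<and> k x \<le> n + 1" by (rule kr)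
    show "50 * n + 50 \<le> t1" by (rule t1)
    fix x s2 t2 and Q2 :: "state \<Rightarrow> int \<Rightarrow> bool"
    assume h: "?fr s1 s2" "regs s2 20 = x" "regs s2 22 = D x" "1 \<le> x" "x \<le> n" "0 \<le> D x"
      "\<And>s3 t3. same_outside {21,25} {} s2 s3 \<Longrightarrow> regs s3 21 = k x \<Longrightarrow> t3 \<ge> t2 - 10 \<Longrightarrow> Q2 s3 t3"
    have "?fr s s2" by (rule same_outside_trans[OF fr h(1)]) auto
    then show "wp w kp Q2 s2 t2" using kp h(2-7) by blast
  next
    fix s2 t2
    assume h: "?fr s1 s2" "\<And>x. 1 \<le> x \<Longrightarrow> x \<le> n \<Longrightarrow> arrays s2 3 x = D x"
      "regs s2 4 = ac + sn * (\<Sum>x\<in>{x. 1 \<le> x \<and> x \<le> n \<and> 0 \<le> D x}. rank_in n D sg (sg x) (k x))"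
      "t2 \<ge> t1 - (50 * n + 50)"
    have "?fr s s2" by (rule same_outside_trans[OF fr h(1)]) auto
    then show "Q1 s2 t2" by (rule q) (use h in \<open>auto simp: S_def B_def\<close>)
  qed
  show ?thesis unfolding count_crossing_def seqs.simps wp_Seq
  proof (rule pass[where ?ac1=acc and ?sn1=1 and ?k1=k1])
    fix s1 t1 assume f1: "?fr s s1" "\<And>x. 1 \<le> x \<Longrightarrow> x \<le> n \<Longrightarrow> arrays s1 3 x = D x" and a1: "regs s1 4 = acc + 1 * S k1"
      and t1: "t1 \<ge> t - (50 * n + 50)"
    show "wp w (rank_pass key_before Sub) (wp w (rank_pass key_reach Add) (wp w (rank_pass key_start Sub) Q)) s1 t1"
    proof (rule pass[where ?ac1="acc + 1 * S k1" and ?sn1="-1" and ?k1=k2, OF f1 a1])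
      fix s2 t2 assume f2: "?fr s s2" "\<And>x. 1 \<le> x \<Longrightarrow> x \<le> n \<Longrightarrow> arrays s2 3 x = D x"
        and a2: "regs s2 4 = acc + 1 * S k1 + -1 * S k2" and t2: "t2 \<ge> t1 - (50 * n + 50)"
      show "wp w (rank_pass key_reach Add) (wp w (rank_pass key_start Sub) Q) s2 t2"
      proof (rule pass[where ?ac1="acc + 1 * S k1 + -1 * S k2" and ?sn1=1 and ?k1=k3, OF f2 a2])
        fix s3 t3 assume f3: "?fr s s3" "\<And>x. 1 \<le> x \<Longrightarrow> x \<le> n \<Longrightarrow> arrays s3 3 x = D x"
          and a3: "regs s3 4 = acc + 1 * S k1 + -1 * S k2 + 1 * S k3" and t3: "t3 \<ge> t2 - (50 * n + 50)"
        show "wp w (rank_pass key_start Sub) Q s3 t3"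
        proof (rule pass[where ?ac1="acc + 1 * S k1 + -1 * S k2 + 1 * S k3" and ?sn1="-1" and ?k1=k4, OF f3 a3])
          fix s4 t4 assume f4: "?fr s s4" and a4: "regs s4 4 = acc + 1 * S k1 + -1 * S k2 + 1 * S k3 + -1 * S k4"
            and t4: "t4 \<ge> t3 - (50 * n + 50)"
          show "Q s4 t4" by (rule Q[OF f4]) (use a4 cc t4 t3 t2 t1 in auto)
        qed (use accb Sb[of k1] Sb[of k2] Sb[of k3] t t1 t2 t3 n_pos kr kp4 in \<open>auto simp: abs_le_iff\<close>)
      qed (use accb Sb[of k1] Sb[of k2] t t1 t2 n_pos kr kp3 in \<open>auto simp: abs_le_iff\<close>)
    qed (use accb Sb[of k1] t t1 n_pos kr kp2 in \<open>auto simp: abs_le_iff\<close>)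
  qed (use accb t n_pos kr kp1 ar same_outside_refl in \<open>auto simp: abs_le_iff acc_def\<close>)
qed

text \<open>Register 4 counts the good pairs whose members are already in different segments: none
  at the start, where there is one segment, and all when every segment is a single element. After
  \<open>2 * Lg\<close> rounds no segment has two elements; one more round is allowed for noticing
  this.\<close>

lemma wp_count_levels:
  assumes ok: "segments_ok (arrays s 1) (arrays s 2)" and one: "\<And>p. 2 \<le> p \<Longrightarrow> p \<le> n \<Longrightarrow> 0 \<le> arrays s 2 p"
    and ar: "\<And>x. 1 \<le> x \<Longrightarrow> x \<le> n \<Longrightarrow> arrays s 10 x = th x \<and> arrays s 11 x = M x"
    and rg: "regs s 0 = n" "regs s 1 = n + 1"
    and Lg: "n < 2 ^ nat Lg" "1 \<le> Lg"
    and t: "520 * n * (2 * Lg + 1) + 10 \<le> t"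
    and Q: "\<And>s' t'. same_outside ({4,5} \<union> {20..35}) ({1,2,3,4} \<union> {12..17}) s s' \<Longrightarrow>
      regs s' 4 = int (card (good_pairs n e th)) \<Longrightarrow> t' \<ge> t - (520 * n * (2 * Lg + 1) + 10) \<Longrightarrow> Q s' t'"
  shows "wp w count_levels Q s t"
proof -
  let ?fr = "same_outside ({4,5} \<union> {20..35}) ({1,2,3,4} \<union> {12..17}) s"
  define small where "small = (\<lambda>(c :: int \<Rightarrow> int) (k :: nat). \<forall>p q. 1 \<le> p \<and> p < q \<and> q \<le> n \<and> (\<forall>r. p < r \<and> r \<le> q \<longrightarrow> 0 \<le> c r) \<longrightarrow>
      (q - p + 1) * 3 ^ k \<le> 2 ^ k * n)"
  define U where "U = (\<lambda>s'::state. {(i, j) \<in> good_pairs n e th. \<not> grouped n (arrays s' 1) (arrays s' 2) i j})"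
  define I where "I = (\<lambda>s' t'. ?fr s' \<and> segments_ok (arrays s' 1) (arrays s' 2) \<and> regs s' 4 = int (card (U s')) \<and>
     (regs s' 5 = 0 \<and> (\<forall>p. 1 \<le> p \<and> p \<le> n \<longrightarrow> arrays s' 2 p = -1) \<and> t' \<ge> t - 3 - 520 * n * (2 * Lg + 1) \<or>
      regs s' 5 = 1 \<and> (\<exists>k::nat. int k \<le> 2 * Lg \<and> small (arrays s' 2) k \<and> t' \<ge> t - 3 - 520 * n * int k)))"
  have step: "wp w (seqs [split_all, count_crossing]) I s1 (t1 - 1)"
    if I: "I s1 t1" and c: "compare_val Equal (operand_val w s1 (Reg 5)) (operand_val w s1 (Const 1))" for s1 t1
  proof -
    have fr: "?fr s1" and ok1: "segments_ok (arrays s1 1) (arrays s1 2)" and r4: "regs s1 4 = int (card (U s1))"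
      using I unfolding I_def by auto
    obtain k where k: "int k \<le> 2 * Lg" "small (arrays s1 2) k" "t1 \<ge> t - 3 - 520 * n * int k"
      using I c unfolding I_def by auto
    have "520 * n * int k \<le> 520 * n * (2 * Lg)" using k n_pos by (intro mult_left_mono) auto
    moreover have "520 * n * (2 * Lg + 1) = 520 * n * (2 * Lg) + 520 * n" by (simp add: algebra_simps)
    ultimately have t1: "290 * n + 220 + 1 \<le> t1" using k(3) t n_pos by linarith
    have r1: "regs s1 0 = n" "regs s1 1 = n + 1" using same_outside_regs[OF fr] rg by auto
    show ?thesis unfolding seqs.simps wp_Seq
    proof (rule wp_split_all[OF ok1 r1])
      show "90 * n + 20 \<le> t1 - 1" using t1 n_pos by simp
      fix s2 t2
      assume f2: "same_outside ({5} \<union> {20..35}) {1, 2, 3, 4, 15, 16} s1 s2"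
        and sl: "split_level n e (arrays s1 1) (arrays s1 2) (arrays s2 1) (arrays s2 2) (arrays s2 3) (arrays s2 4)"
        and any: "regs s2 5 = 0 \<or> regs s2 5 = 1" "regs s2 5 = 0 \<longleftrightarrow> (\<forall>p. 1 \<le> p \<and> p \<le> n \<longrightarrow> arrays s1 2 p = -1)"
        and t2: "t2 \<ge> t1 - 1 - (90 * n + 20)"
      interpret sl: split_level n e "arrays s1 1" "arrays s1 2" "arrays s2 1" "arrays s2 2" "arrays s2 3" "arrays s2 4" by (rule sl)
      have fr2: "?fr s2" by (rule same_outside_trans[OF fr f2]) auto
      show "wp w count_crossing I s2 t2"
      proof (rule wp_count_crossing[OF sl refl refl])
        show "arrays s2 10 x = th x \<and> arrays s2 11 x = M x" if "1 \<le> x" "x \<le> n" for x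
          using same_outside_arrays[OF fr2] ar[OF that] by auto
        show "regs s2 0 = n" "regs s2 1 = n + 1" using same_outside_regs[OF fr2] rg by auto
        show "regs s2 4 = int (card {(i, j) \<in> good_pairs n e th. \<not> grouped n (arrays s1 1) (arrays s1 2) i j})"
          using same_outside_regs[OF f2, of 4] r4 unfolding U_def by simp
        show "200 * n + 200 \<le> t2" using t2 t1 n_pos by simp
        fix s3 t3
        assume f3: "same_outside ({4} \<union> {20..26}) {3, 12, 13, 17} s2 s3"
          and a3: "regs s3 4 = int (card {(i, j) \<in> good_pairs n e th. \<not> grouped n (arrays s2 1) (arrays s2 2) i j})"
          and t3: "t3 \<ge> t2 - (200 * n + 200)"
        have fr3: "?fr s3" by (rule same_outside_trans[OF fr2 f3]) auto
        have ar3: "arrays s3 1 = arrays s2 1" "arrays s3 2 = arrays s2 2" and r5: "regs s3 5 = regs s2 5"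
          using same_outside_arrays[OF f3] same_outside_regs[OF f3] by auto
        have t3': "t3 \<ge> t - 3 - 520 * n * (int k + 1)" using t3 t2 k(3) n_pos by (simp add: algebra_simps)
        have u3: "regs s3 4 = int (card (U s3))" using a3 unfolding U_def ar3 .
        show "I s3 t3"
        proof (cases "regs s2 5 = 0")
          case True
          then have "\<forall>p. 1 \<le> p \<and> p \<le> n \<longrightarrow> arrays s1 2 p = -1" using any by blast
          \<comment> \<open>The flag refers to the segments before this round; single elements stay
            single.\<close>
          then have "arrays s3 2 p = -1" if "1 \<le> p" "p \<le> n" for p
            using sl.c'_start[of p] sl.segments_ok' that unfolding ar3 segments_ok_def by force
          moreover have "t3 \<ge> t - 3 - 520 * n * (2 * Lg + 1)"
          proof -
            have "520 * n * (int k + 1) \<le> 520 * n * (2 * Lg + 1)" using k n_pos by (intro mult_left_mono) auto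
            then show ?thesis using t3' by linarith
          qed
          ultimately show ?thesis unfolding I_def using fr3 u3 True r5 sl.segments_ok' ar3 by auto
        next
          case False
          then have r1: "regs s3 5 = 1" using any r5 by auto
          obtain p where p: "1 \<le> p" "p \<le> n" "arrays s1 2 p \<noteq> -1" using any False by blast
          then have p0: "0 \<le> arrays s1 2 p" "2 \<le> p"
            using ok1 unfolding segments_ok_def by (force, cases "p = 1") (auto simp: segments_ok_def)
          have two: "2 * 3 ^ k \<le> 2 ^ k * n"
          proof -
            have "\<forall>r. p - 1 < r \<and> r \<le> p \<longrightarrow> 0 \<le> arrays s1 2 r"
            proof (intro allI impI)
              fix r assume "p - 1 < r \<and> r \<le> p"
              then have "r = p" by simp
              then show "0 \<le> arrays s1 2 r" using p0 by simp
            qed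
            then have "(p - (p - 1) + 1) * 3 ^ k \<le> 2 ^ k * n"
              using k(2) p p0 unfolding small_def by (metis add.commute add_le_cancel_left diff_ge_0_iff_ge diff_less int_one_le_iff_zero_less le_diff_eq less_numeral_extra(1) one_add_one order_refl zle_diff1_eq)
            then show ?thesis by simp
          qed
          \<comment> \<open>A segment of two elements after \<open>2 * Lg\<close> rounds would give
            \<open>2 * 9 ^ nat Lg \<le> 4 ^ nat Lg * n\<close>, but \<open>n < 2 ^ nat Lg\<close>
            makes the right side smaller than \<open>8 ^ nat Lg\<close>.\<close>
          have "k < nat (2 * Lg)"
          proof (rule ccontr)
            assume "\<not> k < nat (2 * Lg)"
            then have kk: "k = 2 * nat Lg" using k(1) by linarith
            have "(2::int) * 9 ^ nat Lg \<le> 4 ^ nat Lg * n" using two unfolding kk by (simp add: power_mult)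
            also have "\<dots> \<le> 4 ^ nat Lg * 2 ^ nat Lg" using Lg(1) by (intro mult_left_mono) auto
            also have "\<dots> = (8::int) ^ nat Lg" by (simp add: power_mult_distrib[symmetric])
            also have "\<dots> \<le> 9 ^ nat Lg" by (intro power_mono) auto
            finally show False by (simp add: not_le)
          qed
          then have k1: "int (Suc k) \<le> 2 * Lg" by linarith
          have "small (arrays s3 2) (Suc k)" unfolding small_def ar3
          proof (intro allI impI, elim conjE)
            fix p q assume h: "1 \<le> p" "p < q" "q \<le> n" "\<forall>r. p < r \<and> r \<le> q \<longrightarrow> 0 \<le> arrays s2 2 r"
            show "(q - p + 1) * 3 ^ Suc k \<le> 2 ^ Suc k * n"
              by (rule sl.shrink) (use h k(2) in \<open>auto simp: small_def\<close>)
          qed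
          then show ?thesis unfolding I_def using fr3 u3 r1 sl.segments_ok' ar3 k1 t3'
            by (auto intro!: exI[of _ "Suc k"] simp: algebra_simps)
        qed
      qed
    qed
  qed
  have fin: "Q s' (t' - 1)"
    if I: "I s' t'" and c: "\<not> compare_val Equal (operand_val w s' (Reg 5)) (operand_val w s' (Const 1))" for s' t'
  proof -
    have sing: "\<And>p. 1 \<le> p \<Longrightarrow> p \<le> n \<Longrightarrow> arrays s' 2 p = -1" and t': "t' \<ge> t - 3 - 520 * n * (2 * Lg + 1)"
      using I c unfolding I_def by auto
    have "U s' = good_pairs n e th"
    proof -
      have "\<not> grouped n (arrays s' 1) (arrays s' 2) i j" if "i < j" for i j
        using grouped_singletons[of n "arrays s' 2" "arrays s' 1" i j] sing that by auto
      then show ?thesis unfolding U_def good_pairs_def by auto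
    qed
    then show ?thesis using I t' unfolding I_def by (intro Q) auto
  qed
  have pos: "0 \<le> t'" if I: "I s' t'" for s' t'
  proof -
    have "t' \<ge> t - 3 - 520 * n * (2 * Lg + 1)"
    proof (cases "regs s' 5 = 0")
      case True then show ?thesis using I unfolding I_def by auto
    next
      case False
      then obtain k where k: "int k \<le> 2 * Lg" "t' \<ge> t - 3 - 520 * n * int k" using I unfolding I_def by auto
      have "520 * n * int k \<le> 520 * n * (2 * Lg + 1)" using k n_pos by (intro mult_left_mono) auto
      then show ?thesis using k by linarith
    qed
    then show ?thesis using t by linarith
  qed
  have I0: "I (set_reg 5 1 (set_reg 4 0 s)) (t - 2)"
  proof -
    have bij: "bij_betw (arrays s 1) {1..n} {1..n}" using ok unfolding segments_ok_def by blast
    have all: "grouped n (arrays s 1) (arrays s 2) x y" if xy: "1 \<le> x" "x \<le> n" "1 \<le> y" "y \<le> n" for x y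
    proof -
      have "x \<in> arrays s 1 ` {1..n}" "y \<in> arrays s 1 ` {1..n}" using bij xy unfolding bij_betw_def by auto
      then obtain p q where "1 \<le> p" "p \<le> n" "arrays s 1 p = x" "1 \<le> q" "q \<le> n" "arrays s 1 q = y" by auto
      then show ?thesis unfolding grouped_def using one by (intro exI[of _ p] exI[of _ q]) auto
    qed
    have "U (set_reg 5 1 (set_reg 4 0 s)) = {}"
      unfolding U_def using all by (auto simp: good_pairs_def arrays_set_reg)
    moreover have "small (arrays s 2) 0" unfolding small_def by auto
    ultimately show ?thesis unfolding I_def using ok Lg
      by (auto simp: wp_simps intro!: exI[of _ 0])
  qed
  have "wp w (While Equal (Reg 5) (Const 1) (seqs [split_all, count_crossing])) Q (set_reg 5 1 (set_reg 4 0 s)) (t - 2)"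
    by (rule wp_While[where I=I]) (use I0 pos step fin in blast)+
  then show ?thesis unfolding count_levels_def by (simp add: wp_Seq wp_Move)
qed

end

end

section \<open>Oracles\<close>

text \<open>The given programs are relocated to the registers and arrays from 100 on, which the counting program
  only uses to pass the input, the queries and the answers.\<close>

fun shift_operand :: "operand \<Rightarrow> operand" where
  "shift_operand (Const x) = Const x"
| "shift_operand (Reg r) = Reg (r + 100)"

primrec shift :: "prog \<Rightarrow> prog" where
  "shift Skip = Skip"
| "shift (Move r a) = Move (r + 100) (shift_operand a)"
| "shift (Op r f a b) = Op (r + 100) f (shift_operand a) (shift_operand b)"
| "shift (Load r m a) = Load (r + 100) (m + 100) (shift_operand a)"
| "shift (Store m a b) = Store (m + 100) (shift_operand a) (shift_operand b)"
| "shift (Seq P Q) = Seq (shift P) (shift Q)"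
| "shift (If f a b P Q) = If f (shift_operand a) (shift_operand b) (shift P) (shift Q)"
| "shift (While f a b P) = While f (shift_operand a) (shift_operand b) (shift P)"

section \<open>Simulation of relocated programs\<close>

definition embedded :: "state \<Rightarrow> state \<Rightarrow> bool" where
  "embedded s S \<longleftrightarrow> (\<forall>r. regs S (r + 100) = regs s r) \<and> (\<forall>m. arrays S (m + 100) = arrays s m)"

lemma embedded_operand: "embedded s S \<Longrightarrow> operand_val w S (shift_operand a) = operand_val w s a"
  by (cases a) (auto simp: embedded_def)

lemma embedded_set_reg: "embedded s S \<Longrightarrow> embedded (set_reg r x s) (set_reg (r + 100) x S)"
  by (auto simp: embedded_def regs_set_reg arrays_set_reg)

lemma embedded_set_cell: "embedded s S \<Longrightarrow> embedded (set_cell m p x s) (set_cell (m + 100) p x S)"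
  by (auto simp: embedded_def regs_set_cell arrays_set_cell)

lemma embedded_low: "embedded s S \<Longrightarrow> same_outside {..<100} {..<100} S S' \<Longrightarrow> embedded s S'"
  by (auto simp: embedded_def same_outside_def)

lemma exec_shift:
  assumes "exec w P s k s'" "embedded s S"
  shows "\<exists>S'. exec w (shift P) S k S' \<and> embedded s' S' \<and> same_outside {100..} {100..} S S'"
  using assms
proof (induction arbitrary: S rule: exec.induct)
  case (Skip s)
  then show ?case using exec.Skip same_outside_refl by (metis shift.simps(1))
next
  case (Move r a s)
  have e: "exec w (shift (Move r a)) S 1 (set_reg (r + 100) (operand_val w S (shift_operand a)) S)"
    unfolding shift.simps by (rule exec.Move)
  show ?case
    by (intro exI conjI, rule e)
      (use Move in \<open>auto simp: embedded_operand embedded_set_reg embedded_set_cell regs_set_reg arrays_set_reg regs_set_cell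
         arrays_set_cell same_outside_refl intro!: same_outside_set_reg same_outside_set_cell\<close>)
next
  case (Op r f a b s)
  have e: "exec w (shift (Op r f a b)) S 1 (set_reg (r + 100) (wrap w (binop_val f (operand_val w S (shift_operand a)) (operand_val w S (shift_operand b)))) S)"
    unfolding shift.simps by (rule exec.Op)
  show ?case
    by (intro exI conjI, rule e)
      (use Op in \<open>auto simp: embedded_operand embedded_set_reg embedded_set_cell regs_set_reg arrays_set_reg regs_set_cell
         arrays_set_cell same_outside_refl intro!: same_outside_set_reg same_outside_set_cell\<close>)
next
  case (Load r m a s)
  have m: "arrays S (m + 100) = arrays s m" using Load by (simp add: embedded_def)
  have e: "exec w (shift (Load r m a)) S 1 (set_reg (r + 100) (arrays S (m + 100) (operand_val w S (shift_operand a))) S)"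
    unfolding shift.simps by (rule exec.Load)
  show ?case
    by (intro exI conjI, rule e)
      (use Load in \<open>auto simp: m embedded_operand embedded_set_reg embedded_set_cell regs_set_reg arrays_set_reg regs_set_cell
         arrays_set_cell same_outside_refl intro!: same_outside_set_reg same_outside_set_cell\<close>)
next
  case (Store m a b s)
  have e: "exec w (shift (Store m a b)) S 1 (set_cell (m + 100) (operand_val w S (shift_operand a)) (operand_val w S (shift_operand b)) S)"
    unfolding shift.simps by (rule exec.Store)
  show ?case
    by (intro exI conjI, rule e)
      (use Store in \<open>auto simp: embedded_operand embedded_set_reg embedded_set_cell regs_set_reg arrays_set_reg regs_set_cell
         arrays_set_cell same_outside_refl intro!: same_outside_set_reg same_outside_set_cell\<close>)
next
  case (Seq P s k s' Q l s'')
  obtain S1 where 1: "exec w (shift P) S k S1" "embedded s' S1" "same_outside {100..} {100..} S S1"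
    using Seq.IH(1) Seq.prems by blast
  obtain S2 where 2: "exec w (shift Q) S1 l S2" "embedded s'' S2" "same_outside {100..} {100..} S1 S2"
    using Seq.IH(2) 1 by blast
  have "same_outside {100..} {100..} S S2" by (rule same_outside_trans[OF 1(3) 2(3)]) auto
  moreover have "exec w (shift (Seq P Q)) S (k + l) S2" unfolding shift.simps by (rule exec.Seq[OF 1(1) 2(1)])
  ultimately show ?case using 2 by blast
next
  case (IfTrue f s a b P k s' Q)
  then obtain S1 where 1: "exec w (shift P) S k S1" "embedded s' S1" "same_outside {100..} {100..} S S1" by blast
  have "exec w (shift (If f a b P Q)) S (1 + k) S1" unfolding shift.simps
    by (rule exec.IfTrue) (use IfTrue.hyps IfTrue.prems 1 in \<open>simp_all add: embedded_operand\<close>)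
  then show ?case using 1 by blast
next
  case (IfFalse f s a b Q k s' P)
  then obtain S1 where 1: "exec w (shift Q) S k S1" "embedded s' S1" "same_outside {100..} {100..} S S1" by blast
  have "exec w (shift (If f a b P Q)) S (1 + k) S1" unfolding shift.simps
    by (rule exec.IfFalse) (use IfFalse.hyps IfFalse.prems 1 in \<open>simp_all add: embedded_operand\<close>)
  then show ?case using 1 by blast
next
  case (WhileTrue f s a b P k s' l s'')
  obtain S1 where 1: "exec w (shift P) S k S1" "embedded s' S1" "same_outside {100..} {100..} S S1"
    using WhileTrue by blast
  obtain S2 where 2: "exec w (shift (While f a b P)) S1 l S2" "embedded s'' S2" "same_outside {100..} {100..} S1 S2"
    using WhileTrue 1 by blast
  have so: "same_outside {100..} {100..} S S2" by (rule same_outside_trans[OF 1(3) 2(3)]) auto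
  have "exec w (shift (While f a b P)) S (1 + k + l) S2" unfolding shift.simps
    by (rule exec.WhileTrue) (use WhileTrue.hyps WhileTrue.prems 1 2 in \<open>simp_all add: embedded_operand\<close>)
  then show ?case using 2 so by blast
next
  case (WhileFalse f s a b P)
  have "exec w (shift (While f a b P)) S 1 S" unfolding shift.simps
    by (rule exec.WhileFalse) (use WhileFalse in \<open>simp_all add: embedded_operand\<close>)
  then show ?case using WhileFalse.prems same_outside_refl by blast
qed

section \<open>All contents are words, which bounds the encodings polynomially\<close>

definition in_words :: "nat \<Rightarrow> state \<Rightarrow> bool" where
  "in_words w s \<longleftrightarrow> (\<forall>r. - (2 ^ (w - 1)) \<le> regs s r \<and> regs s r < 2 ^ (w - 1)) \<and>
     (\<forall>m p. - (2 ^ (w - 1)) \<le> arrays s m p \<and> arrays s m p < 2 ^ (w - 1))"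

lemma wrap_in_words: "- (2 ^ (w - 1)) \<le> wrap w x \<and> wrap w x < 2 ^ (w - 1)"
  unfolding wrap_def using signed_take_bit_int_greater_eq_minus_exp signed_take_bit_int_less_exp by blast

lemma operand_in_words:
  "in_words w s \<Longrightarrow> - (2 ^ (w - 1)) \<le> operand_val w s a \<and> operand_val w s a < 2 ^ (w - 1)"
  by (cases a) (use wrap_in_words in \<open>auto simp: in_words_def\<close>)

lemma in_words_set_reg:
  "in_words w s \<Longrightarrow> - (2 ^ (w - 1)) \<le> x \<and> x < 2 ^ (w - 1) \<Longrightarrow> in_words w (set_reg r x s)"
  and in_words_set_cell:
  "in_words w s \<Longrightarrow> - (2 ^ (w - 1)) \<le> x \<and> x < 2 ^ (w - 1) \<Longrightarrow> in_words w (set_cell m p x s)"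
  by (auto simp: in_words_def regs_set_reg arrays_set_reg regs_set_cell arrays_set_cell)

lemma exec_in_words: "exec w P s k s' \<Longrightarrow> in_words w s \<Longrightarrow> in_words w s'"
proof (induction rule: exec.induct)
  case (Move r a s)
  then show ?case using operand_in_words in_words_set_reg by blast
next
  case (Op r f a b s)
  then show ?case using wrap_in_words in_words_set_reg by blast
next
  case (Load r m a s)
  then show ?case by (intro in_words_set_reg) (auto simp: in_words_def)
next
  case (Store m a b s)
  then show ?case using operand_in_words in_words_set_cell by blast
qed auto

text \<open>The admissible bound has two factors \<open>n + 2\<close> beyond the alphabet: one pays
  for the sign bit, the other makes room for the length and makes the bound on letters
  strict.\<close>

lemma in_words_input:
  assumes "over_integer_alphabet d T" "admissible_word_size c (length T) w" "d + 2 \<le> c"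
  shows "in_words w (input_state T)" "1 \<le> w" "int (length T) < 2 ^ (w - 1)"
proof -
  let ?n = "length T"
  have a: "(?n + 2) ^ c \<le> 2 ^ w" using assms(2) unfolding admissible_word_size_def .
  have "(?n + 2) ^ (d + 2) \<le> (?n + 2) ^ c" by (rule power_increasing) (use assms(3) in auto)
  then have b: "(?n + 2) ^ (d + 2) \<le> 2 ^ w" using a by linarith
  have "(2::nat) ^ 2 \<le> (?n + 2) ^ (d + 2)"
    by (rule order_trans[OF power_mono[of 2 "?n + 2" 2] power_increasing]) auto
  then have "(2::nat) ^ 2 \<le> 2 ^ w" using b by linarith
  then have "2 \<le> w" by (rule power_le_imp_le_exp[rotated]) simp
  then show w1: "1 \<le> w" by simp
  have pw: "(2::nat) ^ w = 2 * 2 ^ (w - 1)" using w1 by (cases w) auto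
  have "2 * (?n + 2) ^ (d + 1) \<le> (?n + 2) ^ (d + 2)" by simp
  then have c1: "(?n + 2) ^ (d + 1) \<le> 2 ^ (w - 1)" using b pw by linarith
  have "?n + 2 \<le> (?n + 2) ^ (d + 1)" by (rule self_le_power) auto
  then have "?n < 2 ^ (w - 1)" using c1 by linarith
  then show n3: "int ?n < 2 ^ (w - 1)" by (metis of_nat_less_iff of_nat_numeral of_nat_power)
  have "?n ^ d \<le> (?n + 2) ^ d" by (rule power_mono) auto
  also have "\<dots> < (?n + 2) ^ (d + 1)" by (rule power_strict_increasing) auto
  finally have nd: "?n ^ d < 2 ^ (w - 1)" using c1 by linarith
  have "int (T ! k) < 2 ^ (w - 1)" if "k < ?n" for k
  proof -
    have "T ! k \<in> {0..?n ^ d}" using assms(1) nth_mem[OF that] unfolding over_integer_alphabet_def by blast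
    then have "T ! k < 2 ^ (w - 1)" using nd by simp
    then show ?thesis by (metis of_nat_less_iff of_nat_numeral of_nat_power)
  qed
  moreover have "(0::int) < 2 ^ (w - 1)" "- (2 ^ (w - 1)) \<le> (0::int)" by auto
  moreover have "- (2 ^ (w - 1)) \<le> int x" for x by (rule order_trans[of _ 0]) auto
  ultimately show "in_words w (input_state T)" using n3 unfolding in_words_def input_state_def by auto
qed

lemma ready_in_words:
  assumes "ready w P Q T s" "in_words w (input_state T)" "int (length T) < 2 ^ (w - 1)"
  shows "in_words w s"
  using assms
proof (induction rule: ready.induct)
  case (preprocessed k s)
  then show ?case using exec_in_words by blast
next
  case (queried s i j k s')
  have nn: "- (2 ^ (w - 1)) \<le> int x" for x by (rule order_trans[of _ 0]) auto
  have "in_words w (query_state i j s)"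
    unfolding query_state_def using queried nn by (intro in_words_set_reg) auto
  then show ?case using exec_in_words queried by blast
qed

text \<open>The body of \<open>encoding_times\<close> with the programs and the constant as
  parameters, so that one choice of them serves both counting problems.\<close>

definition encoder :: "nat \<Rightarrow> (str \<Rightarrow> int) \<Rightarrow> prog \<Rightarrow> prog \<Rightarrow> nat \<Rightarrow> (nat \<Rightarrow> real) \<Rightarrow> (nat \<Rightarrow> real) \<Rightarrow> bool" where
  "encoder d E P Q c \<pi> \<rho> \<longleftrightarrow> d + 2 \<le> c \<and>
    (\<forall>w T. over_integer_alphabet d T \<and> admissible_word_size c (length T) w \<longrightarrow>
      (\<exists>k s. exec w P (input_state T) k s \<and> real k \<le> \<pi> (length T)) \<and>
      (\<forall>s i j. ready w P Q T s \<and> 1 \<le> i \<and> i \<le> j \<and> j \<le> length T \<longrightarrow>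
        (\<exists>k s'. exec w Q (query_state i j s) k s' \<and> real k \<le> \<rho> (length T) \<and>
          regs s' 0 = E (substr T i j))))"

lemma encoder_pre:
  assumes "encoder d E P Q c \<pi> \<rho>" "over_integer_alphabet d T" "admissible_word_size c (length T) w"
  shows "\<exists>k s. exec w P (input_state T) k s \<and> real k \<le> \<pi> (length T)"
  using assms unfolding encoder_def by blast

lemma encoder_query:
  assumes "encoder d E P Q c \<pi> \<rho>" "over_integer_alphabet d T" "admissible_word_size c (length T) w"
    "ready w P Q T s" "1 \<le> i" "i \<le> j" "j \<le> length T"
  shows "\<exists>k s'. exec w Q (query_state i j s) k s' \<and> real k \<le> \<rho> (length T) \<and> regs s' 0 = E (substr T i j)"
  using assms unfolding encoder_def by blast

lemma admissible_exists: "\<exists>w. admissible_word_size c n w"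
proof -
  have "(n + 2) ^ c < 2 ^ ((n + 2) ^ c)" by (rule less_exp)
  then show ?thesis unfolding admissible_word_size_def by (intro exI[of _ "(n + 2) ^ c"]) simp
qed

text \<open>Encodings do not depend on the word size, so they fit into the smallest admissible word.\<close>

lemma encoding_bound:
  assumes enc: "encoder d E P Q c \<pi> \<rho>" and T: "over_integer_alphabet d T"
    and ij: "1 \<le> i" "i \<le> j" "j \<le> length T"
  shows "\<bar>E (substr T i j)\<bar> < (int (length T) + 2) ^ c"
proof -
  let ?n = "length T"
  define w where "w = (LEAST w. admissible_word_size c ?n w)"
  have adm: "admissible_word_size c ?n w" unfolding w_def using admissible_exists by (rule LeastI_ex)
  have c: "d + 2 \<le> c" using enc unfolding encoder_def by blast
  note iw = in_words_input[OF T adm c]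
  obtain k s where "exec w P (input_state T) k s" using encoder_pre[OF enc T adm] by blast
  then have r: "ready w P Q T s" by (rule ready.preprocessed)
  obtain k' s' where q: "exec w Q (query_state i j s) k' s'" "regs s' 0 = E (substr T i j)"
    using encoder_query[OF enc T adm r ij] by blast
  have "ready w P Q T s'" by (rule ready.queried[OF r ij q(1)])
  then have "in_words w s'" using ready_in_words iw by blast
  then have b: "- (2 ^ (w - 1)) \<le> E (substr T i j)" "E (substr T i j) < 2 ^ (w - 1)"
    using q(2) unfolding in_words_def by metis+
  have "\<not> admissible_word_size c ?n (w - 1)"
    using not_less_Least[of "w - 1" "admissible_word_size c ?n"] iw(2) unfolding w_def by auto
  then have "2 ^ (w - 1) < (?n + 2) ^ c" unfolding admissible_word_size_def by simp
  then have "int (2 ^ (w - 1)) < int ((?n + 2) ^ c)" by (simp only: of_nat_less_iff)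
  then have "(2::int) ^ (w - 1) < (int ?n + 2) ^ c" by (simp add: add.commute)
  then show ?thesis using b by linarith
qed

text \<open>\<open>\<pi>\<close> and \<open>\<rho>\<close> are arbitrary real functions; a run on a
  constant string shows that they bound a number of steps. For \<open>\<rho>\<close> this needs a
  nonempty string, as the empty one admits no query.\<close>

lemma encoder_times_nonneg:
  assumes enc: "encoder d E P Q c \<pi> \<rho>"
  shows "0 \<le> \<pi> n" "1 \<le> n \<Longrightarrow> 0 \<le> \<rho> n"
proof -
  let ?T = "replicate n 0"
  have T: "over_integer_alphabet d ?T" unfolding over_integer_alphabet_def by auto
  obtain w where "admissible_word_size c n w" using admissible_exists by blast
  then have adm: "admissible_word_size c (length ?T) w" by simp
  obtain k s where e: "exec w P (input_state ?T) k s" "real k \<le> \<pi> n" using encoder_pre[OF enc T adm] by auto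
  then show "0 \<le> \<pi> n" by (meson of_nat_0_le_iff order_trans)
  assume n: "1 \<le> n"
  have "ready w P Q ?T s" using e by (blast intro: ready.preprocessed)
  then obtain k s' where "real k \<le> \<rho> n" using encoder_query[OF enc T adm, of s 1 1] n by auto
  then show "0 \<le> \<rho> n" by (meson of_nat_0_le_iff order_trans)
qed

text \<open>The invariant for the oracles: from 100 on there is a state that the given programs can
  reach, and array 0 still holds the text for reading letters.\<close>

definition hidden_ready :: "nat \<Rightarrow> prog \<Rightarrow> prog \<Rightarrow> str \<Rightarrow> state \<Rightarrow> bool" where
  "hidden_ready w P Q T S \<longleftrightarrow> (\<exists>s. ready w P Q T s \<and> embedded s S) \<and> arrays S 0 = arrays (input_state T) 0"

lemma hidden_ready_frame:
  assumes "hidden_ready w P Q T S" "same_outside {..<100} {1..<100} S S'"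
  shows "hidden_ready w P Q T S'"
proof -
  have "same_outside {..<100} {..<100} S S'" by (rule same_outside_mono[OF assms(2)]) auto
  moreover have "arrays S' 0 = arrays S 0" using same_outside_arrays[OF assms(2), of 0] by simp
  ultimately show ?thesis using assms(1) embedded_low unfolding hidden_ready_def by metis
qed

definition ask :: "prog \<Rightarrow> prog" where
  "ask Q = seqs [Move 100 (Reg 10), Move 101 (Reg 11), shift Q, Move 12 (Reg 100)]"

text \<open>The state after an answer is \<open>ready\<close> again, even if the query changed the
  data structure, so queries can be repeated. The extra 3 steps pass the two positions and the
  answer.\<close>

lemma wp_ask:
  assumes enc: "encoder d E P Q c \<pi> \<rho>" "over_integer_alphabet d T" "admissible_word_size c (length T) w"
    and J: "hidden_ready w P Q T S" and rg: "regs S 10 = i" "regs S 11 = j"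
    and ij: "1 \<le> i" "i \<le> j" "j \<le> int (length T)"
    and Qq: "\<And>S' t'. hidden_ready w P Q T S' \<Longrightarrow> same_outside (insert 12 {100..}) {100..} S S' \<Longrightarrow>
      regs S' 12 = E (substr T (nat i) (nat j)) \<Longrightarrow> t' \<ge> t - (max 0 \<lfloor>\<rho> (length T)\<rfloor> + 3) \<Longrightarrow> R S' t'"
  shows "wp w (ask Q) R S t"
proof -
  obtain s where s: "ready w P Q T s" "embedded s S" using J unfolding hidden_ready_def by blast
  have a0: "arrays S 0 = arrays (input_state T) 0" using J unfolding hidden_ready_def by blast
  have ij': "1 \<le> nat i" "nat i \<le> nat j" "nat j \<le> length T" using ij by auto
  obtain k s' where q: "exec w Q (query_state (nat i) (nat j) s) k s'" "real k \<le> \<rho> (length T)"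
    "regs s' 0 = E (substr T (nat i) (nat j))"
    using encoder_query[OF enc s(1) ij'] by blast
  let ?S1 = "set_reg 101 j (set_reg 100 i S)"
  have "embedded (set_reg 1 j (set_reg 0 i s)) (set_reg (1 + 100) j (set_reg (0 + 100) i S))"
    by (intro embedded_set_reg s)
  then have "embedded (query_state (nat i) (nat j) s) ?S1" unfolding query_state_def using ij by simp
  then obtain S2 where S2: "exec w (shift Q) ?S1 k S2" "embedded s' S2" "same_outside {100..} {100..} ?S1 S2"
    using exec_shift[OF q(1)] by blast
  have r': "ready w P Q T s'" by (rule ready.queried[OF s(1) ij' q(1)])
  have v: "regs S2 100 = E (substr T (nat i) (nat j))" using S2(2) q(3) unfolding embedded_def by (metis add_0)
  let ?S3 = "set_reg 12 (regs S2 100) S2"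
  have f2: "same_outside {100..} {100..} S S2"
    by (rule same_outside_trans[OF _ S2(3), of "{100..}" "{}"]) (auto simp: wp_simps)
  have f3: "same_outside (insert 12 {100..}) {100..} S ?S3"
    using same_outside_mono[OF f2, of "insert 12 {100..}" "{100..}"] by (auto intro!: same_outside_set_reg)
  have e3: "embedded s' ?S3" using S2(2) unfolding embedded_def by (simp add: regs_set_reg arrays_set_reg)
  have "arrays ?S3 0 = arrays S 0" using same_outside_arrays[OF f3, of 0] by simp
  then have J3: "hidden_ready w P Q T ?S3" unfolding hidden_ready_def using r' e3 a0 by auto
  have "int k \<le> \<lfloor>\<rho> (length T)\<rfloor>" using q(2) by (simp add: le_floor_iff)
  then have "R ?S3 (t - 2 - int k - 1)"
    by (intro Qq[OF J3 f3]) (auto simp: regs_set_reg v)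
  then have "wp w (shift Q) (wp w (Move 12 (Reg 100)) R) ?S1 (t - 2)"
    unfolding wp_def[of w "shift Q"] using S2(1) by (auto simp: wp_Move)
  then show ?thesis unfolding ask_def using rg by (simp add: wp_Seq wp_Move regs_set_reg)
qed

definition letter_oracle :: prog where "letter_oracle = Load 12 0 (Reg 11)"

lemma wp_letter_oracle:
  assumes J: "hidden_ready w P Q T S" and rg: "regs S 11 = j"
    and j: "1 \<le> j" "j \<le> int (length T)" and q: "1 \<le> q"
    and Qq: "\<And>S' t'. hidden_ready w P Q T S' \<Longrightarrow> same_outside (insert 12 {100..}) {100..} S S' \<Longrightarrow>
      regs S' 12 = int (T ! nat (j - 1)) \<Longrightarrow> t' \<ge> t - q \<Longrightarrow> R S' t'"
  shows "wp w letter_oracle R S t"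
proof -
  have a0: "arrays S 0 = arrays (input_state T) 0" using J unfolding hidden_ready_def by blast
  let ?S = "set_reg 12 (int (T ! nat (j - 1))) S"
  have "hidden_ready w P Q T ?S" by (rule hidden_ready_frame[OF J]) (simp add: wp_simps)
  then have "R ?S (t - 1)" by (rule Qq) (use q in \<open>simp_all add: wp_simps\<close>)
  moreover have "arrays S 0 j = int (T ! nat (j - 1))" unfolding a0 input_state_def using j by simp
  ultimately show ?thesis unfolding letter_oracle_def by (simp add: wp_Load rg)
qed

section \<open>Squares as pairs of positions\<close>

definition part :: "str \<Rightarrow> int \<Rightarrow> int \<Rightarrow> str" where
  "part T i m = take (nat m) (drop (nat (i - 1)) T)"

definition code :: "(str \<Rightarrow> int) \<Rightarrow> str \<Rightarrow> int \<Rightarrow> int \<Rightarrow> int" where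
  "code E T i j = E (substr T (nat i) (nat j))"

lemma length_part: "1 \<le> i \<Longrightarrow> 0 \<le> m \<Longrightarrow> i + m \<le> int (length T) + 1 \<Longrightarrow> length (part T i m) = nat m"
  unfolding part_def by auto

lemma part_substr: "1 \<le> i \<Longrightarrow> 0 \<le> m \<Longrightarrow> part T i m = substr T (nat i) (nat (i + m - 1))"
proof -
  assume a: "1 \<le> i" "0 \<le> m"
  have "nat (i + m - 1) + 1 - nat i = nat m" "nat i - 1 = nat (i - 1)" using a by auto
  then show ?thesis unfolding part_def substr_def by simp
qed

lemma part_prefix: "0 \<le> k \<Longrightarrow> k \<le> m \<Longrightarrow> take (nat k) (part T i m) = part T i k"
  unfolding part_def by (simp add: min_def nat_mono)

lemma part_append:
  assumes "1 \<le> i" "0 \<le> k" "0 \<le> m"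
  shows "part T i (k + m) = part T i k @ part T (i + k) m"
proof -
  have "nat (k + m) = nat k + nat m" using assms by simp
  moreover have "nat (i + k - 1) = nat (i - 1) + nat k" using assms by linarith
  ultimately show ?thesis unfolding part_def by (simp add: take_add add.commute)
qed

lemma part_tail: "1 \<le> i \<Longrightarrow> 0 \<le> m \<Longrightarrow> part T (i + 1) m = substr (part T i (m + 1)) 2 (nat (m + 1))"
proof -
  assume a: "1 \<le> i" "0 \<le> m"
  have n: "nat (m + 1) = Suc (nat m)" "nat (i + 1 - 1) = Suc (nat (i - 1))" using a by auto
  show ?thesis unfolding part_def substr_def n by (simp add: drop_take)
qed

text \<open>A prefix of a part is a part with the same start, and its encoding is a value of
  \<open>code\<close>. The definition of an encoding function, applied to two parts, thus turns into
  \<open>agree\<close>.\<close>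

lemma agree_iff:
  assumes enc: "encoding_function R E" and n: "n = int (length T)"
    and b: "1 \<le> i" "1 \<le> j" "0 \<le> m" "i + m \<le> n + 1" "j + m \<le> n + 1"
  shows "agree n (code E T) m i j \<longleftrightarrow> (part T i m, part T j m) \<in> R"
proof -
  have len: "length (part T i m) = nat m" "length (part T j m) = nat m" using length_part b n by auto
  have pre: "substr (part T x m) 1 k = part T x (int k)" if "k \<le> nat m" for x k
  proof -
    have "substr (part T x m) 1 k = take k (part T x m)" unfolding substr_def by simp
    then show ?thesis using part_prefix[of "int k" m T x] that b by auto
  qed
  have cd: "code E T x (x + k) = E (part T x (k + 1))" if "1 \<le> x" "0 \<le> k" for x k
    using part_substr[of x "k + 1" T] that unfolding code_def by simp
  have "(part T i m, part T j m) \<in> R \<longleftrightarrow>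
      (\<forall>k\<in>{1..nat m}. E (substr (part T i m) 1 k) = E (substr (part T j m) 1 k))"
    using enc[unfolded encoding_function_def, rule_format, of "part T i m" "part T j m"] unfolding len by simp
  also have "\<dots> \<longleftrightarrow> (\<forall>k\<in>{1..nat m}. E (part T i (int k)) = E (part T j (int k)))"
    using pre by simp
  also have "\<dots> \<longleftrightarrow> (\<forall>k. 0 \<le> k \<and> k < m \<longrightarrow> E (part T i (k + 1)) = E (part T j (k + 1)))"
  proof
    assume h: "\<forall>k\<in>{1..nat m}. E (part T i (int k)) = E (part T j (int k))"
    show "\<forall>k. 0 \<le> k \<and> k < m \<longrightarrow> E (part T i (k + 1)) = E (part T j (k + 1))"
    proof (intro allI impI)
      fix k assume k: "0 \<le> k \<and> k < m"
      then have "nat (k + 1) \<in> {1..nat m}" by auto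
      then have "E (part T i (int (nat (k + 1)))) = E (part T j (int (nat (k + 1))))" using h by blast
      then show "E (part T i (k + 1)) = E (part T j (k + 1))" using k by simp
    qed
  next
    assume h: "\<forall>k. 0 \<le> k \<and> k < m \<longrightarrow> E (part T i (k + 1)) = E (part T j (k + 1))"
    show "\<forall>k\<in>{1..nat m}. E (part T i (int k)) = E (part T j (int k))"
    proof
      fix k assume "k \<in> {1..nat m}"
      then have "0 \<le> int k - 1 \<and> int k - 1 < m" by auto
      then show "E (part T i (int k)) = E (part T j (int k))" using h[rule_format, of "int k - 1"] by simp
    qed
  qed
  also have "\<dots> \<longleftrightarrow> agree n (code E T) m i j" unfolding agree_def using b cd by auto
  finally show ?thesis by simp
qed

lemma matching_scer:
  assumes "scer R" "encoding_function R E" "1 \<le> length T"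
  shows "matching (int (length T)) (code E T)"
proof
  show "1 \<le> int (length T)" using assms(3) by simp
  fix i j m assume a: "1 \<le> i" "1 \<le> j" "0 \<le> m" "agree (int (length T)) (code E T) (m + 1) i j"
  let ?n = "int (length T)"
  have b: "i + m + 1 \<le> ?n + 1" "j + m + 1 \<le> ?n + 1" using a unfolding agree_def by auto
  have r: "(part T i (m + 1), part T j (m + 1)) \<in> R"
    using agree_iff[OF assms(2) refl, of i j "m + 1"] a b by simp
  show "agree ?n (code E T) m (i + 1) (j + 1)"
  \<comment> \<open>\<open>scer\<close> speaks about nonempty substrings only, so the empty match is
    treated separately.\<close>
  proof (cases "m = 0")
    case True then show ?thesis using b unfolding agree_def by auto
  next
    case False
    have len: "length (part T i (m + 1)) = nat (m + 1)" using length_part[of i "m + 1" T] a b by auto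
    have "(substr (part T i (m + 1)) 2 (nat (m + 1)), substr (part T j (m + 1)) 2 (nat (m + 1))) \<in> R"
      using assms(1) r False a len unfolding scer_def by auto
    then have "(part T (i + 1) m, part T (j + 1) m) \<in> R" using part_tail a by simp
    then show ?thesis using agree_iff[OF assms(2) refl, of "i + 1" "j + 1" m] a b by simp
  qed
qed

lemma (in matching) ev_shift:
  assumes "0 \<le> k" "1 \<le> i" "1 \<le> j" "0 \<le> m" "ev (k + m) i j"
  shows "ev m (i + k) (j + k)"
  using assms
proof (induction k arbitrary: m rule: int_ge_induct)
  case (step k)
  have "k + 1 + m = k + (m + 1)" by simp
  then have "ev (k + (m + 1)) i j" using step.prems(4) by (simp only:)
  then have "ev (m + 1) (i + k) (j + k)" using step.IH[of "m + 1"] step.prems by auto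
  then have "ev m (i + k + 1) (j + k + 1)" using agree_shift[of "i + k" "j + k" m] step by auto
  then show ?case by (simp only: add.assoc)
qed simp

text \<open>Squares with respect to \<open>R\<close> are counted up to \<open>S\<close>; the theorem needs \<open>S = R\<close> and \<open>S = Id\<close>.\<close>

lemma card_squares:
  assumes R: "scer R" "encoding_function R E" and S: "scer S" "encoding_function S E'"
    and sub: "S \<subseteq> R" and T: "1 \<le> length T"
  defines "n \<equiv> int (length T)"
  shows "card (square_substrings R T // S) =
    card (good_pairs n (code E T) (matching.threshold n (code E' T)))"
proof -
  interpret r: matching n "code E T" unfolding n_def by (rule matching_scer[OF R T])
  interpret s: matching n "code E' T" unfolding n_def by (rule matching_scer[OF S T])
  have eqv: "equiv UNIV S" using S(1) unfolding scer_def by blast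
  have aR: "r.ev m i j \<longleftrightarrow> (part T i m, part T j m) \<in> R"
    if "1 \<le> i" "1 \<le> j" "0 \<le> m" "i + m \<le> n + 1" "j + m \<le> n + 1" for i j m
    by (rule agree_iff[OF R(2) _ that]) (simp add: n_def)
  have aS: "s.ev m i j \<longleftrightarrow> (part T i m, part T j m) \<in> S"
    if "1 \<le> i" "1 \<le> j" "0 \<le> m" "i + m \<le> n + 1" "j + m \<le> n + 1" for i j m
    by (rule agree_iff[OF S(2) _ that]) (simp add: n_def)
  have SR: "r.ev m i j" if "s.ev m i j" "1 \<le> i" "1 \<le> j" for i j m
    using aR[of i j m] aS[of i j m] s.ev_bounds[OF that(1)] that sub by auto
  let ?G = "good_pairs n (code E T) s.threshold"
  let ?Q = "square_substrings R T"
  define f where "f = (\<lambda>(i, j). S `` {part T i (2 * (j - i))})"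
  have square: "part T i (2 * l) \<in> ?Q" if il: "1 \<le> i" "1 \<le> l" "r.ev l i (i + l)" for i l
  proof -
    have b: "i + l + l \<le> n + 1" using r.ev_bounds[OF il(3)] by auto
    have e: "part T i (2 * l) = part T i l @ part T (i + l) l"
      using part_append[of i l l T] il by (simp add: algebra_simps)
    have "is_square R (part T i (2 * l))" unfolding is_square_def e
      using aR[of i "i + l" l] length_part[of i l T] length_part[of "i + l" l T] il b
      by (intro exI[of _ "part T i l"] exI[of _ "part T (i + l) l"]) (auto simp: n_def)
    moreover have "part T i (2 * l) = substr T (nat i) (nat (i + 2 * l - 1))"
      using part_substr[of i "2 * l" T] il by simp
    moreover have "1 \<le> nat i" "nat i \<le> nat (i + 2 * l - 1)" "nat (i + 2 * l - 1) \<le> length T"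
      using il b unfolding n_def by auto
    ultimately show ?thesis unfolding square_substrings_def by auto
  qed
  have "bij_betw f ?G (?Q // S)"
    unfolding bij_betw_def
  proof (intro conjI inj_onI equalityI subsetI)
    fix p q assume p: "p \<in> ?G" and q: "q \<in> ?G" and eq: "f p = f q"
    obtain i j where pij: "p = (i, j)" "1 \<le> i" "i < j" "j \<le> n" "r.ev (j - i) i j" "s.threshold i \<le> j"
      using p unfolding good_pairs_def by auto
    obtain i' j' where qij: "q = (i', j')" "1 \<le> i'" "i' < j'" "j' \<le> n" "r.ev (j' - i') i' j'" "s.threshold i' \<le> j'"
      using q unfolding good_pairs_def by auto
    have "S `` {part T i (2 * (j - i))} = S `` {part T i' (2 * (j' - i'))}"
      using eq unfolding f_def pij qij by simp
    then have rel: "(part T i (2 * (j - i)), part T i' (2 * (j' - i'))) \<in> S"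
      using eq_equiv_class[OF _ eqv] by blast
    have bp: "i + 2 * (j - i) \<le> n + 1" using r.ev_bounds[OF pij(5)] by auto
    have bq: "i' + 2 * (j' - i') \<le> n + 1" using r.ev_bounds[OF qij(5)] by auto
    have "length (part T i (2 * (j - i))) = length (part T i' (2 * (j' - i')))"
      using S(1) rel unfolding scer_def by blast
    then have l: "j - i = j' - i'"
      using length_part[of i "2 * (j - i)" T] length_part[of i' "2 * (j' - i')" T] pij qij bp bq
      unfolding n_def by simp
    have ev: "s.ev (2 * (j - i)) i i'" using aS[of i i' "2 * (j - i)"] rel pij qij bp bq l by auto
    \<comment> \<open>If two starts gave the same class, the square at the later one would match an
      earlier suffix in its full length, against its threshold.\<close>
    have no: False if "a < b" "1 \<le> a" "s.ev (2 * d) a b" "s.threshold b \<le> b + d" for a b d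
    proof -
      have "2 * d \<le> s.lpf b" by (rule s.lpf_ge) (use that in auto)
      then show False using that(4) unfolding s.threshold_def by linarith
    qed
    have "\<not> i < i'" using no[of i i' "j - i"] ev pij qij l by auto
    moreover have "\<not> i' < i" using no[of i' i "j - i"] s.ev_sym[OF ev] pij qij l by auto
    ultimately show "p = q" using pij qij l by auto
  next
    fix C assume "C \<in> f ` ?G"
    then obtain i j where ij: "C = S `` {part T i (2 * (j - i))}" "1 \<le> i" "i < j" "r.ev (j - i) i j"
      unfolding f_def good_pairs_def by auto
    then have "part T i (2 * (j - i)) \<in> ?Q" using square[of i "j - i"] by auto
    then show "C \<in> ?Q // S" unfolding ij(1) by (rule quotientI)
  next
    fix C assume "C \<in> ?Q // S"
    then obtain Z where Z: "Z \<in> ?Q" "C = S `` {Z}" by (rule quotientE)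
    then obtain a0 b0 where ab: "Z = substr T a0 b0" "1 \<le> a0" "a0 \<le> b0" "b0 \<le> length T" "is_square R Z"
      unfolding square_substrings_def by auto
    obtain X Y where XY: "Z = X @ Y" "length X = length Y" "1 \<le> length X" "(X, Y) \<in> R"
      using ab(5) unfolding is_square_def by blast
    define a where "a = int a0"
    define l where "l = int (length X)"
    have lz: "length Z = b0 + 1 - a0" unfolding ab(1) substr_def using ab by simp
    have bl: "int b0 = a + 2 * l - 1" using lz XY ab unfolding a_def l_def by auto
    have a1: "1 \<le> a" "1 \<le> l" "a + 2 * l \<le> n + 1" using ab bl XY unfolding a_def l_def n_def by auto
    have "nat (a + 2 * l - 1) = b0" using bl by linarith
    then have Zp: "Z = part T a (2 * l)" using part_substr[of a "2 * l" T] a1 ab(1) unfolding a_def by simp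
    have split: "Z = part T a l @ part T (a + l) l"
      unfolding Zp using part_append[of a l l T] a1 by (simp add: algebra_simps)
    have "length (part T a l) = length X" using length_part[of a l T] a1 unfolding l_def n_def by simp
    then have XYp: "X = part T a l" "Y = part T (a + l) l" using split XY(1) by simp_all
    have sq: "r.ev l a (a + l)" using aR[of a "a + l" l] XY(4) XYp a1 by auto
    \<comment> \<open>The class is represented by its first occurrence, which is the owner of the
      node at depth \<open>2 * l\<close>.\<close>
    define i where "i = s.owner (2 * l) a"
    have io: "1 \<le> i" "i \<le> a" "s.ev (2 * l) i a" "\<And>j. 1 \<le> j \<Longrightarrow> s.ev (2 * l) j a \<Longrightarrow> i \<le> j"
      using s.owner_props[of a "2 * l"] a1 unfolding i_def by auto
    \<comment> \<open>Being a square is carried over from \<open>a\<close> to \<open>i\<close>: as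
      \<open>S \<subseteq> R\<close>, both halves at \<open>i\<close> are \<open>R\<close>-related
      to those at \<open>a\<close>, and these to each other.\<close>
    have rev: "r.ev (2 * l) i a" using SR io a1 by auto
    have e1: "r.ev l i a" by (rule r.ev_mono[OF rev]) (use a1 in auto)
    have "r.ev (l + l) i a" using rev by (simp only: mult_2)
    then have e2: "r.ev l (i + l) (a + l)" by (rule r.ev_shift[rotated 4]) (use a1 io in auto)
    have sqi: "r.ev l i (i + l)" using e1 sq e2 r.ev_trans r.ev_sym by blast
    have "s.lpf i < 2 * l"
    proof (rule ccontr)
      assume h: "\<not> s.lpf i < 2 * l"
      then have "2 \<le> i" using a1 io s.lpf_one by (cases "i = 1") auto
      moreover have "i \<le> n" using io a1 by auto
      ultimately obtain j where j: "1 \<le> j" "j < i" "s.ev (s.lpf i) j i" using s.lpf_attained by blast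
      have "s.ev (2 * l) j i" by (rule s.ev_mono[OF j(3)]) (use h a1 in auto)
      then have "s.ev (2 * l) j a" using io s.ev_trans by blast
      then show False using io(4)[of j] j by auto
    qed
    then have "s.threshold i \<le> i + l" unfolding s.threshold_def by linarith
    then have g: "(i, i + l) \<in> ?G" using sqi io a1 r.ev_bounds[OF sqi] unfolding good_pairs_def by auto
    have "(part T i (2 * l), Z) \<in> S" using aS[of i a "2 * l"] io a1 Zp by auto
    then have "S `` {part T i (2 * l)} = C" using equiv_class_eq[OF eqv] Z(2) by blast
    then have "f (i, i + l) = C" unfolding f_def by simp
    then show "C \<in> f ` ?G" using g by blast
  qed
  then show ?thesis using bij_betw_same_card by metis
qed

text \<open>Equality of strings in the form of an encoding: all prefixes have equal last letters.
  The value at the empty string is never compared, since the prefixes start at length 1.\<close>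

definition last_letter :: "str \<Rightarrow> int" where
  "last_letter X = (if X = [] then 0 else int (last X))"

lemma scer_Id: "scer Id"
  unfolding scer_def by (auto intro: equivI reflI symI transI simp: refl_on_def)

lemma last_substr: "1 \<le> k \<Longrightarrow> k \<le> length X \<Longrightarrow> last_letter (substr X 1 k) = int (X ! (k - 1))"
  unfolding last_letter_def substr_def by (auto simp: last_conv_nth)

lemma encoding_last_letter: "encoding_function Id last_letter"
  unfolding encoding_function_def
proof (intro allI)
  fix X Y :: str
  show "(X, Y) \<in> Id \<longleftrightarrow> length X = length Y \<and>
      (\<forall>i\<in>{1..length X}. last_letter (substr X 1 i) = last_letter (substr Y 1 i))"
  proof
    assume h: "length X = length Y \<and> (\<forall>i\<in>{1..length X}. last_letter (substr X 1 i) = last_letter (substr Y 1 i))"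
    have "X ! k = Y ! k" if "k < length X" for k
    proof -
      have "last_letter (substr X 1 (Suc k)) = last_letter (substr Y 1 (Suc k))" using h that by auto
      then show ?thesis using last_substr[of "Suc k" X] last_substr[of "Suc k" Y] that h by auto
    qed
    then show "(X, Y) \<in> Id" using h by (auto intro: nth_equalityI)
  qed auto
qed

lemma code_last_letter:
  assumes "1 \<le> i" "i \<le> j" "j \<le> int (length T)"
  shows "code last_letter T i j = int (T ! nat (j - 1))"
proof -
  define a where "a = nat i - 1"
  define k where "k = nat j - nat i"
  have e: "substr T (nat i) (nat j) = take (Suc k) (drop a T)"
    using assms unfolding substr_def a_def k_def by (simp add: Suc_diff_le)
  have ak: "a + k = nat (j - 1)" "a + k < length T" using assms unfolding a_def k_def by auto
  then have "take (Suc k) (drop a T) = take k (drop a T) @ [T ! (a + k)]"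
    by (simp add: take_Suc_conv_app_nth)
  then have "last (take (Suc k) (drop a T)) = T ! (a + k)" "take (Suc k) (drop a T) \<noteq> []" by auto
  then show ?thesis unfolding code_def e last_letter_def using ak by simp
qed

lemma card_quotient_Id: "card (A // Id) = card A"
proof -
  have "A // Id = (\<lambda>x. {x}) ` A" unfolding quotient_def by auto
  then show ?thesis by (simp add: card_image)
qed

section \<open>The counting program\<close>

definition log_ceil :: "nat \<Rightarrow> nat" where
  "log_ceil n = (LEAST k. n < 2 ^ k)"

lemma less_log_ceil: "n < 2 ^ log_ceil n"
  unfolding log_ceil_def by (rule LeastI[of _ n]) (rule less_exp)

lemma log_ceil_le: "n < 2 ^ k \<Longrightarrow> log_ceil n \<le> k"
  unfolding log_ceil_def by (rule Least_le)

lemma log_ceil_bounds: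
  assumes "1 \<le> n" shows "1 \<le> log_ceil n" "log_ceil n \<le> n + 1" "real (log_ceil n) \<le> log 2 (real n) + 1"
proof -
  show ge: "1 \<le> log_ceil n"
  proof (rule ccontr)
    assume "\<not> 1 \<le> log_ceil n"
    then have "log_ceil n = 0" by simp
    then show False using less_log_ceil[of n] assms by simp
  qed
  have "log_ceil n \<le> n" by (rule log_ceil_le) (rule less_exp)
  then show "log_ceil n \<le> n + 1" by simp
  have "\<not> n < 2 ^ (log_ceil n - 1)"
  proof
    assume "n < 2 ^ (log_ceil n - 1)"
    then have "log_ceil n \<le> log_ceil n - 1" by (rule log_ceil_le)
    then show False using ge by simp
  qed
  then have "real (2 ^ (log_ceil n - 1)) \<le> real n" by (simp only: of_nat_le_iff not_less)
  then have "2 powr real (log_ceil n - 1) \<le> real n" by (simp add: powr_realpow)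
  then have "real (log_ceil n - 1) \<le> log 2 (real n)" using assms by (simp add: le_log_iff)
  then show "real (log_ceil n) \<le> log 2 (real n) + 1" using ge by simp
qed

definition copy_input :: prog where
  "copy_input = seqs [Move 20 (Const 1),
     While LessEq (Reg 20) (Reg 0) (seqs [Load 21 0 (Reg 20), Store 100 (Reg 20) (Reg 21), inc 20]),
     Move 100 (Reg 0)]"

text \<open>The exponent is fixed together with the oracle, so the power is computed by unrolled
  code and costs constant time.\<close>

primrec power_loop :: "nat \<Rightarrow> prog" where
  "power_loop 0 = Skip"
| "power_loop (Suc c) = Seq (Op 2 Mult (Reg 2) (Reg 21)) (power_loop c)"

definition constants :: "nat \<Rightarrow> prog" where
  "constants c = seqs [Op 1 Add (Reg 0) (Const 1), Op 21 Add (Reg 0) (Const 2), Move 2 (Const 2),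
     power_loop c, Move 3 (Const 0), Move 21 (Const 1),
     While LessEq (Reg 21) (Reg 0) (seqs [Op 21 Add (Reg 21) (Reg 21), inc 3])]"

text \<open>The order of the positions comes from the last table that is built, so the table for the thresholds is
  built first. Arrays 8 and 9 hold the two dictionaries.\<close>

definition square_counter :: "nat \<Rightarrow> prog \<Rightarrow> prog \<Rightarrow> prog \<Rightarrow> prog" where
  "square_counter c P G G' = If Equal (Reg 0) (Const 0) Skip (seqs [copy_input, shift P, constants c,
     build 8 G, thresholds, build 9 G', make_order, count_levels, Move 0 (Reg 4)])"

context ram begin

text \<open>The relocated preprocessing expects an input state from 100 on. Only register 0 and
  array 0 need a copy for this, since everything else there is zero already.\<close>

lemma wp_copy_input:
  assumes n: "n = int (length T)"
    and t: "4 * n + 4 \<le> t"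
    and Q: "\<And>s' t'. embedded (input_state T) s' \<Longrightarrow> arrays s' 0 = arrays (input_state T) 0 \<Longrightarrow> regs s' 0 = n \<Longrightarrow>
      (\<And>m. 1 \<le> m \<Longrightarrow> m < 100 \<Longrightarrow> arrays s' m = (\<lambda>_. 0)) \<Longrightarrow> t' \<ge> t - (4 * n + 4) \<Longrightarrow> Q s' t'"
  shows "wp w copy_input Q (input_state T) t"
proof -
  let ?s = "input_state T"
  let ?in = "arrays ?s 0"
  have r0: "regs ?s 0 = n" and other: "\<And>r. r \<noteq> 0 \<Longrightarrow> regs ?s r = 0" "\<And>m. m \<noteq> 0 \<Longrightarrow> arrays ?s m = (\<lambda>_. 0)"
    and outside: "\<And>p. \<not> (1 \<le> p \<and> p \<le> n) \<Longrightarrow> ?in p = 0"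
    unfolding input_state_def n by auto
  define I where "I = (\<lambda>s' t'. same_outside {20,21} {100} ?s s' \<and> 1 \<le> regs s' 20 \<and> regs s' 20 \<le> n + 1 \<and>
     arrays s' 100 = (\<lambda>p. if p < regs s' 20 then ?in p else 0) \<and> t' \<ge> t - 1 - 4 * (regs s' 20 - 1))"
  let ?b = "seqs [Load 21 0 (Reg 20), Store 100 (Reg 20) (Reg 21), inc 20]"
  have step: "wp w ?b I s' (t' - 1)"
    if I: "I s' t'" and c: "compare_val LessEq (operand_val w s' (Reg 20)) (operand_val w s' (Reg 0))" for s' t'
  proof -
    define p where "p = regs s' 20"
    have fr: "same_outside {20,21} {100} ?s s'" and p: "1 \<le> p" and a: "arrays s' 100 = (\<lambda>x. if x < p then ?in x else 0)"
      and t': "t' \<ge> t - 1 - 4 * (p - 1)" using I unfolding I_def p_def by auto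
    have pn: "p \<le> n" using c same_outside_regs[OF fr, of 0] r0 unfolding p_def by simp
    have a0: "arrays s' 0 = ?in" using same_outside_arrays[OF fr, of 0] by simp
    have ws: "wrap w (p + 1) = p + 1" using X_linear p pn by (intro wrap_id) auto
    have upd: "(\<lambda>x. if x < p then ?in x else 0)(p := ?in p) = (\<lambda>x. if x < p + 1 then ?in x else 0)"
      by (auto simp: fun_eq_iff)
    show ?thesis using fr p pn t' unfolding I_def
      by (simp add: wp_simps ws a0 a upd p_def[symmetric] del: fun_upd_apply)
  qed
  have fin: "wp w (Move 100 (Reg 0)) Q s' (t' - 1)"
    if I: "I s' t'" and c: "\<not> compare_val LessEq (operand_val w s' (Reg 20)) (operand_val w s' (Reg 0))" for s' t'
  proof -
    have fr: "same_outside {20,21} {100} ?s s'" using I unfolding I_def by blast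
    have p: "regs s' 20 = n + 1" using I c same_outside_regs[OF fr, of 0] r0 unfolding I_def by auto
    have "(\<lambda>x. if x < n + 1 then ?in x else 0) = ?in" using outside by (auto simp: fun_eq_iff)
    then have a: "arrays s' 100 = ?in" using I p unfolding I_def by simp
    have "Q (set_reg 100 n s') (t' - 2)"
    proof (rule Q)
      show "embedded ?s (set_reg 100 n s')" unfolding embedded_def
      proof (intro conjI allI)
        fix r :: nat
        show "regs (set_reg 100 n s') (r + 100) = regs ?s r"
          using same_outside_regs[OF fr, of "r + 100"] other(1) r0 by (cases "r = 0") (auto simp: regs_set_reg)
        show "arrays (set_reg 100 n s') (r + 100) = arrays ?s r"
          using same_outside_arrays[OF fr, of "r + 100"] other(2) a by (cases "r = 0") (auto simp: arrays_set_reg)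
      qed
      show "arrays (set_reg 100 n s') 0 = ?in" using same_outside_arrays[OF fr, of 0] by (simp add: arrays_set_reg)
      show "regs (set_reg 100 n s') 0 = n" using same_outside_regs[OF fr, of 0] r0 by (simp add: regs_set_reg)
      show "arrays (set_reg 100 n s') m = (\<lambda>_. 0)" if "1 \<le> m" "m < 100" for m
        using same_outside_arrays[OF fr, of m] other(2) that by (auto simp: arrays_set_reg)
      show "t - (4 * n + 4) \<le> t' - 2" using I p unfolding I_def by auto
    qed
    then show ?thesis using same_outside_regs[OF fr, of 0] r0 by (simp add: wp_Move)
  qed
  have "I (set_reg 20 1 ?s) (t - 1)"
    unfolding I_def using n_pos other outside by (auto simp: wp_simps fun_eq_iff)
  then have "wp w (While LessEq (Reg 20) (Reg 0) ?b) (wp w (Move 100 (Reg 0)) Q) (set_reg 20 1 ?s) (t - 1)"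
  proof (rule wp_While[where I=I])
    show "0 \<le> t'" if "I s' t'" for s' t' using that t unfolding I_def by auto
  qed (use step fin in blast)+
  then show ?thesis unfolding copy_input_def seqs.simps wp_Seq by (subst wp_Move) simp
qed

lemma wp_power_loop:
  assumes "regs s 2 = z" "regs s 21 = b" "0 \<le> z" "1 \<le> b" "z * b ^ c < X"
    and Q: "\<And>s' t'. same_outside {2} {} s s' \<Longrightarrow> regs s' 2 = z * b ^ c \<Longrightarrow> t' \<ge> t - (int c + 1) \<Longrightarrow> Q s' t'"
  shows "wp w (power_loop c) Q s t"
  using assms
proof (induction c arbitrary: s z t)
  case 0
  then show ?case by (simp add: wp_Skip same_outside_refl)
next
  case (Suc c)
  have "z * b \<le> z * b * b ^ c" using Suc.prems by (intro mult_left_mono[of 1 "b ^ c" "z * b", simplified]) auto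
  then have zb: "z * b < X" "0 \<le> z * b" using Suc.prems by (auto simp: mult.assoc)
  then have ws: "wrap w (z * b) = z * b" by (intro wrap_id) auto
  have "wp w (power_loop c) Q (set_reg 2 (z * b) s) (t - 1)"
  proof (rule Suc.IH[of _ "z * b"])
    show "z * b * b ^ c < X" using Suc.prems(5) by (simp add: mult.assoc)
    fix s' t' assume h: "same_outside {2} {} (set_reg 2 (z * b) s) s'" "regs s' 2 = z * b * b ^ c" "t - 1 - (int c + 1) \<le> t'"
    show "Q s' t'"
    proof (rule Suc.prems(6))
      show "same_outside {2} {} s s'" by (rule same_outside_trans[OF _ h(1), of "{2}" "{}"]) (auto simp: wp_simps)
    qed (use h in \<open>auto simp: mult.assoc\<close>)
  qed (use Suc.prems zb in \<open>auto simp: regs_set_reg\<close>)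
  then show ?case using Suc.prems ws by (simp add: wp_Seq wp_Op)
qed

lemma wp_constants:
  assumes n: "n = int N" and rg: "regs s 0 = n" and Zc: "2 * (n + 2) ^ c < X"
    and t: "4 * int (log_ceil N) + int c + 12 \<le> t"
    and Q: "\<And>s' t'. same_outside {1,2,3,21} {} s s' \<Longrightarrow> regs s' 1 = n + 1 \<Longrightarrow> regs s' 2 = 2 * (n + 2) ^ c \<Longrightarrow>
      regs s' 3 = int (log_ceil N) \<Longrightarrow> t' \<ge> t - (4 * int (log_ceil N) + int c + 12) \<Longrightarrow> Q s' t'"
  shows "wp w (constants c) Q s t"
proof -
  let ?L = "int (log_ceil N)"
  have N1: "1 \<le> N" using n n_pos by simp
  let ?loop = "While LessEq (Reg 21) (Reg 0) (seqs [Op 21 Add (Reg 21) (Reg 21), inc 3])"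
  let ?tail = "seqs [Move 3 (Const 0), Move 21 (Const 1), ?loop]"
  have tail: "wp w ?tail Q s1 t1"
    if fr: "same_outside {1,2,21} {} s s1" and r: "regs s1 1 = n + 1" "regs s1 2 = 2 * (n + 2) ^ c"
      and t1: "t1 \<ge> t - (int c + 4)" for s1 t1
  proof -
    define I where "I = (\<lambda>s' t'. same_outside {3,21} {} s1 s' \<and> (\<exists>k. regs s' 3 = int k \<and> regs s' 21 = 2 ^ k \<and> k \<le> log_ceil N \<and>
       t' \<ge> t1 - 2 - 4 * int k))"
    have r0: "regs s1 0 = n" using same_outside_regs[OF fr] rg by simp
    have step: "wp w (seqs [Op 21 Add (Reg 21) (Reg 21), inc 3]) I s' (t' - 1)"
      if I: "I s' t'" and cc: "compare_val LessEq (operand_val w s' (Reg 21)) (operand_val w s' (Reg 0))" for s' t'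
    proof -
      obtain k where fr': "same_outside {3,21} {} s1 s'" and k: "regs s' 3 = int k" "regs s' 21 = 2 ^ k" "k \<le> log_ceil N"
        "t' \<ge> t1 - 2 - 4 * int k" using I unfolding I_def by blast
      have le: "(2::int) ^ k \<le> n" using cc k same_outside_regs[OF fr', of 0] r0 by simp
      have "\<not> log_ceil N \<le> k"
      proof
        assume "log_ceil N \<le> k"
        then have "(2::nat) ^ log_ceil N \<le> 2 ^ k" by (intro power_increasing) auto
        then have "N < 2 ^ k" using less_log_ceil[of N] by linarith
        then have "int N < int (2 ^ k)" by (simp only: of_nat_less_iff)
        then have "int N < 2 ^ k" by simp
        then show False using le n by simp
      qed
      then have k1: "Suc k \<le> log_ceil N" by simp
      have kN: "int k \<le> n" using k(3) log_ceil_bounds(2)[OF N1] k1 n by linarith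
      have ws: "wrap w (2 ^ k + 2 ^ k) = 2 ^ Suc k" "wrap w (int k + 1) = int (Suc k)" "wrap w (2 * 2 ^ k) = 2 ^ Suc k" "wrap w (1 + int k) = int (Suc k)"
      proof -
        have p: "(0::int) \<le> 2 ^ k" by simp
        have "wrap w (2 * 2 ^ k) = 2 * 2 ^ k" by (rule wrap_id) (use X_linear le p n_pos in linarith)+
        moreover have "wrap w (int k + 1) = int k + 1" by (rule wrap_id) (use X_linear kN n_pos in linarith)+
        ultimately show "wrap w (2 ^ k + 2 ^ k) = 2 ^ Suc k" "wrap w (int k + 1) = int (Suc k)"
          "wrap w (2 * 2 ^ k) = 2 ^ Suc k" "wrap w (1 + int k) = int (Suc k)"
          by (simp_all add: add.commute)
      qed
      have "I (set_reg 3 (int (Suc k)) (set_reg 21 (2 ^ Suc k) s')) (t' - 3)"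
        unfolding I_def using fr' k1 k by (auto simp: wp_simps intro!: exI[of _ "Suc k"])
      then show ?thesis using k ws by (simp add: wp_Seq wp_Op regs_set_reg del: power_Suc of_nat_Suc)
    qed
    have fin: "Q s' (t' - 1)"
      if I: "I s' t'" and cc: "\<not> compare_val LessEq (operand_val w s' (Reg 21)) (operand_val w s' (Reg 0))" for s' t'
    proof -
      obtain k where fr': "same_outside {3,21} {} s1 s'" and k: "regs s' 3 = int k" "regs s' 21 = 2 ^ k" "k \<le> log_ceil N"
        "t' \<ge> t1 - 2 - 4 * int k" using I unfolding I_def by blast
      have "n < 2 ^ k" using cc k same_outside_regs[OF fr', of 0] r0 by simp
      then have "int N < int (2 ^ k)" using n by simp
      then have "N < 2 ^ k" by (simp only: of_nat_less_iff)
      then have kL: "k = log_ceil N" using log_ceil_le k(3) by (metis le_antisym)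
      show ?thesis
      proof (rule Q)
        show "same_outside {1,2,3,21} {} s s'" by (rule same_outside_trans[OF fr fr']) auto
        show "regs s' 1 = n + 1" "regs s' 2 = 2 * (n + 2) ^ c" using same_outside_regs[OF fr'] r by auto
        show "regs s' 3 = ?L" using k kL by simp
        show "t - (4 * ?L + int c + 12) \<le> t' - 1" using k t1 kL by simp
      qed
    qed
    have "I (set_reg 21 1 (set_reg 3 0 s1)) (t1 - 2)"
      unfolding I_def by (auto simp: wp_simps intro!: exI[of _ 0])
    then have "wp w ?loop Q (set_reg 21 1 (set_reg 3 0 s1)) (t1 - 2)"
    proof (rule wp_While[where I=I])
      show "0 \<le> t'" if "I s' t'" for s' t' using that t t1 unfolding I_def by auto
    qed (use step fin in blast)+
    then show ?thesis unfolding seqs.simps wp_Seq by (subst wp_Move, subst wp_Move) simp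
  qed
  have ws: "wrap w (n + 1) = n + 1" "wrap w (n + 2) = n + 2" using X_linear n_pos by (auto intro!: wrap_id)
  define s0 where "s0 = set_reg 2 2 (set_reg 21 (n + 2) (set_reg 1 (n + 1) s))"
  have "wp w (power_loop c) (wp w ?tail Q) s0 (t - 3)"
  proof (rule wp_power_loop[where z=2 and b="n + 2" and c=c])
    show "regs s0 2 = 2" "regs s0 21 = n + 2" by (simp_all add: s0_def regs_set_reg)
    show "2 * (n + 2) ^ c < X" by (rule Zc)
    fix s1 t1 assume h: "same_outside {2} {} s0 s1" "regs s1 2 = 2 * (n + 2) ^ c" "t - 3 - (int c + 1) \<le> t1"
    have r1: "regs s1 1 = n + 1" using same_outside_regs[OF h(1), of 1] by (simp add: s0_def regs_set_reg)
    have f0: "same_outside {1,2,21} {} s s0" unfolding s0_def by (simp add: wp_simps)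
    have "same_outside {1,2,21} {} s s1"
      by (rule same_outside_trans[OF f0 h(1)]) auto
    then show "wp w ?tail Q s1 t1" using tail h r1 by simp
  qed (use n_pos in auto)
  then show ?thesis unfolding constants_def s0_def seqs.simps using rg ws
    by (simp add: wp_Seq wp_Op wp_Move[of w 2] regs_set_reg del: One_nat_def)
qed

end

text \<open>The budgets of all phases: \<open>p\<close> for the preprocessing, two tables with query
  time \<open>q\<close>, the rounds of counting, and linear overhead.\<close>

definition total_cost :: "int \<Rightarrow> int \<Rightarrow> int \<Rightarrow> int \<Rightarrow> int \<Rightarrow> int" where
  "total_cost c n p q L = p + 2 * (n * (6 * q + 15 * L + 100) + 7 * L + 20) +
     520 * n * (2 * L + 1) + 60 * n + 4 * L + c + 200"

text \<open>The table for \<open>e1\<close> is used up once the thresholds are stored, so the one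
  for \<open>e2\<close> may overwrite arrays 5 to 7. Only the dictionaries must be separate, because
  each has to start from zero cells.\<close>

lemma wp_square_counter:
  assumes n: "n = int (length T)" and P: "exec w P (input_state T) k s0" "int k \<le> p"
    and b1: "builder w X n e1 Z L q G1 (hidden_ready w P Q T)"
    and b2: "builder w X n e2 Z L q G2 (hidden_ready w P Q T)"
    and Z: "Z = 2 * (n + 2) ^ c" and L: "L = int (log_ceil (length T))"
    and t: "total_cost (int c) n p q L \<le> t"
    and R: "\<And>s' t'. regs s' 0 = int (card (good_pairs n e2 (matching.threshold n e1))) \<Longrightarrow> 0 \<le> t' \<Longrightarrow> R s' t'"
  shows "wp w (square_counter c P G1 G2) R (input_state T) t"
proof -
  interpret b1: builder w X n e1 Z L q G1 "hidden_ready w P Q T" by (rule b1)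
  interpret b2: builder w X n e2 Z L q G2 "hidden_ready w P Q T" by (rule b2)
  interpret rm1: ram_matching w X n e1 by unfold_locales
  interpret rm2: ram_matching w X n e2 by unfold_locales
  let ?J = "hidden_ready w P Q T"
  have n1: "1 \<le> n" by (rule b1.n_pos)
  have L1: "1 \<le> L" by (rule b1.Lg)
  define B where "B = n * (6 * q + 15 * L + 100) + 7 * L + 20"
  define V where "V = 520 * n * (2 * L + 1)"
  have B0: "0 \<le> B" "0 \<le> V" unfolding B_def V_def using n1 L1 b1.q_nonneg by auto
  have t: "p + 2 * B + V + 60 * n + 4 * L + int c + 200 \<le> t"
    using t unfolding total_cost_def B_def V_def .
  have p0: "0 \<le> p" using P(2) by linarith
  have r0: "regs (input_state T) 0 = n" unfolding input_state_def n by simp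
  have ZX: "2 * (n + 2) ^ c < X"
  proof -
    have "1 * Z \<le> (n + 2) * (n + 2) * Z"
    proof (rule mult_right_mono)
      have "0 \<le> n * (n + 4)" using n1 by auto
      then show "1 \<le> (n + 2) * (n + 2)" by (simp add: algebra_simps)
    qed (use b1.Z_pos in auto)
    then show ?thesis using b1.Z_bound Z by simp
  qed
  let ?rest = "seqs [copy_input, shift P, constants c,
     build 8 G1, thresholds, build 9 G2, make_order, count_levels, Move 0 (Reg 4)]"
  have "wp w ?rest R (input_state T) (t - 1)"
    unfolding seqs.simps wp_Seq
  proof (rule b1.wp_copy_input[OF n])
    show "4 * n + 4 \<le> t - 1" using t B0 p0 n1 L1 by linarith
    fix s1 t1 assume e1: "embedded (input_state T) s1" and i1: "arrays s1 0 = arrays (input_state T) 0"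
      and r1: "regs s1 0 = n" and z1: "\<And>m. 1 \<le> m \<Longrightarrow> m < 100 \<Longrightarrow> arrays s1 m = (\<lambda>_. 0)"
      and t1: "t1 \<ge> t - 1 - (4 * n + 4)"
    obtain s2 where s2: "exec w (shift P) s1 k s2" "embedded s0 s2" "same_outside {100..} {100..} s1 s2"
      using exec_shift[OF P(1) e1] by blast
    have J2: "?J s2" unfolding hidden_ready_def
      using ready.preprocessed[OF P(1)] s2(2) same_outside_arrays[OF s2(3), of 0] i1 by auto
    have r2: "regs s2 0 = n" using same_outside_regs[OF s2(3), of 0] r1 by simp
    have z2: "\<And>m. 1 \<le> m \<Longrightarrow> m < 100 \<Longrightarrow> arrays s2 m = (\<lambda>_. 0)" using same_outside_arrays[OF s2(3)] z1 by auto
    have t2: "t1 - int k \<ge> t - 5 - 4 * n - p" using t1 P(2) by linarith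
    have "wp w (constants c) (wp w (build 8 G1) (wp w thresholds (wp w (build 9 G2) (wp w make_order
       (wp w count_levels (wp w (Move 0 (Reg 4)) R)))))) s2 (t1 - int k)"
    proof (rule b1.wp_constants[OF n r2 ZX])
      show "4 * int (log_ceil (length T)) + int c + 12 \<le> t1 - int k" using t2 t B0 n1 L by linarith
      fix s3 t3 assume f3: "same_outside {1, 2, 3, 21} {} s2 s3" and r3: "regs s3 1 = n + 1" "regs s3 2 = 2 * (n + 2) ^ c"
          "regs s3 3 = int (log_ceil (length T))"
        and t3: "t3 \<ge> t1 - int k - (4 * int (log_ceil (length T)) + int c + 12)"
      have J3: "?J s3" by (rule b1.J_frame[OF J2 same_outside_mono[OF f3]]) auto
      have r3': "regs s3 0 = n" "regs s3 1 = n + 1" "regs s3 2 = Z" "regs s3 3 = L"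
        using same_outside_regs[OF f3] r2 r3 Z L by auto
      have z3: "\<And>m. 1 \<le> m \<Longrightarrow> m < 100 \<Longrightarrow> arrays s3 m = (\<lambda>_. 0)" using same_outside_arrays[OF f3] z2 by auto
      have t3': "t3 \<ge> 2 * B + V + 56 * n + 180" using t3 t2 t L by linarith
      show "wp w (build 8 G1) (wp w thresholds (wp w (build 9 G2) (wp w make_order
         (wp w count_levels (wp w (Move 0 (Reg 4)) R))))) s3 t3"
      proof (rule b1.wp_build[OF J3 _ _ _ r3'])
        show "arrays s3 8 = (\<lambda>_. 0)" by (rule z3) auto
        show "n * (6 * q + 15 * L + 100) + 7 * L + 20 \<le> t3" using t3' B0 n1 unfolding B_def[symmetric] by linarith
        fix s4 t4 assume J4: "?J s4" and f4: "same_outside ({10..30} \<union> {100..}) ({5, 6, 7, 8} \<union> {100..}) s3 s4"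
          and tb4: "\<And>x. 1 \<le> x \<Longrightarrow> x \<le> n \<Longrightarrow> arrays s4 5 x = b1.lpf x \<and> arrays s4 6 x = b1.link x"
          and t4: "t4 \<ge> t3 - (n * (6 * q + 15 * L + 100) + 7 * L + 20)"
        have r4: "regs s4 0 = n" "regs s4 1 = n + 1" "regs s4 2 = Z" "regs s4 3 = L"
          using same_outside_regs[OF f4] r3' by auto
        have z4: "\<And>m. m \<in> {9, 12} \<Longrightarrow> arrays s4 m = (\<lambda>_. 0)" using same_outside_arrays[OF f4] z3 by auto
        have t4': "t4 \<ge> B + V + 56 * n + 180" using t4 t3' unfolding B_def[symmetric] by linarith
        show "wp w thresholds (wp w (build 9 G2) (wp w make_order
          (wp w count_levels (wp w (Move 0 (Reg 4)) R)))) s4 t4"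
        proof (rule rm1.wp_thresholds[OF r4(1,2)])
          show "arrays s4 5 x = b1.lpf x" if "1 \<le> x" "x \<le> n" for x using tb4[OF that] by blast
          show "20 * n + 20 \<le> t4" using t4' B0 n1 by linarith
          fix s5 t5 assume f5: "same_outside {20..23} {10, 11} s4 s5"
            and th5: "\<And>x. 1 \<le> x \<Longrightarrow> x \<le> n \<Longrightarrow> arrays s5 10 x = b1.threshold x \<and> 0 \<le> arrays s5 11 x \<and> arrays s5 11 x \<le> n \<and>
              (\<forall>i. 1 \<le> i \<and> i \<le> n \<longrightarrow> (i \<le> arrays s5 11 x \<longleftrightarrow> b1.threshold i \<le> x))"
            and t5: "t5 \<ge> t4 - (20 * n + 20)"
          have J5: "?J s5" by (rule b1.J_frame[OF J4 same_outside_mono[OF f5]]) auto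
          have r5: "regs s5 0 = n" "regs s5 1 = n + 1" "regs s5 2 = Z" "regs s5 3 = L"
            using same_outside_regs[OF f5] r4 by auto
          have z5: "\<And>m. m \<in> {9, 12} \<Longrightarrow> arrays s5 m = (\<lambda>_. 0)" using same_outside_arrays[OF f5] z4 by auto
          have t5': "t5 \<ge> B + V + 36 * n + 160" using t5 t4' by linarith
          show "wp w (build 9 G2) (wp w make_order (wp w count_levels (wp w (Move 0 (Reg 4)) R))) s5 t5"
          proof (rule b2.wp_build[OF J5 _ _ _ r5])
            show "arrays s5 9 = (\<lambda>_. 0)" by (rule z5) auto
            show "n * (6 * q + 15 * L + 100) + 7 * L + 20 \<le> t5" using t5' B0 n1 unfolding B_def[symmetric] by linarith
            fix s6 t6 assume f6: "same_outside ({10..30} \<union> {100..}) ({5, 6, 7, 9} \<union> {100..}) s5 s6"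
              and tb6: "\<And>x. 1 \<le> x \<Longrightarrow> x \<le> n \<Longrightarrow> arrays s6 5 x = b2.lpf x \<and> arrays s6 6 x = b2.link x"
              and t6: "t6 \<ge> t5 - (n * (6 * q + 15 * L + 100) + 7 * L + 20)"
            have r6: "regs s6 0 = n" "regs s6 1 = n + 1" using same_outside_regs[OF f6] r5 by auto
            have a6: "arrays s6 10 = arrays s5 10" "arrays s6 11 = arrays s5 11" "arrays s6 12 = (\<lambda>_. 0)"
              using same_outside_arrays[OF f6] z5 by auto
            have t6': "t6 \<ge> V + 36 * n + 160" using t6 t5' unfolding B_def[symmetric] by linarith
            show "wp w make_order (wp w count_levels (wp w (Move 0 (Reg 4)) R)) s6 t6"
            proof (rule rm2.wp_make_order[OF r6 tb6 a6(3)])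
              show "30 * n + 30 \<le> t6" using t6' B0 n1 by linarith
              fix s7 t7 assume f7: "same_outside {20..23} {1, 2, 12, 13, 14} s6 s7"
                and ok7: "b2.segments_ok (arrays s7 1) (arrays s7 2)"
                and one7: "\<And>p. 2 \<le> p \<Longrightarrow> p \<le> n \<Longrightarrow> 0 \<le> arrays s7 2 p" and t7: "t7 \<ge> t6 - (30 * n + 30)"
              have r7: "regs s7 0 = n" "regs s7 1 = n + 1" using same_outside_regs[OF f7] r6 by auto
              have a7: "arrays s7 10 = arrays s5 10" "arrays s7 11 = arrays s5 11"
                using same_outside_arrays[OF f7] a6 by auto
              have t7': "t7 \<ge> V + 6 * n + 130" using t7 t6' by linarith
              show "wp w count_levels (wp w (Move 0 (Reg 4)) R) s7 t7"
              proof (rule rm2.wp_count_levels[where th=b1.threshold and M="arrays s5 11" and Lg=L, OF _ _ _ ok7 one7 _ r7])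
                show "i < b1.threshold i \<and> b1.threshold i \<le> n + 2" if "1 \<le> i" "i \<le> n" for i
                  by (rule b1.threshold_bounds[OF that])
                show "i \<le> arrays s5 11 x \<longleftrightarrow> b1.threshold i \<le> x" if "1 \<le> x" "x \<le> n" "1 \<le> i" "i \<le> n" for x i
                  using th5[OF that(1,2)] that by blast
                show "0 \<le> arrays s5 11 x \<and> arrays s5 11 x \<le> n" if "1 \<le> x" "x \<le> n" for x
                  using th5[OF that] by blast
                show "arrays s7 10 x = b1.threshold x \<and> arrays s7 11 x = arrays s5 11 x" if "1 \<le> x" "x \<le> n" for x
                  using th5[OF that] a7 by simp
                show "n < 2 ^ nat L" "1 \<le> L" using b1.Lg by auto
                show "520 * n * (2 * L + 1) + 10 \<le> t7" using t7' n1 unfolding V_def[symmetric] by linarith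
                fix s8 :: state and t8 assume r8: "regs s8 4 = int (card (good_pairs n e2 b1.threshold))"
                  and t8: "t8 \<ge> t7 - (520 * n * (2 * L + 1) + 10)"
                have "0 \<le> t8 - 1" using t8 t7' n1 unfolding V_def[symmetric] by linarith
                then show "wp w (Move 0 (Reg 4)) R s8 t8"
                  unfolding wp_Move using r8 by (intro R) (auto simp: regs_set_reg)
              qed
            qed
          qed (use z5 in auto)
        qed
      qed auto
    qed
    then show "wp w (shift P) (wp w (constants c) (wp w (build 8 G1) (wp w thresholds (wp w (build 9 G2) (wp w make_order
       (wp w count_levels (wp w (Move 0 (Reg 4)) R))))))) s1 t1"
      unfolding wp_def[of w "shift P"] using s2(1) by blast
  qed
  then show ?thesis unfolding square_counter_def wp_If using r0 n1 by simp
qed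

text \<open>Of the ten extra factors, two belong to the index of a trie node in the dictionary. The
  other eight contribute at least 256, which pays for the sign bit and leaves 128 for the constants
  100 and 2.\<close>

lemma word_bounds:
  assumes adm: "admissible_word_size (c + 10) N w"
  defines "X \<equiv> (2::int) ^ (w - 1)" and "n \<equiv> int N"
  shows "admissible_word_size c N w" "100 * (n + 2) * (n + 2) < X"
    "(n + 2) * (n + 2) * (2 * (n + 2) ^ c) < X"
proof -
  have a: "(N + 2) ^ (c + 10) \<le> 2 ^ w" using adm unfolding admissible_word_size_def .
  have "(N + 2) ^ c \<le> (N + 2) ^ (c + 10)" by (rule power_increasing) auto
  then show "admissible_word_size c N w" unfolding admissible_word_size_def using a by linarith
  have "(2::nat) ^ (c + 10) \<le> (N + 2) ^ (c + 10)" by (rule power_mono) auto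
  then have "(2::nat) ^ (c + 10) \<le> 2 ^ w" using a by linarith
  then have "c + 10 \<le> w" by (rule power_le_imp_le_exp[rotated]) simp
  then have w1: "1 \<le> w" by simp
  have "int ((N + 2) ^ (c + 10)) \<le> int (2 ^ w)" using a by (simp only: of_nat_le_iff)
  then have b: "(n + 2) ^ (c + 10) \<le> 2 * X" unfolding X_def n_def using w1 by (cases w) (auto simp: add.commute)
  have n2: "2 \<le> n + 2" unfolding n_def by simp
  have e8: "(256::int) \<le> (n + 2) ^ 8" using power_mono[OF n2, of 8] by simp
  have "(n + 2) ^ (c + 10) = (n + 2) ^ (c + 2) * (n + 2) ^ 8" by (simp only: power_add[symmetric]) (simp add: add.commute)
  moreover have "(n + 2) ^ (c + 2) * 256 \<le> (n + 2) ^ (c + 2) * (n + 2) ^ 8"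
    by (rule mult_left_mono[OF e8]) (use n2 in auto)
  ultimately have c: "128 * (n + 2) ^ (c + 2) \<le> X" using b by linarith
  have pos: "0 < (n + 2) ^ (c + 2)" using n2 by auto
  have sq: "(n + 2) ^ (c + 2) = (n + 2) * (n + 2) * (n + 2) ^ c" by (simp add: power_add power2_eq_square)
  show "(n + 2) * (n + 2) * (2 * (n + 2) ^ c) < X" using c pos unfolding sq by linarith
  have "1 * ((n + 2) * (n + 2)) \<le> (n + 2) ^ c * ((n + 2) * (n + 2))"
    by (rule mult_right_mono) (use n2 in auto)
  moreover have "0 < (n + 2) * (n + 2)" using n2 by auto
  ultimately have "100 * ((n + 2) * (n + 2)) < X" using c unfolding sq by (simp add: mult.commute)
  then show "100 * (n + 2) * (n + 2) < X" by (simp only: mult.assoc)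
qed

text \<open>\<open>\<rho> 0\<close> is unconstrained and may be negative, hence the maximum with 0.
  The 3 is the overhead of \<open>ask\<close>.\<close>

definition counting_time :: "nat \<Rightarrow> (nat \<Rightarrow> real) \<Rightarrow> (nat \<Rightarrow> real) \<Rightarrow> nat \<Rightarrow> real" where
  "counting_time c \<pi> \<rho> n = real_of_int (total_cost (int c) (int n) (max 0 \<lfloor>\<pi> n\<rfloor>) (max 0 \<lfloor>\<rho> n\<rfloor> + 3) (int (log_ceil n)))"

lemma counting_time_bigo:
  assumes enc: "encoder d E P Q c \<pi> \<rho>"
  shows "counting_time c \<pi> \<rho> \<in> O(\<lambda>n. \<pi> n + real n * \<rho> n + real n * log 2 (real n))"
proof (rule bigoI[of _ "real c + 5000"])
  show "eventually (\<lambda>n. norm (counting_time c \<pi> \<rho> n) \<le> (real c + 5000) * norm (\<pi> n + real n * \<rho> n + real n * log 2 (real n))) at_top"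
    using eventually_ge_at_top[of 2]
  proof eventually_elim
    \<comment> \<open>From \<open>n = 2\<close> on the logarithm is at least one, so
      \<open>n * log 2 n\<close> dominates the linear and constant terms. The constant
      \<open>c\<close> is among them and therefore enters the factor; 5000 exceeds the sum of the
      remaining coefficients.\<close>
    case (elim n)
    define x where "x = real n"
    define l where "l = log 2 x"
    define L where "L = real (log_ceil n)"
    have x2: "2 \<le> x" using elim unfolding x_def by simp
    have l1: "1 \<le> l" unfolding l_def using x2 by (simp add: le_log_iff)
    have "L \<le> l + 1" unfolding L_def l_def x_def using elim by (intro log_ceil_bounds(3)) simp
    then have L2: "L \<le> 2 * l" using l1 by linarith
    have L0: "0 \<le> L" unfolding L_def by simp
    have p: "0 \<le> \<pi> n" and r: "0 \<le> \<rho> n" using encoder_times_nonneg[OF enc] elim by auto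
    define p' where "p' = real_of_int (max 0 \<lfloor>\<pi> n\<rfloor>)"
    define q' where "q' = real_of_int (max 0 \<lfloor>\<rho> n\<rfloor>)"
    have pq: "0 \<le> p'" "p' \<le> \<pi> n" "0 \<le> q'" "q' \<le> \<rho> n" using p r unfolding p'_def q'_def by (auto simp: max_def)
    have ct: "counting_time c \<pi> \<rho> n = p' + 2 * (x * (6 * (q' + 3) + 15 * L + 100) + 7 * L + 20) +
        520 * x * (2 * L + 1) + 60 * x + 4 * L + real c + 200"
      unfolding counting_time_def total_cost_def p'_def q'_def x_def L_def by simp
    have "x \<le> x * l" "l \<le> x * l"
      using x2 l1 mult_left_mono[of 1 l x] mult_right_mono[of 1 x l] by auto
    then have xl: "x \<le> x * l" "1 \<le> x * l" "l \<le> x * l" using l1 by linarith+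
    have xL: "x * L \<le> 2 * (x * l)" using mult_left_mono[OF L2, of x] x2 by simp
    have xq: "x * q' \<le> x * \<rho> n" using mult_left_mono[OF pq(4), of x] x2 by simp
    have cl: "real c \<le> real c * (x * l)" using mult_left_mono[OF xl(2), of "real c"] by simp
    have eq: "counting_time c \<pi> \<rho> n = p' + 12 * (x * q') + 1070 * (x * L) + 816 * x + 18 * L + real c + 240"
      unfolding ct by (simp add: algebra_simps)
    have "0 \<le> x * q'" "0 \<le> x * L" using pq L0 x2 by auto
    then have ge0: "0 \<le> counting_time c \<pi> \<rho> n" unfolding eq using pq x2 L0 by simp
    have r0: "0 \<le> x * \<rho> n" using r x2 by simp
    have g0: "0 \<le> \<pi> n + x * \<rho> n + x * l" using p r0 xl by linarith
    have "counting_time c \<pi> \<rho> n \<le> \<pi> n + 12 * (x * \<rho> n) + 5000 * (x * l) + real c * (x * l)"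
      unfolding eq using pq(2) xq xL xl L2 cl by linarith
    also have "\<dots> \<le> (real c + 5000) * (\<pi> n + x * \<rho> n + x * l)"
    proof -
      have "0 \<le> real c * \<pi> n" "0 \<le> real c * (x * \<rho> n)" using p r0 by auto
      then show ?thesis using p r0 by (simp add: algebra_simps)
    qed
    finally show ?case using ge0 g0 unfolding l_def x_def by simp
  qed
qed

text \<open>\<open>R\<close> decides what a square is and is accessed through \<open>ask Q\<close>;
  \<open>S\<close> decides which squares are identified and is accessed through \<open>G\<close>.
  One exponent \<open>c\<close> bounds the encodings of both.\<close>

lemma counting_time_correct:
  assumes R: "scer R" "encoding_function R E" and S: "scer S" "encoding_function S E'" and sub: "S \<subseteq> R"
    and enc: "encoder d E P Q c \<pi> \<rho>"
    and bound: "\<And>T i j. over_integer_alphabet d T \<Longrightarrow> 1 \<le> i \<Longrightarrow> i \<le> j \<Longrightarrow> j \<le> length T \<Longrightarrow>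
      \<bar>E' (substr T i j)\<bar> < (int (length T) + 2) ^ c"
    and G: "\<And>w T s i j t R'. over_integer_alphabet d T \<Longrightarrow> admissible_word_size c (length T) w \<Longrightarrow>
      hidden_ready w P Q T s \<Longrightarrow> regs s 10 = i \<Longrightarrow> regs s 11 = j \<Longrightarrow> 1 \<le> i \<Longrightarrow> i \<le> j \<Longrightarrow> j \<le> int (length T) \<Longrightarrow>
      (\<And>s' t'. hidden_ready w P Q T s' \<Longrightarrow> same_outside (insert 12 {100..}) {100..} s s' \<Longrightarrow>
         regs s' 12 = code E' T i j \<Longrightarrow> t' \<ge> t - (max 0 \<lfloor>\<rho> (length T)\<rfloor> + 3) \<Longrightarrow> R' s' t') \<Longrightarrow> wp w G R' s t"
  shows "computable_in_time d (\<lambda>T. card (square_substrings R T // S)) (counting_time c \<pi> \<rho>)"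
  unfolding computable_in_time_def
proof (rule exI[of _ "square_counter c P G (ask Q)"], rule exI[of _ "c + 10"], rule conjI, goal_cases)
  case 1

  show ?case using enc unfolding encoder_def by auto
next
  case 2
  have dc: "d + 2 \<le> c" using enc unfolding encoder_def by blast
  show ?case
  proof (intro allI impI, elim conjE)
    fix w T assume T: "over_integer_alphabet d T" and adm: "admissible_word_size (c + 10) (length T) w"
    let ?n = "int (length T)" and ?X = "(2::int) ^ (w - 1)" and ?L = "int (log_ceil (length T))"
    let ?p = "max 0 \<lfloor>\<pi> (length T)\<rfloor>" and ?q = "max 0 \<lfloor>\<rho> (length T)\<rfloor> + 3"
    note wb = word_bounds[OF adm]
    show "\<exists>k s. exec w (square_counter c P G (ask Q)) (input_state T) k s \<and>
        real k \<le> counting_time c \<pi> \<rho> (length T) \<and> regs s 0 = int (card (square_substrings R T // S))"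
    proof (cases "T = []")
      case True
      \<comment> \<open>For the empty string register 0 holds the length 0, which is already the
        answer.\<close>
      have w0: "wrap w 0 = 0" unfolding wrap_def by simp
      have r0: "regs (input_state T) 0 = 0" unfolding input_state_def True by simp
      have "wp w (square_counter c P G (ask Q)) (\<lambda>s t. s = input_state T \<and> t = 0) (input_state T) 2"
        unfolding square_counter_def wp_If by (simp add: w0 r0 wp_Skip)
      then obtain k s where k: "exec w (square_counter c P G (ask Q)) (input_state T) k s" "s = input_state T" "k = 2"
        unfolding wp_def by auto
      have "square_substrings R T = {}" unfolding square_substrings_def True by auto
      then have "card (square_substrings R T // S) = 0" by simp
      moreover have "real 2 \<le> counting_time c \<pi> \<rho> (length T)" unfolding counting_time_def total_cost_def True by simp
      ultimately show ?thesis using k r0 by (intro exI[of _ k] exI[of _ s]) simp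
    next
      case False
      then have n1: "1 \<le> length T" by (cases T) auto
      have ram: "ram w ?X ?n"
        by unfold_locales (use n1 wb(2) dc in auto)
      have Lb: "?n < 2 ^ nat ?L" "1 \<le> ?L" "?L \<le> ?n + 1"
      proof -
        have "int (length T) < int (2 ^ log_ceil (length T))" using less_log_ceil[of "length T"] by (simp only: of_nat_less_iff)
        then show "?n < 2 ^ nat ?L" by simp
      qed (use log_ceil_bounds[OF n1] in auto)
      have mR: "matching ?n (code E T)" and mS: "matching ?n (code E' T)"
        using matching_scer R S n1 by auto
      have qn: "0 \<le> ?q" by simp
      have b1: "builder w ?X ?n (code E' T) (2 * (?n + 2) ^ c) ?L ?q G (hidden_ready w P Q T)"
      proof (intro builder.intro builder_axioms.intro ram mS Lb qn wb(3))
        fix i j assume "1 \<le> i" "i \<le> j" "j \<le> ?n"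
        then show "2 * \<bar>code E' T i j\<bar> < 2 * (?n + 2) ^ c"
          using bound[OF T, of "nat i" "nat j"] unfolding code_def by auto
      next
        fix s s' assume "hidden_ready w P Q T s" "same_outside {..<100} {1..<100} s s'"
        then show "hidden_ready w P Q T s'" by (rule hidden_ready_frame)
      next
        fix s i j t and R' :: "state \<Rightarrow> int \<Rightarrow> bool"
        assume h: "hidden_ready w P Q T s" "regs s 10 = i" "regs s 11 = j" "1 \<le> i" "i \<le> j" "j \<le> ?n"
          "\<And>s' t'. hidden_ready w P Q T s' \<Longrightarrow> same_outside (insert 12 {100..}) {100..} s s' \<Longrightarrow>
           regs s' 12 = code E' T i j \<Longrightarrow> t' \<ge> t - ?q \<Longrightarrow> R' s' t'"
        show "wp w G R' s t" by (rule G[OF T wb(1) h])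
      qed
      have b2: "builder w ?X ?n (code E T) (2 * (?n + 2) ^ c) ?L ?q (ask Q) (hidden_ready w P Q T)"
      proof (intro builder.intro builder_axioms.intro ram mR Lb qn wb(3))
        fix i j assume "1 \<le> i" "i \<le> j" "j \<le> ?n"
        then show "2 * \<bar>code E T i j\<bar> < 2 * (?n + 2) ^ c"
          using encoding_bound[OF enc T, of "nat i" "nat j"] unfolding code_def by auto
      next
        fix s s' assume "hidden_ready w P Q T s" "same_outside {..<100} {1..<100} s s'"
        then show "hidden_ready w P Q T s'" by (rule hidden_ready_frame)
      next
        fix s i j t and R' :: "state \<Rightarrow> int \<Rightarrow> bool"
        assume h: "hidden_ready w P Q T s" "regs s 10 = i" "regs s 11 = j" "1 \<le> i" "i \<le> j" "j \<le> ?n"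
          "\<And>s' t'. hidden_ready w P Q T s' \<Longrightarrow> same_outside (insert 12 {100..}) {100..} s s' \<Longrightarrow>
           regs s' 12 = code E T i j \<Longrightarrow> t' \<ge> t - ?q \<Longrightarrow> R' s' t'"
        show "wp w (ask Q) R' s t" by (rule wp_ask[OF enc T wb(1) h(1-6)]) (rule h(7), auto simp: code_def)
      qed
      obtain k0 s0 where P: "exec w P (input_state T) k0 s0" "real k0 \<le> \<pi> (length T)"
        using encoder_pre[OF enc T wb(1)] by blast
      have kp: "int k0 \<le> ?p" using P(2) by (simp add: le_floor_iff le_max_iff_disj)
      let ?t = "total_cost (int c) ?n ?p ?q ?L"
      have "wp w (square_counter c P G (ask Q)) (\<lambda>s t. regs s 0 = int (card (square_substrings R T // S)) \<and> 0 \<le> t) (input_state T) ?t"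
        by (rule wp_square_counter[OF refl P(1) kp b1 b2 refl refl order_refl])
          (simp add: card_squares[OF R S sub n1])
      then obtain k s where k: "exec w (square_counter c P G (ask Q)) (input_state T) k s"
        "regs s 0 = int (card (square_substrings R T // S))" "0 \<le> ?t - int k"
        unfolding wp_def by blast
      have "real k \<le> counting_time c \<pi> \<rho> (length T)" unfolding counting_time_def using k(3) by linarith
      then show ?thesis using k by blast
    qed
  qed
qed

theorem theorem5:
  fixes R :: "str rel" and E :: "str \<Rightarrow> int" and \<pi> \<rho> :: "nat \<Rightarrow> real" and d :: nat
  assumes "scer R"
    and "encoding_function R E"
    and "encoding_times d E \<pi> \<rho>"
  shows "(\<exists>t \<in> O(\<lambda>n. \<pi> n + real n * \<rho> n + real n * log 2 (real n)).
            computable_in_time d (nonequiv_square_count R) t) \<and>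
         (\<exists>t \<in> O(\<lambda>n. \<pi> n + real n * \<rho> n + real n * log 2 (real n)).
            computable_in_time d (distinct_square_count R) t)"
proof -
  obtain P Q c where enc: "encoder d E P Q c \<pi> \<rho>"
    using assms(3) unfolding encoding_times_def encoder_def by blast
  have dc: "d + 2 \<le> c" using enc unfolding encoder_def by blast
  note O = counting_time_bigo[OF enc]
  have "computable_in_time d (\<lambda>T. card (square_substrings R T // R)) (counting_time c \<pi> \<rho>)"
  proof (rule counting_time_correct[OF assms(1,2) assms(1,2) subset_refl enc, where G="ask Q"])
    fix T i j assume "over_integer_alphabet d T" "1 \<le> i" "i \<le> j" "j \<le> length T"
    then show "\<bar>E (substr T i j)\<bar> < (int (length T) + 2) ^ c" by (rule encoding_bound[OF enc])
  next
    fix w T s i j t and R' :: "state \<Rightarrow> int \<Rightarrow> bool"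
    assume h: "over_integer_alphabet d T" "admissible_word_size c (length T) w"
      "hidden_ready w P Q T s" "regs s 10 = i" "regs s 11 = j" "1 \<le> i" "i \<le> j" "j \<le> int (length T)"
      "\<And>s' t'. hidden_ready w P Q T s' \<Longrightarrow> same_outside (insert 12 {100..}) {100..} s s' \<Longrightarrow>
         regs s' 12 = code E T i j \<Longrightarrow> t' \<ge> t - (max 0 \<lfloor>\<rho> (length T)\<rfloor> + 3) \<Longrightarrow> R' s' t'"
    show "wp w (ask Q) R' s t" by (rule wp_ask[OF enc h(1-8)]) (rule h(9), auto simp: code_def)
  qed
  then have 1: "computable_in_time d (nonequiv_square_count R) (counting_time c \<pi> \<rho>)"
    unfolding nonequiv_square_count_def[abs_def] .
  have IdR: "Id \<subseteq> R" using assms(1) unfolding scer_def equiv_def refl_on_def by auto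
  \<comment> \<open>For equality the codes are letters, which array 0 supplies in one step;
    \<open>ask Q\<close> still recognises the squares.\<close>
  have "computable_in_time d (\<lambda>T. card (square_substrings R T // Id)) (counting_time c \<pi> \<rho>)"
  proof (rule counting_time_correct[OF assms(1,2) scer_Id encoding_last_letter IdR enc, where G=letter_oracle])
    fix T i j assume a: "over_integer_alphabet d T" "1 \<le> i" "i \<le> j" "j \<le> length T"
    have "last_letter (substr T i j) = int (T ! (j - 1))"
      using code_last_letter[of "int i" "int j" T] a unfolding code_def by (simp add: nat_diff_distrib)
    moreover have "T ! (j - 1) \<le> length T ^ d"
      using a nth_mem[of "j - 1" T] unfolding over_integer_alphabet_def by fastforce
    moreover have "length T ^ d < (length T + 2) ^ c"
    proof -
      have "length T ^ d \<le> (length T + 2) ^ d" by (rule power_mono) auto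
      also have "\<dots> < (length T + 2) ^ c" by (rule power_strict_increasing) (use dc in auto)
      finally show ?thesis .
    qed
    ultimately have "\<bar>last_letter (substr T i j)\<bar> < int ((length T + 2) ^ c)" by linarith
    then show "\<bar>last_letter (substr T i j)\<bar> < (int (length T) + 2) ^ c" by (simp add: add.commute)
  next
    fix w T s i j t and R' :: "state \<Rightarrow> int \<Rightarrow> bool"
    assume h: "over_integer_alphabet d T" "admissible_word_size c (length T) w"
      "hidden_ready w P Q T s" "regs s 10 = i" "regs s 11 = j" "1 \<le> i" "i \<le> j" "j \<le> int (length T)"
      "\<And>s' t'. hidden_ready w P Q T s' \<Longrightarrow> same_outside (insert 12 {100..}) {100..} s s' \<Longrightarrow>
         regs s' 12 = code last_letter T i j \<Longrightarrow> t' \<ge> t - (max 0 \<lfloor>\<rho> (length T)\<rfloor> + 3) \<Longrightarrow> R' s' t'"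
    show "wp w letter_oracle R' s t"
    proof (rule wp_letter_oracle[OF h(3,5)])
      show "1 \<le> j" "j \<le> int (length T)" using h by auto
      show "1 \<le> max 0 \<lfloor>\<rho> (length T)\<rfloor> + 3" by simp
    qed (rule h(9), auto simp: code_last_letter[OF h(6-8)])
  qed
  then have 2: "computable_in_time d (distinct_square_count R) (counting_time c \<pi> \<rho>)"
    unfolding distinct_square_count_def[abs_def] card_quotient_Id .
  show ?thesis using O 1 2 by blast
qed

end
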